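(* Let $X$ be a connected Hermitian manifold, $\varphi\in C^0(X)$ a weight function, and $\mathcal A$ a bounded subset of $L^2_{p,q}(X,\varphi)$. Then $\mathcal A$ is precompact if and only if the following two conditions are fulfilled: (i) for all $\epsilon>0$ and all $\Omega\subset\subset X$, there exists $\delta>0$ such that $$\|\Phi^*f-f\|_{L^2_{p,q}(X,\varphi)}<\epsilon$$ for all $\Phi\in\operatorname{Def}_\delta(\Omega,X)$ and all $f\in\mathcal A$; (ii) for all $\epsilon>0$, there exists $\Omega_\epsilon\subset\subset X$ such that $$\|f\|_{L^2_{p,q}(X\setminus\Omega_\epsilon,\varphi)}<\epsilon$$ for all $f\in\mathcal A$.
   Context: $L^2_{p,q}(X,\varphi)$ is the Hilbert space of $(p,q)$-forms $f$ with $\|f\|^2_{L^2_{p,q}(X,\varphi)}=\int_X|f|^2e^{-\varphi}dV_X<\infty$, where $|f|$ is the pointwise norm; the same formula is used for the norm of $\Phi^*f-f$, $\Phi^*$ being the pull-back. $\Omega\subset\subset X$ denotes a relatively compact open subset. For $p,q\in X$, $\operatorname{dist}_X(p,q)$ is the infimum of the lengths of curves in $X$ connecting $p$ and $q$. For a diffeomorphism $\Phi:X\to X$ the mapping distance is $\operatorname{md}(\Phi)=\sup_{p\in X}\operatorname{dist}_X(p,\Phi(p))$. The total space $TX$ inherits a metric from $X$ (e.g. the Sasaki metric), with distance $\operatorname{dist}_{TX}$, and $\|\Phi_*-\mathrm{id}\|_\infty=\sup_{p\in X}\sup_{v\in T_pX,|v|=1}\operatorname{dist}_{TX}(\Phi_*v,v)$.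 For $\Omega\subset X$ open, a diffeomorphism $\Phi:(\Omega,X)\to(\Omega,X)$ (a diffeomorphism of $X$ mapping $\Omega$ to $\Omega$) is a $\delta$-variation of $\Omega$ in $X$ if $\Phi|_{X\setminus\Omega}$ is the identity, $\operatorname{md}(\Phi)<\delta$ and $\|\Phi_*-\mathrm{id}\|_\infty,\ \|(\Phi^{-1})_*-\mathrm{id}\|_\infty<3\delta$; the set of these is $\operatorname{Var}_\delta(\Omega,X)$. $\Phi\in\operatorname{Var}_\delta(\Omega,X)$ is a $\delta$-deformation if there is a smooth map $[0,1]\times X\to X$, $(t,x)\mapsto\Phi_t(x)$, with $\Phi_t\in\operatorname{Var}_\delta(\Omega,X)$ for all $t$, $\Phi_0=\mathrm{id}$, $\Phi_1=\Phi$ and $|\frac{\partial}{\partial t}\Phi_t(x)|\le3\delta$ for all $t\in[0,1]$, $x\in X$. $\operatorname{Def}_\delta(\Omega,X)$ is the set of all $\delta$-deformations of $\Omega$ in $X$. *)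

theory Defs
  imports "HOL-Analysis.Analysis"
begin

section \<open>Smooth and holomorphic maps between coordinate spaces\<close>

(* Meaningful for open S only: all iterated directional derivatives up to order k exist
   on S, the lower ones are Frechet differentiable and the last ones are continuous. *)
primrec Ck_on :: "nat \<Rightarrow> ('e::real_normed_vector \<Rightarrow> 'f::real_normed_vector) \<Rightarrow> 'e set \<Rightarrow> bool" where
  "Ck_on 0 f S \<longleftrightarrow> continuous_on S f"
| "Ck_on (Suc k) f S \<longleftrightarrow>
     (\<forall>x\<in>S. f differentiable (at x)) \<and> (\<forall>v. Ck_on k (\<lambda>x. frechet_derivative f (at x) v) S)"

(* Smoothness on a set S that need not be open, such as [0,1] \<times> W: smooth extendability
   to a neighbourhood of each point of S. *)
definition smooth_on :: "'e::real_normed_vector set \<Rightarrow> ('e \<Rightarrow> 'f::real_normed_vector) \<Rightarrow> bool" where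
  "smooth_on S f \<longleftrightarrow>
     (\<forall>x\<in>S. \<exists>W g. open W \<and> x \<in> W \<and> (\<forall>k. Ck_on k g W) \<and> (\<forall>y\<in>S \<inter> W. f y = g y))"

(* The second condition is the system of Cauchy-Riemann equations. *)
definition holomorphic_map_on ::
    "(complex^'n) set \<Rightarrow> (complex^'n \<Rightarrow> complex^'n) \<Rightarrow> bool" where
  "holomorphic_map_on S f \<longleftrightarrow> smooth_on S f \<and>
     (\<forall>z\<in>S. \<forall>a v. frechet_derivative f (at z) (a *s v) = a *s frechet_derivative f (at z) v)"


section \<open>Complex manifolds and their tangent spaces\<close>

(* The manifold is the whole type 'a, a second countable Hausdorff space; 'n is the index
   type of the complex coordinates.  A chart is a domain with a coordinate map. *)
type_synonym ('a, 'n) chart = "'a set \<times> ('a \<Rightarrow> complex^'n)"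

definition complex_atlas ::
    "('a::{t2_space,second_countable_topology}, 'n::finite) chart set \<Rightarrow> bool" where
  "complex_atlas A \<longleftrightarrow>
     (\<Union>c\<in>A. fst c) = UNIV \<and>
     (\<forall>(U, x)\<in>A. open U \<and> open (x ` U) \<and> homeomorphism U (x ` U) x (inv_into U x)) \<and>
     (\<forall>(U, x)\<in>A. \<forall>(V, y)\<in>A. holomorphic_map_on (x ` (U \<inter> V)) (y \<circ> inv_into U x))"

definition chart_inv :: "('a, 'n) chart \<Rightarrow> complex^'n \<Rightarrow> 'a" where
  "chart_inv c = inv_into (fst c) (snd c)"

definition chart_at :: "('a, 'n) chart set \<Rightarrow> 'a \<Rightarrow> ('a, 'n) chart" where
  "chart_at A p = (SOME c. c \<in> A \<and> p \<in> fst c)"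

(* The tangent space at p is complex^'n: a tangent vector at p is represented by its
   components in the chart  chart_at A p.  Chart changes being holomorphic, multiplication
   by \<i> on complex^'n is the complex structure of the tangent space.  The total space of the
   tangent bundle is the set of pairs (p, v).
   comps_in A c p v  are the components in the chart c of the tangent vector v at p, and
   vec_of A c p u  is the tangent vector at p with components u in the chart c. *)
definition chart_change ::
    "('a, 'n::finite) chart \<Rightarrow> ('a, 'n) chart \<Rightarrow> 'a \<Rightarrow> complex^'n \<Rightarrow> complex^'n" where
  "chart_change c d p = frechet_derivative (snd d \<circ> chart_inv c) (at (snd c p))"

definition comps_in ::
    "('a, 'n::finite) chart set \<Rightarrow> ('a, 'n) chart \<Rightarrow> 'a \<Rightarrow> complex^'n \<Rightarrow> complex^'n" where
  "comps_in A c p = chart_change (chart_at A p) c p"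

definition vec_of ::
    "('a, 'n::finite) chart set \<Rightarrow> ('a, 'n) chart \<Rightarrow> 'a \<Rightarrow> complex^'n \<Rightarrow> complex^'n" where
  "vec_of A c p = chart_change c (chart_at A p) p"


section \<open>Hermitian metrics\<close>

type_synonym ('a, 'n) metric_field = "'a \<Rightarrow> complex^'n \<Rightarrow> complex^'n \<Rightarrow> complex"

definition coord_metric ::
    "('a, 'n::finite) chart set \<Rightarrow> ('a, 'n) metric_field \<Rightarrow> ('a, 'n) chart \<Rightarrow>
     complex^'n \<Rightarrow> complex^'n \<Rightarrow> complex^'n \<Rightarrow> complex" where
  "coord_metric A h c z u v =
     (let p = chart_inv c z in h p (vec_of A c p u) (vec_of A c p v))"

definition hermitian_inner :: "(complex^'n \<Rightarrow> complex^'n \<Rightarrow> complex) \<Rightarrow> bool" where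
  "hermitian_inner b \<longleftrightarrow>
     (\<forall>u v w. b (u + v) w = b u w + b v w) \<and>
     (\<forall>a u v. b (a *s u) v = a * b u v) \<and>
     (\<forall>u v. b v u = cnj (b u v)) \<and>
     (\<forall>u. u \<noteq> 0 \<longrightarrow> 0 < Re (b u u))"

definition hermitian_manifold ::
    "('a::{t2_space,second_countable_topology}, 'n::finite) chart set \<Rightarrow>
     ('a, 'n) metric_field \<Rightarrow> bool" where
  "hermitian_manifold A h \<longleftrightarrow> complex_atlas A \<and> (\<forall>p. hermitian_inner (h p)) \<and>
     (\<forall>c\<in>A. \<forall>u v. smooth_on (snd c ` fst c) (\<lambda>z. coord_metric A h c z u v))"

(* Lengths, distances and volumes refer to the Riemannian metric Re h. *)
definition vec_norm :: "('a, 'n) metric_field \<Rightarrow> 'a \<Rightarrow> complex^'n \<Rightarrow> real" where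
  "vec_norm h p v = sqrt (Re (h p v v))"

(* The Riemannian volume.  In a chart the density sqrt (det (g_ij)) of the real 2n by 2n matrix
   of g = Re h is the determinant of the n by n Hermitian matrix of h. *)
definition volume ::
    "('a::{t2_space,second_countable_topology}, 'n::finite) chart set \<Rightarrow>
     ('a, 'n) metric_field \<Rightarrow> 'a measure" where
  "volume A h = (THE M. sets M = sets borel \<and>
     (\<forall>c\<in>A. \<forall>S\<in>sets borel. S \<subseteq> fst c \<longrightarrow>
        emeasure M S =
          (\<integral>\<^sup>+z\<in>snd c ` S. ennreal (Re (det (\<chi> i j. coord_metric A h c z (axis i 1) (axis j 1))))
             \<partial>lborel)))"


section \<open>Distances on the manifold and on its tangent bundle\<close>

definition velocity ::
    "('a, 'n::finite) chart set \<Rightarrow> (real \<Rightarrow> 'a) \<Rightarrow> real \<Rightarrow> complex^'n" where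
  "velocity A \<gamma> t = vector_derivative (snd (chart_at A (\<gamma> t)) \<circ> \<gamma>) (at t within {0..1})"

definition curve ::
    "('a::{t2_space,second_countable_topology}, 'n::finite) chart set \<Rightarrow> (real \<Rightarrow> 'a) \<Rightarrow> bool" where
  "curve A \<gamma> \<longleftrightarrow> continuous_on {0..1} \<gamma> \<and>
     (\<forall>c\<in>A. \<forall>a b. 0 \<le> a \<and> a < b \<and> b \<le> 1 \<and> \<gamma> ` {a..b} \<subseteq> fst c \<longrightarrow>
        (snd c \<circ> \<gamma>) piecewise_C1_differentiable_on {a..b})"

definition curve_length ::
    "('a, 'n::finite) chart set \<Rightarrow> ('a, 'n) metric_field \<Rightarrow> (real \<Rightarrow> 'a) \<Rightarrow> ennreal" where
  "curve_length A h \<gamma> =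
     (\<integral>\<^sup>+t\<in>{0..1}. ennreal (vec_norm h (\<gamma> t) (velocity A \<gamma> t)) \<partial>lborel)"

definition distX ::
    "('a::{t2_space,second_countable_topology}, 'n::finite) chart set \<Rightarrow>
     ('a, 'n) metric_field \<Rightarrow> 'a \<Rightarrow> 'a \<Rightarrow> ennreal" where
  "distX A h p q = (INF \<gamma>\<in>{\<gamma>. curve A \<gamma> \<and> \<gamma> 0 = p \<and> \<gamma> 1 = q}. curve_length A h \<gamma>)"

(* The Christoffel symbol \<Gamma>(u, v) of the Levi-Civita connection of g = Re h in the chart c,
   at the coordinate point z: the vector w with
     2 g(w, x) = u(g(v, x)) + v(g(u, x)) - x(g(u, v))   for all constant fields x. *)
definition christoffel ::
    "('a, 'n::finite) chart set \<Rightarrow> ('a, 'n) metric_field \<Rightarrow> ('a, 'n) chart \<Rightarrow>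
     complex^'n \<Rightarrow> complex^'n \<Rightarrow> complex^'n \<Rightarrow> complex^'n" where
  "christoffel A h c z u v =
     (let g = (\<lambda>y a b. Re (coord_metric A h c y a b));
          D = (\<lambda>x a b. frechet_derivative (\<lambda>y. g y a b) (at z) x)
      in THE w. \<forall>x. 2 * g z w x = D u v x + D v u x - D x u v)"

(* Curves in the tangent bundle: a curve \<gamma> and a vector field V along \<gamma>. *)
definition tangent_curve ::
    "('a::{t2_space,second_countable_topology}, 'n::finite) chart set \<Rightarrow>
     (real \<Rightarrow> 'a) \<Rightarrow> (real \<Rightarrow> complex^'n) \<Rightarrow> bool" where
  "tangent_curve A \<gamma> V \<longleftrightarrow> curve A \<gamma> \<and>
     (\<forall>c\<in>A. \<forall>a b. 0 \<le> a \<and> a < b \<and> b \<le> 1 \<and> \<gamma> ` {a..b} \<subseteq> fst c \<longrightarrow>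
        (\<lambda>t. comps_in A c (\<gamma> t) (V t)) piecewise_C1_differentiable_on {a..b})"

definition covariant_derivative ::
    "('a, 'n::finite) chart set \<Rightarrow> ('a, 'n) metric_field \<Rightarrow>
     (real \<Rightarrow> 'a) \<Rightarrow> (real \<Rightarrow> complex^'n) \<Rightarrow> real \<Rightarrow> complex^'n" where
  "covariant_derivative A h \<gamma> V t =
     (let c = chart_at A (\<gamma> t)
      in vector_derivative (\<lambda>s. comps_in A c (\<gamma> s) (V s)) (at t within {0..1})
         + christoffel A h c (snd c (\<gamma> t)) (velocity A \<gamma> t) (V t))"

(* Length with respect to the Sasaki metric, for which the tangent vector to (\<gamma>, V) has
   horizontal part \<gamma>' and vertical part the covariant derivative of V along \<gamma>. *)
definition tangent_curve_length ::
    "('a, 'n::finite) chart set \<Rightarrow> ('a, 'n) metric_field \<Rightarrow>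
     (real \<Rightarrow> 'a) \<Rightarrow> (real \<Rightarrow> complex^'n) \<Rightarrow> ennreal" where
  "tangent_curve_length A h \<gamma> V =
     (\<integral>\<^sup>+t\<in>{0..1}. ennreal (sqrt ((vec_norm h (\<gamma> t) (velocity A \<gamma> t))\<^sup>2
                            + (vec_norm h (\<gamma> t) (covariant_derivative A h \<gamma> V t))\<^sup>2)) \<partial>lborel)"

definition distTX ::
    "('a::{t2_space,second_countable_topology}, 'n::finite) chart set \<Rightarrow>
     ('a, 'n) metric_field \<Rightarrow> 'a \<times> (complex^'n) \<Rightarrow> 'a \<times> (complex^'n) \<Rightarrow> ennreal" where
  "distTX A h P Q =
     (INF (\<gamma>, V)\<in>{(\<gamma>, V). tangent_curve A \<gamma> V \<and> (\<gamma> 0, V 0) = P \<and> (\<gamma> 1, V 1) = Q}.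
        tangent_curve_length A h \<gamma> V)"


section \<open>Variations and deformations\<close>

definition smooth_map ::
    "('a::{t2_space,second_countable_topology}, 'n::finite) chart set \<Rightarrow> ('a \<Rightarrow> 'a) \<Rightarrow> bool" where
  "smooth_map A \<Phi> \<longleftrightarrow> continuous_on UNIV \<Phi> \<and>
     (\<forall>c\<in>A. \<forall>d\<in>A. smooth_on (snd c ` (fst c \<inter> \<Phi> -` fst d)) (snd d \<circ> \<Phi> \<circ> chart_inv c))"

definition diffeo ::
    "('a::{t2_space,second_countable_topology}, 'n::finite) chart set \<Rightarrow> ('a \<Rightarrow> 'a) \<Rightarrow> bool" where
  "diffeo A \<Phi> \<longleftrightarrow> bij \<Phi> \<and> smooth_map A \<Phi> \<and> smooth_map A (inv \<Phi>)"

definition push_forward ::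
    "('a, 'n::finite) chart set \<Rightarrow> ('a \<Rightarrow> 'a) \<Rightarrow> 'a \<Rightarrow> complex^'n \<Rightarrow> complex^'n" where
  "push_forward A \<Phi> p =
     (let c = chart_at A p; d = chart_at A (\<Phi> p)
      in frechet_derivative (snd d \<circ> \<Phi> \<circ> chart_inv c) (at (snd c p)))"

definition mapping_distance ::
    "('a::{t2_space,second_countable_topology}, 'n::finite) chart set \<Rightarrow>
     ('a, 'n) metric_field \<Rightarrow> ('a \<Rightarrow> 'a) \<Rightarrow> ennreal" where
  "mapping_distance A h \<Phi> = (SUP p. distX A h p (\<Phi> p))"

definition push_forward_distance ::
    "('a::{t2_space,second_countable_topology}, 'n::finite) chart set \<Rightarrow>
     ('a, 'n) metric_field \<Rightarrow> ('a \<Rightarrow> 'a) \<Rightarrow> ennreal" where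
  "push_forward_distance A h \<Phi> =
     (SUP p. SUP v\<in>{v. vec_norm h p v = 1}. distTX A h (\<Phi> p, push_forward A \<Phi> p v) (p, v))"

definition Var ::
    "('a::{t2_space,second_countable_topology}, 'n::finite) chart set \<Rightarrow>
     ('a, 'n) metric_field \<Rightarrow> real \<Rightarrow> 'a set \<Rightarrow> ('a \<Rightarrow> 'a) set" where
  "Var A h \<delta> \<Omega> = {\<Phi>. diffeo A \<Phi> \<and> \<Phi> ` \<Omega> = \<Omega> \<and> (\<forall>x. x \<notin> \<Omega> \<longrightarrow> \<Phi> x = x) \<and>
     mapping_distance A h \<Phi> < ennreal \<delta> \<and>
     push_forward_distance A h \<Phi> < ennreal (3 * \<delta>) \<and>
     push_forward_distance A h (inv \<Phi>) < ennreal (3 * \<delta>)}"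

definition smooth_family ::
    "('a::{t2_space,second_countable_topology}, 'n::finite) chart set \<Rightarrow>
     (real \<Rightarrow> 'a \<Rightarrow> 'a) \<Rightarrow> bool" where
  "smooth_family A \<Psi> \<longleftrightarrow> continuous_on ({0..1} \<times> UNIV) (\<lambda>(t, x). \<Psi> t x) \<and>
     (\<forall>c\<in>A. \<forall>d\<in>A.
        smooth_on {(t, z). t \<in> {0..1} \<and> z \<in> snd c ` fst c \<and> \<Psi> t (chart_inv c z) \<in> fst d}
          (\<lambda>(t, z). snd d (\<Psi> t (chart_inv c z))))"

definition Def ::
    "('a::{t2_space,second_countable_topology}, 'n::finite) chart set \<Rightarrow>
     ('a, 'n) metric_field \<Rightarrow> real \<Rightarrow> 'a set \<Rightarrow> ('a \<Rightarrow> 'a) set" where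
  "Def A h \<delta> \<Omega> = {\<Phi> \<in> Var A h \<delta> \<Omega>. \<exists>\<Psi>. smooth_family A \<Psi> \<and>
     (\<forall>t\<in>{0..1}. \<Psi> t \<in> Var A h \<delta> \<Omega>) \<and> \<Psi> 0 = id \<and> \<Psi> 1 = \<Phi> \<and>
     (\<forall>t\<in>{0..1}. \<forall>x. vec_norm h (\<Psi> t x) (velocity A (\<lambda>s. \<Psi> s x) t) \<le> 3 * \<delta>)}"


section \<open>Differential forms and L2 spaces\<close>

(* A complex-valued k-form at a point is a function of the list of its k arguments, and
   vanishes on lists of any other length. *)
type_synonym 'n form = "(complex^'n) list \<Rightarrow> complex"

(* dz_I \<and> d(cnj z)_J for multi-indices I and J, not necessarily increasing. *)
definition dz_form :: "('n::finite) list \<Rightarrow> 'n list \<Rightarrow> 'n form" where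
  "dz_form I J vs =
     (if length vs = length I + length J
      then \<Sum>\<pi> | \<pi> permutes {..<length vs}. of_int (sign \<pi>)
             * (\<Prod>r<length I. (vs ! \<pi> r) $ (I ! r))
             * (\<Prod>s<length J. cnj ((vs ! \<pi> (length I + s)) $ (J ! s)))
      else 0)"

definition pq_forms :: "nat \<Rightarrow> nat \<Rightarrow> ('n::finite) form set" where
  "pq_forms p q = {\<omega>. \<exists>a :: 'n list \<Rightarrow> 'n list \<Rightarrow> complex.
     \<omega> = (\<lambda>vs. \<Sum>I | length I = p. \<Sum>J | length J = q. a I J * dz_form I J vs)}"

definition orthonormal_frame ::
    "('a, 'n::finite) metric_field \<Rightarrow> 'a \<Rightarrow> (complex^'n) set \<Rightarrow> bool" where
  "orthonormal_frame h x B \<longleftrightarrow>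
     (\<forall>u\<in>B. \<forall>v\<in>B. Re (h x u v) = (if u = v then 1 else 0)) \<and> span B = UNIV"

(* The norm induced by the Riemannian metric Re h on complex-valued k-forms: the sum over
   increasing index tuples, written as 1/k! times the sum over all tuples.  It does not depend
   on the frame, and it applies to pull-backs of (p,q)-forms, which need not be of type (p,q). *)
definition form_norm ::
    "('a, 'n::finite) metric_field \<Rightarrow> nat \<Rightarrow> 'a \<Rightarrow> 'n form \<Rightarrow> real" where
  "form_norm h k x \<omega> =
     (let B = (SOME B. orthonormal_frame h x B)
      in sqrt ((\<Sum>vs | set vs \<subseteq> B \<and> length vs = k. (cmod (\<omega> vs))\<^sup>2) / fact k))"

(* The norm may be infinite. *)
definition L2_norm ::
    "('a::{t2_space,second_countable_topology}, 'n::finite) chart set \<Rightarrow>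
     ('a, 'n) metric_field \<Rightarrow> ('a \<Rightarrow> real) \<Rightarrow> nat \<Rightarrow> 'a set \<Rightarrow> ('a \<Rightarrow> 'n form) \<Rightarrow> ennreal" where
  "L2_norm A h \<phi> k S f =
     (let N = (\<integral>\<^sup>+x\<in>S. ennreal ((form_norm h k x (f x))\<^sup>2 * exp (- \<phi> x)) \<partial>volume A h)
      in if N = \<infinity> then \<infinity> else ennreal (sqrt (enn2real N)))"

(* Measurability means measurability of the components in every chart; the components in
   chart_at A x need not depend measurably on x. *)
definition measurable_form ::
    "('a::{t2_space,second_countable_topology}, 'n::finite) chart set \<Rightarrow>
     ('a \<Rightarrow> 'n form) \<Rightarrow> bool" where
  "measurable_form A f \<longleftrightarrow>
     (\<forall>c\<in>A. \<forall>vs. (\<lambda>x. f x (map (vec_of A c x) vs)) \<in> borel_measurable (restrict_space borel (fst c)))"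

definition L2_forms ::
    "('a::{t2_space,second_countable_topology}, 'n::finite) chart set \<Rightarrow>
     ('a, 'n) metric_field \<Rightarrow> ('a \<Rightarrow> real) \<Rightarrow> nat \<Rightarrow> nat \<Rightarrow> ('a \<Rightarrow> 'n form) set" where
  "L2_forms A h \<phi> p q =
     {f. (\<forall>x. f x \<in> pq_forms p q) \<and> measurable_form A f \<and> L2_norm A h \<phi> (p + q) UNIV f < \<infinity>}"

definition ae_equal ::
    "('a::{t2_space,second_countable_topology}, 'n::finite) chart set \<Rightarrow>
     ('a, 'n) metric_field \<Rightarrow> ('a \<Rightarrow> real) \<Rightarrow> nat \<Rightarrow> nat \<Rightarrow> (('a \<Rightarrow> 'n form) \<times> ('a \<Rightarrow> 'n form)) set" where
  "ae_equal A h \<phi> p q = {(f, g). f \<in> L2_forms A h \<phi> p q \<and> g \<in> L2_forms A h \<phi> p q \<and>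
     (AE x in volume A h. f x = g x)}"

definition L2_space ::
    "('a::{t2_space,second_countable_topology}, 'n::finite) chart set \<Rightarrow>
     ('a, 'n) metric_field \<Rightarrow> ('a \<Rightarrow> real) \<Rightarrow> nat \<Rightarrow> nat \<Rightarrow> ('a \<Rightarrow> 'n form) set set" where
  "L2_space A h \<phi> p q = L2_forms A h \<phi> p q // ae_equal A h \<phi> p q"

definition form_diff :: "('a \<Rightarrow> 'n form) \<Rightarrow> ('a \<Rightarrow> 'n form) \<Rightarrow> 'a \<Rightarrow> 'n form" where
  "form_diff f g = (\<lambda>x vs. f x vs - g x vs)"

definition L2_dist ::
    "('a::{t2_space,second_countable_topology}, 'n::finite) chart set \<Rightarrow>
     ('a, 'n) metric_field \<Rightarrow> ('a \<Rightarrow> real) \<Rightarrow> nat \<Rightarrow> nat \<Rightarrow>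
     ('a \<Rightarrow> 'n form) set \<Rightarrow> ('a \<Rightarrow> 'n form) set \<Rightarrow> real" where
  "L2_dist A h \<phi> p q F G =
     enn2real (L2_norm A h \<phi> (p + q) UNIV (form_diff (SOME f. f \<in> F) (SOME g. g \<in> G)))"

definition L2_bounded ::
    "('a::{t2_space,second_countable_topology}, 'n::finite) chart set \<Rightarrow>
     ('a, 'n) metric_field \<Rightarrow> ('a \<Rightarrow> real) \<Rightarrow> nat \<Rightarrow> nat \<Rightarrow> ('a \<Rightarrow> 'n form) set set \<Rightarrow> bool" where
  "L2_bounded A h \<phi> p q = Metric_space.mbounded (L2_space A h \<phi> p q) (L2_dist A h \<phi> p q)"

definition L2_precompact ::
    "('a::{t2_space,second_countable_topology}, 'n::finite) chart set \<Rightarrow>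
     ('a, 'n) metric_field \<Rightarrow> ('a \<Rightarrow> real) \<Rightarrow> nat \<Rightarrow> nat \<Rightarrow> ('a \<Rightarrow> 'n form) set set \<Rightarrow> bool" where
  "L2_precompact A h \<phi> p q \<A> =
     (let T = Metric_space.mtopology (L2_space A h \<phi> p q) (L2_dist A h \<phi> p q)
      in compactin T (T closure_of \<A>))"

definition pull_back ::
    "('a, 'n::finite) chart set \<Rightarrow> ('a \<Rightarrow> 'a) \<Rightarrow> ('a \<Rightarrow> 'n form) \<Rightarrow> 'a \<Rightarrow> 'n form" where
  "pull_back A \<Phi> f = (\<lambda>x vs. f (\<Phi> x) (map (push_forward A \<Phi> x) vs))"

definition relatively_compact_open :: "'a::topological_space set \<Rightarrow> bool" where
  "relatively_compact_open \<Omega> \<longleftrightarrow> open \<Omega> \<and> compact (closure \<Omega>)"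

end

theory Submission
  imports Defs
begin

text \<open>
In the complete metric space of \<open>L\<^sup>2\<close> forms precompactness is total boundedness, and the proof
is that of the Kolmogorov--Riesz theorem in finitely many charts.

If (i) and (ii) hold, cover a relatively compact set carrying almost all of the energy by
coordinate balls. A small translation of such a ball, cut off outside a larger concentric ball, is
a \<open>\<delta>\<close>-deformation, so (i) says that the coefficients of the forms are uniformly
\<open>L\<^sup>2\<close>-continuous under translations. Hence the means of the coefficients over finitely
many small balls, which are bounded, determine the forms up to a small error.

Conversely, a curve in the tangent bundle that is short for the Sasaki metric, ending at a unit vector,
stays in the chart and moves both the base point and the components of the vector by at most a
multiple of its length. So a \<open>\<delta>\<close>-variation is, in coordinates, a map that is \<open>C\<^sup>1\<close>-close to
the identity. For a single \<open>L\<^sup>2\<close> form the pull-backs under such maps converge to it, by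
approximation with simple functions; a finite net gives the uniformity in (i) and the tail estimate (ii).
\<close>

text \<open>Three obstacles shape the work. Tangent vectors are stored in the chart
  \<open>chart_at\<close>, which may jump with the point, and frames come from \<open>SOME\<close>;
  measurability and differentiability cannot be read off the definitions, so velocity, covariant
  derivative, push-forward and form norm are each recomputed in one fixed chart. The volume is a
  \<open>THE\<close>: its existence rests on the change of variables formula and on the fact that a
  complex matrix has real Jacobian |det|^2. Pull-backs of (p,q)-forms are neither of type (p,q) nor
  known to be measurable; they are handled as multilinear forms and compared with measurable
  coefficient functions, which suffices because the nonnegative integral is monotone for arbitrary
  functions. Estimates are made for squared norms (\<open>energy\<close>), where Young's inequality
  does the work of the triangle inequality. Coordinate balls come with nested radii: r for covering
  and estimating, 2r where a cut-off translation is a true translation, 3r for the deformed set and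
  the coefficients, 4r for the bounds on metric, Christoffel symbols and weight.\<close>

abbreviation bmeas :: "('x::topological_space => 'y::topological_space) set" where
  "bmeas == borel_measurable borel"

abbreviation nsq :: "'v::real_normed_vector => ennreal" where
  "nsq x == ennreal ((norm x)\<^sup>2)"

abbreviation fd :: "('v::real_normed_vector => 'w::real_normed_vector) => 'v => 'v => 'w" where
  "fd f x == frechet_derivative f (at x)"

notation scaleR (infixr "*R" 75)

syntax
  "_LI" :: "pttrn => ennreal => ennreal" ("(LI _./ _)" [0, 10] 10)
  "_LI_set" :: "pttrn => 'x set => ennreal => ennreal" ("(LI _:_./ _)" [0, 0, 10] 10)
translations
  "LI x. f" == "CONST nn_integral CONST lborel (%x. f)"
  "LI x:S. f" == "CONST set_nn_integral CONST lborel S (%x. f)"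

section \<open>Calculus of \<open>Ck_on\<close>, smooth cut-offs, symmetry of second
  derivatives\<close>

lemma frechet_derivative_cong_open:
 assumes "open S" "x : S" "!!y. y : S ==> f y = g y"
 shows "fd f x = fd g x"
proof -
 have "(f has_derivative D) (at x) \<longleftrightarrow> (g has_derivative D) (at x)" for D
  using assms by (metis has_derivative_transform_within_open)
 thus ?thesis by (simp add: frechet_derivative_def)
qed

lemma differentiable_cong_open:
 assumes "open S" "x : S" "!!y. y : S ==> f y = g y"
 shows "f differentiable (at x) \<longleftrightarrow> g differentiable (at x)"
 unfolding differentiable_def using assms by (metis has_derivative_transform_within_open)

lemma Ck_on_cong:
 assumes "open S" "!!x. x : S ==> f x = g x"
 shows "Ck_on k f S \<longleftrightarrow> Ck_on k g S" using assms(2)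
proof (induction k arbitrary: f g)
 case 0
 thus ?case using continuous_on_cong by force
next
 case (Suc k)
 have "f differentiable (at x) \<longleftrightarrow> g differentiable (at x)" if "x : S" for x
  using differentiable_cong_open[OF assms(1) that] Suc.prems by blast
 moreover have "Ck_on k (%x. fd f x v) S
   \<longleftrightarrow> Ck_on k (%x. fd g x v) S" for v
  by (rule Suc.IH) (metis frechet_derivative_cong_open[OF assms(1)] Suc.prems)
 ultimately show ?case by simp
qed

lemma Ck_on_transfer:
 "open S ==> Ck_on k f S ==> (!!x. x : S ==> f x = g x) ==> Ck_on k g S" using Ck_on_cong by blast

lemma Ck_on_subset: "Ck_on k f S ==> T <= S ==> Ck_on k f T"
 by (induction k arbitrary: f) (auto intro: continuous_on_subset)

text \<open>Continuity and differentiability are local notions. This is what turns the pointwise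
  extensions in \<open>smooth_on\<close> into regularity on a whole open set.\<close>

lemma Ck_on_local:
 assumes "!!x. x : S ==> EX W. open W & x : W & Ck_on k f W"
 shows "Ck_on k f S" using assms
proof (induction k arbitrary: f)
 case 0
 hence "isCont f x" if "x : S" for x using that by (metis Ck_on.simps(1) continuous_on_eq_continuous_at)
 thus ?case by (simp add: continuous_at_imp_continuous_on)
next
 case (Suc k)
 thus ?case by (simp, meson)
qed

lemma Ck_on_SucD: "Ck_on (Suc k) f S ==> Ck_on k f S"
proof (induction k arbitrary: f)
 case 0
 thus ?case by (auto intro!: differentiable_imp_continuous_on simp: differentiable_on_def differentiable_at_withinI)
next
 case (Suc k)
 thus ?case by (metis Ck_on.simps(2))
qed

lemma Ck_on_const: "Ck_on k (%x. c) S"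
proof (induction k arbitrary: c)
 case (Suc k)
 thus ?case by (simp add: frechet_derivative_const)
qed simp

lemma frechet_derivative_eqI: "(f has_derivative D) (at x) ==> fd f x = D" using frechet_derivative_at by blast

lemma frechet_derivative_bounded_linear: "bounded_linear f ==> fd f x = f"
 by (intro frechet_derivative_eqI bounded_linear_imp_has_derivative)

lemma Ck_on_bounded_linear: "bounded_linear f ==> Ck_on k f S"
 by (cases k) (auto simp: linear_continuous_on frechet_derivative_bounded_linear Ck_on_const
   bounded_linear_imp_differentiable)

lemma Ck_on_add:
 assumes "open S"
 shows "Ck_on k f S ==> Ck_on k g S ==> Ck_on k (%x. f x + g x) S"
proof (induction k arbitrary: f g)
 case 0
 thus ?case by (simp add: continuous_on_add)
next
 case (Suc k)
 have eq: "fd f x v + fd g x v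
   = fd (%x. f x + g x) x v" if "x : S" for x v using Suc.prems that
  by (intro fun_cong[OF frechet_derivative_eqI, symmetric] has_derivative_add)
   (auto simp: frechet_derivative_works)
 have "Ck_on k (%x. fd f x v + fd g x v) S" for v using Suc by simp
 hence "Ck_on k (%x. fd (%x. f x + g x) x v) S" for v by (rule Ck_on_transfer[OF assms]) (rule eq)
 thus ?case using Suc.prems by (auto intro: differentiable_add)
qed

lemma Ck_on_sum:
 assumes "open S"
 shows "(!!i. i : I ==> Ck_on k (f i) S) ==> Ck_on k (%x. SUM i:I. f i x) S"
 by (induction I rule: infinite_finite_induct) (auto intro!: Ck_on_const Ck_on_add[OF assms])

lemma Ck_on_bilinear:
 assumes "open S" and p: "bounded_bilinear p"
 shows "Ck_on k f S ==> Ck_on k g S ==> Ck_on k (%x. p (f x) (g x)) S"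
proof (induction k arbitrary: f g)
 case 0
 thus ?case by (simp add: bounded_bilinear.continuous_on[OF p])
next
 case (Suc k)
 have hd: "((%x. p (f x) (g x)) has_derivative
   (%v. p (f x) (fd g x v) + p (fd f x v) (g x))) (at x)"
  if "x : S" for x using Suc.prems that by (intro bounded_bilinear.FDERIV[OF p]) (auto simp: frechet_derivative_works)
 have eq: "p (f x) (fd g x v) + p (fd f x v) (g x)
   = fd (%x. p (f x) (g x)) x v" if "x : S" for x v using frechet_derivative_eqI[OF hd[OF that]] by simp
 have "Ck_on k (%x. p (f x) (fd g x v)
    + p (fd f x v) (g x)) S" for v using Suc.prems Ck_on_SucD[of k f S] Ck_on_SucD[of k g S]
  by (intro Ck_on_add[OF assms(1)] Suc.IH) simp_all
 hence "Ck_on k (%x. fd (%x. p (f x) (g x)) x v) S" for v by (rule Ck_on_transfer[OF assms(1)]) (rule eq)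
 thus ?case using hd by (auto simp: differentiable_def)
qed

text \<open>\<open>Ck_on\<close> speaks of derivatives in a fixed direction, whereas the chain rule
  evaluates \<open>fd g (f x)\<close> in the moving direction \<open>fd f x v\<close>. Expanding
  that direction in \<open>Basis\<close> gives a sum of products to which the induction applies;
  this is why the middle space is Euclidean.\<close>

lemma Ck_on_compose:
 fixes f :: "'e::real_normed_vector => 'f::euclidean_space" and g :: "'f => 'g::real_normed_vector"
 assumes "open S" and fS: "f ` S <= T"
 shows "Ck_on k g T ==> Ck_on k f S ==> Ck_on k (%x. g (f x)) S"
proof (induction k arbitrary: g)
 case 0
 thus ?case using fS by (auto intro: continuous_on_compose2)
next
 case (Suc k)
 have hd: "((%x. g (f x)) has_derivative
   (%v. fd g (f x) (fd f x v))) (at x)"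
  if "x : S" for x using Suc.prems that fS
  by (intro has_derivative_compose[of f, where g = g]) (auto simp: frechet_derivative_works)
 have eq: "(SUM b:Basis. (fd f x v \<bullet> b) *R fd g (f x) b)
   = fd (%x. g (f x)) x v" if "x : S" for x v
 proof -
  have "linear (fd g (f x))" using Suc.prems that fS by (auto intro!: linear_frechet_derivative)
  hence "fd g (f x) (fd f x v)
   = (SUM b:Basis. (fd f x v \<bullet> b) *R fd g (f x) b)"
   by (subst euclidean_representation[of "fd f x v", symmetric])
    (simp only: linear_sum linear_scale)
  thus ?thesis using frechet_derivative_eqI[OF hd[OF that]] by simp
 qed
 have "Ck_on k (%x. SUM b:Basis. (fd f x v \<bullet> b) *R
   fd g (f x) b) S" for v
 proof (intro Ck_on_sum[OF assms(1)] Ck_on_bilinear[OF assms(1) bounded_bilinear_scaleR])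
  fix b :: 'f
  show "Ck_on k (%x. fd f x v \<bullet> b) S"
   using Ck_on_bilinear[OF assms(1) bounded_bilinear_inner, of k "%x. fd f x v" "%_. b"]
    Suc.prems Ck_on_const by auto
  show "Ck_on k (%x. fd g (f x) b) S" using Suc.prems by (intro Suc.IH) (auto intro: Ck_on_SucD)
 qed
 hence "Ck_on k (%x. fd (%x. g (f x)) x v) S" for v by (rule Ck_on_transfer[OF assms(1)]) (rule eq)
 thus ?case using hd by (auto simp: differentiable_def)
qed

lemma smooth_on_open_iff:
 assumes "open S"
 shows "smooth_on S f \<longleftrightarrow> (ALL k. Ck_on k f S)"
proof
 assume L: "smooth_on S f"
 show "ALL k. Ck_on k f S"
 proof (intro allI Ck_on_local)
  fix k x assume "x : S"
  with L obtain W g where W: "open W" "x : W" "ALL k. Ck_on k g W" "ALL y:S \<inter> W. f y = g y"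
   unfolding smooth_on_def by meson
  have "Ck_on k g (S \<inter> W)" using W(3) Ck_on_subset by (metis inf.cobounded2)
  hence "Ck_on k f (S \<inter> W)" by (rule Ck_on_transfer[rotated]) (use W assms in auto)
  thus "EX W. open W & x : W & Ck_on k f W"
   using W \<open>x : S\<close> assms by (intro exI[of _ "S \<inter> W"]) auto
 qed
next
 assume "ALL k. Ck_on k f S"
 thus "smooth_on S f" unfolding smooth_on_def using assms by blast
qed

lemma Ck_on_inverse_real: "Ck_on k (inverse :: real => real) (-{0})"
proof (induction k)
 case 0
 thus ?case by (auto intro!: continuous_intros)
next
 case (Suc k)
 have hd: "(inverse has_derivative (%v. - (inverse x * v * inverse x))) (at x)" if "x ~= 0" for x :: real
  using that by (rule has_derivative_inverse')
 have "Ck_on k (%x. (- v) * (inverse x * inverse x)) (-{0})" for v :: real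
  using Suc by (intro Ck_on_bilinear[OF _ bounded_bilinear_mult] Ck_on_const) auto
 moreover have "(- v) * (inverse x * inverse x) = fd inverse x v"
  if "x : -{0}" for x v :: real using frechet_derivative_eqI[OF hd[of x]] that by (simp add: mult_ac)
 ultimately have "Ck_on k (%x. fd inverse x v) (-{0})" for v :: real by (rule Ck_on_transfer[rotated]) auto
 thus ?case using hd by (auto simp: differentiable_def)
qed

text \<open>The exponential 1/x^n times e^(-1/x), continued by 0. The case n = 0 is the one of
  interest; the whole family is closed under differentiation up to linear combinations, so
  smoothness follows by an induction that treats all n at once.\<close>

definition flat_fun :: "nat => real => real" where
 "flat_fun n x = (if x > 0 then inverse x ^ n * exp (- inverse x) else 0)"

lemma flat_fun_tendsto_0: "(flat_fun n \<longlongrightarrow> 0) (at 0)"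
proof -
 have "((%x. (inverse x) ^ n / exp (inverse x)) \<longlongrightarrow> 0) (at_right (0::real))"
  using filterlim_compose[OF tendsto_power_div_exp_0 filterlim_inverse_at_top_right] by simp
 hence "(flat_fun n \<longlongrightarrow> 0) (at_right 0)"
 proof (rule Lim_transform_eventually)
  show "\<forall>\<^sub>F x in at_right 0. inverse x ^ n / exp (inverse x) = flat_fun n x"
   by (auto simp: eventually_at_filter flat_fun_def exp_minus field_simps)
 qed
 moreover have "(flat_fun n \<longlongrightarrow> 0) (at_left 0)"
  by (rule Lim_transform_eventually[OF tendsto_const]) (auto simp: eventually_at_filter flat_fun_def)
 ultimately show ?thesis by (simp add: filterlim_split_at)
qed

lemma flat_fun_deriv:
 "(flat_fun n has_real_derivative (flat_fun (n + 2) x - real n * flat_fun (n + 1) x)) (at x)"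
proof -
 consider "x > 0" | "x < 0" | "x = 0" by linarith
 thus ?thesis
 proof cases
  case 1
  have "((%x. inverse x ^ n * exp (- inverse x)) has_real_derivative
    (flat_fun (n + 2) x - real n * flat_fun (n + 1) x)) (at x)"
   using 1 by (auto intro!: derivative_eq_intros simp: flat_fun_def field_simps power2_eq_square)
    (cases n; simp add: field_simps)
  thus ?thesis
   by (rule has_field_derivative_transform_within_open[where S = "{0<..}"]) (use 1 in \<open>auto simp: flat_fun_def\<close>)
 next
  case 2
  have "((%x. 0) has_real_derivative 0) (at x)" by simp
  hence "(flat_fun n has_real_derivative 0) (at x)"
   by (rule has_field_derivative_transform_within_open[where S = "{..<0}"]) (use 2 in \<open>auto simp: flat_fun_def\<close>)
  thus ?thesis using 2 by (simp add: flat_fun_def)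
 next
  case 3
  \<comment> \<open>The difference quotient of \<open>flat_fun n\<close> at 0 is
    \<open>flat_fun (Suc n)\<close>.\<close>
  have "((%h. (flat_fun n (0 + h) - flat_fun n 0) / h) \<longlongrightarrow> 0) (at 0)"
   by (rule Lim_transform_eventually[OF flat_fun_tendsto_0[of "Suc n"]])
    (auto simp: eventually_at_filter flat_fun_def field_simps)
  thus ?thesis using 3 by (simp add: DERIV_def flat_fun_def)
 qed
qed

lemma Ck_on_flat_fun: "Ck_on k (flat_fun n) UNIV"
proof (induction k arbitrary: n)
 case 0
 show ?case by (simp add: continuous_at_imp_continuous_on DERIV_isCont[OF flat_fun_deriv])
next
 case (Suc k)
 have hd: "(flat_fun n has_derivative (%v. v * (flat_fun (n + 2) x + (- real n) * flat_fun (n + 1) x))) (at x)" for x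
  using flat_fun_deriv[of n x] by (simp add: has_field_derivative_def mult.commute[of _ "_ - _"])
 have eq: "fd (flat_fun n) x v = v * (flat_fun (n + 2) x + (- real n) * flat_fun (n + 1) x)" for x v
  using frechet_derivative_eqI[OF hd] by simp
 have "Ck_on k (%x. v * (flat_fun (n + 2) x + (- real n) * flat_fun (n + 1) x)) UNIV" for v
  by (intro Ck_on_bilinear[OF _ bounded_bilinear_mult] Ck_on_const Ck_on_add Suc.IH) auto
 thus ?case using hd by (auto simp: differentiable_def eq)
qed

text \<open>The usual quotient a / (a + b): \<open>a\<close> is positive exactly on the open ball of
  radius R and \<open>b\<close> exactly outside the closed ball of radius r, so they have no common
  zero. Both are functions of the squared distance, which is smooth also at the centre.\<close>

lemma smooth_cutoff:
 fixes z0 :: "'e::euclidean_space" and r R :: real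
 assumes "0 < r" "r < R"
 obtains cut :: "'e => real" where "!!k. Ck_on k cut UNIV" "!!z. dist z0 z <= r ==> cut z = 1"
  "!!z. dist z0 z >= R ==> cut z = 0" "!!z. 0 <= cut z" "!!z. cut z <= 1"
proof
 define s where "s z = (z - z0) \<bullet> (z - z0)" for z
 have s: "s z = (dist z0 z)\<^sup>2" for z by (metis s_def dist_commute dist_norm power2_norm_eq_inner)
 define a where "a z = flat_fun 0 (R\<^sup>2 - s z)" for z
 define b where "b z = flat_fun 0 (s z - r\<^sup>2)" for z
 define cut where "cut z = a z * inverse (a z + b z)" for z
 have rR: "r\<^sup>2 < R\<^sup>2" using assms by (simp add: power_strict_mono)
 have nn: "a z >= 0" "b z >= 0" for z by (auto simp: a_def b_def flat_fun_def)
 have pos: "a z + b z > 0" for z using rR by (auto simp: a_def b_def flat_fun_def intro!: add_pos_pos)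
 have Cz: "Ck_on k (%z. z - z0) UNIV" for k
 proof -
  have "Ck_on k (%z. z + - z0) UNIV"
   by (intro Ck_on_add Ck_on_bounded_linear[OF bounded_linear_ident] Ck_on_const open_UNIV)
  thus ?thesis by simp
 qed
 have Cs: "Ck_on k s UNIV" for k unfolding s_def by (intro Ck_on_bilinear[OF _ bounded_bilinear_inner] Cz) auto
 have Ca: "Ck_on k a UNIV" for k unfolding a_def
 proof (rule Ck_on_compose[OF _ _ Ck_on_flat_fun])
  show "Ck_on k (%z. R\<^sup>2 - s z) UNIV"
  proof -
   have "Ck_on k (%z. R\<^sup>2 + (- 1) * s z) UNIV"
    by (intro Ck_on_add Ck_on_bilinear[OF _ bounded_bilinear_mult] Cs Ck_on_const open_UNIV)
   thus ?thesis by simp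
  qed
 qed auto
 have Cb: "Ck_on k b UNIV" for k unfolding b_def
 proof (rule Ck_on_compose[OF _ _ Ck_on_flat_fun])
  show "Ck_on k (%z. s z - r\<^sup>2) UNIV"
  proof -
   have "Ck_on k (%z. s z + - r\<^sup>2) UNIV" by (intro Ck_on_add Cs Ck_on_const open_UNIV)
   thus ?thesis by simp
  qed
 qed auto
 show "Ck_on k cut UNIV" for k unfolding cut_def
 proof (rule Ck_on_bilinear[OF _ bounded_bilinear_mult Ca], simp)
  show "Ck_on k (%x. inverse (a x + b x)) UNIV"
   by (rule Ck_on_compose[OF _ _ Ck_on_inverse_real]) (use pos in \<open>auto intro!: Ck_on_add Ca Cb simp: less_imp_neq[symmetric] dest: less_imp_neq\<close>)
 qed
 show "cut z = 1" if "dist z0 z <= r" for z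
 proof -
  have "(dist z0 z)\<^sup>2 <= r\<^sup>2" using that by (intro power_mono) auto
  hence "b z = 0" by (simp add: b_def flat_fun_def s)
  thus ?thesis using pos[of z] by (simp add: cut_def)
 qed
 show "cut z = 0" if "dist z0 z >= R" for z
 proof -
  have "R\<^sup>2 <= (dist z0 z)\<^sup>2" using that assms by (intro power_mono) auto
  hence "a z = 0" by (simp add: a_def flat_fun_def s)
  thus ?thesis by (simp add: cut_def)
 qed
 show "0 <= cut z" "cut z <= 1" for z using nn[of z] pos[of z] by (auto simp: cut_def divide_inverse[symmetric])
qed

text \<open>Two applications of the mean value theorem to the second difference: first in direction
  u, then to the resulting difference of u-derivatives in direction v.\<close>

lemma second_derivative_mvt:
 fixes f :: "'e::real_normed_vector => real"
 assumes C: "Ck_on 2 f (ball x r)" and t: "0 < t" "t * (norm u + norm v) < r"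
 shows "EX \<xi> \<eta>. 0 < \<xi> & \<xi> < t & 0 < \<eta> & \<eta> < t &
   f (x + t *R u + t *R v) - f (x + t *R u) - f (x + t *R v) + f x
   = t * t * fd (%y. fd f y u) (x + \<xi> *R u + \<eta> *R v) v"
proof -
 have inb: "x + a *R u + b *R v : ball x r" if "0 <= a" "a <= t" "0 <= b" "b <= t" for a b
 proof -
  have "norm (a *R u + b *R v) <= a * norm u + b * norm v" using norm_triangle_ineq[of "a *R u" "b *R v"] that by simp
  also have "... <= t * norm u + t * norm v" using that by (intro add_mono mult_right_mono) auto
  finally have "norm (a *R u + b *R v) < r" using t by (simp add: algebra_simps)
  moreover have "dist x (x + a *R u + b *R v) = norm (a *R u + b *R v)"
   by (metis add.assoc add_diff_cancel_left' dist_commute dist_norm)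
  ultimately show ?thesis by simp
 qed
 define f' where "f' y = fd f y" for y
 have hd: "(f has_derivative f' y) (at y)" if "y : ball x r" for y
  using C that by (auto simp: numeral_2_eq_2 f'_def frechet_derivative_works)
 have hd2: "((%y. f' y u) has_derivative fd (%y. f' y u) y) (at y)" if "y : ball x r" for y
  using C that by (auto simp: numeral_2_eq_2 f'_def frechet_derivative_works[symmetric])
 have lin: "linear (f' y)" if "y : ball x r" for y using hd[OF that] has_derivative_linear by blast
 define G where "G s = f (x + s *R u + t *R v) - f (x + s *R u + 0 *R v)" for s
 have G': "(G has_real_derivative (f' (x + s *R u + t *R v) u - f' (x + s *R u + 0 *R v) u)) (at s)"
  if "0 <= s" "s <= t" for s
 proof -
  have hdb: "((%s. f (x + s *R u + b *R v)) has_derivative (%h. f' (x + s *R u + b *R v) (h *R u))) (at s)"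
   if "0 <= b" "b <= t" for b using inb[OF \<open>0 <= s\<close> \<open>s <= t\<close> that]
   by (intro has_derivative_compose[OF _ hd]) (auto intro!: derivative_eq_intros)
  hence "((%s. f (x + s *R u + b *R v)) has_real_derivative f' (x + s *R u + b *R v) u) (at s)"
   if "0 <= b" "b <= t" for b using hdb[OF that] lin[OF inb[OF \<open>0 <= s\<close> \<open>s <= t\<close> that]]
   by (simp add: has_field_derivative_def linear_scale mult_commute_abs)
  from this[of t] this[of 0] show ?thesis unfolding G_def using t by (auto intro!: DERIV_diff)
 qed
 obtain \<xi> where \<xi>: "0 < \<xi>" "\<xi> < t"
  "G t - G 0 = t * (f' (x + \<xi> *R u + t *R v) u - f' (x + \<xi> *R u + 0 *R v) u)" using MVT2[OF t(1) G'] by auto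
 define H where "H s = f' (x + \<xi> *R u + s *R v) u" for s
 have H': "(H has_real_derivative fd (%y. f' y u) (x + \<xi> *R u + s *R v) v) (at s)"
  if "0 <= s" "s <= t" for s
 proof -
  let ?y = "x + \<xi> *R u + s *R v"
  have y: "?y : ball x r" using inb \<xi> that by simp
  have "(H has_derivative (%h. fd (%y. f' y u) ?y (h *R v))) (at s)"
   unfolding H_def by (rule has_derivative_compose[where g = "%y. f' y u" and f = "%s. x + \<xi> *R u + s *R v", OF _ hd2[OF y]]) (auto intro!: derivative_eq_intros)
  moreover have "linear (fd (%y. f' y u) ?y)" using hd2[OF y] has_derivative_linear by blast
  ultimately show ?thesis by (simp add: has_field_derivative_def linear_scale mult_commute_abs)
 qed
 obtain \<eta> where \<eta>: "0 < \<eta>" "\<eta> < t"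
  "H t - H 0 = t * fd (%y. f' y u) (x + \<xi> *R u + \<eta> *R v) v" using MVT2[OF t(1) H'] by auto
 show ?thesis using \<xi> \<eta> by (intro exI[of _ \<xi>] exI[of _ \<eta>]) (auto simp: G_def H_def f'_def)
qed

text \<open>The second difference is symmetric in u and v, while its two mean value expressions are
  values of the two mixed derivatives close to x. A gap of \<open>2 * e\<close> between these
  derivatives at x contradicts their continuity.\<close>

lemma symmetric_second_derivative_real:
 fixes f :: "'e::real_normed_vector => real"
 assumes "open S" "x : S" and C: "Ck_on 2 f S"
 shows "fd (%y. fd f y u) x v
    = fd (%y. fd f y v) x u"
proof (rule ccontr)
 define A where "A u v y = fd (%y. fd f y u) y v" for u v y
 assume "\<not> ?thesis"
 hence ne: "A u v x ~= A v u x" by (simp add: A_def)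
 define e where "e = \<bar>A u v x - A v u x\<bar> / 2"
 have e: "e > 0" using ne by (simp add: e_def)
 have cont: "isCont (A u v) x" for u v
 proof -
  have "continuous_on S (A u v)" using C by (auto simp: numeral_2_eq_2 A_def)
  thus ?thesis using assms continuous_on_eq_continuous_at by blast
 qed
 obtain d1 where d1: "d1 > 0" "!!y. dist y x < d1 ==> \<bar>A u v y - A u v x\<bar> < e"
  using cont[of u v] e by (metis continuous_at_eps_delta dist_real_def)
 obtain d2 where d2: "d2 > 0" "!!y. dist y x < d2 ==> \<bar>A v u y - A v u x\<bar> < e"
  using cont[of v u] e by (metis continuous_at_eps_delta dist_real_def)
 obtain r0 where r0: "r0 > 0" "ball x r0 <= S" using assms openE by blast
 define r where "r = min r0 (min d1 d2)"
 have r: "r > 0" "ball x r <= S" using r0 d1 d2 by (auto simp: r_def)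
 have Cr: "Ck_on 2 f (ball x r)" using C r(2) Ck_on_subset by blast
 \<comment> \<open>Small enough to keep the parallelogram inside the ball; the 1 covers u = v =
   0.\<close>
 define t where "t = r / (2 * (norm u + norm v + 1))"
 have n: "norm u + norm v + 1 > 0" by (simp add: add_nonneg_pos)
 have t: "t > 0" using r n by (simp add: t_def)
 have tr: "t * (norm u + norm v) < r"
 proof -
  have "t * (norm u + norm v) <= t * (norm u + norm v + 1)" using t by simp
  also have "... = r / 2" using n by (simp add: t_def field_simps)
  finally show ?thesis using r by simp
 qed
 have near: "dist (x + a *R u' + b *R v') x < r"
  if "0 < a" "a < t" "0 < b" "b < t" "t * (norm u' + norm v') < r" for a b u' v'
 proof -
  have "dist (x + a *R u' + b *R v') x = norm (a *R u' + b *R v')" by (simp add: dist_norm algebra_simps)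
  also have "... <= a * norm u' + b * norm v'" using norm_triangle_ineq[of "a *R u'" "b *R v'"] that by simp
  also have "... <= t * norm u' + t * norm v'" using that by (intro add_mono mult_right_mono) auto
  finally show ?thesis using that by (simp add: algebra_simps)
 qed
 obtain a b where 1: "0 < a" "a < t" "0 < b" "b < t"
   "f (x + t *R u + t *R v) - f (x + t *R u) - f (x + t *R v) + f x = t * t * A u v (x + a *R u + b *R v)"
  using second_derivative_mvt[OF Cr t tr] unfolding A_def by blast
 obtain a' b' where 2: "0 < a'" "a' < t" "0 < b'" "b' < t"
   "f (x + t *R v + t *R u) - f (x + t *R v) - f (x + t *R u) + f x = t * t * A v u (x + a' *R v + b' *R u)"
  using second_derivative_mvt[OF Cr t, of v u] tr unfolding A_def by (auto simp: add.commute)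
 have "t * t * A u v (x + a *R u + b *R v) = t * t * A v u (x + a' *R v + b' *R u)"
 proof -
  have "x + t *R v + t *R u = x + t *R u + t *R v" by (simp add: add_ac)
  hence "f (x + t *R v + t *R u) = f (x + t *R u + t *R v)" by (rule arg_cong)
  thus ?thesis using 1(5) 2(5) by linarith
 qed
 hence eq: "A u v (x + a *R u + b *R v) = A v u (x + a' *R v + b' *R u)" using t by simp
 have "\<bar>A u v (x + a *R u + b *R v) - A u v x\<bar> < e" using near[OF 1(1-4) tr] by (intro d1) (simp add: r_def)
 moreover have "\<bar>A v u (x + a' *R v + b' *R u) - A v u x\<bar> < e"
  using near[OF 2(1-4), of v u] tr by (intro d2) (simp add: r_def add.commute)
 ultimately show False using eq e_def by (simp add: abs_if split: if_splits)
qed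

lemma symmetric_second_derivative:
 fixes f :: "'e::real_normed_vector => 'f::euclidean_space"
 assumes "open S" "x : S" and C: "Ck_on 2 f S"
 shows "fd (%y. fd f y u) x v
    = fd (%y. fd f y v) x u"
proof (rule euclidean_eqI)
 fix b :: 'f
 define g where "g y = f y \<bullet> b" for y
 have fd: "f differentiable (at y)" "(%y. fd f y u) differentiable (at y)" if "y : S" for y u
  using C that by (auto simp: numeral_2_eq_2)
 have g1: "fd g y u = fd f y u \<bullet> b" if "y : S" for y u using fd[OF that] unfolding g_def
  by (intro fun_cong[OF frechet_derivative_eqI]) (auto intro!: derivative_eq_intros simp: frechet_derivative_works)
 have g2: "fd (%y. fd g y u) x v
   = fd (%y. fd f y u) x v \<bullet> b" for u v
 proof -
  have "fd (%y. fd g y u) x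
    = fd (%y. fd f y u \<bullet> b) x" by (rule frechet_derivative_cong_open[OF assms(1,2) g1])
  moreover have "fd (%y. fd f y u \<bullet> b) x v
    = fd (%y. fd f y u) x v \<bullet> b" using fd(2)[OF assms(2), of u]
   by (intro fun_cong[OF frechet_derivative_eqI]) (auto intro!: derivative_eq_intros simp: frechet_derivative_works)
  ultimately show ?thesis by simp
 qed
 have "Ck_on 2 g S" unfolding g_def by (rule Ck_on_bilinear[OF assms(1) bounded_bilinear_inner C Ck_on_const])
 from symmetric_second_derivative_real[OF assms(1,2) this, of u v]
 show "fd (%y. fd f y u) x v \<bullet> b
   = fd (%y. fd f y v) x u \<bullet> b" by (simp add: g2)
qed

section \<open>Jacobians of maps between complex coordinate spaces\<close>

text \<open>The change of variables theorem of the library is stated for an index type of class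
 wellorder; the type \<^typ>\<open>'n bit0\<close> has this class and the right cardinality.\<close>

definition real_basis :: "'n::finite bit0 => complex^'n" where
 "real_basis = (SOME \<beta>. bij_betw \<beta> UNIV Basis)"

lemma bij_real_basis: "bij_betw (real_basis :: 'n::finite bit0 => complex^'n) UNIV Basis"
proof -
 have "card (UNIV :: 'n bit0 set) = card (Basis :: (complex^'n) set)" by simp
 hence "EX \<beta>. bij_betw \<beta> (UNIV :: 'n bit0 set) (Basis :: (complex^'n) set)"
  by (intro finite_same_card_bij) auto
 thus ?thesis unfolding real_basis_def by (rule someI_ex)
qed

definition to_real :: "complex^'n::finite => real^'n bit0" where
 "to_real z = (\<chi> i. z \<bullet> real_basis i)"

definition from_real :: "real^'n::finite bit0 => complex^'n" where
 "from_real x = (SUM i:UNIV. x $ i *R real_basis i)"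

lemma real_basis_inner: "real_basis i \<bullet> real_basis j = (if i = j then 1 else 0)"
proof -
 have "real_basis i : Basis" "real_basis j : Basis" "real_basis i = real_basis j \<longleftrightarrow> i = j"
  using bij_real_basis by (auto simp: bij_betw_def dest: injD)
 thus ?thesis by (simp add: inner_Basis)
qed

lemma from_to_real [simp]: "from_real (to_real z) = z"
proof -
 have "from_real (to_real z) = (SUM b:Basis. (z \<bullet> b) *R b)" unfolding from_real_def to_real_def
  by (simp add: sum.reindex_bij_betw[OF bij_real_basis, of "%b. (z \<bullet> b) *R b"])
 thus ?thesis by (simp add: euclidean_representation)
qed

lemma to_from_real [simp]: "to_real (from_real x) = x"
 by (simp add: to_real_def from_real_def vec_eq_iff inner_sum_left real_basis_inner if_distrib cong: if_cong)

lemma linear_to_real: "linear to_real" by (intro linearI) (auto simp: to_real_def vec_eq_iff inner_add_left)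

lemma linear_from_real: "linear from_real"
 by (intro linearI) (auto simp: from_real_def scaleR_add_left sum.distrib scaleR_sum_right)

lemma continuous_to_real [continuous_intros]: "continuous_on S f ==> continuous_on S (%x. to_real (f x))"
 by (rule bounded_linear.continuous_on[OF linear_to_real[unfolded linear_conv_bounded_linear]])

lemma continuous_from_real [continuous_intros]: "continuous_on S f ==> continuous_on S (%x. from_real (f x))"
 by (rule bounded_linear.continuous_on[OF linear_from_real[unfolded linear_conv_bounded_linear]])

lemma measurable_to_real [measurable]: "to_real : bmeas" by (intro borel_measurable_continuous_onI continuous_intros)

lemma measurable_from_real [measurable]: "from_real : bmeas"
 by (intro borel_measurable_continuous_onI continuous_intros)

text \<open>A bijection between the two bases turns a box into a box with the same edges, and
  Lebesgue measure is determined by its values on boxes.\<close>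

lemma lborel_distr_from_real: "(lborel :: (complex^'n::finite) measure) = distr lborel borel from_real"
proof (rule lborel_eqI)
 fix l u :: "complex^'n"
 assume le: "!!b. b : Basis ==> l \<bullet> b <= u \<bullet> b"
 have axb: "bij_betw (%i. axis i (1::real)) (UNIV :: 'n bit0 set) Basis"
  by (auto simp: bij_betw_def Basis_vec_def inj_on_def axis_eq_axis)
 have rb: "real_basis i : Basis" for i :: "'n bit0" using bij_real_basis by (auto simp: bij_betw_def)
 have "from_real -` box l u = box (to_real l) (to_real u)"
 proof (intro set_eqI)
  fix x :: "real^'n bit0"
  have "from_real x \<bullet> real_basis i = x $ i" for i
   using arg_cong[OF to_from_real[of x], of "%y. y $ i"] by (simp add: to_real_def)
  moreover have "(ALL b:Basis. P b) \<longleftrightarrow> (ALL i. P (real_basis i))" for P :: "complex^'n => bool"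
   using bij_real_basis by (metis UNIV_I bij_betw_iff_bijections)
  moreover have "from_real x : box l u \<longleftrightarrow> (ALL b:Basis. l \<bullet> b < from_real x \<bullet> b & from_real x \<bullet> b < u \<bullet> b)"
   by (simp add: mem_box)
  ultimately show "x : from_real -` box l u \<longleftrightarrow> x : box (to_real l) (to_real u)"
   by (simp add: mem_box_cart to_real_def)
 qed
 hence "emeasure (distr lborel borel from_real) (box l u) = emeasure lborel (box (to_real l) (to_real u))"
  by (simp add: emeasure_distr)
 also have "... = (\<Prod>b\<in>Basis. (to_real u - to_real l) \<bullet> b)"
  using rb le by (intro emeasure_lborel_box) (auto simp: Basis_vec_def inner_axis to_real_def)
 also have "(\<Prod>b\<in>Basis. (to_real u - to_real l) \<bullet> b) = (\<Prod>i\<in>UNIV. (to_real u - to_real l) \<bullet> axis i 1)"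
  by (rule prod.reindex_bij_betw[OF axb, symmetric])
 also have "... = (\<Prod>i\<in>UNIV. (u - l) \<bullet> real_basis i)"
  by (simp add: inner_axis to_real_def inner_diff_left)
 also have "... = (\<Prod>b\<in>Basis. (u - l) \<bullet> b)" by (rule prod.reindex_bij_betw[OF bij_real_basis])
 finally show "emeasure (distr lborel borel from_real) (box l u) = ennreal (\<Prod>b\<in>Basis. (u - l) \<bullet> b)" .
qed simp

text \<open>The absolute real Jacobian determinant. The argument is meant to be only real linear:
  derivatives of diffeomorphisms need not commute with the complex structure.\<close>

definition jac :: "(complex^'n::finite => complex^'n) => real" where
 "jac T = \<bar>det (matrix (to_real o T o from_real))\<bar>"

lemma jac_nonneg: "0 <= jac T" by (simp add: jac_def)

lemma linear_conj_real: "linear T ==> linear (to_real o T o from_real)"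
 by (intro linear_compose linear_to_real linear_from_real)

lemma jac_compose:
 assumes "linear T" "linear U"
 shows "jac (T o U) = jac T * jac U"
proof -
 have "to_real o (T o U) o from_real = (to_real o T o from_real) o (to_real o U o from_real)"
  by (auto simp: fun_eq_iff)
 thus ?thesis using matrix_compose[OF linear_conj_real[OF assms(2)] linear_conj_real[OF assms(1)]]
  by (simp add: jac_def det_mul abs_mult)
qed

lemma jac_compose3:
 "linear T ==> linear U ==> linear V ==> jac (T o U o V) = jac T * jac U * jac V"
 by (simp only: jac_compose linear_compose)

lemma jac_id: "jac (%x. x) = 1"
proof -
 have e: "to_real o (%x. x) o from_real = id" by (auto simp: fun_eq_iff)
 show ?thesis unfolding jac_def e by (simp add: matrix_id_mat_1)
qed

lemma jac_involution: "linear T ==> (!!x. T (T x) = x) ==> jac T = 1"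
proof -
 assume T: "linear T" "!!x. T (T x) = x"
 have "T o T = (%x. x)" using T by auto
 hence "jac T * jac T = 1" using jac_compose[OF T(1) T(1)] by (simp only: jac_id)
 thus ?thesis using jac_nonneg[of T] by (metis abs_of_nonneg power2_eq_1_iff power2_eq_square abs_1 abs_minus_cancel)
qed

lemma jac_scaleR: "jac (%z::complex^'n::finite. s *R z) = \<bar>s\<bar> ^ (2 * CARD('n))"
proof -
 have "to_real o (%z::complex^'n. s *R z) o from_real = (%x. s *R x)"
  by (auto simp: fun_eq_iff linear_scale[OF linear_to_real])
 moreover have "det (matrix (%x::real^'n bit0. s *R x)) = s ^ (2 * CARD('n))"
  by (subst det_diagonal) (auto simp: matrix_def axis_def)
 ultimately show ?thesis by (simp add: jac_def power_abs)
qed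

lemma linear_mult_vec: "linear ((*v) (M :: complex^'n^'m))" by (intro linearI, simp add: matrix_vector_right_distrib)
  (simp add: matrix_vector_mult_def vec_eq_iff scaleR_sum_right)

lemma jac_matrix_mult: "jac ((*v) (M ** N)) = jac ((*v) M) * jac ((*v) (N :: complex^'n::finite^'n))"
proof -
 have "(*v) (M ** N) = (*v) M o (*v) N" by (auto simp: fun_eq_iff matrix_vector_mul_assoc)
 thus ?thesis using jac_compose linear_mult_vec by metis
qed

definition scale_on :: "'n set => complex => complex^'n => complex^'n" where
 "scale_on K a z = (\<chi> i. if i : K then a * z $ i else z $ i)"

lemma linear_scale_on: "linear (scale_on K a)" by (intro linearI) (auto simp: scale_on_def vec_eq_iff algebra_simps)

lemma jac_swap: "jac (%z::complex^'n::finite. \<chi> l. z $ Transposition.transpose i k l) = 1"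
 by (rule jac_involution) (auto intro!: linearI simp: vec_eq_iff)

text \<open>Scaling by \<open>cnj a\<close> is conjugate to scaling by \<open>a\<close> under
  complex conjugation, an involution with Jacobian 1, and the product of the two scalings is a real
  scaling. A square root then gives the value without any matrix computation.\<close>

lemma jac_scale_all: "jac (%z::complex^'n::finite. a *s z) = (cmod a) ^ (2 * CARD('n))"
proof -
 define C :: "complex^'n => complex^'n" where "C z = (\<chi> i. cnj (z $ i))" for z
 have C: "linear C" "jac C = 1" by (auto intro!: linearI jac_involution simp: C_def vec_eq_iff)
 have lin: "linear (%z::complex^'n. a *s z)" for a by (auto intro!: linearI simp: vec_eq_iff algebra_simps)
 have "(%z. cnj a *s z) = C o (%z. a *s z) o C" by (auto simp: C_def vec_eq_iff)
 hence 1: "jac (%z::complex^'n. cnj a *s z) = jac (%z::complex^'n. a *s z)"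
  using C lin by (simp only: jac_compose3 mult_1_left mult_1_right)
 have "(%z::complex^'n. cnj a *s z) o (%z. a *s z) = (%z. (cmod a)\<^sup>2 *R z)"
 proof -
  have "cnj a * a * w = (cmod a)\<^sup>2 *R w" for w
   by (simp add: scaleR_conv_of_real complex_norm_square mult_ac del: of_real_power)
  thus ?thesis by (simp add: vec_eq_iff fun_eq_iff)
 qed
 hence "(jac (%z::complex^'n. a *s z))\<^sup>2 = \<bar>(cmod a)\<^sup>2\<bar> ^ (2 * CARD('n))"
  using jac_compose[OF lin lin] 1 jac_scaleR by (metis power2_eq_square)
 also have "... = ((cmod a) ^ (2 * CARD('n)))\<^sup>2" by (simp add: power_mult[symmetric] mult.commute)
 finally show ?thesis by (rule power2_eq_imp_eq) (auto simp: jac_nonneg)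
qed

text \<open>Exchanging coordinates shows that the Jacobian does not depend on k. The product over
  all k is the scaling of the whole space, so a root of order \<open>CARD('n)\<close> is
  taken.\<close>

lemma jac_scale_on: "jac (scale_on {k} a :: complex^'n::finite => _) = (cmod a)\<^sup>2"
proof -
 define S where "S k = (scale_on {k} a :: complex^'n => _)" for k
 have jS: "jac (S i) = jac (S k)" for i
 proof -
  let ?t = "%z::complex^'n. \<chi> l. z $ Transposition.transpose i k l"
  have "S i = ?t o S k o ?t" by (auto simp: S_def scale_on_def vec_eq_iff fun_eq_iff Transposition.transpose_def)
  moreover have "linear ?t" by (auto intro!: linearI simp: vec_eq_iff)
  ultimately show ?thesis by (simp only: jac_compose3 jac_swap linear_scale_on S_def mult_1_left mult_1_right)
 qed
 have "jac (scale_on K a :: complex^'n => _) = jac (S k) ^ card K" for K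
 proof (induction K rule: infinite_finite_induct)
  case empty
  have "scale_on {} a = (%z::complex^'n. z)" by (auto simp: scale_on_def)
  thus ?case by (simp add: jac_id)
 next
  case (insert i K)
  have "scale_on (insert i K) a = S i o scale_on K a"
   using insert by (auto simp: S_def scale_on_def vec_eq_iff fun_eq_iff)
  hence "jac (scale_on (insert i K) a :: complex^'n => _) = jac (S i) * jac (scale_on K a :: complex^'n => _)"
   by (simp only: jac_compose linear_scale_on S_def)
  thus ?case using insert jS[of i] by simp
 qed auto
 from this[of UNIV] have "jac (S k) ^ CARD('n) = ((cmod a)\<^sup>2) ^ CARD('n)"
  using jac_scale_all[of a, where 'n = 'n] by (simp add: scale_on_def[abs_def] vector_scalar_mult_def power_mult)
 hence "jac (S k) = (cmod a)\<^sup>2" by (rule power_eq_imp_eq_base) (auto simp: jac_nonneg)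
 thus ?thesis by (simp add: S_def)
qed

text \<open>The inverse shear is the shear conjugated by the sign change of coordinate k, so the
  Jacobian equals its own inverse.\<close>

lemma jac_shear:
 assumes "b $ k = 0"
 shows "jac (%z::complex^'n::finite. z + z $ k *s b) = 1"
proof -
 define S where "S b z = z + z $ k *s b" for b z :: "complex^'n"
 have lin: "linear (S b)" for b by (auto intro!: linearI simp: S_def vec_eq_iff algebra_simps)
 have "S b o S (-b) = (%z. z)" using assms by (auto simp: S_def vec_eq_iff fun_eq_iff algebra_simps)
 hence 1: "jac (S b) * jac (S (-b)) = 1" using jac_compose[OF lin lin] jac_id by metis
 have "S (-b) = scale_on {k} (-1) o S b o scale_on {k} (-1)"
  using assms by (auto simp: S_def vec_eq_iff fun_eq_iff scale_on_def)
 hence "jac (S (-b)) = jac (S b)" by (simp only: jac_compose3 lin linear_scale_on jac_scale_on) simp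
 hence "(jac (S b))\<^sup>2 = 1" using 1 by (simp add: power2_eq_square)
 thus ?thesis using jac_nonneg[of "S b"] by (simp add: power2_eq_1_iff S_def[abs_def])
qed

text \<open>Such a matrix is a scaling of coordinate k followed by a shear; it is the elementary
  factor of the elimination below.\<close>

lemma jac_one_column:
 fixes x :: "complex^'n::finite"
 assumes "x $ k ~= 0"
 shows "jac ((*v) (\<chi> i j. if j = k then x $ i else (mat 1 :: complex^'n^'n) $ i $ j)) = (cmod (x $ k))\<^sup>2"
proof -
 let ?E = "(\<chi> i j. if j = k then x $ i else (mat 1 :: complex^'n^'n) $ i $ j)"
 define b where "b = (\<chi> i. if i = k then 0 else x $ i / x $ k)"
 have "(?E *v z) $ i = (scale_on {k} (x $ k) z + (scale_on {k} (x $ k) z) $ k *s b) $ i" for z i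
 proof -
  have "(?E *v z) $ i = (SUM j:UNIV. (if j = k then x $ i * z $ k else 0) + (if j = i & j ~= k then z $ i else 0))"
   unfolding matrix_vector_mult_def by (simp, intro sum.cong) (auto simp: mat_def)
  also have "... = x $ i * z $ k + (SUM j:UNIV. if j = i & j ~= k then z $ i else 0)" by (simp add: sum.distrib)
  also have "(SUM j:UNIV. if j = i & j ~= k then z $ i else 0) = (SUM j:UNIV. if j = i then if i ~= k then z $ i else 0 else 0)"
   by (intro sum.cong) auto
  also have "... = (if i ~= k then z $ i else 0)" by simp
  finally show ?thesis using assms by (auto simp: scale_on_def b_def)
 qed
 hence "(*v) ?E = (%z. z + z $ k *s b) o scale_on {k} (x $ k)" by (simp add: fun_eq_iff vec_eq_iff)
 moreover have "linear (%z. z + z $ k *s b)" by (auto intro!: linearI simp: vec_eq_iff algebra_simps)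
 ultimately show ?thesis
  using jac_shear[of b k] by (simp only: jac_compose linear_scale_on jac_scale_on) (simp add: b_def)
qed

text \<open>Gaussian elimination by columns. If the entry (k, k) is nonzero, the matrix E that has
  column k of M and is the identity elsewhere splits off, and \<open>E' ** M\<close> has one more
  unit column. A zero entry is first removed by exchanging row k with a row of K.\<close>

lemma jac_complex_matrix_aux:
 fixes M :: "complex^'n::finite^'n"
 assumes "finite K" "det M ~= 0" "!!j. j ~: K ==> column j M = axis j 1"
 shows "jac ((*v) M) = (cmod (det M))\<^sup>2" using assms
proof (induction K arbitrary: M rule: finite_induct)
 case empty
 hence "M = mat 1" by (simp add: vec_eq_iff column_def axis_def mat_def)
 thus ?case by (simp add: jac_id)
next
 case (insert k K)
 have main: "jac ((*v) M) = (cmod (det M))\<^sup>2"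
  if M: "det M ~= 0" "!!j. j ~: insert k K ==> column j M = axis j 1" "M $ k $ k ~= 0"
  for M :: "complex^'n^'n"
 proof -
  define E where "E = (\<chi> i j. if j = k then column k M $ i else (mat 1 :: complex^'n^'n) $ i $ j)"
  have dE: "det E = M $ k $ k" using cramer_lemma[where A = "mat 1 :: complex^'n^'n" and x = "column k M" and k = k]
   by (simp add: E_def cong: if_cong) (simp add: column_def)
  have jE: "jac ((*v) E) = (cmod (det E))\<^sup>2"
   using jac_one_column[of "column k M" k] M(3) dE by (simp add: E_def) (simp add: column_def)
  have "invertible E" using dE M(3) by (simp add: invertible_det_nz)
  then obtain E' where E': "E' ** E = mat 1" "E ** E' = mat 1" unfolding invertible_def by blast
  define M' where "M' = E' ** M"
  have EM: "M = E ** M'" by (simp add: M'_def matrix_mul_assoc E')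
  have dM: "det M = det E * det M'" by (simp add: EM det_mul)
  have Eax: "column j E = axis j 1" if "j ~= k" for j
   using that by (auto simp: E_def column_def vec_eq_iff mat_def axis_def)
  have Ek: "column k E = column k M" by (auto simp: E_def column_def vec_eq_iff)
  have col: "column j (A ** B) = A *v column j B" for A B :: "complex^'n^'n" and j
   by (auto simp: column_def matrix_matrix_mult_def matrix_vector_mult_def vec_eq_iff)
  have ax: "column j (mat 1 :: complex^'n^'n) = axis j 1" for j by (auto simp: column_def vec_eq_iff mat_def axis_def)
  have cM': "column j M' = axis j 1" if "j ~: K" for j
  proof -
   have "column j M = column j E" using that Ek Eax M(2)[of j] by (cases "j = k") auto
   hence "column j M' = column j (E' ** E)" by (simp add: M'_def col)
   thus ?thesis by (simp add: E' ax)
  qed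
  have "jac ((*v) M') = (cmod (det M'))\<^sup>2" using M(1) dM cM' by (intro insert.IH) auto
  thus ?thesis using jE by (simp add: EM jac_matrix_mult det_mul norm_mult power_mult_distrib)
 qed
 show ?case
 proof (cases "M $ k $ k = 0")
  case False
  thus ?thesis using main insert.prems by blast
 next
  case True
  \<comment> \<open>Otherwise column k of M would be a vector y with M y = y, because y vanishes on
    the columns that are not unit columns. Then M e_k = y = M y, so y = e_k by injectivity, against
    the zero entry (k, k).\<close>
  have "EX i:K. M $ i $ k ~= 0"
  proof (rule ccontr)
   assume "\<not> ?thesis"
   hence z: "M $ i $ k = 0" if "i : insert k K" for i using that True by auto
   define y where "y = column k M"
   have "M *v y = y"
   proof -
    have "M $ i $ j * y $ j = (if j = i then y $ i else 0)" for i j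
    proof (cases "j : insert k K")
     case True
     thus ?thesis using z[of j] by (auto simp: y_def column_def)
    next
     case False
     hence "M $ i $ j = axis j 1 $ i" using insert.prems(2)[of j] by (metis column_def vec_lambda_beta)
     thus ?thesis by (auto simp: axis_def)
    qed
    thus ?thesis by (simp add: matrix_vector_mult_def vec_eq_iff)
   qed
   moreover have "M *v axis k 1 = y" by (simp add: y_def matrix_vector_mul_component column_def vec_eq_iff
      matrix_vector_mult_def axis_def if_distrib cong: if_cong)
   ultimately have "M *v (axis k 1) = M *v y" by simp
   hence "axis k 1 = y" using insert.prems(1) inj_matrix_vector_mult[of M] by (simp add: invertible_det_nz inj_eq)
   hence "y $ k = 1" by (metis axis_nth)
   thus False using True by (simp add: y_def column_def)
  qed
  then obtain i where i: "i : K" "M $ i $ k ~= 0" by blast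
  have ik: "i ~= k" using i insert.hyps by auto
  define P :: "complex^'n^'n" where "P = (\<chi> l j. if j = Transposition.transpose i k l then 1 else 0)"
  have Pv: "P *v z = (\<chi> l. z $ Transposition.transpose i k l)" for z
   by (simp add: P_def matrix_vector_mult_def vec_eq_iff if_distrib if_distribR cong: if_cong)
  have jP: "jac ((*v) P) = 1" using jac_swap[of i k] by (simp add: Pv[abs_def])
  have "(P ** P) *v z = mat 1 *v z" for z by (simp add: matrix_vector_mul_assoc[symmetric] Pv vec_eq_iff)
  hence PP: "P ** P = mat 1" by (metis matrix_eq)
  hence "det P * det P = 1" by (metis det_mul det_I)
  hence "cmod (det P) * cmod (det P) = 1" by (metis norm_mult norm_one)
  hence dP: "cmod (det P) = 1" using power2_eq_1_iff[of "cmod (det P)"] norm_ge_zero[of "det P"]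
   unfolding power2_eq_square by linarith
  have PM: "(P ** M) $ l $ j = M $ (Transposition.transpose i k l) $ j" for l j
   by (simp add: P_def matrix_matrix_mult_def if_distrib if_distribR cong: if_cong)
  have "jac ((*v) (P ** M)) = (cmod (det (P ** M)))\<^sup>2"
  proof (rule main)
   show "det (P ** M) ~= 0" using dP insert.prems(1) by (auto simp: det_mul)
   show "(P ** M) $ k $ k ~= 0" using i by (simp add: PM)
   fix j assume j: "j ~: insert k K"
   have "M $ l $ j = axis j 1 $ l" for l using insert.prems(2)[OF j] by (metis column_def vec_lambda_beta)
   moreover have "j ~= k" "j ~= i" using j i by auto
   ultimately show "column j (P ** M) = axis j 1"
    by (auto simp: column_def vec_eq_iff PM axis_def Transposition.transpose_def)
  qed
  thus ?thesis using jP dP by (simp add: jac_matrix_mult det_mul norm_mult)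
 qed
qed

lemma jac_complex_matrix:
 "det M ~= 0 ==> jac ((*v) M) = (cmod (det (M :: complex^'n::finite^'n)))\<^sup>2"
 using jac_complex_matrix_aux[of UNIV M] by simp

lemma continuous_on_jac:
 assumes "!!v. continuous_on S (%x. T x v)"
 shows "continuous_on S (%x. jac (T x))" unfolding jac_def det_def matrix_def
 by (simp, intro continuous_intros) (simp add: to_real_def, intro continuous_intros assms)

text \<open>Leibniz formula: each real matrix entry of T is at most |K|. The added 1 keeps C
  positive.\<close>

lemma jac_bounded:
 "EX C>0. ALL T :: complex^'n::finite => complex^'n. (ALL z. norm (T z) <= K * norm z) --> jac T <= C"
proof (intro exI conjI allI impI)
 let ?P = "{p. p permutes (UNIV :: 'n bit0 set)}"
 let ?C = "real (card ?P) * \<bar>K\<bar> ^ CARD('n bit0) + 1"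
 show "?C > 0" by (simp add: add_nonneg_pos)
 fix T :: "complex^'n => complex^'n" assume T: "ALL z. norm (T z) <= K * norm z"
 let ?M = "matrix (to_real o T o from_real)"
 have e: "\<bar>?M $ i $ j\<bar> <= \<bar>K\<bar>" for i j
 proof -
  have "real_basis j : Basis" using bij_real_basis by (auto simp: bij_betw_def)
  hence "norm (from_real (axis j (1::real))) = 1"
   by (simp add: from_real_def axis_def if_distrib if_distribR cong: if_cong)
  hence "norm (T (from_real (axis j 1))) <= \<bar>K\<bar>" using T by (metis abs_ge_self mult.right_neutral order_trans)
  moreover have "real_basis i : Basis" using bij_real_basis by (auto simp: bij_betw_def)
  ultimately show ?thesis
   using Basis_le_norm[of "real_basis i" "T (from_real (axis j 1))"] by (simp add: matrix_def to_real_def)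
 qed
 have "jac T <= (SUM p:?P. \<bar>of_int (sign p) * (\<Prod>i\<in>UNIV. ?M $ i $ p i)\<bar>)"
  unfolding jac_def det_def by (rule sum_abs)
 also have "... <= (SUM p:?P. \<bar>K\<bar> ^ CARD('n bit0))"
 proof (rule sum_mono)
  fix p
  have "\<bar>of_int (sign p) * (\<Prod>i\<in>UNIV. ?M $ i $ p i)\<bar> = (\<Prod>i\<in>UNIV. \<bar>?M $ i $ p i\<bar>)"
   by (simp add: abs_mult abs_prod sign_def)
  also have "... <= (\<Prod>i\<in>(UNIV::'n bit0 set). \<bar>K\<bar>)" by (intro prod_mono) (auto simp: e)
  finally show "\<bar>of_int (sign p) * (\<Prod>i\<in>UNIV. ?M $ i $ p i)\<bar> <= \<bar>K\<bar> ^ CARD('n bit0)" by simp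
 qed
 finally show "jac T <= ?C" by simp
qed

text \<open>The change of variables theorem, transported to real coordinates. It equates finite
  measure of the image with integrability of the Jacobian, and both directions are used: one when
  the integral is finite, the other to see that an infinite integral forces infinite
  measure.\<close>

lemma emeasure_image_jac:
 fixes f :: "complex^'n::finite => complex^'n"
 assumes S: "S : sets borel" and fS: "f ` S : sets borel"
  and der: "!!x. x : S ==> (f has_derivative f' x) (at x)"
  and inj: "inj_on f S"
  and meas: "(%x. indicator S x * jac (f' x)) : bmeas"
 shows "emeasure lborel (f ` S) = (LI x:S. ennreal (jac (f' x)))"
proof -
 define S' where "S' = to_real ` S"
 have S'v: "S' = from_real -` S" unfolding S'_def by (auto simp: image_iff) (metis to_from_real)
 have S'b: "S' : sets borel" using measurable_sets[OF measurable_from_real S] by (simp add: S'v)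
 define F where "F = to_real o f o from_real"
 define F' where "F' y = to_real o f' (from_real y) o from_real" for y
 define g where "g y = \<bar>det (matrix (F' y))\<bar>" for y
 have g: "g y = jac (f' (from_real y))" for y by (simp add: g_def F'_def jac_def)
 have FS: "F ` S' = from_real -` (f ` S)" unfolding F_def S'_def by (auto simp: image_iff) (metis to_from_real)
 have FSb: "F ` S' : sets borel" using measurable_sets[OF measurable_from_real fS] by (simp add: FS)
 have derF: "(F has_derivative F' y) (at y within S')" if "y : S'" for y
 proof -
  have "(f has_derivative f' (from_real y)) (at (from_real y))" using that der by (auto simp: S'v)
  have "((%y. f (from_real y)) has_derivative (%v. f' (from_real y) (from_real v))) (at y)"
   by (rule has_derivative_compose[of from_real from_real y UNIV f "f' (from_real y)"])
    (use \<open>(f has_derivative _) _\<close> linear_from_real in \<open>auto intro: linear_imp_has_derivative\<close>)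
  hence "((%y. to_real (f (from_real y))) has_derivative (%v. to_real (f' (from_real y) (from_real v)))) (at y)"
   by (rule has_derivative_compose[of "%y. f (from_real y)" _ y UNIV to_real to_real])
    (use linear_to_real in \<open>auto intro: linear_imp_has_derivative\<close>)
  thus ?thesis unfolding F_def F'_def o_def by (rule has_derivative_at_withinI)
 qed
 have injF: "inj_on F S'"
 proof (rule inj_onI)
  fix x y assume xy: "x : S'" "y : S'" "F x = F y"
  hence "f (from_real x) = f (from_real y)" unfolding F_def by (metis comp_apply from_to_real)
  hence "from_real x = from_real y" using inj xy by (auto simp: S'v inj_on_def)
  thus "x = y" by (metis to_from_real)
 qed
 have hm: "F ` S' : lmeasurable & measure lebesgue (F ` S') = m \<longleftrightarrow> (g has_integral m) S'" for m
  unfolding g_def by (rule has_measure_differentiable_image[OF _ derF injF]) (use S'b in auto)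
 have "(%y. (%x. indicator S x * jac (f' x)) (from_real y)) : bmeas"
  by (rule measurable_compose[OF measurable_from_real meas])
 hence gm: "(%y. indicator S' y * g y) : bmeas" by (simp add: g S'v indicator_def vimage_def cong: if_cong)
 have fe: "(%y. indicator S' y * g y) = (%y. if y : S' then g y else 0)" by (auto simp: fun_eq_iff)
 have "emeasure lborel (f ` S) = emeasure (distr lborel borel from_real) (f ` S)"
  using lborel_distr_from_real by metis
 also have "... = emeasure lborel (F ` S')" using fS by (simp add: emeasure_distr FS)
 also have "... = (LI y. ennreal (indicator S' y * g y))"
 proof (cases "(LI y. ennreal (indicator S' y * g y)) < \<infinity>")
  case True
  obtain m where m: "m >= 0" "(LI y. ennreal (indicator S' y * g y)) = ennreal m"
   using True by (cases "\<integral>\<^sup>+y. ennreal (indicator S' y * g y) \<partial>lborel") auto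
  have "((%y. indicator S' y * g y) has_integral m) UNIV"
   by (rule nn_integral_has_integral[OF gm _ m(2,1)]) (simp add: g_def indicator_def)
  hence "(g has_integral m) S'" by (simp add: fe has_integral_restrict_UNIV)
  hence "F ` S' : lmeasurable" "measure lebesgue (F ` S') = m" using hm by auto
  hence "emeasure lebesgue (F ` S') = ennreal m" by (simp add: emeasure_eq_measure2)
  thus ?thesis using m FSb by (simp add: emeasure_completion)
 next
  case False
  have "emeasure lborel (F ` S') = \<infinity>"
  proof (rule ccontr)
   assume "emeasure lborel (F ` S') ~= \<infinity>"
   hence "F ` S' : lmeasurable" using FSb by (intro fmeasurableI) (auto simp: top.not_eq_extremum)
   hence "(g has_integral measure lebesgue (F ` S')) S'" using hm by blast
   hence "((%y. indicator S' y * g y) has_integral measure lebesgue (F ` S')) UNIV"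
    by (simp add: fe has_integral_restrict_UNIV)
   from nn_integral_has_integral_lborel[OF gm _ this]
   have "(LI y. ennreal (indicator S' y * g y)) = ennreal (measure lebesgue (F ` S'))"
    by (simp add: g_def indicator_def)
   thus False using False by simp
  qed
  thus ?thesis using False by (metis top.not_eq_extremum infinity_ennreal_def)
 qed
 also have "... = (\<integral>\<^sup>+x. ennreal (indicator S x * jac (f' x)) \<partial>distr lborel borel from_real)"
  by (subst nn_integral_distr) (use meas in \<open>auto simp: g S'v indicator_def intro!: nn_integral_cong\<close>)
 also have "... = (LI x:S. ennreal (jac (f' x)))" unfolding lborel_distr_from_real[symmetric]
  by (intro nn_integral_cong) (auto simp: indicator_def)
 finally show ?thesis .
qed

text \<open>The version for sets says that the push-forward of the density \<open>jac\<close> on T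
  is Lebesgue measure on the image of T; equal measures have equal integrals.\<close>

lemma nn_integral_image_jac:
 fixes f :: "complex^'n::finite => complex^'n"
 assumes S: "open S" and cont: "continuous_on S f" and fb: "!!T. T : sets borel ==> T <= S ==> f ` T : sets borel"
  and der: "!!x. x : S ==> (f has_derivative f' x) (at x)"
  and inj: "inj_on f S"
  and cont': "!!v. continuous_on S (%x. f' x v)"
  and u[measurable]: "u : bmeas"
  and T: "T : sets borel" "T <= S"
 shows "(LI y:f ` T. u y) = (LI x:T. ennreal (jac (f' x)) * u (f x))"
proof -
 \<comment> \<open>The extension by 0 is Borel on the whole space, so it can push measures
   forward.\<close>
 define g where "g x = (if x : S then f x else 0)" for x
 have Sb[measurable]: "S : sets borel" using S by simp
 note T(1)[measurable]
 have g[measurable]: "g : bmeas"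
  unfolding g_def using cont Sb by (intro borel_measurable_continuous_on_if continuous_intros) auto
 have jm: "(%x. indicator R x * jac (f' x)) : bmeas" if "R : sets borel" "R <= S" for R
 proof -
  have "(%x. indicator S x *R jac (f' x)) : bmeas"
   by (rule borel_measurable_continuous_on_indicator[OF Sb continuous_on_jac[OF cont']])
  hence "(%x. indicator R x * (indicator S x *R jac (f' x))) : bmeas" using that(1) by measurable
  moreover have "(%x. indicator R x * (indicator S x *R jac (f' x))) = (%x. indicator R x * jac (f' x))"
   using that(2) by (auto simp: indicator_def fun_eq_iff)
  ultimately show ?thesis by simp
 qed
 have jmT: "(%x. ennreal (jac (f' x)) * indicator R x) : bmeas" if "R : sets borel" "R <= S" for R
 proof -
  have "(%x. ennreal (jac (f' x)) * indicator R x) = (%x. ennreal (indicator R x * jac (f' x)))"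
   by (auto simp: fun_eq_iff indicator_def)
  thus ?thesis using jm[OF that] by simp
 qed
 let ?M = "distr (density lborel (%x. ennreal (jac (f' x)) * indicator T x)) borel g"
 let ?N = "density lborel (indicator (f ` T))"
 have fT[measurable]: "f ` T : sets borel" using fb T by simp
 have "?M = ?N"
 proof (rule measure_eqI)
  fix E :: "(complex^'n) set" assume "E : sets ?M"
  hence E[measurable]: "E : sets borel" by simp
  let ?R = "T \<inter> g -` E"
  have R[measurable]: "?R : sets borel" using measurable_sets[OF g E] T by auto
  have RS: "?R <= S" using T by auto
  have fR: "f ` ?R = f ` T \<inter> E" using T by (auto simp: g_def)
  have "emeasure ?M E = (LI x. ennreal (jac (f' x)) * indicator T x * indicator (g -` E) x)"
   using measurable_sets[OF g E] jmT[OF T] by (subst emeasure_distr) (auto simp: emeasure_density)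
  also have "... = (LI x:?R. ennreal (jac (f' x)))" by (intro nn_integral_cong) (auto simp: indicator_def)
  also have "... = emeasure lborel (f ` ?R)"
   using RS der inj by (intro emeasure_image_jac[symmetric] fb jm R) (auto intro: inj_on_subset)
  also have "... = emeasure ?N E"
  proof -
   have "emeasure ?N E = (LI x. indicator (f ` T \<inter> E) x)" by (simp add: emeasure_density indicator_inter_arith)
   thus ?thesis by (simp add: fR)
  qed
  finally show "emeasure ?M E = emeasure ?N E" .
 qed simp
 hence "(\<integral>\<^sup>+y. u y \<partial>?M) = (\<integral>\<^sup>+y. u y \<partial>?N)" by simp
 moreover have "(\<integral>\<^sup>+y. u y \<partial>?N) = (LI y:f ` T. u y)"
  by (subst nn_integral_density) (auto simp: mult.commute)
 moreover have "(\<integral>\<^sup>+y. u y \<partial>?M) = (LI x. ennreal (jac (f' x)) * indicator T x * u (g x))"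
  using jmT[OF T] by (simp add: nn_integral_distr nn_integral_density)
 moreover have "... = (LI x:T. ennreal (jac (f' x)) * u (f x))"
  using T(2) by (intro nn_integral_cong) (auto simp: indicator_def g_def)
 ultimately show ?thesis by simp
qed

section \<open>Charts and the metric in coordinates\<close>

lemma Ck_on_Suc_frechet: "Ck_on (Suc k) f S ==> Ck_on k (%x. fd f x v) S" by simp

lemma Ck_on_Suc_has_derivative:
 "Ck_on (Suc k) f S ==> x : S ==> (f has_derivative fd f x) (at x)"
 unfolding frechet_derivative_works[symmetric] by (simp only: Ck_on.simps)

lemma linear_expand: "linear f ==> f u = (SUM b:Basis. (u \<bullet> b) *R f (b::'e::euclidean_space))"
 by (subst euclidean_representation[of u, symmetric]) (simp only: linear_sum linear_scale)

locale herm_mfd =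
 fixes A :: "('a::{t2_space,second_countable_topology}, 'n::finite) chart set"
  and h :: "('a, 'n) metric_field"
 assumes herm: "hermitian_manifold A h"
begin

abbreviation img :: "('a, 'n) chart => (complex^'n) set" where
 "img c \<equiv> snd c ` fst c"

abbreviation trans :: "('a, 'n) chart => ('a, 'n) chart => complex^'n => complex^'n" where
 "trans c d \<equiv> snd d o chart_inv c"

abbreviation overlap :: "('a, 'n) chart => ('a, 'n) chart => (complex^'n) set" where
 "overlap c d \<equiv> snd c ` (fst c \<inter> fst d)"

lemma atlas: "complex_atlas A" using herm by (simp add: hermitian_manifold_def)

lemma chart_props:
 assumes "c : A"
 shows "open (fst c)" "open (img c)" "homeomorphism (fst c) (img c) (snd c) (chart_inv c)"
 using atlas assms unfolding complex_atlas_def chart_inv_def by (cases c; force)+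

lemma continuous_chart: "c : A ==> continuous_on (fst c) (snd c)"
 and continuous_chart_inv: "c : A ==> continuous_on (img c) (chart_inv c)"
 using chart_props(3) homeomorphism_def by blast+

lemma chart_inv_chart [simp]: "c : A ==> p : fst c ==> chart_inv c (snd c p) = p"
 using chart_props(3) unfolding homeomorphism_def by blast

lemma chart_chart_inv [simp]: "c : A ==> z : img c ==> snd c (chart_inv c z) = z"
 using chart_props(3) unfolding homeomorphism_def by blast

lemma chart_inv_in [simp]: "c : A ==> z : img c ==> chart_inv c z : fst c"
 using chart_props(3) unfolding homeomorphism_def by blast

lemma chart_at: "chart_at A p : A" "p : fst (chart_at A p)"
proof -
 have "EX c. c : A & p : fst c"
 proof -
  have "(\<Union>c\<in>A. fst c) = UNIV" using atlas unfolding complex_atlas_def by (rule conjunct1)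
  thus ?thesis by blast
 qed
 hence "chart_at A p : A & p : fst (chart_at A p)" unfolding chart_at_def by (rule someI_ex)
 thus "chart_at A p : A" "p : fst (chart_at A p)" by auto
qed

lemma open_chart_preimage:
 assumes "c : A" "open V"
 shows "open {z : img c. chart_inv c z : V}"
proof -
 have "open (img c \<inter> chart_inv c -` V)"
  using assms by (intro continuous_open_preimage continuous_chart_inv chart_props(2))
 thus ?thesis by (simp add: vimage_def Int_def)
qed

lemma overlap_eq: "c : A ==> overlap c d = {z : img c. chart_inv c z : fst d}" by (auto simp: image_iff)

lemma open_overlap: "c : A ==> d : A ==> open (overlap c d)"
 using overlap_eq open_chart_preimage chart_props(1) by presburger

lemma holomorphic_trans: "c : A ==> d : A ==> holomorphic_map_on (overlap c d) (trans c d)"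
 using atlas unfolding complex_atlas_def chart_inv_def by (fastforce split: prod.splits)

lemma Ck_trans: "c : A ==> d : A ==> Ck_on k (trans c d) (overlap c d)"
 using holomorphic_trans smooth_on_open_iff open_overlap unfolding holomorphic_map_on_def by blast

lemma trans_differentiable: "c : A ==> d : A ==> z : overlap c d ==> trans c d differentiable (at z)"
 using Ck_on_Suc_has_derivative[OF Ck_trans] differentiableI by blast

lemma trans_deriv:
 assumes "c : A" "d : A" "p : fst c" "p : fst d"
 shows "(trans c d has_derivative chart_change c d p) (at (snd c p))"
 unfolding chart_change_def using trans_differentiable[OF assms(1,2)] assms(3,4)
 by (simp add: frechet_derivative_works[symmetric] image_iff) blast

lemma linear_chart_change:
 assumes "c : A" "d : A" "p : fst c" "p : fst d"
 shows "linear (chart_change c d p)" using trans_deriv[OF assms] has_derivative_linear by blast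

lemma chart_change_smult:
 assumes "c : A" "d : A" "p : fst c" "p : fst d"
 shows "chart_change c d p (a *s v) = a *s chart_change c d p v"
 using holomorphic_trans[OF assms(1,2)] assms(3,4) unfolding holomorphic_map_on_def chart_change_def by blast

lemma chart_change_same:
 assumes "c : A" "p : fst c"
 shows "chart_change c c p v = v"
proof -
 have "fd (trans c c) (snd c p) = fd (%z. z) (snd c p)"
  by (rule frechet_derivative_cong_open[OF chart_props(2)[OF assms(1)]]) (use assms in auto)
 thus ?thesis by (simp add: chart_change_def frechet_derivative_eqI[OF has_derivative_ident])
qed

text \<open>Chain rule for the transition maps. Together with \<open>chart_change_same\<close> it
  yields all conversions between vectors, components and charts.\<close>

lemma chart_change_trans:
 assumes "c : A" "d : A" "e : A" "p : fst c" "p : fst d" "p : fst e"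
 shows "chart_change d e p (chart_change c d p v) = chart_change c e p v"
proof -
 have z: "snd c p : overlap c d" using assms by auto
 have e: "trans c d (snd c p) = snd d p" using assms by simp
 have "((%z. trans d e (trans c d z)) has_derivative (%v. chart_change d e p (chart_change c d p v))) (at (snd c p))"
  by (rule has_derivative_compose[OF trans_deriv[OF assms(1,2,4,5)] trans_deriv[OF assms(2,3,5,6), folded e]])
 hence "(trans c e has_derivative (%v. chart_change d e p (chart_change c d p v))) (at (snd c p))"
  by (rule has_derivative_transform_within_open[OF _ open_overlap[OF assms(1,2)] z])
   (use assms in auto)
 from frechet_derivative_eqI[OF this] show ?thesis by (simp add: chart_change_def)
qed

lemma comps_vec_of: "c : A ==> p : fst c ==> comps_in A c p (vec_of A c p u) = u"
 by (simp add: comps_in_def vec_of_def chart_change_trans chart_at chart_change_same)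

lemma vec_of_comps: "c : A ==> p : fst c ==> vec_of A c p (comps_in A c p u) = u"
 by (simp add: comps_in_def vec_of_def chart_change_trans chart_at chart_change_same)

lemma change_comps:
 "c : A ==> d : A ==> p : fst c ==> p : fst d ==> chart_change c d p (comps_in A c p u) = comps_in A d p u"
 by (simp add: comps_in_def chart_change_trans chart_at)

lemma vec_of_change:
 "c : A ==> d : A ==> p : fst c ==> p : fst d ==> vec_of A d p (chart_change c d p u) = vec_of A c p u"
 by (simp add: vec_of_def chart_change_trans chart_at)

lemma comps_of_vec_of:
 "c : A ==> d : A ==> p : fst c ==> p : fst d ==> comps_in A d p (vec_of A c p u) = chart_change c d p u"
 by (metis change_comps comps_vec_of)

lemma linear_vec_of: "c : A ==> p : fst c ==> linear (vec_of A c p)"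
 and linear_comps_in: "c : A ==> p : fst c ==> linear (comps_in A c p)"
 by (simp_all add: vec_of_def comps_in_def linear_chart_change chart_at)

abbreviation gmet :: "('a, 'n) chart => complex^'n => complex^'n => complex^'n => real" where
 "gmet c z u v \<equiv> Re (coord_metric A h c z u v)"

lemma hermitian_coord_metric:
 assumes "c : A" "z : img c"
 shows "hermitian_inner (coord_metric A h c z)"
proof -
 define p where "p = chart_inv c z"
 have p: "p : fst c" using assms by (simp add: p_def)
 have H: "hermitian_inner (h p)" using herm by (simp add: hermitian_manifold_def)
 have smult: "vec_of A c p (a *s u) = a *s vec_of A c p u" for a u
  using assms(1) p chart_at by (simp add: vec_of_def chart_change_smult)
 have nz: "vec_of A c p u ~= 0" if "u ~= 0" for u
  using comps_vec_of[OF assms(1) p, of u] linear_0[OF linear_comps_in[OF assms(1) p]] that by metis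
 have H1: "h p (u + v) w = h p u w + h p v w" "h p (a *s u) v = a * h p u v" "h p v u = cnj (h p u v)"
  "u ~= 0 ==> 0 < Re (h p u u)" for u v w a using H unfolding hermitian_inner_def by blast+
 have e: "coord_metric A h c z u v = h p (vec_of A c p u) (vec_of A c p v)" for u v
  by (simp add: coord_metric_def p_def Let_def)
 show ?thesis unfolding hermitian_inner_def e linear_add[OF linear_vec_of[OF assms(1) p]] smult using H1 nz by blast
qed

lemma coord_metric_comps:
 "c : A ==> p : fst c ==> coord_metric A h c (snd c p) (comps_in A c p u) (comps_in A c p v) = h p u v"
 by (simp add: coord_metric_def vec_of_comps)

lemma coord_metric_change:
 assumes "c : A" "d : A" "p : fst c" "p : fst d"
 shows "coord_metric A h c (snd c p) u v
   = coord_metric A h d (snd d p) (chart_change c d p u) (chart_change c d p v)"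
 using assms by (simp add: coord_metric_def vec_of_change)

lemma vec_norm_vec_of:
 "c : A ==> p : fst c ==> vec_norm h p (vec_of A c p u) = sqrt (gmet c (snd c p) u u)"
 by (simp add: coord_metric_def vec_norm_def)

lemma vec_norm_comps:
 "c : A ==> p : fst c ==> vec_norm h p v = sqrt (gmet c (snd c p) (comps_in A c p v) (comps_in A c p v))"
 by (simp add: coord_metric_comps vec_norm_def)

lemma smult_of_real: "of_real a *s (u :: complex^'n) = a *R u"
 unfolding vec_eq_iff vector_smult_component vector_scaleR_component by (simp add: scaleR_conv_of_real)

lemma gmet_props:
 assumes "c : A" "z : img c"
 shows "gmet c z (u + u') v = gmet c z u v + gmet c z u' v"
  "gmet c z (a *R u) v = a * gmet c z u v"
  "gmet c z u v = gmet c z v u"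
  "u ~= 0 ==> 0 < gmet c z u u"
proof -
 let ?G = "coord_metric A h c z"
 have H: "?G (u + u') v = ?G u v + ?G u' v" "?G (of_real a *s u) v = of_real a * ?G u v" "?G u v = cnj (?G v u)"
  "u ~= 0 ==> 0 < Re (?G u u)" using hermitian_coord_metric[OF assms] unfolding hermitian_inner_def by blast+
 show "gmet c z (u + u') v = gmet c z u v + gmet c z u' v" by (simp add: H(1))
 show "gmet c z (a *R u) v = a * gmet c z u v" using H(2) by (simp add: smult_of_real)
 show "gmet c z u v = gmet c z v u" by (subst H(3)) simp
 show "u ~= 0 ==> 0 < gmet c z u u" by (rule H(4))
qed

lemma linear_gmet_left: "c : A ==> z : img c ==> linear (%u. gmet c z u v)"
 by (intro linearI) (auto simp: gmet_props(1,2))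

lemma linear_gmet_right: "c : A ==> z : img c ==> linear (%v. gmet c z u v)"
 using linear_gmet_left[of c z u] gmet_props(3) by presburger

lemma gmet_expand:
 assumes "c : A" "z : img c"
 shows "gmet c z u v = (SUM i:Basis. SUM j:Basis. (u \<bullet> i) * ((v \<bullet> j) * gmet c z i j))"
 by (subst linear_expand[OF linear_gmet_left[OF assms]], subst linear_expand[OF linear_gmet_right[OF assms]])
  (simp add: sum_distrib_left)

lemma Ck_gmet:
 assumes "c : A"
 shows "Ck_on k (%z. gmet c z u v) (img c)"
proof -
 have "Ck_on k (%z. coord_metric A h c z u v) (img c)"
  using herm assms smooth_on_open_iff[OF chart_props(2)[OF assms]] unfolding hermitian_manifold_def by blast
 thus ?thesis by (intro Ck_on_compose[OF chart_props(2)[OF assms], where T = UNIV and g = Re])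
   (auto intro: Ck_on_bounded_linear bounded_linear_Re)
qed

lemma continuous_coord_metric:
 assumes "c : A"
 shows "continuous_on (img c) (%z. coord_metric A h c z u v)"
proof -
 have "Ck_on 0 (%z. coord_metric A h c z u v) (img c)"
  using herm assms smooth_on_open_iff[OF chart_props(2)[OF assms]] unfolding hermitian_manifold_def by blast
 thus ?thesis by simp
qed

section \<open>Christoffel symbols and covariant derivatives\<close>

abbreviation dgmet :: "('a, 'n) chart => complex^'n => complex^'n => complex^'n => complex^'n => real" where
 "dgmet c z x a b \<equiv> fd (%y. gmet c y a b) z x"

lemma gmet_deriv:
 assumes "c : A" "z : img c"
 shows "((%y. gmet c y a b) has_derivative (%x. dgmet c z x a b)) (at z)"
 by (rule Ck_on_Suc_has_derivative[OF Ck_gmet assms(2)]) (rule assms(1))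

lemma linear_dgmet: "c : A ==> z : img c ==> linear (%x. dgmet c z x a b)"
 using gmet_deriv has_derivative_linear by blast

text \<open>The product rule for the metric evaluated along maps; the metric is bilinear only over the
 image of the chart.\<close>

lemma gmet_compose_deriv:
 fixes \<psi> F H :: "'e::real_normed_vector => complex^'n"
 assumes d: "d : A" and z: "open W" "z : W" "\<psi> ` W <= img d"
  and \<psi>: "(\<psi> has_derivative \<psi>') (at z)"
  and F: "(F has_derivative F') (at z)" and H: "(H has_derivative H') (at z)"
 shows "((%y. gmet d (\<psi> y) (F y) (H y)) has_derivative
   (%x. (SUM i:Basis. SUM j:Basis. (F z \<bullet> i) * ((H z \<bullet> j) * dgmet d (\<psi> z) (\<psi>' x) i j))
    + gmet d (\<psi> z) (F' x) (H z) + gmet d (\<psi> z) (F z) (H' x))) (at z)"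
proof -
 have pz: "\<psi> z : img d" using z by auto
 have g: "((%y. gmet d (\<psi> y) i j) has_derivative (%x. dgmet d (\<psi> z) (\<psi>' x) i j)) (at z)" for i j
  by (rule has_derivative_compose[OF \<psi> gmet_deriv[OF d pz]])
 have "((%y. SUM i:Basis. SUM j:Basis. (F y \<bullet> i) * ((H y \<bullet> j) * gmet d (\<psi> y) i j)) has_derivative
   (%x. SUM i:Basis. SUM j:Basis. (F z \<bullet> i) * ((H z \<bullet> j) * dgmet d (\<psi> z) (\<psi>' x) i j
     + (H' x \<bullet> j) * gmet d (\<psi> z) i j) + (F' x \<bullet> i) * ((H z \<bullet> j) * gmet d (\<psi> z) i j))) (at z)"
  by (intro has_derivative_sum has_derivative_mult has_derivative_inner_left F H g)
 hence "((%y. gmet d (\<psi> y) (F y) (H y)) has_derivative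
   (%x. SUM i:Basis. SUM j:Basis. (F z \<bullet> i) * ((H z \<bullet> j) * dgmet d (\<psi> z) (\<psi>' x) i j
     + (H' x \<bullet> j) * gmet d (\<psi> z) i j) + (F' x \<bullet> i) * ((H z \<bullet> j) * gmet d (\<psi> z) i j))) (at z)"
  by (rule has_derivative_transform_within_open[OF _ z(1,2)])
    (rule gmet_expand[OF d, symmetric], use z(3) in auto)
 thus ?thesis by (simp add: gmet_expand[OF d pz, of "F' _"] gmet_expand[OF d pz, of "F z" "H' _"]
    sum.distrib algebra_simps)
qed

text \<open>The metric is bilinear only over the image of the chart, so this bilinearity is taken
  from the product rule with constant fields a and b.\<close>

lemma dgmet_expand:
 assumes "c : A" "z : img c"
 shows "dgmet c z x a b = (SUM i:Basis. SUM j:Basis. (a \<bullet> i) * ((b \<bullet> j) * dgmet c z x i j))"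
proof -
 have "((%y. gmet c y a b) has_derivative (%x. (SUM i:Basis. SUM j:Basis. (a \<bullet> i) * ((b \<bullet> j) * dgmet c z x i j))
    + gmet c z 0 b + gmet c z a 0)) (at z)"
  using gmet_compose_deriv[OF assms(1) chart_props(2)[OF assms(1)] assms(2), of "%y. y" "%x. x" "%_. a" "%_. 0" "%_. b" "%_. 0"]
  by auto
 thus ?thesis using fun_cong[OF frechet_derivative_eqI, of _ _ z x]
   linear_0[OF linear_gmet_left[OF assms]] linear_0[OF linear_gmet_right[OF assms]] by simp
qed

lemma gmet_eqI:
 assumes "c : A" "z : img c" "!!x. gmet c z w x = gmet c z w' x"
 shows "w = w'"
proof (rule ccontr)
 assume "w ~= w'"
 hence "0 < gmet c z (w - w') (w - w')" using gmet_props(4)[OF assms(1,2)] by simp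
 thus False using assms(3) linear_diff[OF linear_gmet_left[OF assms(1,2)], of w w'] by simp
qed

text \<open>The map sending w to its products with the basis vectors is injective by definiteness,
  hence onto in finite dimension.\<close>

lemma gmet_riesz:
 assumes c: "c : A" "z : img c" and L: "linear L"
 shows "EX! w. ALL x. gmet c z w x = L x"
proof -
 define f where "f w = (SUM b:Basis. gmet c z w b *R b)" for w
 have fb: "f w \<bullet> b = gmet c z w b" if "b : Basis" for w b using that by (simp add: f_def)
 have lf: "linear f"
  by (intro linearI) (auto simp: f_def gmet_props(1,2)[OF c] scaleR_add_left sum.distrib scaleR_sum_right)
 have "inj f"
 proof (rule injI)
  fix w w' assume "f w = f w'"
  hence "gmet c z w b = gmet c z w' b" if "b : Basis" for b using fb that by metis
  thus "w = w'"
   by (intro gmet_eqI[OF c]) (metis (no_types, lifting) linear_expand[OF linear_gmet_right[OF c]] sum.cong)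
 qed
 hence "surj f" using lf linear_injective_imp_surjective by blast
 then obtain w where w: "f w = (SUM b:Basis. L b *R b)" by (metis surjD)
 have "gmet c z w b = L b" if "b : Basis" for b using fb[OF that, of w] w that by simp
 hence "gmet c z w x = L x" for x by (subst linear_expand[OF linear_gmet_right[OF c]], subst linear_expand[OF L]) simp
 thus ?thesis using gmet_eqI[OF c] by metis
qed

abbreviation chris :: "('a, 'n) chart => complex^'n => complex^'n => complex^'n => complex^'n" where
 "chris c z u v \<equiv> christoffel A h c z u v"

text \<open>The Koszul expression is linear in x, so Riesz representation makes the
  \<open>THE\<close> in \<open>christoffel\<close> meaningful. The equivalence serves both to
  evaluate the symbol and to recognise it.\<close>

lemma chris_unique:
 assumes c: "c : A" "z : img c"
 shows "(ALL x. 2 * gmet c z w x = dgmet c z u v x + dgmet c z v u x - dgmet c z x u v) \<longleftrightarrow> w = chris c z u v"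
proof -
 define L where "L x = (dgmet c z u v x + dgmet c z v u x - dgmet c z x u v) / 2" for x
 have lin: "linear (%x. dgmet c z a b x)" for a b
 proof -
  have "(%x. dgmet c z a b x) = (%x. SUM i:Basis. SUM j:Basis. (b \<bullet> i) * ((x \<bullet> j) * dgmet c z a i j))"
   using dgmet_expand[OF c] by blast
  thus ?thesis by (simp only:) (intro linearI; simp add: inner_add_left algebra_simps sum.distrib sum_distrib_left)
 qed
 have "linear L" unfolding L_def using lin linear_dgmet[OF c]
  by (intro linearI) (auto simp: linear_add[OF lin] linear_add[OF linear_dgmet[OF c]]
    linear_scale[OF lin] linear_scale[OF linear_dgmet[OF c]] field_simps)
 hence ex: "EX! w. ALL x. gmet c z w x = L x" by (rule gmet_riesz[OF c])
 have eq: "(ALL x. 2 * gmet c z w x = dgmet c z u v x + dgmet c z v u x - dgmet c z x u v) \<longleftrightarrow> (ALL x. gmet c z w x = L x)" for w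
  by (auto simp: L_def field_simps)
 have ch: "chris c z u v = (THE w. ALL x. gmet c z w x = L x)" unfolding christoffel_def Let_def eq ..
 show ?thesis unfolding eq ch
 proof
  assume "ALL x. gmet c z w x = L x"
  from the1_equality[OF ex this] show "w = (THE w. ALL x. gmet c z w x = L x)" by (rule sym)
 next
  assume "w = (THE w. ALL x. gmet c z w x = L x)"
  thus "ALL x. gmet c z w x = L x" using theI'[OF ex] by simp
 qed
qed

lemmas chris_eq = chris_unique[THEN iffD2, OF _ _ refl, rule_format]

abbreviation hess :: "('a, 'n) chart => ('a, 'n) chart => complex^'n => complex^'n => complex^'n => complex^'n" where
 "hess c d z u v \<equiv> fd (%y. fd (trans c d) y u) z v"

lemma hess_deriv:
 assumes "c : A" "d : A" "z : overlap c d"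
 shows "((%y. fd (trans c d) y u) has_derivative (%v. hess c d z u v)) (at z)"
 by (rule Ck_on_Suc_has_derivative[OF Ck_on_Suc_frechet[OF Ck_trans[OF assms(1,2)]] assms(3)])

lemma hess_sym:
 assumes "c : A" "d : A" "z : overlap c d"
 shows "hess c d z u v = hess c d z v u"
 by (rule symmetric_second_derivative[OF open_overlap[OF assms(1,2)] assms(3) Ck_trans[OF assms(1,2)]])

text \<open>Differentiate the identity g_c(a, b) = g_d(T a, T b). Since T varies with the point, its
  derivative \<open>hess\<close> enters once for each argument.\<close>

lemma dgmet_change:
 assumes cd: "c : A" "d : A" and p: "p : fst c" "p : fst d"
 defines "T \<equiv> chart_change c d p" and "z \<equiv> snd c p" and "w \<equiv> snd d p"
 shows "dgmet c z x a b = dgmet d w (T x) (T a) (T b)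
   + gmet d w (hess c d z a x) (T b) + gmet d w (T a) (hess c d z b x)"
proof -
 let ?F = "%a y. fd (trans c d) y a"
 have z: "z : overlap c d" using p by (auto simp: z_def)
 have w: "w : img d" using p by (auto simp: w_def)
 have tz: "trans c d z = w" using cd p by (simp add: z_def w_def)
 have sub: "trans c d ` overlap c d <= img d" using cd by auto
 have tder: "(trans c d has_derivative T) (at z)" unfolding T_def z_def by (rule trans_deriv[OF cd p])
 have FT: "?F a z = T a" for a by (simp add: T_def chart_change_def z_def)
 have "((%y. gmet d (trans c d y) (?F a y) (?F b y)) has_derivative
   (%x. dgmet d w (T x) (T a) (T b)
    + gmet d w (hess c d z a x) (T b) + gmet d w (T a) (hess c d z b x))) (at z)"
  using gmet_compose_deriv[OF cd(2) open_overlap[OF cd] z sub tder hess_deriv[OF cd z, of a] hess_deriv[OF cd z, of b]]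
  unfolding tz FT dgmet_expand[OF cd(2) w, symmetric] .
 moreover have "gmet d (trans c d y) (?F a y) (?F b y) = gmet c y a b" if "y : overlap c d" for y
 proof -
  from that obtain p' where p': "p' : fst c \<inter> fst d" "y = snd c p'" by (rule imageE)
  have t: "trans c d (snd c p') = snd d p'" using p' cd by simp
  show ?thesis unfolding p'(2) t using coord_metric_change[OF cd, of p' a b] p'(1) unfolding chart_change_def by auto
 qed
 ultimately have "((%y. gmet c y a b) has_derivative
   (%x. dgmet d w (T x) (T a) (T b)
    + gmet d w (hess c d z a x) (T b) + gmet d w (T a) (hess c d z b x))) (at z)"
  by (rule has_derivative_transform_within_open[OF _ open_overlap[OF cd] z])
 from frechet_derivative_eqI[OF this] show ?thesis by simp
qed

text \<open>The classical inhomogeneous transformation law. Of the six Hessian terms in the Koszul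
  formula four cancel by symmetry of the Hessian, the other two agree, and
  \<open>chris_unique\<close> identifies the vector.\<close>

lemma chris_change:
 assumes cd: "c : A" "d : A" and p: "p : fst c" "p : fst d"
 defines "T \<equiv> chart_change c d p" and "z \<equiv> snd c p" and "w \<equiv> snd d p"
 shows "chris d w (T u) (T v) = T (chris c z u v) - hess c d z u v"
proof -
 have z: "z : img c" "z : overlap c d" using p by (auto simp: z_def)
 have w: "w : img d" using p by (auto simp: w_def)
 have gT: "gmet d w (T a) (T b) = gmet c z a b" for a b
  unfolding T_def z_def w_def using coord_metric_change[OF cd p] by simp
 note L = linear_gmet_left[OF cd(2) w] linear_gmet_right[OF cd(2) w]
 have "ALL x. 2 * gmet d w (T (chris c z u v) - hess c d z u v) x
   = dgmet d w (T u) (T v) x + dgmet d w (T v) (T u) x - dgmet d w x (T u) (T v)"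
 proof
  fix x
  define y where "y = chart_change d c p x"
  have x: "x = T y" unfolding y_def T_def using cd p by (simp add: chart_change_trans chart_change_same)
  have "2 * gmet d w (T (chris c z u v) - hess c d z u v) x
    = 2 * gmet c z (chris c z u v) y - 2 * gmet d w (hess c d z u v) (T y)" by (simp add: x linear_diff[OF L(1)] gT)
  also have "... = dgmet c z u v y + dgmet c z v u y - dgmet c z y u v - 2 * gmet d w (hess c d z u v) (T y)"
   by (simp add: chris_eq[OF cd(1) z(1)])
  also have "... = dgmet d w (T u) (T v) x + dgmet d w (T v) (T u) x - dgmet d w x (T u) (T v)"
   unfolding x T_def z_def w_def dgmet_change[OF cd p] unfolding T_def[symmetric] z_def[symmetric] w_def[symmetric]
   by (simp add: hess_sym[OF cd z(2), of v u] hess_sym[OF cd z(2), of y u] hess_sym[OF cd z(2), of y v]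
     gmet_props(3)[OF cd(2) w, of "T v" "hess c d z u y"])
  finally show "2 * gmet d w (T (chris c z u v) - hess c d z u v) x
    = dgmet d w (T u) (T v) x + dgmet d w (T v) (T u) x - dgmet d w x (T u) (T v)" .
 qed
 from chris_unique[OF cd(2) w, THEN iffD1, OF this] show ?thesis ..
qed

lemma vector_deriv_trans:
 assumes cd: "c : A" "d : A" and p: "\<gamma> t : fst c" "\<gamma> t : fst d" and t: "t : {0..1}"
  and cont: "continuous_on {0..1} \<gamma>"
  and z: "((snd c o \<gamma>) has_vector_derivative z') (at t within {0..1})"
 shows "((snd d o \<gamma>) has_vector_derivative chart_change c d (\<gamma> t) z') (at t within {0..1})"
proof -
 have "((%s. trans c d ((snd c o \<gamma>) s)) has_derivative (%x. chart_change c d (\<gamma> t) (x *R z'))) (at t within {0..1})"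
 proof (rule has_derivative_compose[OF z[unfolded has_vector_derivative_def]])
  show "(trans c d has_derivative chart_change c d (\<gamma> t)) (at ((snd c o \<gamma>) t))"
   using trans_deriv[OF cd p] by (simp only: comp_apply[of "snd c" \<gamma> t])
 qed
 moreover have "\<forall>\<^sub>F s in at t within {0..1}. trans c d ((snd c o \<gamma>) s) = (snd d o \<gamma>) s"
 proof -
  have "(\<gamma> \<longlongrightarrow> \<gamma> t) (at t within {0..1})" using cont t by (simp add: continuous_on_def)
  hence "\<forall>\<^sub>F s in at t within {0..1}. \<gamma> s : fst c"
   using topological_tendstoD chart_props(1)[OF cd(1)] p(1) by blast
  thus ?thesis by eventually_elim (use cd in auto)
 qed
 ultimately have "((snd d o \<gamma>) has_derivative (%x. chart_change c d (\<gamma> t) (x *R z'))) (at t within {0..1})"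
  using t cd p by (elim has_derivative_transform_eventually) auto
 thus ?thesis by (simp add: has_vector_derivative_def linear_scale[OF linear_chart_change[OF cd p]])
qed

text \<open>\<open>velocity\<close> uses the chart selected at the current point; the chain rule for
  transitions allows any chart around it.\<close>

lemma velocity_in_chart:
 assumes c: "c : A" and p: "\<gamma> t : fst c" and t: "t : {0..1}"
  and cont: "continuous_on {0..1} \<gamma>"
  and z: "((snd c o \<gamma>) has_vector_derivative z') (at t within {0..1})"
 shows "velocity A \<gamma> t = vec_of A c (\<gamma> t) z'" unfolding velocity_def vec_of_def
 by (rule vector_derivative_within_closed_interval[OF _ t])
  (use vector_deriv_trans[OF c chart_at(1) p chart_at(2) t cont z] in auto)

text \<open>Changing charts differentiates the transition matrix along the curve, which adds a
  Hessian term to the derivative of the components; it cancels the Hessian term of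
  \<open>chris_change\<close>. So the derivative, defined by a chart that depends on t, can be
  computed in one chart along a whole piece of the curve.\<close>

lemma covariant_derivative_in_chart:
 assumes c: "c : A" and p: "\<gamma> t : fst c" and t: "t : {0..1}"
  and cont: "continuous_on {0..1} \<gamma>"
  and z: "((snd c o \<gamma>) has_vector_derivative z') (at t within {0..1})"
  and v: "((%s. comps_in A c (\<gamma> s) (V s)) has_vector_derivative v') (at t within {0..1})"
 shows "covariant_derivative A h \<gamma> V t
   = vec_of A c (\<gamma> t) (v' + chris c (snd c (\<gamma> t)) z' (comps_in A c (\<gamma> t) (V t)))"
proof -
 define d where "d = chart_at A (\<gamma> t)"
 have d: "d : A" "\<gamma> t : fst d" using chart_at by (auto simp: d_def)
 define T where "T = chart_change c d (\<gamma> t)"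
 define zt where "zt = snd c (\<gamma> t)"
 define u where "u s = comps_in A c (\<gamma> s) (V s)" for s
 have zt: "zt : overlap c d" using p d by (auto simp: zt_def)
 have lT: "linear T" unfolding T_def by (rule linear_chart_change[OF c d(1) p d(2)])
 let ?F = "%i y. fd (trans c d) y i"
 have ev: "\<forall>\<^sub>F s in at t within {0..1}. \<gamma> s : fst c \<inter> fst d"
 proof -
  have "(\<gamma> \<longlongrightarrow> \<gamma> t) (at t within {0..1})" using cont t by (simp add: continuous_on_def)
  thus ?thesis
   using topological_tendstoD[of \<gamma> "\<gamma> t" _ "fst c \<inter> fst d"] chart_props(1)[OF c] chart_props(1)[OF d(1)] p d by blast
 qed
 have expand: "comps_in A d (\<gamma> s) (V s) = (SUM i:Basis. (u s \<bullet> i) *R ?F i ((snd c o \<gamma>) s))"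
  if "\<gamma> s : fst c \<inter> fst d" for s
 proof -
  have "comps_in A d (\<gamma> s) (V s) = chart_change c d (\<gamma> s) (u s)"
   unfolding u_def using c d that by (simp add: change_comps)
  thus ?thesis
   using linear_expand[OF linear_chart_change[OF c d(1)], of "\<gamma> s" "u s"] that by (simp add: chart_change_def)
 qed
 have u': "(u has_derivative (%x. x *R v')) (at t within {0..1})"
  using v by (simp add: u_def[abs_def] has_vector_derivative_def)
 have F': "((%s. ?F i ((snd c o \<gamma>) s)) has_derivative (%x. hess c d zt i (x *R z'))) (at t within {0..1})" for i
 proof (rule has_derivative_compose[OF z[unfolded has_vector_derivative_def]])
  show "(?F i has_derivative (%v. hess c d zt i v)) (at ((snd c o \<gamma>) t))"
   using hess_deriv[OF c d(1) zt, of i] by (simp only: comp_apply[of "snd c" \<gamma> t] zt_def)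
 qed
 have Fzt: "?F i ((snd c o \<gamma>) t) = T i" for i by (simp add: T_def chart_change_def)
 have "((%s. SUM i:Basis. (u s \<bullet> i) *R ?F i ((snd c o \<gamma>) s)) has_derivative
   (%x. SUM i:Basis. (u t \<bullet> i) *R hess c d zt i (x *R z') + ((x *R v') \<bullet> i) *R ?F i ((snd c o \<gamma>) t))) (at t within {0..1})"
  by (intro has_derivative_sum has_derivative_scaleR has_derivative_inner_left F' u')
 hence "((%s. comps_in A d (\<gamma> s) (V s)) has_derivative
   (%x. SUM i:Basis. (u t \<bullet> i) *R hess c d zt i (x *R z') + ((x *R v') \<bullet> i) *R ?F i ((snd c o \<gamma>) t))) (at t within {0..1})"
  by (rule has_derivative_transform_eventually)
   (use ev p d t in \<open>auto elim!: eventually_mono simp: expand\<close>)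
 moreover have "(SUM i:Basis. (u t \<bullet> i) *R hess c d zt i (x *R z') + ((x *R v') \<bullet> i) *R ?F i ((snd c o \<gamma>) t))
   = x *R (hess c d zt (u t) z' + T v')" for x
 proof -
  have lh: "linear (%v. hess c d zt w v)" for w using hess_deriv[OF c d(1) zt] has_derivative_linear by blast
  have lh2: "linear (%w. hess c d zt w v)" for v
  proof -
   have "(%w. hess c d zt w v) = (%w. hess c d zt v w)" using hess_sym[OF c d(1) zt] by (intro ext)
   thus ?thesis using lh[of v] by (simp only:)
  qed
  have "(SUM i:Basis. (u t \<bullet> i) *R hess c d zt i (x *R z')) = hess c d zt (u t) (x *R z')"
   by (rule linear_expand[OF lh2, symmetric])
  moreover have "(SUM i:Basis. ((x *R v') \<bullet> i) *R T i) = T (x *R v')"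
   by (rule linear_expand[OF lT, symmetric])
  ultimately show ?thesis
   unfolding sum.distrib Fzt by (simp add: linear_scale[OF lh] linear_scale[OF lT] scaleR_add_right)
 qed
 ultimately have "((%s. comps_in A d (\<gamma> s) (V s)) has_vector_derivative (hess c d zt (u t) z' + T v')) (at t within {0..1})"
  by (simp add: has_vector_derivative_def)
 hence 1: "vector_derivative (%s. comps_in A d (\<gamma> s) (V s)) (at t within {0..1}) = hess c d zt (u t) z' + T v'"
  by (rule vector_derivative_within_closed_interval[OF _ t, rotated]) simp
 have 2: "velocity A \<gamma> t = T z'" using velocity_in_chart[OF c p t cont z] by (simp add: vec_of_def T_def d_def)
 have 3: "V t = T (u t)" using vec_of_comps[OF c p, of "V t"] by (simp add: T_def u_def d_def vec_of_def)
 have "chris d (snd d (\<gamma> t)) (T z') (T (u t)) = T (chris c zt z' (u t)) - hess c d zt z' (u t)"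
  unfolding T_def zt_def by (rule chris_change[OF c d(1) p d(2)])
 hence "covariant_derivative A h \<gamma> V t = T v' + T (chris c zt z' (u t))"
  unfolding covariant_derivative_def Let_def d_def[symmetric] 1 2 3 using hess_sym[OF c d(1) zt, of "u t" z'] by simp
 thus ?thesis by (simp add: linear_add[OF lT, symmetric]) (simp add: T_def vec_of_def d_def u_def zt_def)
qed

end

section \<open>The volume measure\<close>

definition gram :: "(complex^'n => complex^'n => complex) => complex^'n^'n::finite" where
 "gram b = (\<chi> i j. b (axis i 1) (axis j 1))"

lemma vec_axis_expand: "(x :: complex^'n::finite) = (SUM i:UNIV. x $ i *s axis i 1)"
 by (simp add: vec_eq_iff axis_def if_distrib cong: if_cong)

lemma hermitian_inner_zero_left: "hermitian_inner b ==> b 0 v = 0"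
 unfolding hermitian_inner_def by (metis add_cancel_right_right add_0)

lemma hermitian_inner_sum_left:
 assumes "hermitian_inner b"
 shows "b (SUM i:I. f i) v = (SUM i:I. b (f i) v)"
proof (induction I rule: infinite_finite_induct)
 case (insert x F)
 have "b (f x + sum f F) v = b (f x) v + b (sum f F) v" using assms unfolding hermitian_inner_def by blast
 thus ?case using insert by simp
qed (simp_all add: hermitian_inner_zero_left[OF assms])

lemma hermitian_inner_sum_right:
 assumes "hermitian_inner b"
 shows "b v (SUM i:I. f i) = (SUM i:I. b v (f i))"
proof -
 have c: "b u w = cnj (b w u)" for u w using assms unfolding hermitian_inner_def by blast
 show ?thesis by (subst c, subst hermitian_inner_sum_left[OF assms], simp, subst c, simp)
qed

lemma hermitian_inner_smult:
 assumes "hermitian_inner b"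
 shows "b (a *s u) v = a * b u v" "b u (a *s v) = cnj a * b u v"
proof -
 have c: "b u w = cnj (b w u)" and s: "b (a *s u) v = a * b u v" for a u v w
  using assms unfolding hermitian_inner_def by blast+
 show "b (a *s u) v = a * b u v" by (rule s)
 show "b u (a *s v) = cnj a * b u v" by (subst c, subst s, subst (2) c, simp)
qed

lemma hermitian_inner_expand:
 assumes "hermitian_inner b"
 shows "b u v = (SUM i:UNIV. SUM j:UNIV. u $ i * (cnj (v $ j) * gram b $ i $ j))"
proof -
 have "b u v = b (SUM i:UNIV. u $ i *s axis i 1) (SUM j:UNIV. v $ j *s axis j 1)"
  using vec_axis_expand[of u] vec_axis_expand[of v] by simp
 thus ?thesis by (simp add: hermitian_inner_sum_left[OF assms] hermitian_inner_sum_right[OF assms]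
    hermitian_inner_smult[OF assms] gram_def sum_distrib_left)
   (subst sum.swap, simp add: mult.left_commute)
qed

text \<open>A kernel vector x of the transposed Gram matrix would give b x x = 0.\<close>

lemma det_gram_nonzero:
 assumes "hermitian_inner b"
 shows "det (gram b) ~= 0"
proof
 assume "det (gram b) = 0"
 hence "\<not> invertible (transpose (gram b))" by (simp add: invertible_det_nz)
 then obtain x where x: "x ~= 0" "transpose (gram b) *v x = 0"
  using matrix_left_invertible_ker[of "transpose (gram b)"] invertible_left_inverse by blast
 have "(SUM i:UNIV. x $ i * gram b $ i $ j) = 0" for j using arg_cong[OF x(2), of "%y. y $ j"]
  by (simp add: matrix_vector_mult_def transpose_def mult.commute)
 hence "(SUM i:UNIV. SUM j:UNIV. x $ i * (cnj (x $ j) * gram b $ i $ j)) = 0"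
  by (subst sum.swap) (simp add: mult.left_commute[of "x $ _"] sum_distrib_left[symmetric])
 hence "b x x = 0" using hermitian_inner_expand[OF assms] by metis
 thus False using assms x(1) unfolding hermitian_inner_def by (metis less_irrefl zero_complex.simps(1))
qed

lemma det_gram_real:
 fixes b :: "complex^'n::finite => complex^'n => complex"
 assumes "hermitian_inner b"
 shows "det (gram b) = of_real (Re (det (gram b)))"
proof -
 have c: "b (axis i 1) (axis j 1) = cnj (b (axis j 1) (axis i 1))" for i j
  using assms unfolding hermitian_inner_def by blast
 have "gram b $ i $ j = cnj (transpose (gram b) $ i $ j)" for i j
  by (simp only: gram_def transpose_def vec_lambda_beta) (rule c)
 hence e: "gram b = (\<chi> i j. cnj (transpose (gram b) $ i $ j))" by (simp only: vec_eq_iff vec_lambda_beta) blast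
 have "det (\<chi> i j. cnj (N $ i $ j)) = cnj (det N)" for N :: "complex^'n^'n" by (simp add: det_def)
 from trans[OF arg_cong[OF e, of det] this] have "det (gram b) = cnj (det (transpose (gram b)))" .
 hence "det (gram b) = cnj (det (gram b))" by (simp add: det_transpose)
 thus ?thesis by (simp add: complex_eq_iff)
qed

text \<open>Along the segment from the standard inner product to b the determinant is real,
  continuous and never 0, and it starts at 1; by the intermediate value theorem it stays
  positive.\<close>

lemma det_gram_pos:
 fixes b :: "complex^'n::finite => complex^'n => complex"
 assumes b: "hermitian_inner b"
 shows "0 < Re (det (gram b))"
proof (rule ccontr)
 assume neg: "\<not> ?thesis"
 define b0 :: "complex^'n => complex^'n => complex" where "b0 u v = (SUM i:UNIV. u $ i * cnj (v $ i))" for u v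
 have b0: "hermitian_inner b0" unfolding hermitian_inner_def
 proof (intro conjI allI impI)
  fix u :: "complex^'n" assume "u ~= 0"
  then obtain i where "u $ i ~= 0" by (metis vec_eq_iff zero_index)
  hence "0 < (SUM i:UNIV. (cmod (u $ i))\<^sup>2)" by (intro sum_pos2[of _ i]) auto
  thus "0 < Re (b0 u u)" unfolding b0_def by (simp only: complex_norm_square[symmetric] Re_sum Re_complex_of_real)
 qed (auto simp: b0_def algebra_simps sum.distrib sum_distrib_left)
 define bt where "bt t u v = of_real (1 - t) * b0 u v + of_real t * b u v" for t :: real and u v
 have bt: "hermitian_inner (bt t)" if "0 <= t" "t <= 1" for t unfolding hermitian_inner_def
 proof (intro conjI allI impI)
  fix u v w :: "complex^'n" and a
  have 1: "b (u + v) w = b u w + b v w" "b0 (u + v) w = b0 u w + b0 v w"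
   "b v u = cnj (b u v)" "b0 v u = cnj (b0 u v)" using b b0 unfolding hermitian_inner_def by blast+
  show "bt t (u + v) w = bt t u w + bt t v w" by (simp add: bt_def 1 algebra_simps)
  show "bt t (a *s u) v = a * bt t u v"
   by (simp add: bt_def hermitian_inner_smult[OF b] hermitian_inner_smult[OF b0] algebra_simps)
  show "bt t v u = cnj (bt t u v)" unfolding bt_def 1 by simp
  assume "u ~= 0"
  hence "0 < Re (b u u)" "0 < Re (b0 u u)" using b b0 unfolding hermitian_inner_def by blast+
  hence "0 < (1 - t) * Re (b0 u u) + t * Re (b u u)" using that by (cases "t = 0") (auto intro: add_nonneg_pos)
  thus "0 < Re (bt t u u)" by (simp add: bt_def)
 qed
 define f where "f t = Re (det (gram (bt t)))" for t
 have cont: "continuous_on {0..1} f" unfolding f_def det_def gram_def bt_def by (simp, intro continuous_intros)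
 have g0: "gram (bt 0) = mat 1"
 proof -
  have "b0 (axis i 1) (axis j 1) = (if i = j then 1 else 0)" for i j
  proof -
   have "b0 (axis i 1) (axis j 1) = (SUM k:UNIV. if k = i then cnj ((axis j 1 :: complex^'n) $ i) else 0)"
    unfolding b0_def by (intro sum.cong) (auto simp: axis_def)
   thus ?thesis by (auto simp: axis_def)
  qed
  hence "gram (bt 0) $ i $ j = mat 1 $ i $ j" for i j by (simp add: gram_def bt_def mat_def)
  thus ?thesis by (simp add: vec_eq_iff)
 qed
 have "f 0 = 1" unfolding f_def g0 by simp
 moreover have "f 1 = Re (det (gram b))" by (simp add: f_def bt_def[abs_def])
 ultimately have "EX t>=0. t <= 1 & f t = 0" using neg by (intro IVT2' cont) auto
 then obtain t where t: "0 <= t" "t <= 1" "f t = 0" by blast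
 hence "det (gram (bt t)) = 0" using det_gram_real[OF bt[OF t(1,2)]] by (simp add: f_def)
 thus False using det_gram_nonzero[OF bt[OF t(1,2)]] by blast
qed

text \<open>Two factors arise, det M and its conjugate, because the form is conjugate linear in its
  second argument.\<close>

lemma gram_linear_change:
 fixes M :: "complex^'n::finite^'n"
 assumes "hermitian_inner b"
 shows "det (gram (%u v. b (M *v u) (M *v v))) = of_real ((cmod (det M))\<^sup>2) * det (gram b)"
proof -
 define N where "N = (\<chi> i j. cnj (M $ i $ j))"
 have ax: "(M *v axis i 1) $ k = M $ k $ i" for i k
  by (simp add: matrix_vector_mult_def axis_def if_distrib cong: if_cong)
 have "gram (%u v. b (M *v u) (M *v v)) $ i $ j = (transpose M ** gram b ** N) $ i $ j" for i j
 proof -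
  have "gram (%u v. b (M *v u) (M *v v)) $ i $ j = (SUM k:UNIV. SUM l:UNIV. M $ k $ i * (cnj (M $ l $ j) * gram b $ k $ l))"
   using hermitian_inner_expand[OF assms, of "M *v axis i 1" "M *v axis j 1"] by (simp add: ax) (simp add: gram_def)
  also have "... = (SUM l:UNIV. SUM k:UNIV. M $ k $ i * (cnj (M $ l $ j) * gram b $ k $ l))" by (rule sum.swap)
  finally show ?thesis
   by (simp add: matrix_matrix_mult_def transpose_def N_def sum_distrib_left sum_distrib_right mult_ac)
 qed
 hence "gram (%u v. b (M *v u) (M *v v)) = transpose M ** gram b ** N" by (simp add: vec_eq_iff)
 moreover have "det N = cnj (det M)" by (simp add: det_def N_def)
 ultimately show ?thesis by (simp add: det_mul det_transpose complex_norm_square del: of_real_power)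
qed

section \<open>Existence and uniqueness of the Riemannian volume\<close>

context herm_mfd
begin

definition rho :: "('a, 'n) chart => complex^'n => real" where
 "rho c z = Re (det (\<chi> i j. coord_metric A h c z (axis i 1) (axis j 1)))"

lemma rho_gram: "rho c z = Re (det (gram (coord_metric A h c z)))" by (simp add: rho_def gram_def)

lemma rho_pos: "c : A ==> z : img c ==> 0 < rho c z" unfolding rho_gram by (intro det_gram_pos hermitian_coord_metric)

lemma continuous_rho: "c : A ==> continuous_on (img c) (rho c)"
 unfolding rho_def det_def by (simp, intro continuous_intros continuous_coord_metric)

text \<open>Holomorphy enters here: the change of components is complex linear, so its real Jacobian
  is |det|^2, which is exactly the factor by which the Gram determinant changes.\<close>

lemma rho_change:
 assumes "c : A" "d : A" "p : fst c" "p : fst d"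
 shows "rho c (snd c p) = jac (chart_change c d p) * rho d (snd d p)"
proof -
 define T where "T = chart_change c d p"
 define M where "M = matrix T"
 have T: "T = (*v) M"
 proof -
  have "Vector_Spaces.linear (*s) (*s) T" unfolding Vector_Spaces.linear_iff T_def
   by (simp add: linear_add[OF linear_chart_change[OF assms]] chart_change_smult[OF assms] vec.vector_space_axioms)
  from matrix_works[OF this] show ?thesis by (auto simp: M_def)
 qed
 have dM: "det M ~= 0"
 proof
  assume "det M = 0"
  hence "\<not> invertible M" by (simp add: invertible_det_nz)
  then obtain x where "x ~= 0" "M *v x = 0" using matrix_left_invertible_ker[of M] invertible_left_inverse by blast
  hence "x ~= 0" "T x = T 0" by (simp_all add: T matrix_vector_mult_0_right)
  thus False using chart_change_trans[OF assms(1,2,1,3,4,3)] chart_change_same[OF assms(1,3)] unfolding T_def by metis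
 qed
 have e: "coord_metric A h c (snd c p) = (%u v. coord_metric A h d (snd d p) (M *v u) (M *v v))"
  using coord_metric_change[OF assms] by (simp add: fun_eq_iff T_def[symmetric] T)
 have H: "hermitian_inner (coord_metric A h d (snd d p))" using hermitian_coord_metric assms by simp
 have "det (gram (coord_metric A h c (snd c p))) = of_real ((cmod (det M))\<^sup>2) * det (gram (coord_metric A h d (snd d p)))"
  unfolding e by (rule gram_linear_change[OF H])
 thus ?thesis unfolding rho_gram using jac_complex_matrix[OF dM] by (simp add: T_def[symmetric] T)
qed

text \<open>A total Borel map: it is constant off the image of the chart, where
  \<open>chart_inv\<close> is arbitrary.\<close>

definition cinv :: "('a, 'n) chart => complex^'n => 'a" where
 "cinv c z = (if z : img c then chart_inv c z else undefined)"

lemma img_borel [measurable]: "c : A ==> img c : sets borel" by (intro borel_open chart_props(2))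

lemma dom_borel [measurable]: "c : A ==> fst c : sets borel" by (intro borel_open chart_props(1))

lemma measurable_cinv: "c : A ==> cinv c : bmeas" unfolding cinv_def[abs_def]
 by (intro borel_measurable_continuous_on_if continuous_chart_inv) auto

lemma image_chart_eq: "c : A ==> S <= fst c ==> snd c ` S = img c \<inter> cinv c -` S" by (auto simp: cinv_def)

lemma image_chart_borel:
 assumes "c : A" "S : sets borel" "S <= fst c"
 shows "snd c ` S : sets borel" unfolding image_chart_eq[OF assms(1,3)]
 using measurable_sets[OF measurable_cinv[OF assms(1)] assms(2)] img_borel[OF assms(1)] by auto

lemma chart_inv_image_borel:
 assumes "c : A" "T : sets borel" "T <= img c"
 shows "chart_inv c ` T : sets borel"
proof -
 have "(%x. if x : fst c then snd c x else 0) : bmeas"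
  by (intro borel_measurable_continuous_on_if continuous_chart dom_borel assms) auto
 from measurable_sets[OF this assms(2)]
 have "fst c \<inter> (%x. if x : fst c then snd c x else 0) -` T : sets borel" using dom_borel[OF assms(1)] by auto
 moreover have "fst c \<inter> (%x. if x : fst c then snd c x else 0) -` T = chart_inv c ` T"
  using assms by (auto simp: image_iff subset_iff) (metis chart_inv_chart)+
 ultimately show ?thesis by simp
qed

definition rho0 :: "('a, 'n) chart => complex^'n => ennreal" where
 "rho0 c z = ennreal (indicator (img c) z * rho c z)"

lemma measurable_rho0: "c : A ==> rho0 c : bmeas" unfolding rho0_def[abs_def]
 using borel_measurable_continuous_on_indicator[OF img_borel continuous_rho, of c] by simp

text \<open>The Riemannian measure of a single chart, made a Borel measure on the whole manifold
  that is concentrated on the chart domain.\<close>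

definition chart_vol :: "('a, 'n) chart => 'a measure" where
 "chart_vol c = distr (density lborel (rho0 c)) borel (cinv c)"

lemma sets_chart_vol [simp]: "sets (chart_vol c) = sets borel" by (simp add: chart_vol_def)

lemma emeasure_chart_vol:
 assumes c: "c : A" and S: "S : sets borel" "S <= fst c"
 shows "emeasure (chart_vol c) S = (LI z:snd c ` S. ennreal (rho c z))"
proof -
 have "emeasure (chart_vol c) S = (LI z. rho0 c z * indicator (cinv c -` S) z)"
  unfolding chart_vol_def using measurable_sets[OF measurable_cinv[OF c] S(1)] measurable_rho0[OF c] measurable_cinv[OF c] S
  by (subst emeasure_distr) (auto simp: emeasure_density)
 also have "... = (LI z:snd c ` S. ennreal (rho c z))"
  by (intro nn_integral_cong) (auto simp: image_chart_eq[OF c S(2)] rho0_def indicator_def)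
 finally show ?thesis .
qed

text \<open>Change of variables for the transition map; its Jacobian is absorbed by
  \<open>rho_change\<close>.\<close>

lemma chart_vol_indep:
 assumes cd: "c : A" "d : A" and S: "S : sets borel" "S <= fst c" "S <= fst d"
 shows "emeasure (chart_vol c) S = emeasure (chart_vol d) S"
proof -
 let ?f' = "%z. fd (trans c d) z"
 have im: "snd d ` S = trans c d ` (snd c ` S)"
 proof -
  have "trans c d (snd c p) = snd d p" if "p : S" for p using that S cd by auto
  thus ?thesis unfolding image_image by (intro image_cong refl) (rule sym)
 qed
 have "emeasure (chart_vol d) S = (LI z:snd d ` S. ennreal (rho d z))" by (rule emeasure_chart_vol[OF cd(2) S(1,3)])
 also have "... = (LI z:trans c d ` (snd c ` S). rho0 d z)"
  unfolding im[symmetric] using S by (intro nn_integral_cong) (auto simp: rho0_def indicator_def)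
 also have "... = (LI z:snd c ` S. ennreal (jac (?f' z)) * rho0 d (trans c d z))"
 proof (rule nn_integral_image_jac[OF open_overlap[OF cd]])
  show "continuous_on (overlap c d) (trans c d)" using Ck_trans[OF cd, of 0] by simp
  show "continuous_on (overlap c d) (%x. fd (trans c d) x v)" for v
   using Ck_on_Suc_frechet[OF Ck_trans[OF cd, of "Suc 0"], of v] by simp
  show "inj_on (trans c d) (overlap c d)"
  proof (rule inj_onI)
   fix x y assume xy: "x : overlap c d" "y : overlap c d" "trans c d x = trans c d y"
   then obtain p q where "p : fst c \<inter> fst d" "q : fst c \<inter> fst d" "x = snd c p" "y = snd c q" by blast
   thus "x = y" using xy(3) cd by simp (metis chart_inv_chart)
  qed
  show "trans c d ` T : sets borel" if T: "T : sets borel" "T <= overlap c d" for T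
  proof -
   have "chart_inv c ` T : sets borel" using T by (intro chart_inv_image_borel[OF cd(1)]) auto
   moreover have "chart_inv c ` T <= fst d" using T overlap_eq[OF cd(1)] by auto
   ultimately have "snd d ` (chart_inv c ` T) : sets borel" by (intro image_chart_borel[OF cd(2)])
   thus ?thesis by (simp add: image_comp)
  qed
  show "rho0 d : bmeas" by (rule measurable_rho0[OF cd(2)])
  show "snd c ` S : sets borel" by (rule image_chart_borel[OF cd(1) S(1,2)])
  show "snd c ` S <= overlap c d" using S by auto
  show "(trans c d has_derivative ?f' x) (at x)" if "x : overlap c d" for x
   using Ck_on_Suc_has_derivative[OF Ck_trans[OF cd] that] .
 qed
 also have "... = (LI z:snd c ` S. ennreal (rho c z))"
 proof (intro nn_integral_cong)
  fix z
  show "ennreal (jac (?f' z)) * rho0 d (trans c d z) * indicator (snd c ` S) z = ennreal (rho c z) * indicator (snd c ` S) z"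
  proof (cases "z : snd c ` S")
   case True
   then obtain p where p: "p : S" "z = snd c p" by blast
   have pcd: "p : fst c" "p : fst d" using p S by auto
   have "rho c z = jac (?f' z) * rho d (snd d p)"
    unfolding p(2) by (subst rho_change[OF cd pcd]) (simp add: chart_change_def)
   moreover have "trans c d z = snd d p" using p pcd cd by simp
   ultimately show ?thesis using pcd rho_pos[OF cd(2), of "snd d p"] by (simp add: rho0_def ennreal_mult' jac_nonneg)
  qed simp
 qed
 also have "... = emeasure (chart_vol c) S" by (rule emeasure_chart_vol[OF cd(1) S(1,2), symmetric])
 finally show ?thesis ..
qed

lemma countable_charts: obtains cc :: "nat => ('a, 'n) chart" where "!!i. cc i : A" "(\<Union>i. fst (cc i)) = UNIV"
proof -
 obtain F where F: "F <= fst ` A" "countable F" "\<Union>F = \<Union>(fst ` A)"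
  using Lindelof[of "fst ` A"] chart_props(1) by blast
 have U: "\<Union>(fst ` A) = UNIV" using chart_at by blast
 hence ne: "F ~= {}" using F(3) by auto
 have "ALL i. EX c:A. fst c = from_nat_into F i" using F(1) from_nat_into[OF ne] by (metis imageE subsetD)
 then obtain cc where cc: "!!i. cc i : A" "!!i. fst (cc i) = from_nat_into F i" by metis
 have "(\<Union>i. fst (cc i)) = \<Union>F" using range_from_nat_into[OF ne F(2)] by (simp add: cc(2))
 thus ?thesis using that[OF cc(1)] F(3) U by auto
qed

text \<open>The condition under the \<open>THE\<close> in \<open>volume\<close>, with the coordinate
  integral packaged as a measure.\<close>

definition is_volume :: "'a measure => bool" where
 "is_volume M \<longleftrightarrow> sets M = sets borel &
  (ALL c:A. ALL S:sets borel. S <= fst c --> emeasure M S = emeasure (chart_vol c) S)"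

text \<open>The domains of countably many charts, made disjoint, carry one chart measure each, and
  the sum of these is the volume. By \<open>chart_vol_indep\<close> it agrees with every chart of
  the atlas, also with those outside the countable list.\<close>

lemma is_volume_exists: "EX M. is_volume M"
proof -
 obtain cc where cc: "!!i::nat. cc i : A" "(\<Union>i. fst (cc i)) = UNIV" using countable_charts by blast
 define E where "E = disjointed (%i. fst (cc i))"
 have E: "disjoint_family E" "(\<Union>i. E i) = UNIV" "!!i. E i <= fst (cc i)" unfolding E_def
  by (rule disjoint_family_disjointed, unfold UN_disjointed_eq, rule cc(2), rule disjointed_subset)
 have Eb: "E i : sets borel" for i unfolding E_def disjointed_def using cc(1) dom_borel by auto
 define \<mu> where "\<mu> S = (\<Sum>i. emeasure (chart_vol (cc i)) (S \<inter> E i))" for S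
 define M where "M = measure_of UNIV (sets borel) \<mu>"
 have sM: "sets M = sets borel"
  unfolding M_def by (metis sets.sigma_sets_eq sets_measure_of sets.space_closed space_borel)
 have eM: "emeasure M S = \<mu> S" if "S : sets borel" for S
 proof (rule emeasure_measure_of[OF M_def])
  show "sets borel <= Pow UNIV" by simp
  show "S : sets M" using that sM by simp
  show "positive (sets M) \<mu>" by (simp add: positive_def \<mu>_def)
  show "countably_additive (sets M) \<mu>" unfolding countably_additive_def sM
  proof (intro allI impI)
   fix F :: "nat => 'a set" assume F: "range F <= sets borel" "disjoint_family F"
   let ?f = "%n i. emeasure (chart_vol (cc i)) (F n \<inter> E i)"
   \<comment> \<open>The two sums are exchanged by reading the one over i as an integral for
     counting measure.\<close>
   have "(\<Sum>n. \<mu> (F n)) = (\<Sum>n. \<integral>\<^sup>+i. ?f n i \<partial>count_space UNIV)"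
    by (simp add: \<mu>_def nn_integral_count_space_nat)
   also have "... = (\<integral>\<^sup>+i. (\<Sum>n. ?f n i) \<partial>count_space UNIV)"
    by (rule nn_integral_suminf[symmetric]) simp
   also have "... = (\<Sum>i. \<Sum>n. ?f n i)" by (rule nn_integral_count_space_nat)
   also have "... = \<mu> (\<Union>(range F))" unfolding \<mu>_def
   proof (rule suminf_cong)
    fix i
    have "(\<Sum>n. ?f n i) = emeasure (chart_vol (cc i)) (\<Union>n. F n \<inter> E i)"
     using F Eb by (intro suminf_emeasure) (auto simp: disjoint_family_on_def)
    thus "(\<Sum>n. ?f n i) = emeasure (chart_vol (cc i)) (\<Union>(range F) \<inter> E i)" by simp
   qed
   finally show "(\<Sum>n. \<mu> (F n)) = \<mu> (\<Union>(range F))" .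
  qed
 qed
 have "is_volume M" unfolding is_volume_def
 proof (intro conjI ballI impI sM)
  fix c S assume c: "c : A" and S: "S : sets borel" "S <= fst c"
  have "emeasure M S = (\<Sum>i. emeasure (chart_vol (cc i)) (S \<inter> E i))" using eM S by (simp add: \<mu>_def)
  also have "... = (\<Sum>i. emeasure (chart_vol c) (S \<inter> E i))"
   using S c cc(1) E(3) Eb by (intro suminf_cong chart_vol_indep) auto
  also have "... = emeasure (chart_vol c) (\<Union>i. S \<inter> E i)"
   using S Eb E(1) by (intro suminf_emeasure) (auto simp: disjoint_family_on_def, blast)
  also have "(\<Union>i. S \<inter> E i) = S" using E(2) by auto
  finally show "emeasure M S = emeasure (chart_vol c) S" .
 qed
 thus ?thesis ..
qed

text \<open>Countable additivity over disjoint pieces reduces any Borel set to sets inside charts,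
  where the value is prescribed.\<close>

lemma is_volume_unique:
 assumes "is_volume M" "is_volume N"
 shows "M = N"
proof (rule measure_eqI)
 show "sets M = sets N" using assms by (simp add: is_volume_def)
 fix S assume "S : sets M"
 hence S: "S : sets borel" using assms by (simp add: is_volume_def)
 obtain cc where cc: "!!i::nat. cc i : A" "(\<Union>i. fst (cc i)) = UNIV" using countable_charts by blast
 define E where "E = disjointed (%i. fst (cc i))"
 have E: "disjoint_family E" "(\<Union>i. E i) = UNIV" "!!i. E i <= fst (cc i)" unfolding E_def
  by (rule disjoint_family_disjointed, unfold UN_disjointed_eq, rule cc(2), rule disjointed_subset)
 have Eb: "E i : sets borel" for i unfolding E_def disjointed_def using cc(1) dom_borel by auto
 have "emeasure K S = (\<Sum>i. emeasure (chart_vol (cc i)) (S \<inter> E i))" if K: "is_volume K" for K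
 proof -
  have "(\<Sum>i. emeasure (chart_vol (cc i)) (S \<inter> E i)) = (\<Sum>i. emeasure K (S \<inter> E i))"
  proof (rule suminf_cong)
   fix i
   have "S \<inter> E i : sets borel" "S \<inter> E i <= fst (cc i)" using S Eb E(3) by auto
   hence "emeasure K (S \<inter> E i) = emeasure (chart_vol (cc i)) (S \<inter> E i)"
    using K cc(1)[of i] unfolding is_volume_def by blast
   thus "emeasure (chart_vol (cc i)) (S \<inter> E i) = emeasure K (S \<inter> E i)" ..
  qed
  also have "... = emeasure K (\<Union>i. S \<inter> E i)"
   using K S Eb E(1) by (intro suminf_emeasure) (auto simp: disjoint_family_on_def is_volume_def, blast?)
  also have "(\<Union>i. S \<inter> E i) = S" using E(2) by auto
  finally show ?thesis ..
 qed
 thus "emeasure M S = emeasure N S" using assms by simp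
qed

abbreviation vol :: "'a measure" where "vol \<equiv> volume A h"

lemma is_volume_vol: "is_volume vol"
proof -
 have "volume A h = (THE M. is_volume M)" unfolding volume_def is_volume_def rho_def[symmetric]
  by (intro arg_cong[where f = The] ext) (auto simp: emeasure_chart_vol)
 moreover have "EX! M. is_volume M" using is_volume_exists is_volume_unique by blast
 ultimately show ?thesis using theI' by metis
qed

lemma sets_vol [simp, measurable_cong]: "sets vol = sets borel" using is_volume_vol by (simp add: is_volume_def)

lemma space_vol [simp]: "space vol = UNIV" using sets_eq_imp_space_eq[OF sets_vol] by simp

lemma borel_measurable_vol [simp]: "borel_measurable vol = bmeas" by (rule measurable_cong_sets) auto

text \<open>Restricted to the chart domain, the volume equals \<open>chart_vol\<close>; equality of
  measures carries over to integrals.\<close>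

lemma nn_integral_vol_chart:
 assumes c: "c : A" and S: "S : sets borel" "S <= fst c" and u: "u : bmeas"
 shows "(\<integral>\<^sup>+x\<in>S. u x \<partial>vol) = (LI z:snd c ` S. ennreal (rho c z) * u (chart_inv c z))"
proof -
 have "density vol (indicator (fst c)) = chart_vol c"
 proof (rule measure_eqI)
  fix R assume "R : sets (density vol (indicator (fst c)))"
  hence R: "R : sets borel" by simp
  have "emeasure (density vol (indicator (fst c))) R = (\<integral>\<^sup>+x. indicator (fst c \<inter> R) x \<partial>vol)"
   using R dom_borel[OF c] by (simp add: emeasure_density indicator_inter_arith)
  also have "... = emeasure vol (fst c \<inter> R)" using R dom_borel[OF c] by simp
  also have "... = emeasure (chart_vol c) (fst c \<inter> R)"
   using is_volume_vol c R dom_borel[OF c] unfolding is_volume_def by simp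
  also have "... = emeasure (chart_vol c) R"
  proof -
   have "AE x in chart_vol c. x : fst c"
    unfolding chart_vol_def using dom_borel[OF c] measurable_cinv[OF c] measurable_rho0[OF c] c
    by (subst AE_distr_iff) (auto simp: AE_density rho0_def cinv_def indicator_def)
   thus ?thesis by (intro emeasure_eq_AE) (use R dom_borel[OF c] in auto)
  qed
  finally show "emeasure (density vol (indicator (fst c))) R = emeasure (chart_vol c) R" .
 qed simp
 note eq = this
 have m: "(%x. u x * indicator S x) : bmeas" using u S by simp
 have "(\<integral>\<^sup>+x\<in>S. u x \<partial>vol) = (\<integral>\<^sup>+x. indicator (fst c) x * (u x * indicator S x) \<partial>vol)"
  using S by (intro nn_integral_cong) (auto simp: indicator_def)
 also have "... = (\<integral>\<^sup>+x. u x * indicator S x \<partial>chart_vol c)"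
  unfolding eq[symmetric] using dom_borel[OF c] m by (subst nn_integral_density) auto
 also have "... = (LI z. rho0 c z * (u (cinv c z) * indicator S (cinv c z)))"
  unfolding chart_vol_def using measurable_cinv[OF c] measurable_rho0[OF c] m measurable_compose[OF measurable_cinv[OF c] m]
  by (simp add: nn_integral_distr nn_integral_density)
 also have "... = (LI z:snd c ` S. ennreal (rho c z) * u (chart_inv c z))"
  by (intro nn_integral_cong) (auto simp: image_chart_eq[OF c S(2)] rho0_def cinv_def indicator_def)
 finally show ?thesis .
qed

end

section \<open>Multilinear forms and orthonormal frames\<close>

text \<open>Multilinearity is written by recursion on the first argument because all later estimates
  peel off one argument at a time. Lists of the wrong length give 0, as for forms.\<close>

primrec mlin :: "nat => ('v::real_vector list => complex) => bool" where
 "mlin 0 \<omega> \<longleftrightarrow> (ALL v vs. \<omega> (v # vs) = 0)"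
| "mlin (Suc k) \<omega> \<longleftrightarrow> \<omega> [] = 0 & (ALL v. mlin k (%vs. \<omega> (v # vs))) & (ALL vs. linear (%v. \<omega> (v # vs)))"

text \<open>The slot-by-slot formulation is the one that can be checked for \<open>dz_form\<close>,
  where a permutation moves the arguments around.\<close>

definition slot_linear :: "nat => ('v::real_vector list => complex) => bool" where
 "slot_linear k \<omega> \<longleftrightarrow> (ALL vs. length vs ~= k --> \<omega> vs = 0) &
   (ALL vs i. length vs = k --> i < k --> linear (%v. \<omega> (vs[i := v])))"

lemma linear_zero_fun: "linear (%v. 0)" by (intro linearI) auto

lemma slot_linear_mlin: "slot_linear k \<omega> ==> mlin k \<omega>"
proof (induction k arbitrary: \<omega>)
 case 0
 thus ?case by (simp add: slot_linear_def)
next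
 case (Suc k)
 have len: "\<omega> vs = 0" if "length vs ~= Suc k" for vs using Suc.prems that by (simp add: slot_linear_def)
 have slot: "linear (%v. \<omega> (vs[i := v]))" if "length vs = Suc k" "i < Suc k" for vs i
  using Suc.prems that by (simp add: slot_linear_def)
 have "slot_linear k (%vs. \<omega> (v # vs))" for v unfolding slot_linear_def
 proof (intro conjI allI impI)
  fix vs :: "'a list" and i assume "length vs = k" "i < k"
  thus "linear (%w. \<omega> (v # vs[i := w]))" using slot[of "v # vs" "Suc i"] by simp
 qed (simp add: len)
 moreover have "linear (%v. \<omega> (v # vs))" for vs
 proof (cases "length vs = k")
  case True
  thus ?thesis using slot[of "undefined # vs" 0] by simp
 qed (simp add: len linear_zero_fun)
 ultimately show ?case using Suc.IH len by simp
qed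

lemma slot_linear_sum:
 assumes "!!i. i : I ==> slot_linear k (\<omega> i)"
 shows "slot_linear k (%vs. SUM i:I. a i * \<omega> i vs)"
proof -
 have "linear (%v. SUM i:I. a i * \<omega> i (vs[j := v]))" if "length vs = k" "j < k" for vs j
 proof (rule linear_compose_sum, rule ballI)
  fix i assume "i : I"
  hence l: "linear (%v. \<omega> i (vs[j := v]))" using assms that by (simp add: slot_linear_def)
  show "linear (%v. a i * \<omega> i (vs[j := v]))"
   by (intro linearI) (simp_all add: linear_add[OF l] linear_scale[OF l] algebra_simps)
 qed
 moreover have "(SUM i:I. a i * \<omega> i vs) = 0" if "length vs ~= k" for vs
  using assms that by (intro sum.neutral) (simp add: slot_linear_def)
 ultimately show ?thesis by (simp add: slot_linear_def)
qed

text \<open>The varied argument sits in exactly one factor, the one with index j such that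
  \<open>\<pi> j = i\<close>.\<close>

lemma slot_linear_prod:
 assumes L: "!!m. linear (L m)" and \<pi>: "\<pi> permutes {..<k}"
 shows "slot_linear k (%vs. if length vs = k then \<Prod>m<k. L m (vs ! \<pi> m) else 0)" unfolding slot_linear_def
proof (intro conjI allI impI)
 fix vs :: "'a list" and i assume vs: "length vs = k" "i < k"
 obtain j where j: "j < k" "\<pi> j = i" using permutes_image[OF \<pi>] vs(2) by (metis imageE lessThan_iff)
 have inj: "inj_on \<pi> {..<k}" using \<pi> permutes_inj_on by blast
 have "(\<Prod>m<k. L m (vs[i := v] ! \<pi> m)) = L j v * (\<Prod>m\<in>{..<k}-{j}. L m (vs ! \<pi> m))" for v
 proof -
  have "(\<Prod>m<k. L m (vs[i := v] ! \<pi> m))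
   = L j (vs[i := v] ! \<pi> j) * (\<Prod>m\<in>{..<k}-{j}. L m (vs[i := v] ! \<pi> m))"
   using j by (intro prod.remove) auto
  also have "(\<Prod>m\<in>{..<k}-{j}. L m (vs[i := v] ! \<pi> m)) = (\<Prod>m\<in>{..<k}-{j}. L m (vs ! \<pi> m))"
  proof (rule prod.cong[OF refl])
   fix m assume "m : {..<k} - {j}"
   hence "\<pi> m ~= i" using j inj by (auto dest: inj_onD)
   thus "L m (vs[i := v] ! \<pi> m) = L m (vs ! \<pi> m)" by simp
  qed
  finally show ?thesis using j vs by simp
 qed
 thus "linear (%v. if length (vs[i := v]) = k then \<Prod>m<k. L m (vs[i := v] ! \<pi> m) else 0)"
  using vs by (simp, intro linearI) (simp_all add: linear_add[OF L] linear_scale[OF L] algebra_simps)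
qed simp

lemma prod_lessThan_add: "(\<Prod>m<p + q. f m) = (\<Prod>m<p. f m) * (\<Prod>s<q. f (p + s :: nat))"
 for f :: "nat => 'c::comm_monoid_mult" by (induction q) (simp_all add: mult.assoc)

lemma slot_linear_dz_form:
 fixes I J :: "'n::finite list"
 shows "slot_linear (length I + length J) (dz_form I J)"
proof -
 let ?k = "length I + length J"
 define L where "L m v = (if m < length I then v $ (I ! m) else cnj (v $ (J ! (m - length I))))" for m and v :: "complex^'n"
 have L: "linear (L m)" for m by (intro linearI) (auto simp: L_def)
 have "dz_form I J = (%vs. \<Sum>\<pi> | \<pi> permutes {..<?k}. of_int (sign \<pi>) *
   (if length vs = ?k then \<Prod>m<?k. L m (vs ! \<pi> m) else 0))"
  by (auto simp: fun_eq_iff dz_form_def prod_lessThan_add L_def mult.assoc intro!: sum.cong)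
 thus ?thesis using slot_linear_prod[OF L] by (simp only:) (intro slot_linear_sum, auto)
qed

definition pq_index :: "nat => nat => ('n::finite list \<times> 'n list) set" where
 "pq_index p q = {I. length I = p} \<times> {J. length J = q}"

lemma finite_length_eq: "finite {I :: 'n::finite list. length I = p}"
 using finite_lists_length_eq[of "UNIV :: 'n set" p] by simp

lemma finite_pq_index: "finite (pq_index p q)" by (simp add: pq_index_def finite_length_eq)

lemma pq_forms_iff:
 "\<omega> : pq_forms p q \<longleftrightarrow> (EX a. \<omega> = (%vs. SUM i:pq_index p q. a i * dz_form (fst i) (snd i) vs))"
proof
 assume "\<omega> : pq_forms p q"
 then obtain a where "\<omega> = (%vs. \<Sum>I | length I = p. \<Sum>J | length J = q. a I J * dz_form I J vs)"
  unfolding pq_forms_def by blast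
 thus "EX a. \<omega> = (%vs. SUM i:pq_index p q. a i * dz_form (fst i) (snd i) vs)"
  by (intro exI[of _ "%i. a (fst i) (snd i)"])
   (simp add: pq_index_def sum.cartesian_product case_prod_beta)
next
 assume "EX a. \<omega> = (%vs. SUM i:pq_index p q. a i * dz_form (fst i) (snd i) vs)"
 then obtain a where "\<omega> = (%vs. SUM i:pq_index p q. a i * dz_form (fst i) (snd i) vs)" by blast
 thus "\<omega> : pq_forms p q" unfolding pq_forms_def by (intro CollectI exI[of _ "%I J. a (I, J)"])
   (simp add: pq_index_def sum.cartesian_product case_prod_beta)
qed

lemma mlin_pq: "\<omega> : pq_forms p q ==> mlin (p + q) \<omega>" unfolding pq_forms_iff
 by (auto intro!: slot_linear_mlin slot_linear_sum simp: pq_index_def)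
  (use slot_linear_dz_form in blast)

lemma pq_forms_diff: "\<omega> : pq_forms p q ==> \<eta> : pq_forms p q ==> (%vs. \<omega> vs - \<eta> vs) : pq_forms p q"
 unfolding pq_forms_iff
proof (elim exE)
 fix a b
 assume "\<omega> = (%vs. SUM i:pq_index p q. a i * dz_form (fst i) (snd i) vs)"
  "\<eta> = (%vs. SUM i:pq_index p q. b i * dz_form (fst i) (snd i) vs)"
 thus "EX a. (%vs. \<omega> vs - \<eta> vs) = (%vs. SUM i:pq_index p q. a i * dz_form (fst i) (snd i) vs)"
  by (intro exI[of _ "%i. a i - b i"]) (simp add: sum_subtractf algebra_simps)
qed

lemma pq_forms_zero: "(%vs. 0) : pq_forms p q" unfolding pq_forms_iff by (intro exI[of _ "%_. 0"]) simp

text \<open>Induction on T. If g t depends on the other functions it is dropped. Otherwise its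
  coefficients are bounded, because dividing by an unbounded sequence of them would exhibit g t as a
  limit from the span of the others; along a convergent subsequence the part of g t splits off. The
  functions may be linearly dependent, as the \<open>dz_form\<close> for arbitrary multi-indices
  are.\<close>

lemma pointwise_limit_span:
 fixes g :: "'i => 'b => complex" and f :: "nat => 'b => complex"
 assumes "finite T" "!!n. EX a. f n = (%x. SUM i:T. a i * g i x)" "!!x. (%n. f n x) \<longlonglongrightarrow> F x"
 shows "EX a. F = (%x. SUM i:T. a i * g i x)" using assms
proof (induction T arbitrary: f F rule: finite_induct)
 case empty
 hence "f n x = 0" for n x by simp
 hence "F x = 0" for x using empty(2)[of x] by (simp add: LIMSEQ_const_iff)
 thus ?case by auto
next
 case (insert t T)
 have "EX a. ALL x. f n x = (SUM i:insert t T. a i * g i x)" for n using insert.prems(1)[of n] by auto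
 then obtain a where a: "!!n x. f n x = (SUM i:insert t T. a n i * g i x)" by metis
 define c where "c n = a n t" for n
 define v where "v n x = (SUM i:T. a n i * g i x)" for n x
 have fv: "f n x = c n * g t x + v n x" for n x using insert.hyps by (simp add: a c_def v_def)
 have vspan: "EX b. (%x. s * v n x) = (%x. SUM i:T. b i * g i x)" for n s
  by (intro exI[of _ "%i. s * a n i"]) (simp add: v_def sum_distrib_left mult.assoc)
 show ?case
 proof (cases "EX b. g t = (%x. SUM i:T. b i * g i x)")
  case True
  then obtain b where b: "!!x. g t x = (SUM i:T. b i * g i x)" by metis
  have "EX a. F = (%x. SUM i:T. a i * g i x)"
  proof (rule insert.IH)
   show "EX a. f n = (%x. SUM i:T. a i * g i x)" for n by (intro exI[of _ "%i. c n * b i + a n i"])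
     (auto simp: fv b v_def fun_eq_iff sum.distrib algebra_simps sum_distrib_left)
  qed (rule insert.prems(2))
  then obtain a where "F = (%x. SUM i:T. a i * g i x)" by blast
  thus ?thesis using insert.hyps
   by (intro exI[of _ "%i. if i = t then 0 else a i"]) (auto simp: fun_eq_iff intro!: sum.cong)
 next
  case False
  have "Bseq c"
  proof (rule ccontr)
   assume "\<not> Bseq c"
   hence "EX m. cmod (c m) > real n + 1" for n unfolding Bseq_def not_ex de_Morgan_conj not_all not_le
    by (metis add_nonneg_pos of_nat_0_le_iff zero_less_one)
   then obtain r where r: "!!n. cmod (c (r n)) > real n + 1" by metis
   have cne: "c (r n) ~= 0" for n using r[of n] by auto
   \<comment> \<open>The values of f converge, hence are bounded, and vanish after division by
     coefficients that tend to infinity.\<close>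
   have lim: "(%n. (- inverse (c (r n))) * v (r n) x) \<longlonglongrightarrow> g t x" for x
   proof -
    have "Bseq (%n. f n x)" using insert.prems(2)[of x] by (intro convergent_imp_Bseq convergentI)
    then obtain M where M: "M > 0" "!!n. cmod (f n x) <= M" by (elim BseqE) blast
    have "(%n. f (r n) x * inverse (c (r n))) \<longlonglongrightarrow> 0"
    proof (rule Lim_null_comparison)
     show "\<forall>\<^sub>F n in sequentially. norm (f (r n) x * inverse (c (r n))) <= M * inverse (real (Suc n))"
     proof (rule always_eventually, rule allI)
      fix n
      have "inverse (cmod (c (r n))) <= inverse (real (Suc n))" using r[of n] by (intro le_imp_inverse_le) auto
      thus "norm (f (r n) x * inverse (c (r n))) <= M * inverse (real (Suc n))"
       using M by (simp add: norm_mult norm_inverse mult_mono)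
     qed
     show "(%n. M * inverse (real (Suc n))) \<longlonglongrightarrow> 0"
      using tendsto_mult_left[OF LIMSEQ_inverse_real_of_nat, of M] by simp
    qed
    hence "(%n. g t x - f (r n) x * inverse (c (r n))) \<longlonglongrightarrow> g t x - 0"
     by (intro tendsto_diff tendsto_const)
    moreover have "g t x - f (r n) x * inverse (c (r n)) = (- inverse (c (r n))) * v (r n) x" for n
     using cne[of n] by (simp add: fv field_simps)
    ultimately show ?thesis by simp
   qed
   have "EX b. g t = (%x. SUM i:T. b i * g i x)"
    by (rule insert.IH[of "%n x. (- inverse (c (r n))) * v (r n) x"]) (rule vspan, rule lim)
   thus False using False by blast
  qed
  hence "bounded (range c)" by (simp add: Bseq_eq_bounded)
  then obtain l r where r: "strict_mono (r :: nat => nat)" "(c o r) \<longlonglongrightarrow> l"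
   using bounded_imp_convergent_subsequence by blast
  have L1: "(%n. v (r n) x) \<longlonglongrightarrow> F x - l * g t x" for x
  proof -
   have "(%n. f (r n) x - c (r n) * g t x) \<longlonglongrightarrow> F x - l * g t x"
   proof (intro tendsto_diff tendsto_mult tendsto_const)
    show "(%n. f (r n) x) \<longlonglongrightarrow> F x"
     using LIMSEQ_subseq_LIMSEQ[OF insert.prems(2)[of x] r(1)] by (simp only: o_def)
    show "(%n. c (r n)) \<longlonglongrightarrow> l" using r(2) by (simp only: o_def)
   qed
   thus ?thesis by (simp add: fv)
  qed
  have L2: "EX b. v (r n) = (%x. SUM i:T. b i * g i x)" for n using vspan[of 1 "r n"] by simp
  have "EX b. (%x. F x - l * g t x) = (%x. SUM i:T. b i * g i x)" by (rule insert.IH[OF L2 L1])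
  then obtain b where b: "!!x. F x - l * g t x = (SUM i:T. b i * g i x)" by metis
  have "F x = (SUM i:insert t T. (if i = t then l else b i) * g i x)" for x
  proof -
   have "(SUM i:T. (if i = t then l else b i) * g i x) = (SUM i:T. b i * g i x)"
    using insert.hyps by (intro sum.cong) auto
   thus ?thesis using b[of x] insert.hyps by (simp add: algebra_simps)
  qed
  thus ?thesis by (intro exI[of _ "%i. if i = t then l else b i"]) auto
 qed
qed

lemma pq_forms_limit:
 assumes "!!n. \<omega> n : pq_forms p q" "!!vs. (%n. \<omega> n vs) \<longlonglongrightarrow> \<eta> vs"
 shows "\<eta> : pq_forms p q" unfolding pq_forms_iff
 by (rule pointwise_limit_span[OF finite_pq_index _ assms(2)]) (use assms(1) pq_forms_iff in blast)

section \<open>Sums of squares of a multilinear form over a frame\<close>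

definition frame_sum :: "'v set => nat => ('v list => complex) => real" where
 "frame_sum B k \<omega> = (\<Sum>vs | set vs <= B & length vs = k. (cmod (\<omega> vs))\<^sup>2)"

lemma frame_sum_0: "frame_sum B 0 \<omega> = (cmod (\<omega> []))\<^sup>2"
proof -
 have "{vs. set vs <= B & length vs = 0} = {[]}" by auto
 thus ?thesis by (simp add: frame_sum_def)
qed

lemma lists_Suc_image: "{vs. set vs <= B & length vs = Suc k} = (%(v, vs). v # vs) ` (B \<times> {vs. set vs <= B & length vs = k})"
 by (auto simp: length_Suc_conv image_iff)

lemma frame_sum_Suc: "finite B ==> frame_sum B (Suc k) \<omega> = (SUM v:B. frame_sum B k (%vs. \<omega> (v # vs)))"
 unfolding frame_sum_def lists_Suc_image
 by (subst sum.reindex) (auto simp: inj_on_def sum.cartesian_product case_prod_beta)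

lemma frame_sum_nonneg: "0 <= frame_sum B k \<omega>" by (simp add: frame_sum_def sum_nonneg)

text \<open>Peeling off one argument reduces the inequality to the one for linear functionals, with
  one factor C per argument. With C = 1 it yields independence of the frame, in general the
  comparison with the coordinate basis.\<close>

lemma frame_sum_compare:
 fixes \<omega> :: "'v::real_vector list => complex"
 assumes fin: "finite B" "finite B'" and C: "C >= 0"
  and le: "!!l :: 'v => complex. linear l ==> (SUM v:B. (cmod (l v))\<^sup>2) <= C * (SUM v:B'. (cmod (l v))\<^sup>2)"
 shows "mlin k \<omega> ==> frame_sum B k \<omega> <= C ^ k * frame_sum B' k \<omega>"
proof (induction k arbitrary: \<omega>)
 case 0
 thus ?case by (simp add: frame_sum_0)
next
 case (Suc k)
 let ?L = "{vs. set vs <= B' & length vs = k}"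
 have fL: "finite ?L" using finite_lists_length_eq[OF fin(2)] .
 have "frame_sum B (Suc k) \<omega> <= (SUM v:B. C ^ k * frame_sum B' k (%vs. \<omega> (v # vs)))"
  unfolding frame_sum_Suc[OF fin(1)] using Suc by (intro sum_mono) auto
 also have "... = C ^ k * (SUM vs:?L. SUM v:B. (cmod (\<omega> (v # vs)))\<^sup>2)"
  unfolding frame_sum_def sum_distrib_left[symmetric] by (subst sum.swap) simp
 also have "... <= C ^ k * (SUM vs:?L. C * (SUM v:B'. (cmod (\<omega> (v # vs)))\<^sup>2))"
  using Suc.prems C by (intro mult_left_mono sum_mono le) auto
 also have "... = C ^ Suc k * (SUM v:B'. frame_sum B' k (%vs. \<omega> (v # vs)))"
  unfolding frame_sum_def sum_distrib_left[symmetric] by (subst sum.swap) simp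
 finally show ?case by (simp add: frame_sum_Suc[OF fin(2)])
qed

lemma frame_sum_map: "inj_on T B ==> frame_sum (T ` B) k \<omega> = frame_sum B k (%vs. \<omega> (map T vs))"
proof -
 assume inj: "inj_on T B"
 have "{vs. set vs <= T ` B & length vs = k} = map T ` {vs. set vs <= B & length vs = k}"
 proof (intro equalityI subsetI)
  fix vs assume vs: "vs : {vs. set vs <= T ` B & length vs = k}"
  hence "vs : map T ` lists B" by (auto simp: lists_image[symmetric])
  thus "vs : map T ` {vs. set vs <= B & length vs = k}" using vs by auto
 qed (auto simp: subset_iff)
 moreover have "inj_on (map T) {vs. set vs <= B & length vs = k}"
  using inj_on_map_lists[OF inj] by (rule inj_on_subset) auto
 ultimately show ?thesis by (simp add: frame_sum_def sum.reindex)
qed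

section \<open>Orthonormal frames of a real inner product\<close>

definition is_inner :: "('v::euclidean_space => 'v => real) => bool" where
 "is_inner g \<longleftrightarrow> (ALL v. linear (%u. g u v)) & (ALL u v. g u v = g v u) & (ALL u. u ~= 0 --> 0 < g u u)"

definition on_frame :: "('v::euclidean_space => 'v => real) => 'v set => bool" where
 "on_frame g B \<longleftrightarrow> (ALL u:B. ALL v:B. g u v = (if u = v then 1 else 0)) & span B = UNIV"

lemma is_innerD:
 assumes "is_inner g"
 shows "linear (%u. g u v)" "linear (%u. g v u)" "g u v = g v u" "u ~= 0 ==> 0 < g u u"
proof -
 show 1: "linear (%u. g u v)" and 2: "g u v = g v u" and "u ~= 0 ==> 0 < g u u" for u v
  using assms by (auto simp: is_inner_def)
 have "(%u. g v u) = (%u. g u v)" using 2 by blast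
 thus "linear (%u. g v u)" using 1[of v] by simp
qed

lemma is_inner_nonneg: "is_inner g ==> 0 <= g u u"
 using is_innerD(4)[of g u] linear_0[OF is_innerD(1)[of g u]] by (cases "u = 0") auto

lemma orthonormal_independent:
 assumes g: "is_inner g" and o: "!!u v. u : B ==> v : B ==> g u v = (if u = v then 1 else 0)"
 shows "independent B"
proof
 assume "dependent B"
 then obtain t c v where t: "finite t" "t <= B" "(SUM u:t. c u *R u) = 0" "v : t" "c v ~= 0"
  unfolding dependent_explicit by blast
 have "0 = g (SUM u:t. c u *R u) v" using t(3) linear_0[OF is_innerD(1)[OF g]] by simp
 also have "... = (SUM u:t. c u * g u v)"
  by (simp add: linear_sum[OF is_innerD(1)[OF g]] linear_scale[OF is_innerD(1)[OF g]])
 also have "... = (SUM u:t. if u = v then c v else 0)"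
  using t(5) o[OF subsetD[OF t(2)] subsetD[OF t(2) t(4)]] by (intro sum.cong) auto
 also have "... = c v" using t by simp
 finally show False using t by simp
qed

lemma on_frame_finite: "is_inner g ==> on_frame g B ==> finite B & card B <= DIM('v)"
 for B :: "'v::euclidean_space set"
 using orthonormal_independent[of g B] independent_bound[of B] by (auto simp: on_frame_def)

lemma on_frame_expand:
 assumes g: "is_inner g" and B: "on_frame g B"
 shows "x = (SUM u:B. g x u *R u)"
proof -
 have fin: "finite B" using on_frame_finite[OF assms] by simp
 define y where "y = x - (SUM u:B. g x u *R u)"
 have "g y v = 0" if "v : B" for v
 proof -
  have "g (SUM u:B. g x u *R u) v = (SUM u:B. g x u * g u v)"
   by (simp add: linear_sum[OF is_innerD(1)[OF g]] linear_scale[OF is_innerD(1)[OF g]])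
  also have "... = (SUM u:B. if u = v then g x v else 0)" using B that by (intro sum.cong) (auto simp: on_frame_def)
  also have "... = g x v" using that fin by simp
  finally show ?thesis by (simp add: y_def linear_diff[OF is_innerD(1)[OF g]])
 qed
 moreover have "subspace {v. g y v = 0}"
  using is_innerD(2)[OF g, of y] by (auto simp: subspace_def linear_0 linear_add linear_scale)
 ultimately have "span B <= {v. g y v = 0}" by (intro span_minimal) auto
 hence "g y y = 0" using B by (auto simp: on_frame_def)
 hence "y = 0" using is_innerD(4)[OF g, of y] by force
 thus ?thesis by (simp add: y_def)
qed

lemma on_frame_norm:
 assumes g: "is_inner g" and B: "on_frame g B"
 shows "(SUM u:B. (g x u)\<^sup>2) = g x x"
proof -
 have "g x x = g x (SUM u:B. g x u *R u)" using on_frame_expand[OF assms, of x] by simp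
 also have "... = (SUM u:B. g x u * g x u)"
  by (simp add: linear_sum[OF is_innerD(2)[OF g]] linear_scale[OF is_innerD(2)[OF g]])
 finally show ?thesis by (simp add: power2_eq_square)
qed

text \<open>A real functional is represented by some w, and for both frames the sum is g w w; the
  complex case adds real and imaginary parts.\<close>

lemma on_frame_parseval:
 fixes l :: "'v::euclidean_space => complex"
 assumes g: "is_inner g" and B: "on_frame g B" "on_frame g B'" and l: "linear l"
 shows "(SUM v:B. (cmod (l v))\<^sup>2) = (SUM v:B'. (cmod (l v))\<^sup>2)"
proof -
 have real: "(SUM v:B. (r v)\<^sup>2) = (SUM v:B'. (r v)\<^sup>2)" if r: "linear r" for r :: "'v => real"
 proof -
  define w where "w = (SUM u:B. r u *R u)"
  have gw: "g w v = r v" for v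
  proof -
   have "g w v = (SUM u:B. r u * g u v)"
    unfolding w_def by (simp add: linear_sum[OF is_innerD(1)[OF g]] linear_scale[OF is_innerD(1)[OF g]])
   also have "... = (SUM u:B. r u * g v u)" by (rule sum.cong[OF refl], metis is_innerD(3)[OF g])
   also have "... = r (SUM u:B. g v u *R u)" by (simp add: linear_sum[OF r] linear_scale[OF r] mult.commute)
   finally show ?thesis using on_frame_expand[OF g B(1), of v] by simp
  qed
  show ?thesis using on_frame_norm[OF g B(1), of w] on_frame_norm[OF g B(2), of w] by (simp add: gw)
 qed
 have "linear (%v. Re (l v))" "linear (%v. Im (l v))" using l by (auto intro!: linearI simp: linear_add linear_scale)
 from this[THEN real] show ?thesis by (simp add: cmod_power2 sum.distrib)
qed

lemma cmod_sum_cauchy: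
 "(cmod (SUM i:I. a i *R z i))\<^sup>2 <= (SUM i:I. (a i)\<^sup>2) * (SUM i:I. (cmod (z i))\<^sup>2)"
proof -
 have "cmod (SUM i:I. a i *R z i) <= (SUM i:I. \<bar>a i\<bar> * cmod (z i))" by (rule order_trans[OF norm_sum]) simp
 hence "(cmod (SUM i:I. a i *R z i))\<^sup>2 <= (SUM i:I. \<bar>a i\<bar> * cmod (z i))\<^sup>2"
  by (intro power_mono) auto
 also have "... <= (SUM i:I. \<bar>a i\<bar>\<^sup>2) * (SUM i:I. (cmod (z i))\<^sup>2)" by (rule Cauchy_Schwarz_ineq_sum)
 finally show ?thesis by simp
qed

text \<open>Expand v in the frame and apply Cauchy-Schwarz; the squared coefficients add up to g v
  v. V is arbitrary so that it can be the coordinate basis or the set of arguments of a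
  form.\<close>

lemma on_frame_dominates:
 fixes l :: "'v::euclidean_space => complex"
 assumes g: "is_inner g" and B: "on_frame g B" and l: "linear l" and V: "finite V"
 shows "(SUM v:V. (cmod (l v))\<^sup>2) <= (SUM v:V. g v v) * (SUM v:B. (cmod (l v))\<^sup>2)"
proof -
 have "(cmod (l v))\<^sup>2 <= g v v * (SUM v:B. (cmod (l v))\<^sup>2)" for v
 proof -
  have "l v = (SUM u:B. g v u *R l u)"
   using arg_cong[OF on_frame_expand[OF g B, of v], of l] by (simp add: linear_sum[OF l] linear_scale[OF l])
  thus ?thesis using cmod_sum_cauchy[of "g v" l B] on_frame_norm[OF g B, of v] by simp
 qed
 thus ?thesis by (simp add: sum_distrib_right sum_mono)
qed

lemma frame_dominated_basis:
 fixes l :: "'v::euclidean_space => complex"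
 assumes l: "linear l" and V: "finite V"
 shows "(SUM v:V. (cmod (l v))\<^sup>2) <= (SUM v:V. (norm v)\<^sup>2) * (SUM v:Basis. (cmod (l v))\<^sup>2)"
proof -
 have g: "is_inner (inner :: 'v => _)"
  unfolding is_inner_def using inner_commute bounded_linear.linear[OF bounded_linear_inner_left]
  by (auto simp: inner_gt_zero_iff)
 have B: "on_frame (inner :: 'v => _) Basis" by (simp add: on_frame_def inner_Basis)
 show ?thesis using on_frame_dominates[OF g B l V] by (simp add: power2_norm_eq_inner)
qed

text \<open>\<open>form_norm\<close> selects a frame at each point by choice, with no regularity.
  Gram-Schmidt applied to a constant basis gives frames that vary continuously with z. The vector y
  never vanishes because b lies outside the span of the other basis vectors, a condition independent
  of z.\<close>

lemma gram_schmidt_continuous: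
 fixes g :: "'z::topological_space => 'v::euclidean_space => 'v => real"
 assumes g: "!!z. z : W ==> is_inner (g z)" and cont: "!!u v. continuous_on W (%z. g z u v)"
  and "finite B" "independent B"
 shows "EX F. (ALL b:B. continuous_on W (F b)) &
  (ALL z:W. ALL b:B. F b z : span B & (ALL b':B. g z (F b z) (F b' z) = (if b = b' then 1 else 0)))" using assms(3,4)
proof (induction B rule: finite_induct)
 case empty
 show ?case by auto
next
 case (insert b B)
 have cg: "continuous_on W (%z. g z (F z) (H z))" if "continuous_on W F" "continuous_on W H" for F H :: "'z => 'v"
 proof -
  have "continuous_on W (%z. SUM i:Basis. SUM j:Basis. (F z \<bullet> i) * ((H z \<bullet> j) * g z i j))"
   by (intro continuous_intros cont that)
  moreover have "g z (F z) (H z) = (SUM i:Basis. SUM j:Basis. (F z \<bullet> i) * ((H z \<bullet> j) * g z i j))" if "z : W" for z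
   by (subst linear_expand[OF is_innerD(1)[OF g[OF that]]], subst linear_expand[OF is_innerD(2)[OF g[OF that]]])
    (simp add: sum_distrib_left)
  ultimately show ?thesis by (simp cong: continuous_on_cong)
 qed
 have indB: "independent B" "b ~: span B" using insert.prems insert.hyps by (auto simp: independent_insert)
 obtain F where F: "!!c. c : B ==> continuous_on W (F c)"
  "!!z c. z : W ==> c : B ==> F c z : span B"
  "!!z c c'. z : W ==> c : B ==> c' : B ==> g z (F c z) (F c' z) = (if c = c' then 1 else 0)"
  using insert.IH[OF indB(1)] by blast
 define y where "y z = b - (SUM c:B. g z b (F c z) *R F c z)" for z
 have ycont: "continuous_on W y" unfolding y_def by (intro continuous_intros cg F(1))
 have sp: "(SUM c:B. g z b (F c z) *R F c z) : span B" if "z : W" for z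
  using F(2)[OF that] by (intro span_sum span_scale)
 have y0: "y z ~= 0" if "z : W" for z using sp[OF that] indB(2) by (auto simp: y_def)
 have ypos: "0 < g z (y z) (y z)" if "z : W" for z using is_innerD(4)[OF g[OF that] y0[OF that]] .
 have yort: "g z (y z) (F c z) = 0" if "z : W" "c : B" for z c
 proof -
  note L = is_innerD(1)[OF g[OF that(1)]]
  have "g z (SUM c':B. g z b (F c' z) *R F c' z) (F c z) = (SUM c':B. g z b (F c' z) * g z (F c' z) (F c z))"
   by (simp add: linear_sum[OF L] linear_scale[OF L])
  also have "... = (SUM c':B. if c' = c then g z b (F c z) else 0)" using F(3) that by (intro sum.cong) auto
  also have "... = g z b (F c z)" using that insert.hyps by simp
  finally show ?thesis by (simp add: y_def linear_diff[OF L])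
 qed
 define G where "G c z = (if c = b then (1 / sqrt (g z (y z) (y z))) *R y z else F c z)" for c z
 have nb: "c ~= b" if "c : B" for c using that insert.hyps by auto
 show ?case
 proof (intro exI[of _ G] conjI ballI)
  fix c assume c: "c : insert b B"
  show "continuous_on W (G c)"
  proof (cases "c = b")
   case True
   have "continuous_on W (%z. (1 / sqrt (g z (y z) (y z))) *R y z)"
    using ypos by (intro continuous_intros ycont cg) (auto simp: less_imp_neq[symmetric] dest: less_imp_neq)
   thus ?thesis using True by (simp add: G_def)
  next
   case False
   thus ?thesis using c F(1) by (simp add: G_def[abs_def])
  qed
  fix z assume z: "z : W"
  have spb: "span B <= span (insert b B)" by (intro span_mono) auto
  have "y z : span (insert b B)" unfolding y_def using sp[OF z] spb by (intro span_diff) (auto intro: span_base)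
  thus "G c z : span (insert b B)" using c F(2)[OF z] spb by (auto simp: G_def intro: span_scale)
  note L = is_innerD(1)[OF g[OF z]] is_innerD(2)[OF g[OF z]]
  fix c' assume c': "c' : insert b B"
  have "g z (F c z) (y z) = 0" if "c : B" for c using yort[OF z that] is_innerD(3)[OF g[OF z]] by metis
  moreover have "sqrt (g z (y z) (y z)) * sqrt (g z (y z) (y z)) = g z (y z) (y z)" using ypos[OF z] by simp
  ultimately show "g z (G c z) (G c' z) = (if c = c' then 1 else 0)" using c c' yort[OF z] F(3)[OF z] nb ypos[OF z]
   by (auto simp: G_def linear_scale[OF L(1)] linear_scale[OF L(2)] field_simps)
 qed
qed

lemma continuous_on_frame:
 fixes g :: "'z::topological_space => 'v::euclidean_space => 'v => real"
 assumes g: "!!z. z : W ==> is_inner (g z)" and cont: "!!u v. continuous_on W (%z. g z u v)"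
 obtains F where "!!b. b : (Basis :: 'v set) ==> continuous_on W (F b)"
  "!!z. z : W ==> on_frame (g z) ((%b. F b z) ` Basis)" "!!z. z : W ==> inj_on (%b. F b z) Basis"
proof -
 obtain F where F: "!!b. b : (Basis :: 'v set) ==> continuous_on W (F b)"
  "!!z b b'. z : W ==> b : Basis ==> b' : Basis ==> g z (F b z) (F b' z) = (if b = b' then 1 else 0)"
 proof -
  have "EX F. (ALL b:(Basis :: 'v set). continuous_on W (F b)) &
   (ALL z:W. ALL b:Basis. F b z : span Basis & (ALL b':Basis. g z (F b z) (F b' z) = (if b = b' then 1 else 0)))"
   by (rule gram_schmidt_continuous[OF _ _ finite_Basis independent_Basis]) (fact g, fact cont)
  thus ?thesis using that by blast
 qed
 have inj: "inj_on (%b. F b z) Basis" if "z : W" for z using F(2)[OF that] by (intro inj_onI) (metis zero_neq_one)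
 have o: "g z u v = (if u = v then 1 else 0)" if "z : W" "u : (%b. F b z) ` Basis" "v : (%b. F b z) ` Basis" for z u v
  using that F(2)[OF that(1)] inj[OF that(1)] by (auto simp: inj_on_eq_iff)
 have "span ((%b. F b z) ` Basis) = UNIV" if z: "z : W" for z
 proof -
  have "independent ((%b. F b z) ` Basis)" using orthonormal_independent[OF g[OF z] o[OF z]] .
  moreover have "card ((%b. F b z) ` Basis) = dim (UNIV :: 'v set)" using card_image[OF inj[OF z]] by simp
  ultimately show ?thesis using card_ge_dim_independent[of "(%b. F b z) ` Basis" UNIV] by auto
 qed
 thus ?thesis using that[OF F(1) _ inj] o by (simp add: on_frame_def)
qed

lemma on_frame_exists: "is_inner g ==> EX B. on_frame g B"
 using continuous_on_frame[of "UNIV :: real set" "%_. g"] by (metis UNIV_I continuous_on_const)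

text \<open>Expanding the first moving argument in the constant basis leaves measurable scalars and
  a form of lower degree.\<close>

lemma measurable_mlin_map:
 fixes \<omega> :: "'x => 'v::euclidean_space list => complex"
 assumes "!!x. x : space M ==> mlin (length Fs) (\<omega> x)" "!!us. (%x. \<omega> x us) : borel_measurable M"
  "!!F. F : set Fs ==> F : borel_measurable M"
 shows "(%x. \<omega> x (map (%F. F x) Fs)) : borel_measurable M" using assms
proof (induction Fs arbitrary: \<omega>)
 case Nil
 thus ?case by simp
next
 case (Cons F Fs)
 have [measurable]: "F : borel_measurable M" using Cons.prems by simp
 have [measurable]: "(%x. \<omega> x (i # map (%F. F x) Fs)) : borel_measurable M" for i
  using Cons.prems by (intro Cons.IH[of "%x us. \<omega> x (i # us)"]) auto
 have "(%x. SUM i:Basis. (F x \<bullet> i) *R \<omega> x (i # map (%F. F x) Fs)) : borel_measurable M" by measurable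
 moreover have "\<omega> x (map (%F. F x) (F # Fs)) = (SUM i:Basis. (F x \<bullet> i) *R \<omega> x (i # map (%F. F x) Fs))"
  if "x : space M" for x
 proof -
  have "linear (%v. \<omega> x (v # map (%F. F x) Fs))" using Cons.prems(1)[OF that] by simp
  from linear_expand[OF this, of "F x"] show ?thesis by simp
 qed
 ultimately show ?case by (simp cong: measurable_cong)
qed

lemma mlin_map_linear: "linear T ==> mlin k \<omega> ==> mlin k (%us. \<omega> (map T us))"
proof (induction k arbitrary: \<omega>)
 case (Suc k)
 have "linear (%v. \<omega> (T v # map T vs))" for vs
  using Suc.prems linear_compose[OF Suc.prems(1), of "%v. \<omega> (v # map T vs)"] by (simp add: o_def)
 moreover have "mlin k (%vs. \<omega> (T v # map T vs))" for v
  using Suc.IH[of "%vs. \<omega> (T v # vs)"] Suc.prems by simp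
 ultimately show ?case using Suc.prems by simp
qed simp

section \<open>Pointwise norms of forms on the manifold\<close>

context herm_mfd
begin

abbreviation hmet :: "'a => complex^'n => complex^'n => real" where
 "hmet p u v \<equiv> Re (h p u v)"

lemma is_inner_gmet: "c : A ==> z : img c ==> is_inner (gmet c z)"
 unfolding is_inner_def using linear_gmet_left gmet_props(3,4) by blast

lemma gmet_chart_vec_of:
 "c : A ==> p : fst c ==> gmet c (snd c p) u v = hmet p (vec_of A c p u) (vec_of A c p v)"
 by (simp add: coord_metric_def)

lemma is_inner_hmet: "is_inner (hmet p)"
proof -
 let ?c = "chart_at A p"
 have "hmet p = gmet ?c (snd ?c p)"
  using gmet_chart_vec_of[OF chart_at] by (simp add: fun_eq_iff vec_of_def chart_change_same chart_at)
 thus ?thesis using is_inner_gmet[OF chart_at(1), of "snd ?c p" p] chart_at(2) by simp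
qed

lemma orthonormal_frame_eq: "orthonormal_frame h p B \<longleftrightarrow> on_frame (hmet p) B"
 by (simp add: orthonormal_frame_def on_frame_def)

definition the_frame :: "'a => (complex^'n) set" where
 "the_frame p = (SOME B. orthonormal_frame h p B)"

lemma the_frame: "on_frame (hmet p) (the_frame p)"
proof -
 have "EX B. orthonormal_frame h p B" using on_frame_exists[OF is_inner_hmet] by (simp add: orthonormal_frame_eq)
 thus ?thesis unfolding the_frame_def orthonormal_frame_eq[symmetric] by (rule someI_ex)
qed

lemma finite_the_frame: "finite (the_frame p)" using on_frame_finite[OF is_inner_hmet the_frame] by blast

definition fnorm2 :: "nat => 'a => 'n form => real" where
 "fnorm2 k p \<omega> = (form_norm h k p \<omega>)\<^sup>2"

lemma fnorm2_eq: "fnorm2 k p \<omega> = frame_sum (the_frame p) k \<omega> / fact k"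
 unfolding fnorm2_def form_norm_def the_frame_def[symmetric] Let_def frame_sum_def by (simp add: sum_nonneg)

lemma fnorm2_nonneg: "0 <= fnorm2 k p \<omega>" by (simp add: fnorm2_def)

text \<open>The comparison with constant 1, supplied by Parseval, is used in both directions. Only
  multilinearity is assumed, which covers pull-backs.\<close>

lemma fnorm2_frame:
 assumes "mlin k \<omega>" "on_frame (hmet p) B"
 shows "fnorm2 k p \<omega> = frame_sum B k \<omega> / fact k"
proof -
 have le: "frame_sum B k \<omega> <= frame_sum B' k \<omega>" if "on_frame (hmet p) B" "on_frame (hmet p) B'" for B B'
  using frame_sum_compare[of B B' 1 k \<omega>] on_frame_parseval[OF is_inner_hmet that]
   on_frame_finite[OF is_inner_hmet] that assms(1) by auto
 show ?thesis unfolding fnorm2_eq using le[OF the_frame assms(2)] le[OF assms(2) the_frame] by simp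
qed

lemma on_frame_vec_of:
 assumes c: "c : A" "p : fst c" and B: "on_frame (gmet c (snd c p)) B"
 shows "on_frame (hmet p) (vec_of A c p ` B)" "inj_on (vec_of A c p) B"
proof -
 show inj: "inj_on (vec_of A c p) B" by (metis c comps_vec_of inj_on_inverseI)
 have "span (vec_of A c p ` B) = vec_of A c p ` span B" by (rule linear_span_image[OF linear_vec_of[OF c]])
 also have "... = UNIV" using B vec_of_comps[OF c] unfolding on_frame_def by (metis surjI)
 finally show "on_frame (hmet p) (vec_of A c p ` B)"
  using B inj unfolding on_frame_def by (auto simp: gmet_chart_vec_of[OF c, symmetric] inj_on_eq_iff)
qed

definition cform :: "('a, 'n) chart => 'a => 'n form => 'n form" where
 "cform c p \<omega> us = \<omega> (map (vec_of A c p) us)"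

lemma mlin_cform: "c : A ==> p : fst c ==> mlin k \<omega> ==> mlin k (cform c p \<omega>)"
 unfolding cform_def[abs_def] by (intro mlin_map_linear linear_vec_of)

lemma fnorm2_chart_frame:
 assumes "c : A" "p : fst c" "mlin k \<omega>" "on_frame (gmet c (snd c p)) B"
 shows "fnorm2 k p \<omega> = frame_sum B k (cform c p \<omega>) / fact k"
 unfolding fnorm2_frame[OF assms(3) on_frame_vec_of(1)[OF assms(1,2,4)]]
  frame_sum_map[OF on_frame_vec_of(2)[OF assms(1,2,4)]] cform_def ..

text \<open>A frame has at most \<open>DIM(complex^'n)\<close> vectors, each of squared coordinate
  norm at most K; likewise for the coordinate basis measured by the metric. Hence one factor D per
  argument.\<close>

lemma fnorm2_coord_bounds:
 assumes c: "c : A" "p : fst c" and m: "mlin k \<omega>"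
  and K: "K > 0" "!!u. gmet c (snd c p) u u <= K * (norm u)\<^sup>2" "!!u. (norm u)\<^sup>2 <= K * gmet c (snd c p) u u"
 defines "D \<equiv> real (DIM(complex^'n)) * K"
 shows "fnorm2 k p \<omega> <= D ^ k * frame_sum Basis k (cform c p \<omega>)"
  and "frame_sum Basis k (cform c p \<omega>) <= D ^ k * fact k * fnorm2 k p \<omega>"
proof -
 let ?g = "gmet c (snd c p)"
 have g: "is_inner ?g" using is_inner_gmet c by simp
 obtain B where B: "on_frame ?g B" using on_frame_exists[OF g] by blast
 have fin: "finite B" "card B <= DIM(complex^'n)" using on_frame_finite[OF g B] by auto
 note mc = mlin_cform[OF c m]
 have D: "D >= 0" using K(1) by (simp add: D_def)
 have "(SUM v:B. (norm v)\<^sup>2) <= (SUM v:B. K)"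
  using B K(3) by (intro sum_mono) (metis mult.right_neutral on_frame_def)
 also have "... <= D" using fin K(1) by (simp add: D_def mult_right_mono)
 finally have "frame_sum B k (cform c p \<omega>) <= D ^ k * frame_sum Basis k (cform c p \<omega>)"
  using frame_dominated_basis[OF _ fin(1)] by (intro frame_sum_compare[OF fin(1) finite_Basis D _ mc])
   (meson mult_right_mono order_trans sum_nonneg zero_le_power2)
 moreover have "frame_sum B k (cform c p \<omega>) / fact k <= frame_sum B k (cform c p \<omega>)"
  using frac_le[of "frame_sum B k (cform c p \<omega>)" "frame_sum B k (cform c p \<omega>)" 1 "fact k"] frame_sum_nonneg[of B k]
  by simp
 ultimately show "fnorm2 k p \<omega> <= D ^ k * frame_sum Basis k (cform c p \<omega>)"
  unfolding fnorm2_chart_frame[OF c m B] by linarith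
 have "(SUM v:Basis. ?g v v) <= (SUM v:(Basis :: (complex^'n) set). K)"
  using K(2) by (intro sum_mono) (metis mult.right_neutral norm_Basis one_power2)
 also have "... = D" by (simp add: D_def)
 finally have "frame_sum Basis k (cform c p \<omega>) <= D ^ k * frame_sum B k (cform c p \<omega>)"
  using on_frame_dominates[OF g B _ finite_Basis] by (intro frame_sum_compare[OF finite_Basis fin(1) D _ mc])
   (meson mult_right_mono order_trans sum_nonneg zero_le_power2)
 thus "frame_sum Basis k (cform c p \<omega>) <= D ^ k * fact k * fnorm2 k p \<omega>"
  unfolding fnorm2_chart_frame[OF c m B] by simp
qed

text \<open>The sum of squares over the finite set of arguments is dominated by the sum over the
  frame.\<close>

lemma fnorm2_zero:
 assumes "mlin k \<omega>" "fnorm2 k p \<omega> = 0"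
 shows "\<omega> vs = 0"
proof (cases "length vs = k")
 case True
 let ?V = "set vs"
 have "frame_sum ?V k \<omega> <= (SUM v:?V. hmet p v v) ^ k * frame_sum (the_frame p) k \<omega>"
  by (intro frame_sum_compare on_frame_dominates is_inner_hmet the_frame finite_the_frame assms(1)
    sum_nonneg is_inner_nonneg) auto
 also have "... = 0" using assms(2) by (simp add: fnorm2_eq)
 finally have "frame_sum ?V k \<omega> = 0" using frame_sum_nonneg[of ?V k \<omega>] by simp
 thus ?thesis using True unfolding frame_sum_def
  by (subst (asm) sum_nonneg_eq_0_iff) (auto simp: finite_lists_length_eq)
next
 case False
 thus ?thesis using assms(1)
 proof (induction k arbitrary: \<omega> vs)
  case 0
  thus ?case by (cases vs) auto
 next
  case (Suc k)
  thus ?case by (cases vs) auto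
 qed
qed

text \<open>Young's form of the triangle inequality is linear in the squared norms, so it can be
  integrated term by term; the parameter s is chosen afterwards.\<close>

lemma fnorm2_young:
 assumes "s > 0"
 shows "fnorm2 k p (%vs. \<omega> vs - \<eta> vs) <= (1 + s) * fnorm2 k p \<omega> + (1 + 1 / s) * fnorm2 k p \<eta>"
proof -
 have pt: "(cmod (a - b))\<^sup>2 <= (1 + s) * (cmod a)\<^sup>2 + (1 + 1 / s) * (cmod b)\<^sup>2" for a b
 proof -
  have "0 <= (s * cmod a - cmod b)\<^sup>2 / s" using assms by simp
  also have "... = s * (cmod a)\<^sup>2 + (1 / s) * (cmod b)\<^sup>2 - 2 * (cmod a * cmod b)"
   using assms by (simp add: power2_eq_square field_simps)
  finally have "2 * (cmod a * cmod b) <= s * (cmod a)\<^sup>2 + (1 / s) * (cmod b)\<^sup>2" by simp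
  moreover have "(cmod (a - b))\<^sup>2 <= (cmod a + cmod b)\<^sup>2" by (intro power_mono norm_triangle_ineq4) simp
  ultimately show ?thesis by (simp add: power2_sum algebra_simps)
 qed
 have "frame_sum (the_frame p) k (%vs. \<omega> vs - \<eta> vs)
   <= (1 + s) * frame_sum (the_frame p) k \<omega> + (1 + 1 / s) * frame_sum (the_frame p) k \<eta>"
  unfolding frame_sum_def sum_distrib_left sum.distrib[symmetric] by (intro sum_mono pt)
 thus ?thesis unfolding fnorm2_eq by (simp add: add_divide_distrib[symmetric] divide_right_mono)
qed

lemma fnorm2_minus_commute: "fnorm2 k p (%vs. \<omega> vs - \<eta> vs) = fnorm2 k p (%vs. \<eta> vs - \<omega> vs)"
 unfolding fnorm2_eq frame_sum_def by (simp add: norm_minus_commute)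

text \<open>In each chart a continuous frame reduces the norm to finitely many measurable functions
  by \<open>measurable_mlin_map\<close>; countably many charts are glued.\<close>

lemma measurable_fnorm2:
 assumes f: "measurable_form A f" and m: "!!x. mlin k (f x)"
 shows "(%x. fnorm2 k x (f x)) : bmeas"
proof -
 obtain cc where cc: "!!i::nat. cc i : A" "(\<Union>i. fst (cc i)) = UNIV" using countable_charts by blast
 have local: "(%x. fnorm2 k x (f x)) : borel_measurable (restrict_space borel (fst c))" if c: "c : A" for c
 proof -
  let ?M = "restrict_space borel (fst c)"
  have sp: "space ?M = fst c" by (simp add: space_restrict_space)
  have cg: "continuous_on (img c) (%z. gmet c z u v)" for u v using Ck_gmet[OF c, of 0] by simp
  obtain F where F: "!!b. b : (Basis :: (complex^'n) set) ==> continuous_on (img c) (F b)"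
   "!!z. z : img c ==> on_frame (gmet c z) ((%b. F b z) ` Basis)" "!!z. z : img c ==> inj_on (%b. F b z) Basis"
  proof (rule continuous_on_frame[of "img c" "gmet c", OF is_inner_gmet[OF c] cg])
   fix F :: "complex^'n => complex^'n => complex^'n"
   assume "!!b. b : Basis ==> continuous_on (img c) (F b)"
    "!!z. z : img c ==> on_frame (gmet c z) ((%b. F b z) ` Basis)"
    "!!z. z : img c ==> inj_on (%b. F b z) Basis"
   thus thesis by (rule that)
  qed
  have Fm: "(%x. F b (snd c x)) : borel_measurable ?M" if "b : Basis" for b
   by (intro borel_measurable_continuous_on_restrict continuous_on_compose2[OF F(1)[OF that] continuous_chart[OF c]]) auto
  have eq: "fnorm2 k x (f x) = (\<Sum>bs | set bs <= Basis & length bs = k.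
    (cmod (cform c x (f x) (map (%G. G x) (map (%b x. F b (snd c x)) bs))))\<^sup>2) / fact k"
   if x: "x : fst c" for x
  proof -
   have z: "snd c x : img c" using x by simp
   have "fnorm2 k x (f x) = frame_sum ((%b. F b (snd c x)) ` Basis) k (cform c x (f x)) / fact k"
    by (rule fnorm2_chart_frame[OF c x m F(2)[OF z]])
   thus ?thesis unfolding frame_sum_map[OF F(3)[OF z]] by (simp add: frame_sum_def o_def)
  qed
  have mm: "(%x. cform c x (f x) (map (%G. G x) (map (%b x. F b (snd c x)) bs))) : borel_measurable ?M"
   if "set bs <= Basis" "length bs = k" for bs
  proof (rule measurable_mlin_map)
   show "mlin (length (map (%b x. F b (snd c x)) bs)) (cform c x (f x))" if "x : space ?M" for x
    using that mlin_cform[OF c _ m] \<open>length bs = k\<close> by (simp add: sp)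
   show "(%x. cform c x (f x) us) : borel_measurable ?M" for us
    using f c unfolding measurable_form_def cform_def by blast
   show "G : borel_measurable ?M" if "G : set (map (%b x. F b (snd c x)) bs)" for G
    using that \<open>set bs <= Basis\<close> Fm by auto
  qed
  have "(%x. (\<Sum>bs | set bs <= Basis & length bs = k.
    (cmod (cform c x (f x) (map (%G. G x) (map (%b x. F b (snd c x)) bs))))\<^sup>2) / fact k) : borel_measurable ?M"
  proof (intro borel_measurable_divide borel_measurable_sum borel_measurable_power borel_measurable_const)
   fix bs :: "(complex^'n) list" assume "bs : {bs. set bs <= Basis & length bs = k}"
   hence "set bs <= Basis" "length bs = k" by auto
   from measurable_compose[OF mm[OF this] borel_measurable_norm]
   show "(%x. cmod (cform c x (f x) (map (%G. G x) (map (%b x. F b (snd c x)) bs)))) : borel_measurable ?M" by simp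
  qed
  thus ?thesis using eq by (subst measurable_cong[where M = ?M]) (simp_all only: sp)
 qed
 show ?thesis
 proof (rule measurable_piecewise_restrict[of "range (%i. fst (cc i))"])
  show "\<Omega> \<inter> space borel : sets borel" if "\<Omega> : range (%i. fst (cc i))" for \<Omega>
   using that cc(1) dom_borel by auto
  show "space borel <= \<Union> (range (%i. fst (cc i)))" using cc(2) by simp
  show "(%x. fnorm2 k x (f x)) : borel_measurable (restrict_space borel \<Omega>)" if "\<Omega> : range (%i. fst (cc i))" for \<Omega>
   using that local[OF cc(1)] by blast
 qed simp
qed

end

section \<open>The Hilbert space of square integrable forms\<close>

text \<open>The optimal parameter is s = sqrt b / sqrt a; if a or b vanishes, s is sent to infinity
  or to 0 instead.\<close>

lemma sqrt_triangle_of_young: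
 fixes a b c :: real
 assumes "a >= 0" "b >= 0" and y: "!!s. s > 0 ==> c <= (1 + s) * a + (1 + 1 / s) * b"
 shows "sqrt c <= sqrt a + sqrt b"
proof -
 have "c <= (sqrt a + sqrt b)\<^sup>2"
 proof -
  consider "a = 0" | "b = 0" | "a > 0" "b > 0" using assms by linarith
  thus ?thesis
  proof cases
   case 1
   have "c <= b"
   proof (rule field_le_epsilon)
    fix e :: real assume e: "e > 0"
    have "c <= (1 + 1 / ((b + 1) / e)) * b" using y[of "(b + 1) / e"] 1 e assms by simp
    also have "... = b + e * (b / (b + 1))" using e by (simp add: field_simps)
    also have "... <= b + e * 1" using e assms by (intro add_left_mono mult_left_mono) auto
    finally show "c <= b + e" by simp
   qed
   thus ?thesis using 1 assms by simp
  next
   case 2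
   have "c <= a"
   proof (rule field_le_epsilon)
    fix e :: real assume e: "e > 0"
    have "c <= (1 + e / (a + 1)) * a" using y[of "e / (a + 1)"] 2 e assms by simp
    also have "... = a + e * (a / (a + 1))" by (simp add: field_simps)
    also have "... <= a + e * 1" using e assms by (intro add_left_mono mult_left_mono) auto
    finally show "c <= a + e" by simp
   qed
   thus ?thesis using 2 assms by simp
  next
   case 3
   let ?a = "sqrt a" and ?b = "sqrt b"
   have p: "?a > 0" "?b > 0" "a = ?a\<^sup>2" "b = ?b\<^sup>2" using 3 by auto
   have "c <= (1 + ?b / ?a) * ?a\<^sup>2 + (1 + 1 / (?b / ?a)) * ?b\<^sup>2" using y[of "?b / ?a"] p by simp
   also have "... = (?a + ?b)\<^sup>2" using p(1,2) by (simp add: field_simps power2_eq_square)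
   finally show ?thesis .
  qed
 qed
 hence "sqrt c <= sqrt ((sqrt a + sqrt b)\<^sup>2)" by (rule real_sqrt_le_mono)
 thus ?thesis using assms by simp
qed

lemma convergent_of_geometric_steps:
 fixes z :: "nat => complex"
 assumes "!!n. (cmod (z (Suc n) - z n))\<^sup>2 <= C * (1/2) ^ n"
 shows "convergent z"
proof -
 have C: "C >= 0" using order_trans[OF zero_le_power2 assms[of 0]] by simp
 have "cmod (z (Suc n) - z n) <= sqrt C * (sqrt (1/2)) ^ n" for n
 proof -
  have "cmod (z (Suc n) - z n) = sqrt ((cmod (z (Suc n) - z n))\<^sup>2)" by simp
  also have "... <= sqrt (C * (1/2) ^ n)" by (rule real_sqrt_le_mono[OF assms])
  finally show ?thesis by (simp add: real_sqrt_mult real_sqrt_power)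
 qed
 moreover have "summable (%n. sqrt C * (sqrt (1/2)) ^ n)"
  by (intro summable_mult summable_geometric) (simp add: real_sqrt_divide)
 ultimately have "summable (%n. z (Suc n) - z n)" by (rule summable_comparison_test'[rotated, where N = 0])
 hence "convergent (%n. \<Sum>i<n. z (Suc i) - z i)" by (simp add: summable_iff_convergent)
 hence "convergent (%n. z n - z 0)" by (simp add: sum_lessThan_telescope)
 hence "convergent (%n. (z n - z 0) + z 0)" by (intro convergent_add convergent_const)
 thus ?thesis by simp
qed

locale herm_L2 = herm_mfd A h
 for A :: "('a::{t2_space,second_countable_topology}, 'n::finite) chart set"
  and h :: "('a, 'n) metric_field" +
 fixes \<phi> :: "'a => real" and p q :: nat
 assumes weight: "continuous_on UNIV \<phi>"
begin

abbreviation deg :: nat where "deg \<equiv> p + q"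

abbreviation forms :: "('a => 'n form) set" where "forms \<equiv> L2_forms A h \<phi> p q"

abbreviation L2n :: "'a set => ('a => 'n form) => ennreal" where
 "L2n \<equiv> L2_norm A h \<phi> deg"

definition dens :: "('a => 'n form) => 'a => real" where
 "dens f x = fnorm2 deg x (f x) * exp (- \<phi> x)"

text \<open>The squared norm, kept in \<open>ennreal\<close>: it is additive in the set and may be
  infinite, so no integrability has to be carried along.\<close>

definition energy :: "'a set => ('a => 'n form) => ennreal" where
 "energy S f = (\<integral>\<^sup>+x\<in>S. ennreal (dens f x) \<partial>vol)"

lemma dens_nonneg: "0 <= dens f x" by (simp add: dens_def fnorm2_nonneg)

lemma L2n_energy: "L2n S f = (if energy S f = \<infinity> then \<infinity> else ennreal (sqrt (enn2real (energy S f))))"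
 by (simp add: L2_norm_def energy_def dens_def fnorm2_def Let_def)

lemma L2n_less_iff: "e > 0 ==> L2n S f < ennreal e \<longleftrightarrow> energy S f < ennreal (e\<^sup>2)"
proof -
 assume e: "e > 0"
 show ?thesis
 proof (cases "energy S f")
  case (real r)
  hence "L2n S f = ennreal (sqrt r)" by (simp add: L2n_energy)
  moreover have "sqrt r < e \<longleftrightarrow> r < e\<^sup>2" using real e
   by (metis real_sqrt_less_iff real_sqrt_abs abs_of_pos)
  ultimately show ?thesis using real e by (simp add: ennreal_less_iff)
 qed (simp add: L2n_energy)
qed

lemma L2n_finite_iff: "L2n S f < \<infinity> \<longleftrightarrow> energy S f < \<infinity>"
 by (auto simp: L2n_energy top.not_eq_extremum)

lemma formsD:
 assumes "f : forms"
 shows "f x : pq_forms p q" "mlin deg (f x)" "measurable_form A f" "energy UNIV f < \<infinity>"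
 using assms mlin_pq unfolding L2_forms_def L2n_finite_iff by auto

lemma formsI:
 "(!!x. f x : pq_forms p q) ==> measurable_form A f ==> energy UNIV f < \<infinity> ==> f : forms"
 unfolding L2_forms_def L2n_finite_iff by simp

lemma weight_measurable [measurable]: "\<phi> : bmeas" using weight by (rule borel_measurable_continuous_onI)

lemma measurable_dens:
 assumes "measurable_form A f" "!!x. mlin deg (f x)"
 shows "dens f : bmeas"
proof -
 have [measurable]: "(%x. fnorm2 deg x (f x)) : bmeas" by (rule measurable_fnorm2[OF assms])
 show ?thesis unfolding dens_def[abs_def] by measurable
qed

lemma measurable_form_diff:
 "measurable_form A f ==> measurable_form A g ==> measurable_form A (form_diff f g)"
 unfolding measurable_form_def form_diff_def by (intro ballI allI borel_measurable_diff) blast+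

lemma dens_young: "s > 0 ==> dens (form_diff f g) x <= (1 + s) * dens f x + (1 + 1 / s) * dens g x"
 using mult_right_mono[OF fnorm2_young[of s deg x "f x" "g x"], of "exp (- \<phi> x)"]
 by (simp add: dens_def form_diff_def algebra_simps)

lemma energy_young:
 assumes f: "measurable_form A f" "!!x. mlin deg (f x)" and g: "measurable_form A g" "!!x. mlin deg (g x)"
  and S: "S : sets borel" and s: "s > 0"
 shows "energy S (form_diff f g) <= ennreal (1 + s) * energy S f + ennreal (1 + 1 / s) * energy S g"
proof -
 note [measurable] = measurable_dens[OF f] measurable_dens[OF g] S
 have "energy S (form_diff f g) <= (\<integral>\<^sup>+x\<in>S. ennreal (1 + s) * ennreal (dens f x) + ennreal (1 + 1 / s) * ennreal (dens g x) \<partial>vol)"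
  unfolding energy_def
 proof (intro nn_integral_mono mult_right_mono)
  fix x
  show "ennreal (dens (form_diff f g) x) <= ennreal (1 + s) * ennreal (dens f x) + ennreal (1 + 1 / s) * ennreal (dens g x)"
   using dens_young[OF s, of f g x] s dens_nonneg
   by (simp add: ennreal_mult[symmetric] ennreal_plus[symmetric] del: ennreal_plus)
 qed simp
 also have "... = (\<integral>\<^sup>+x. ennreal (1 + s) * (ennreal (dens f x) * indicator S x) + ennreal (1 + 1 / s) * (ennreal (dens g x) * indicator S x) \<partial>vol)"
  by (intro nn_integral_cong) (simp add: algebra_simps)
 also have "... = ennreal (1 + s) * energy S f + ennreal (1 + 1 / s) * energy S g" unfolding energy_def
  by (subst nn_integral_add, measurable) (simp add: nn_integral_cmult)
 finally show ?thesis .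
qed

lemma energy_mono_set: "S <= T ==> energy S f <= energy T f"
 unfolding energy_def by (intro nn_integral_mono) (auto simp: indicator_def)

lemma forms_diff:
 assumes "f : forms" "g : forms"
 shows "form_diff f g : forms"
proof (rule formsI)
 note F = formsD[OF assms(1)] and G = formsD[OF assms(2)]
 show "form_diff f g x : pq_forms p q" for x unfolding form_diff_def using pq_forms_diff F(1) G(1) by blast
 show "measurable_form A (form_diff f g)" by (rule measurable_form_diff[OF F(3) G(3)])
 have "energy UNIV (form_diff f g) <= ennreal (1 + 1) * energy UNIV f + ennreal (1 + 1 / 1) * energy UNIV g"
  by (rule energy_young[OF F(3,2) G(3,2)]) auto
 also have "... < \<infinity>" using F(4) G(4) by (simp add: ennreal_mult_less_top)
 finally show "energy UNIV (form_diff f g) < \<infinity>" .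
qed

lemma energy_diff_commute: "energy S (form_diff f g) = energy S (form_diff g f)"
 unfolding energy_def dens_def form_diff_def by (subst fnorm2_minus_commute) simp

lemma energy_diff_le:
 assumes "f : forms" "g : forms" "S : sets borel"
 shows "energy S (form_diff f g) <= 2 * energy S f + 2 * energy S g"
 using energy_young[OF formsD(3,2)[OF assms(1)] formsD(3,2)[OF assms(2)] assms(3), of 1] by simp

section \<open>The metric space of classes of forms and its completeness\<close>

definition nrm :: "('a => 'n form) => real" where
 "nrm f = sqrt (enn2real (energy UNIV f))"

lemma nrm_nonneg: "0 <= nrm f" by (simp add: nrm_def)

lemma energy_nrm: "energy UNIV f < \<infinity> ==> energy UNIV f = ennreal ((nrm f)\<^sup>2)"
 by (cases "energy UNIV f") (auto simp: nrm_def)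

lemma nrm_eq_L2n: "enn2real (L2n UNIV f) = nrm f" by (simp add: L2n_energy nrm_def)

text \<open>f - l is the difference of f - g and l - g; Young's inequality for all s gives the
  triangle inequality after integration.\<close>

lemma nrm_triangle:
 assumes f: "f : forms" and g: "g : forms" and l: "l : forms"
 shows "nrm (form_diff f l) <= nrm (form_diff f g) + nrm (form_diff g l)"
proof -
 let ?a = "form_diff f g" and ?b = "form_diff l g"
 note A = formsD[OF forms_diff[OF f g]] and B = formsD[OF forms_diff[OF l g]] and C = formsD[OF forms_diff[OF f l]]
 have e: "form_diff f l = form_diff ?a ?b" by (simp add: form_diff_def fun_eq_iff)
 have "sqrt (enn2real (energy UNIV (form_diff f l))) <= sqrt (enn2real (energy UNIV ?a)) + sqrt (enn2real (energy UNIV ?b))"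
 proof (rule sqrt_triangle_of_young)
  fix s :: real assume s: "s > 0"
  have "energy UNIV (form_diff f l) <= ennreal (1 + s) * energy UNIV ?a + ennreal (1 + 1 / s) * energy UNIV ?b"
   unfolding e by (rule energy_young[OF A(3,2) B(3,2) _ s]) simp
  also have "... = ennreal ((1 + s) * (nrm ?a)\<^sup>2 + (1 + 1 / s) * (nrm ?b)\<^sup>2)"
   using s unfolding energy_nrm[OF A(4)] energy_nrm[OF B(4)]
   by (simp add: ennreal_mult[symmetric] ennreal_plus[symmetric] del: ennreal_plus)
  finally have "enn2real (energy UNIV (form_diff f l)) <= (1 + s) * (nrm ?a)\<^sup>2 + (1 + 1 / s) * (nrm ?b)\<^sup>2"
   using s by (intro enn2real_leI) auto
  thus "enn2real (energy UNIV (form_diff f l)) <= (1 + s) * enn2real (energy UNIV ?a) + (1 + 1 / s) * enn2real (energy UNIV ?b)"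
   by (simp add: nrm_def)
 qed auto
 thus ?thesis unfolding nrm_def using energy_diff_commute[of UNIV l g] by simp
qed

abbreviation rel :: "(('a => 'n form) \<times> ('a => 'n form)) set" where "rel \<equiv> ae_equal A h \<phi> p q"
abbreviation space2 :: "('a => 'n form) set set" where "space2 \<equiv> L2_space A h \<phi> p q"
abbreviation dist2 :: "('a => 'n form) set => ('a => 'n form) set => real" where "dist2 \<equiv> L2_dist A h \<phi> p q"

lemma rel_iff: "(f, g) : rel \<longleftrightarrow> f : forms & g : forms & (AE x in vol. f x = g x)"
 by (simp add: ae_equal_def)

lemma equiv_rel: "equiv forms rel"
proof (rule equivI)
 show "rel <= forms \<times> forms" by (auto simp: rel_iff)
 show "refl_on forms rel" by (auto simp: refl_on_def rel_iff)
 show "sym rel" by (auto simp: sym_def rel_iff elim: AE_mp)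
 show "Relation.trans rel"
 proof (rule transI)
  fix x y z assume "(x, y) : rel" "(y, z) : rel"
  hence "x : forms" "z : forms" "AE a in vol. x a = y a" "AE a in vol. y a = z a" by (auto simp: rel_iff)
  moreover from this(3,4) have "AE a in vol. x a = z a" by eventually_elim simp
  ultimately show "(x, z) : rel" by (simp add: rel_iff)
 qed
qed

lemma energy_zero_iff:
 assumes f: "f : forms" and g: "g : forms"
 shows "energy UNIV (form_diff f g) = 0 \<longleftrightarrow> (f, g) : rel"
proof -
 note D = formsD[OF forms_diff[OF f g]]
 note [measurable] = measurable_dens[OF D(3,2)]
 have "energy UNIV (form_diff f g) = 0 \<longleftrightarrow> (AE x in vol. dens (form_diff f g) x <= 0)"
  unfolding energy_def by (subst nn_integral_0_iff_AE) (auto simp: ennreal_eq_0_iff)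
 also have "... \<longleftrightarrow> (AE x in vol. f x = g x)"
 proof -
  have "dens (form_diff f g) x <= 0 \<longleftrightarrow> f x = g x" for x
  proof
   assume "dens (form_diff f g) x <= 0"
   hence "fnorm2 deg x (form_diff f g x) = 0"
    using fnorm2_nonneg[of deg x "form_diff f g x"] by (simp add: dens_def mult_le_0_iff)
   from fnorm2_zero[OF D(2) this] show "f x = g x" by (auto simp: form_diff_def)
  next
   assume "f x = g x"
   hence "form_diff f g x = (%_. 0)" by (simp add: form_diff_def)
   thus "dens (form_diff f g) x <= 0" by (simp add: dens_def fnorm2_eq frame_sum_def)
  qed
  thus ?thesis by simp
 qed
 finally show ?thesis using f g by (simp add: rel_iff)
qed

lemma space2D:
 assumes "F : space2"
 shows "F <= forms" "(SOME f. f : F) : F" "f : F ==> g : F ==> (f, g) : rel" "F ~= {}"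
proof -
 show F: "F ~= {}" using assms in_quotient_imp_non_empty[OF equiv_rel] unfolding L2_space_def by blast
 show "F <= forms" using assms in_quotient_imp_subset[OF equiv_rel] unfolding L2_space_def by blast
 show "(SOME f. f : F) : F" using F some_in_eq by blast
 show "f : F ==> g : F ==> (f, g) : rel" using assms quotient_eq_iff[OF equiv_rel] unfolding L2_space_def by blast
qed

lemma energy_cong_rel:
 assumes "(f, f') : rel" "(g, g') : rel"
 shows "energy S (form_diff f g) = energy S (form_diff f' g')"
proof -
 have "AE x in vol. f x = f' x" "AE x in vol. g x = g' x" using assms by (auto simp: rel_iff)
 hence "AE x in vol. dens (form_diff f g) x = dens (form_diff f' g') x"
  by eventually_elim (simp add: dens_def form_diff_def)
 thus ?thesis unfolding energy_def by (intro nn_integral_cong_AE) auto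
qed

text \<open>\<open>L2_dist\<close> evaluates chosen representatives; equality almost everywhere
  makes the choice immaterial.\<close>

lemma dist2_eq:
 assumes "F : space2" "G : space2" "f : F" "g : G"
 shows "dist2 F G = nrm (form_diff f g)"
proof -
 have "dist2 F G = nrm (form_diff (SOME f. f : F) (SOME g. g : G))" by (simp add: L2_dist_def nrm_eq_L2n)
 thus ?thesis unfolding nrm_def using energy_cong_rel space2D[OF assms(1)] space2D[OF assms(2)] assms(3,4) by metis
qed

lemma rel_class: "f : forms ==> rel `` {f} : space2" "f : forms ==> f : rel `` {f}"
 unfolding L2_space_def by (auto intro: quotientI simp: rel_iff)

lemma metric_space2: "Metric_space space2 dist2"
proof
 show "0 <= dist2 F G" for F G by (simp add: L2_dist_def)
 show "dist2 F G = dist2 G F" for F G by (simp add: L2_dist_def nrm_eq_L2n) (simp add: nrm_def energy_diff_commute)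
 fix F G H
 assume F: "F : space2" and G: "G : space2"
 obtain f g where fg: "f : F" "g : G" using space2D(4)[OF F] space2D(4)[OF G] by blast
 have fg': "f : forms" "g : forms" using fg space2D(1) F G by auto
 have "dist2 F G = 0 \<longleftrightarrow> energy UNIV (form_diff f g) = 0"
  using dist2_eq[OF F G fg] energy_nrm[OF formsD(4)[OF forms_diff[OF fg']]] nrm_nonneg[of "form_diff f g"] by auto
 also have "... \<longleftrightarrow> (f, g) : rel" by (rule energy_zero_iff[OF fg'])
 also have "... \<longleftrightarrow> F = G"
  using quotient_eq_iff[OF equiv_rel, of F G f g] F G fg unfolding L2_space_def by blast
 finally show "dist2 F G = 0 \<longleftrightarrow> F = G" .
 assume H: "H : space2"
 obtain l where l: "l : H" using space2D(4)[OF H] by blast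
 thus "dist2 F H <= dist2 F G + dist2 G H" using dist2_eq[OF F H fg(1) l] dist2_eq[OF F G fg] dist2_eq[OF G H fg(2) l]
   nrm_triangle[OF fg', of l] space2D(1)[OF H] by auto
qed

sublocale L2: Metric_space space2 dist2 by (rule metric_space2)

text \<open>The arguments form a finite set dominated by the frame. So evaluation on fixed arguments
  is continuous for the pointwise norm, which is what makes pointwise limits of forms
  available.\<close>

lemma cmod_le_fnorm2:
 assumes "mlin k \<omega>"
 shows "(cmod (\<omega> vs))\<^sup>2 <= (SUM v:set vs. hmet x v v) ^ k * fact k * fnorm2 k x \<omega>"
proof (cases "length vs = k")
 case True
 let ?V = "set vs"
 have "(cmod (\<omega> vs))\<^sup>2 <= frame_sum ?V k \<omega>"
  unfolding frame_sum_def using True finite_lists_length_eq[of ?V k]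
  by (intro member_le_sum[of vs, where f = "%vs. (cmod (\<omega> vs))\<^sup>2"]) auto
 also have "... <= (SUM v:?V. hmet x v v) ^ k * frame_sum (the_frame x) k \<omega>"
  by (intro frame_sum_compare on_frame_dominates is_inner_hmet the_frame finite_the_frame assms
    sum_nonneg is_inner_nonneg) auto
 finally show ?thesis by (simp add: fnorm2_eq)
next
 case False
 hence "\<omega> vs = 0" using assms
 proof (induction k arbitrary: \<omega> vs)
  case 0
  thus ?case by (cases vs) auto
 next
  case (Suc k)
  thus ?case by (cases vs) auto
 qed
 thus ?thesis by (simp add: fnorm2_nonneg sum_nonneg is_inner_nonneg[OF is_inner_hmet])
qed

text \<open>Riesz-Fischer for forms: fast steps force pointwise convergence almost everywhere,
  \<open>pq_forms_limit\<close> keeps the type, and Fatou's lemma bounds the distance to the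
  limit.\<close>

lemma forms_complete:
 fixes f :: "nat => 'a => 'n form"
 assumes f: "!!n. f n : forms"
  and fast: "!!n. energy UNIV (form_diff (f (Suc n)) (f n)) <= ennreal ((1/8) ^ n)"
  and cauchy: "!!e. e > 0 ==> EX M. ALL m>=M. ALL n>=M. energy UNIV (form_diff (f m) (f n)) <= ennreal e"
 shows "EX g:forms. ALL e>0. EX M. ALL n>=M. energy UNIV (form_diff g (f n)) <= ennreal e"
proof -
 define a where "a n x = dens (form_diff (f (Suc n)) (f n)) x" for n x
 have am[measurable]: "a n : bmeas" for n
  unfolding a_def[abs_def] using formsD[OF forms_diff[OF f f]] by (intro measurable_dens)
 \<comment> \<open>The weight 2^n leaves integrals of at most (2/8)^n, so the series is finite
   almost everywhere; on G the unweighted densities decay like 2^(-n).\<close>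
 define G where "G = {x. (\<Sum>n. ennreal (2 ^ n * a n x)) < \<infinity>}"
 have Gm[measurable]: "G : sets borel" unfolding G_def by measurable
 have "(\<integral>\<^sup>+x. (\<Sum>n. ennreal (2 ^ n * a n x)) \<partial>vol) = (\<Sum>n. \<integral>\<^sup>+x. ennreal (2 ^ n * a n x) \<partial>vol)"
  by (rule nn_integral_suminf) measurable
 also have "... <= (\<Sum>n. ennreal ((1/4) ^ n))"
 proof (rule suminf_le)
  fix n
  have "(\<integral>\<^sup>+x. ennreal (2 ^ n * a n x) \<partial>vol) = ennreal (2 ^ n) * energy UNIV (form_diff (f (Suc n)) (f n))"
   unfolding energy_def a_def[symmetric] using dens_nonneg
   using am[of n] by (subst nn_integral_cmult[symmetric]) (auto simp: ennreal_mult' a_def[abs_def])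
  also have "... <= ennreal (2 ^ n) * ennreal ((1/8) ^ n)" by (intro mult_left_mono fast) simp
  also have "... = ennreal ((1/4) ^ n)" by (simp add: ennreal_mult[symmetric] power_mult_distrib[symmetric] del: ennreal_power)
  finally show "(\<integral>\<^sup>+x. ennreal (2 ^ n * a n x) \<partial>vol) <= ennreal ((1/4) ^ n)" .
 qed auto
 also have "... = ennreal (\<Sum>n. (1/4) ^ n)" by (intro suminf_ennreal2) auto
 finally have "(\<integral>\<^sup>+x. (\<Sum>n. ennreal (2 ^ n * a n x)) \<partial>vol) ~= \<infinity>" by (auto simp: top_unique)
 hence AEG: "AE x in vol. x : G"
  unfolding G_def using nn_integral_PInf_AE[of "%x. (\<Sum>n. ennreal (2 ^ n * a n x))" vol]
  by (auto simp: top.not_eq_extremum)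
 have conv: "convergent (%n. f n x vs)" if x: "x : G" for x vs
 proof -
  obtain C where C: "C >= 0" "(\<Sum>n. ennreal (2 ^ n * a n x)) = ennreal C"
   using x unfolding G_def by (cases "\<Sum>n. ennreal (2 ^ n * a n x)") auto
  have an: "a n x <= C * (1/2) ^ n" for n
  proof -
   have "ennreal (2 ^ n * a n x) <= (\<Sum>n. ennreal (2 ^ n * a n x))"
    using sum_le_suminf[of "%n. ennreal (2 ^ n * a n x)" "{n}"] by simp
   hence "2 ^ n * a n x <= C" using C by simp
   thus ?thesis by (simp add: power_one_over field_simps)
  qed
  let ?D = "(SUM v:set vs. hmet x v v) ^ deg * fact deg * exp (\<phi> x)"
  have D: "?D >= 0" by (simp add: sum_nonneg is_inner_nonneg[OF is_inner_hmet])
  show ?thesis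
  proof (rule convergent_of_geometric_steps[where C = "?D * C"])
   fix n
   have "(cmod (f (Suc n) x vs - f n x vs))\<^sup>2 <= (SUM v:set vs. hmet x v v) ^ deg * fact deg * fnorm2 deg x (form_diff (f (Suc n)) (f n) x)"
    using cmod_le_fnorm2[OF formsD(2)[OF forms_diff[OF f[of "Suc n"] f[of n]]], of x vs x] by (simp add: form_diff_def)
   also have "... = ?D * a n x" by (simp add: a_def dens_def exp_minus field_simps)
   also have "... <= ?D * (C * (1/2) ^ n)" by (intro mult_left_mono an D)
   finally show "(cmod (f (Suc n) x vs - f n x vs))\<^sup>2 <= ?D * C * (1/2) ^ n" by simp
  qed
 qed
 define g where "g x = (if x : G then (%vs. lim (%n. f n x vs)) else (%vs. 0))" for x
 have lim: "(%n. f n x vs) \<longlonglongrightarrow> g x vs" if "x : G" for x vs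
  using conv[OF that, of vs] that by (simp add: g_def convergent_LIMSEQ_iff)
 have gpq: "g x : pq_forms p q" for x
 proof (cases "x : G")
  case True
  show ?thesis by (rule pq_forms_limit[OF formsD(1)[OF f] lim[OF True]])
 next
  case False
  thus ?thesis by (simp add: g_def pq_forms_zero)
 qed
 have gmeas: "measurable_form A g" unfolding measurable_form_def
 proof (intro ballI allI)
  fix c vs assume c: "c : A"
  let ?M = "restrict_space borel (fst c)"
  have "(%x. f n x (map (vec_of A c x) vs)) : borel_measurable ?M" for n
   using formsD(3)[OF f] c unfolding measurable_form_def by blast
  hence [measurable]: "(%x. lim (%n. f n x (map (vec_of A c x) vs))) : borel_measurable ?M"
   by (rule borel_measurable_lim_metric)
  have [measurable]: "(%x. indicator G x :: complex) : borel_measurable ?M"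
   by (intro measurable_restrict_space1) measurable
  have "g x (map (vec_of A c x) vs) = indicator G x * lim (%n. f n x (map (vec_of A c x) vs))" for x
   by (simp add: g_def)
  thus "(%x. g x (map (vec_of A c x) vs)) : borel_measurable ?M" by simp
 qed
 have fatou: "energy UNIV (form_diff g (f n)) <= ennreal e"
  if "ALL m>=M. energy UNIV (form_diff (f m) (f n)) <= ennreal e" for n e M
 proof -
  have "AE x in vol. ennreal (dens (form_diff g (f n)) x) <= liminf (%m. ennreal (dens (form_diff (f m) (f n)) x))"
   using AEG
  proof eventually_elim
   fix x assume x: "x : G"
   have "(%m. dens (form_diff (f m) (f n)) x) \<longlonglongrightarrow> dens (form_diff g (f n)) x"
    unfolding dens_def fnorm2_eq frame_sum_def form_diff_def by (intro tendsto_intros lim x) simp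
   hence "(%m. ennreal (dens (form_diff (f m) (f n)) x)) \<longlonglongrightarrow> ennreal (dens (form_diff g (f n)) x)"
    by (intro tendsto_ennrealI)
   thus "ennreal (dens (form_diff g (f n)) x) <= liminf (%m. ennreal (dens (form_diff (f m) (f n)) x))"
    by (simp add: lim_imp_Liminf)
  qed
  hence "energy UNIV (form_diff g (f n)) <= (\<integral>\<^sup>+x. liminf (%m. ennreal (dens (form_diff (f m) (f n)) x)) \<partial>vol)"
   unfolding energy_def by (intro nn_integral_mono_AE) simp
  also have "... <= liminf (%m. \<integral>\<^sup>+x. ennreal (dens (form_diff (f m) (f n)) x) \<partial>vol)"
  proof (rule nn_integral_liminf)
   fix m
   have [measurable]: "dens (form_diff (f m) (f n)) : bmeas"
    using formsD[OF forms_diff[OF f f]] by (intro measurable_dens)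
   show "(%x. ennreal (dens (form_diff (f m) (f n)) x)) : borel_measurable vol" by simp
  qed
  also have "... = liminf (%m. energy UNIV (form_diff (f m) (f n)))" by (simp add: energy_def)
  also have "... <= ennreal e"
  proof (rule Liminf_le)
   show "\<forall>\<^sub>F m in sequentially. energy UNIV (form_diff (f m) (f n)) <= ennreal e"
    using that eventually_sequentially by blast
  qed simp
  finally show ?thesis .
 qed
 have gf: "g : forms"
 proof (rule formsI[OF gpq gmeas])
  obtain M where M: "ALL m>=M. ALL n>=M. energy UNIV (form_diff (f m) (f n)) <= ennreal 1" using cauchy[of 1] by auto
  let ?u = "form_diff g (f M)" and ?z = "form_diff (f M) (f M)"
  have "energy UNIV ?u <= ennreal 1" using fatou[of M M 1] M by auto
  hence u: "energy UNIV ?u < \<infinity>" by (simp add: order_le_less_trans)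
  have um: "measurable_form A ?u" "mlin deg (?u x)" for x
   using measurable_form_diff[OF gmeas formsD(3)[OF f]] mlin_pq[OF pq_forms_diff[OF gpq formsD(1)[OF f]]]
   by (auto simp: form_diff_def)
  \<comment> \<open>This is - f M: only closure under differences is available, and g = (g - f M) -
    w.\<close>
  define w where "w = form_diff ?z (f M)"
  have w: "w : forms" unfolding w_def by (intro forms_diff f)
  have "g = form_diff ?u w" by (simp add: w_def form_diff_def fun_eq_iff)
  hence "energy UNIV g <= ennreal (1 + 1) * energy UNIV ?u + ennreal (1 + 1 / 1) * energy UNIV w"
   using energy_young[OF um formsD(3,2)[OF w], of UNIV 1] by simp
  also have "... < \<infinity>" using u formsD(4)[OF w] by (simp add: ennreal_mult_less_top)
  finally show "energy UNIV g < \<infinity>" .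
 qed
 have "EX M. ALL n>=M. energy UNIV (form_diff g (f n)) <= ennreal e" if e: "e > 0" for e
  using cauchy[OF e] fatou by meson
 thus ?thesis using gf by blast
qed

lemma dist2_less_iff:
 assumes "F : space2" "G : space2" "f : F" "g : G" "e > 0"
 shows "dist2 F G < e \<longleftrightarrow> energy UNIV (form_diff f g) < ennreal (e\<^sup>2)"
proof -
 have fg: "f : forms" "g : forms" using assms space2D(1) by auto
 have "dist2 F G < e \<longleftrightarrow> (nrm (form_diff f g))\<^sup>2 < e\<^sup>2"
  unfolding dist2_eq[OF assms(1-4)] using assms(5) nrm_nonneg[of "form_diff f g"]
  using power_strict_mono[of "nrm (form_diff f g)" e 2] power2_less_imp_less[of "nrm (form_diff f g)" e] by auto
 thus ?thesis unfolding energy_nrm[OF formsD(4)[OF forms_diff[OF fg]]] by (simp add: ennreal_less_iff)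
qed

lemma mcomplete_space2: "L2.mcomplete" unfolding L2.mcomplete_def
proof (intro allI impI)
 fix \<sigma> assume \<sigma>: "L2.MCauchy \<sigma>"
 have \<sigma>s: "\<sigma> n : space2" for n using \<sigma> unfolding L2.MCauchy_def by auto
 have \<sigma>c: "EX M. ALL m n. M <= m --> M <= n --> dist2 (\<sigma> m) (\<sigma> n) < e" if "e > 0" for e
  using \<sigma> that unfolding L2.MCauchy_def by blast
 define s where "s n = (SOME f. f : \<sigma> n)" for n
 have s: "s n : \<sigma> n" "s n : forms" for n using space2D(1,2)[OF \<sigma>s] by (auto simp: s_def)
 have cauchy: "EX M. ALL m>=M. ALL n>=M. energy UNIV (form_diff (s m) (s n)) <= ennreal e" if e: "e > 0" for e
 proof -
  obtain M where M: "!!m n. M <= m ==> M <= n ==> dist2 (\<sigma> m) (\<sigma> n) < sqrt e"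
   using \<sigma>c[of "sqrt e"] e by auto
  have "energy UNIV (form_diff (s m) (s n)) <= ennreal e" if "m >= M" "n >= M" for m n
   using M[OF that] dist2_less_iff[OF \<sigma>s \<sigma>s s(1) s(1), of "sqrt e" m n] e by auto
  thus ?thesis by blast
 qed
 have "EX M. ALL n. ALL m>=M n. ALL m'>=M n. energy UNIV (form_diff (s m) (s m')) <= ennreal ((1/8) ^ n)"
  using cauchy[of "(1/8) ^ n" for n] by (intro choice) auto
 then obtain M where M: "!!n m m'. m >= M n ==> m' >= M n ==> energy UNIV (form_diff (s m) (s m')) <= ennreal ((1/8) ^ n)"
  by blast
 \<comment> \<open>The partial sums give r n >= M n, and the summand n makes r strictly
   increasing.\<close>
 define r where "r n = (\<Sum>i\<le>n. M i) + n" for n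
 have r: "strict_mono r" by (rule strict_monoI_Suc) (simp add: r_def)
 have rM: "r n >= M n" for n unfolding r_def using member_le_sum[of n "{..n}" M] by (simp add: trans_le_add1)
 obtain g where g: "g : forms" "!!e. e > 0 ==> EX M. ALL n>=M. energy UNIV (form_diff g (s (r n))) <= ennreal e"
 proof -
  have "EX g:forms. ALL e>0. EX M. ALL n>=M. energy UNIV (form_diff g (s (r n))) <= ennreal e"
  proof (rule forms_complete[where f = "%n. s (r n)"])
   show "energy UNIV (form_diff (s (r (Suc n))) (s (r n))) <= ennreal ((1/8) ^ n)" for n
    using rM[of n] strict_mono_less_eq[OF r, of n "Suc n"] by (intro M) auto
   show "EX M. ALL m>=M. ALL n>=M. energy UNIV (form_diff (s (r m)) (s (r n))) <= ennreal e" if "e > 0" for e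
    using cauchy[OF that] seq_suble[OF r] by (meson order_trans)
  qed (rule s(2))
  thus ?thesis using that by blast
 qed
 define x where "x = rel `` {g}"
 have x: "x : space2" "g : x" using rel_class g(1) by (auto simp: x_def)
 have "limitin L2.mtopology (\<sigma> o r) x sequentially" unfolding L2.limit_metric_sequentially
 proof (intro conjI x(1) allI impI)
  fix e :: real assume e: "e > 0"
  obtain M where M: "ALL n>=M. energy UNIV (form_diff g (s (r n))) <= ennreal (e\<^sup>2 / 4)"
   using g(2)[of "e\<^sup>2 / 4"] e by auto
  have "dist2 ((\<sigma> o r) n) x < e" if "n >= M" for n
  proof -
   have "energy UNIV (form_diff (s (r n)) g) <= ennreal (e\<^sup>2 / 4)" using M that energy_diff_commute by metis
   also have "... < ennreal (e\<^sup>2)" using e by (simp add: ennreal_less_iff)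
   finally show ?thesis using dist2_less_iff[OF \<sigma>s x(1) s(1) x(2) e] by simp
  qed
  thus "EX N. ALL n>=N. (\<sigma> o r) n : space2 & dist2 ((\<sigma> o r) n) x < e" using \<sigma>s by auto
 qed
 thus "EX x. limitin L2.mtopology \<sigma> x sequentially"
  using L2.MCauchy_convergent_subsequence[OF \<sigma> r] by blast
qed

lemma precompact_iff_totally_bounded:
 assumes "\<A> <= space2"
 shows "L2_precompact A h \<phi> p q \<A> \<longleftrightarrow> L2.mtotally_bounded \<A>"
 unfolding L2_precompact_def Let_def L2.mtotally_bounded_eq_compact_closure_of[OF mcomplete_space2]
 using assms by simp

lemma bounded_energy:
 assumes "L2_bounded A h \<phi> p q \<A>" "\<A> <= space2"
 shows "EX R>0. ALL F:\<A>. ALL f:F. energy UNIV f <= ennreal R"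
proof -
 obtain X B where XB: "\<A> <= L2.mcball X B" using assms(1) unfolding L2_bounded_def L2.mbounded_def by blast
 show ?thesis
 proof (cases "\<A> = {}")
  case False
  hence X: "X : space2" using XB by auto
  obtain g where g: "g : X" "g : forms" using space2D(1,4)[OF X] by blast
  \<comment> \<open>This is - g, so that f = (f - g) - w is again a difference.\<close>
  define w where "w = form_diff (form_diff g g) g"
  have w: "w : forms" unfolding w_def by (intro forms_diff g)
  let ?R = "2 * B\<^sup>2 + 2 * (nrm w)\<^sup>2 + 1"
  have "energy UNIV f <= ennreal ?R" if F: "F : \<A>" "f : F" for F f
  proof -
   have Fs: "F : space2" "dist2 X F <= B" using F XB by auto
   have f: "f : forms" using space2D(1)[OF Fs(1)] F by auto
   have d: "nrm (form_diff g f) <= B" using Fs dist2_eq[OF X Fs(1) g(1) F(2)] by simp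
   note e = energy_nrm[OF formsD(4)[OF forms_diff[OF f g(2)]]] energy_nrm[OF formsD(4)[OF w]]
   have "nrm (form_diff f g) <= B" using d energy_diff_commute[of UNIV f g] by (simp add: nrm_def)
   hence sq: "(nrm (form_diff f g))\<^sup>2 <= B\<^sup>2" by (intro power_mono nrm_nonneg)
   have "f = form_diff (form_diff f g) w" by (simp add: w_def form_diff_def fun_eq_iff)
   hence "energy UNIV f <= 2 * energy UNIV (form_diff f g) + 2 * energy UNIV w"
    using energy_diff_le[OF forms_diff[OF f g(2)] w, of UNIV] by simp
   also have "... = ennreal (2 * (nrm (form_diff f g))\<^sup>2 + 2 * (nrm w)\<^sup>2)"
    unfolding e by (simp add: ennreal_mult[symmetric] ennreal_plus[symmetric] numeral_mult_ennreal del: ennreal_plus)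
   also have "... <= ennreal ?R" using sq by (intro ennreal_leI) auto
   finally show ?thesis .
  qed
  moreover have "?R > 0" by (intro add_nonneg_pos) auto
  ultimately show ?thesis by blast
 qed (auto intro: exI[of _ 1])
qed

end

section \<open>Euclidean $L^2$ estimates\<close>

text \<open>The map $x \mapsto |x| x$ carries $L^2$ to $L^1$ and its inverse is Hoelder continuous; this
 reduces continuity of translations in $L^2$ to $L^1$.\<close>

lemma norm_diff_square_le:
 fixes x y :: "'v::real_inner"
 shows "(norm (x - y))\<^sup>2 <= 2 * norm (norm x *R x - norm y *R y)"
proof (cases "x = y")
 case False
 let ?X = "norm x" and ?Y = "norm y" and ?d = "norm (x - y)"
 have d2: "?d\<^sup>2 = ?X\<^sup>2 + ?Y\<^sup>2 - 2 * (x \<bullet> y)"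
  by (simp add: power2_norm_eq_inner inner_diff inner_commute)
 have xx: "x \<bullet> x = ?X\<^sup>2" "y \<bullet> y = ?Y\<^sup>2" by (simp_all add: power2_norm_eq_inner)
 \<comment> \<open>Testing against x - y: the product is (|x| + |y|) times a sum of squares
   containing half of |x - y|^2, and |x| + |y| >= |x - y|.\<close>
 have "(?X *R x - ?Y *R y) \<bullet> (x - y) = ?X * ?X\<^sup>2 + ?Y * ?Y\<^sup>2 - (?X + ?Y) * (x \<bullet> y)"
  by (simp add: inner_diff_left inner_diff_right xx inner_commute algebra_simps)
 also have "... = (?X + ?Y) * (?d\<^sup>2 / 2 + (?X - ?Y)\<^sup>2 / 2)"
 proof -
  have "X * X\<^sup>2 + Y * Y\<^sup>2 - (X + Y) * i = (X + Y) * ((X\<^sup>2 + Y\<^sup>2 - 2 * i) / 2 + (X - Y)\<^sup>2 / 2)" for X Y i :: real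
   by (simp add: power2_eq_square field_simps)
  thus ?thesis unfolding d2 .
 qed
 finally have e: "(?X *R x - ?Y *R y) \<bullet> (x - y) = (?X + ?Y) * (?d\<^sup>2 / 2 + (?X - ?Y)\<^sup>2 / 2)" .
 have "?d * (?d\<^sup>2 / 2) <= (?X + ?Y) * (?d\<^sup>2 / 2 + (?X - ?Y)\<^sup>2 / 2)"
  by (intro mult_mono norm_triangle_ineq4) auto
 also have "... <= norm (?X *R x - ?Y *R y) * ?d" unfolding e[symmetric] by (rule norm_cauchy_schwarz)
 finally have "?d * ?d\<^sup>2 <= ?d * (2 * norm (?X *R x - ?Y *R y))" by (simp add: algebra_simps)
 thus ?thesis using False by simp
qed simp

text \<open>The measure clause bounds the push-forward of Lebesgue measure on b by C times Lebesgue
  measure. It is what the approximation arguments use, so neither smoothness nor injectivity of F is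
  part of the notion; off b the values are constrained only by Borel measurability.\<close>

definition almost_id :: "'e::euclidean_space set => real => real => ('e => 'e) => bool" where
 "almost_id b C \<delta> F \<longleftrightarrow> F : bmeas & (ALL z:b. dist (F z) z <= \<delta>) &
   (ALL S:sets borel. emeasure lborel (b \<inter> F -` S) <= ennreal C * emeasure lborel S)"

lemma almost_id_mono: "almost_id b C \<delta> F ==> \<delta> <= \<delta>' ==> almost_id b C \<delta>' F"
 unfolding almost_id_def by force

lemma nn_integral_almost_id:
 assumes F: "almost_id b C \<delta> F" and b: "b : sets borel" and u: "u : bmeas"
 shows "(LI z:b. u (F z)) <= ennreal C * (LI z. u z)"
proof -
 have Fm[measurable]: "F : bmeas" using F by (simp add: almost_id_def)
 note [measurable] = b u
 let ?M = "distr (density lborel (indicator b)) borel F"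
 have "?M <= scale_measure (ennreal C) lborel"
 proof (rule le_measure[THEN iffD2])
  show "ALL S:sets ?M. emeasure ?M S <= emeasure (scale_measure (ennreal C) lborel) S"
  proof
   fix S assume "S : sets ?M"
   hence S[measurable]: "S : sets borel" by simp
   have "emeasure ?M S = (LI z. indicator b z * indicator (F -` S) z)"
    using measurable_sets[OF Fm S] by (simp add: emeasure_distr emeasure_density)
   also have "... = (LI z. indicator (b \<inter> F -` S) z)" by (simp add: indicator_inter_arith)
   also have "... = emeasure lborel (b \<inter> F -` S)" using measurable_sets[OF Fm S] by simp
   also have "... <= ennreal C * emeasure lborel S" using F S by (simp add: almost_id_def)
   finally show "emeasure ?M S <= emeasure (scale_measure (ennreal C) lborel) S" by simp
  qed
 qed simp
 hence "(\<integral>\<^sup>+z. u z \<partial>?M) <= (\<integral>\<^sup>+z. u z \<partial>scale_measure (ennreal C) lborel)"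
  by (intro nn_integral_mono_measure) simp
 moreover have "(\<integral>\<^sup>+z. u z \<partial>?M) = (LI z:b. u (F z))"
  by (simp add: nn_integral_distr nn_integral_density mult.commute)
 ultimately show ?thesis by (simp add: nn_integral_scale_measure)
qed

text \<open>Inner regularity for K and outer regularity for U, with e / 2 each. Inner regularity is
  applied to the finite measure M. A set of measure below e / 2 takes the empty K, so that in the
  other case \<open>measure lborel E - e / 2\<close> is nonnegative.\<close>

lemma compact_open_approx:
 fixes E :: "'e::euclidean_space set"
 assumes E: "E : sets borel" "emeasure lborel E < \<infinity>" and e: "e > 0"
 obtains K U where "compact K" "open U" "K <= E" "E <= U" "emeasure lborel (U - K) <= ennreal e"
proof -
 have lm: "E : lmeasurable" using E by (simp add: fmeasurable_def emeasure_completion)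
 define M where "M = density lborel (indicator E :: 'e => ennreal)"
 have M: "emeasure M B = emeasure lborel (E \<inter> B)" if "B : sets borel" for B
  using that E(1) by (simp add: M_def emeasure_density indicator_inter_arith[symmetric])
 obtain K where K: "compact K" "K <= E" "emeasure lborel (E - K) < ennreal (e / 2)"
 proof (cases "measure lborel E < e / 2")
  case True
  hence "emeasure lborel (E - {}) < ennreal (e / 2)"
   using E by (simp add: emeasure_eq_ennreal_measure ennreal_less_iff)
  thus ?thesis using that[of "{}"] by simp
 next
  case False
  have "emeasure M E = (SUP K\<in>{K. K <= E & compact K}. emeasure M K)"
   by (rule inner_regular) (use E M[of UNIV] in \<open>auto simp: M_def\<close>)
  moreover have "ennreal (measure lborel E - e / 2) < emeasure M E"
  proof -
   have "emeasure lborel E = ennreal (measure lborel E)" by (rule emeasure_eq_ennreal_measure) (use E in auto)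
   thus ?thesis unfolding M[OF E(1)] Int_absorb using False e by (simp only: ennreal_less_iff)
  qed
  ultimately obtain K where K: "K <= E" "compact K" "ennreal (measure lborel E - e / 2) < emeasure M K"
   by (auto simp: less_SUP_iff)
  have Kb: "K : sets borel" using K by (simp add: compact_imp_closed borel_closed)
  have Kf: "emeasure lborel K < \<infinity>" using emeasure_compact_finite[OF K(2)] by simp
  have "ennreal (measure lborel E - e / 2) < emeasure lborel K" using K M[OF Kb] by (simp add: Int_absorb1)
  hence "measure lborel E - e / 2 < measure lborel K"
   using Kf False by (simp add: emeasure_eq_ennreal_measure ennreal_less_iff)
  moreover have "emeasure lborel (E - K) = ennreal (measure lborel E - measure lborel K)"
  proof -
   have m: "emeasure lborel E = ennreal (measure lborel E)" "emeasure lborel K = ennreal (measure lborel K)"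
    by (rule emeasure_eq_ennreal_measure, use E Kf in auto)+
   have "emeasure lborel (E - K) = emeasure lborel E - emeasure lborel K"
    by (rule emeasure_Diff) (use E Kb K(1) Kf in auto)
   thus ?thesis unfolding m by (simp only: ennreal_minus[OF measure_nonneg])
  qed
  ultimately show ?thesis using that[of K] K e by (simp add: ennreal_less_iff ennreal_lessI)
 qed
 have Kb: "K : sets borel" using K by (simp add: compact_imp_closed borel_closed)
 obtain U where U: "open U" "E <= U" "U - E : lmeasurable" "emeasure lebesgue (U - E) < ennreal (e / 2)"
  using sets_lebesgue_outer_open[of E "e / 2"] e lm by auto
 have "emeasure lborel (U - K) = emeasure lborel ((U - E) \<union> (E - K))"
  using K(2) U(2) by (intro arg_cong[where f = "emeasure lborel"]) auto
 also have "... <= emeasure lborel (U - E) + emeasure lborel (E - K)"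
  using U K E Kb by (intro emeasure_subadditive) auto
 also have "... <= ennreal (e / 2) + ennreal (e / 2)"
  using U(1,4) E K(3) by (intro add_mono) (auto simp: emeasure_completion)
 also have "... = ennreal e" using e by (simp add: ennreal_plus[symmetric] del: ennreal_plus)
 finally show ?thesis using that K U by blast
qed

text \<open>Induction on integrable functions: indicators, sums, dominated limits. The bound is
  uniform over the whole class of maps, so \<delta> is fixed before F in every case.\<close>

lemma L1_continuity:
 fixes a :: "'e::euclidean_space => complex"
 assumes a: "integrable lborel a" and b[measurable]: "b : sets borel" and C: "C >= 0" and eps: "eps > 0"
 shows "EX \<delta>>0. ALL F. almost_id b C \<delta> F --> (LI z:b. ennreal (norm (a (F z) - a z))) <= ennreal eps"
 using a eps
proof (induction arbitrary: eps rule: integrable_induct)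
 case (base E c)
 hence E: "E : sets borel" "emeasure lborel E < \<infinity>" by auto
 \<comment> \<open>The final bound has measure e for z in U - K and C * e for F z in U - K, times
   norm c.\<close>
 define e where "e = eps / ((norm c + 1) * (C + 1))"
 have e: "e > 0" using base.prems C by (simp add: e_def add_nonneg_pos)
 obtain K U where KU: "compact K" "open U" "K <= E" "E <= U" "emeasure lborel (U - K) <= ennreal e"
  using compact_open_approx[OF E e] by blast
 have [measurable]: "U - K : sets borel" using KU by (simp add: compact_imp_closed borel_closed borel_open)
 obtain d where d: "d > 0" "!!x y. x : K ==> y ~: U ==> d <= dist x y"
 proof -
  have "closed (- U)" "K \<inter> - U = {}" using KU by auto
  from separate_compact_closed[OF KU(1) this] show ?thesis using that by auto
 qed
 show ?case
 proof (intro exI[of _ "d / 2"] conjI allI impI)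
  show "d / 2 > 0" using d by simp
  fix F assume F: "almost_id b C (d / 2) F"
  have Fm[measurable]: "F : bmeas" using F by (simp add: almost_id_def)
  have "(LI z:b. ennreal (norm (indicator E (F z) *R c - indicator E z *R c)))
   <= (LI z. ennreal (norm c) * (indicator (U - K) z + indicator (U - K) (F z) * indicator b z))"
  proof (rule nn_integral_mono)
   fix z
   show "ennreal (norm (indicator E (F z) *R c - indicator E z *R c)) * indicator b z
    <= ennreal (norm c) * (indicator (U - K) z + indicator (U - K) (F z) * indicator b z)"
   proof (cases "z : b & (F z : E \<longleftrightarrow> z ~: E)")
    case True
    \<comment> \<open>A move shorter than d cannot lead from K out of U. So if exactly one of z and
      F z lies in E, one of the two lies in U - K.\<close>
    have dz: "dist (F z) z < d" using F True d unfolding almost_id_def by force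
    have "z : U - K \<or> F z : U - K"
    proof (cases "z : E")
     case zE: True
     hence "F z : U" if "z : K" using d(2)[OF that, of "F z"] dz by (auto simp: dist_commute)
     thus ?thesis using zE True KU by blast
    next
     case zE: False
     hence "z : U" if "F z : K" using d(2)[OF that, of z] dz by auto
     thus ?thesis using zE True KU by blast
    qed
    hence "1 <= (indicator (U - K) z + indicator (U - K) (F z) * indicator b z :: ennreal)"
     using True by (auto simp: indicator_def)
    from mult_left_mono[OF this, of "ennreal (norm c)"]
    show ?thesis using True by (auto simp: indicator_def)
   qed (auto simp: indicator_def)
  qed
  also have "... = ennreal (norm c) * (emeasure lborel (U - K) + (LI z:b. indicator (U - K) (F z)))"
   by (subst nn_integral_cmult, measurable) (subst nn_integral_add, measurable)
  also have "... <= ennreal (norm c) * (ennreal e + ennreal C * ennreal e)"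
  proof (intro mult_left_mono add_mono KU(5))
   have "(LI z:b. indicator (U - K) (F z)) <= ennreal C * (LI z. indicator (U - K) z)"
    by (rule nn_integral_almost_id[OF F b]) measurable
   also have "... <= ennreal C * ennreal e" using KU(5) by (simp add: mult_left_mono)
   finally show "(LI z:b. indicator (U - K) (F z)) <= ennreal C * ennreal e" .
  qed simp
  also have "... = ennreal (norm c * (C + 1) * e)"
   using C e by (simp add: ennreal_mult[symmetric] ennreal_plus[symmetric] algebra_simps del: ennreal_plus)
  also have "... <= ennreal eps"
  proof (rule ennreal_leI)
   have "norm c * (C + 1) * e <= (norm c + 1) * (C + 1) * e" using C e by (intro mult_right_mono) auto
   also have "... = eps" using C by (simp add: e_def add_nonneg_eq_0_iff)
   finally show "norm c * (C + 1) * e <= eps" .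
  qed
  finally show "(LI z:b. ennreal (norm (indicator E (F z) *R c - indicator E z *R c))) <= ennreal eps" .
 qed
next
 case (add f g)
 have [measurable]: "f : bmeas" "g : bmeas" using add.hyps by auto
 obtain d1 where d1: "d1 > 0" "!!F. almost_id b C d1 F ==> (LI z:b. ennreal (norm (f (F z) - f z))) <= ennreal (eps / 2)"
  using add.IH(1)[of "eps / 2"] add.prems by auto
 obtain d2 where d2: "d2 > 0" "!!F. almost_id b C d2 F ==> (LI z:b. ennreal (norm (g (F z) - g z))) <= ennreal (eps / 2)"
  using add.IH(2)[of "eps / 2"] add.prems by auto
 show ?case
 proof (intro exI[of _ "min d1 d2"] conjI allI impI)
  show "min d1 d2 > 0" using d1 d2 by simp
  fix F assume F: "almost_id b C (min d1 d2) F"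
  have Fm[measurable]: "F : bmeas" using F by (simp add: almost_id_def)
  have "(LI z:b. ennreal (norm (f (F z) + g (F z) - (f z + g z))))
   <= (LI z. ennreal (norm (f (F z) - f z)) * indicator b z + ennreal (norm (g (F z) - g z)) * indicator b z)"
  proof (rule nn_integral_mono)
   fix z
   have "norm (f (F z) + g (F z) - (f z + g z)) <= norm (f (F z) - f z) + norm (g (F z) - g z)"
    using norm_triangle_ineq[of "f (F z) - f z" "g (F z) - g z"] by (simp add: algebra_simps)
   thus "ennreal (norm (f (F z) + g (F z) - (f z + g z))) * indicator b z
     <= ennreal (norm (f (F z) - f z)) * indicator b z + ennreal (norm (g (F z) - g z)) * indicator b z"
    by (auto simp: indicator_def ennreal_plus[symmetric] simp del: ennreal_plus intro: ennreal_leI)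
  qed
  also have "... = (LI z:b. ennreal (norm (f (F z) - f z))) + (LI z:b. ennreal (norm (g (F z) - g z)))"
   by (rule nn_integral_add) measurable
  also have "... <= ennreal (eps / 2) + ennreal (eps / 2)"
   using F by (intro add_mono d1(2) d2(2)) (auto elim: almost_id_mono)
  also have "... = ennreal eps" using add.prems by (simp add: ennreal_plus[symmetric] del: ennreal_plus)
  finally show "(LI z:b. ennreal (norm (f (F z) + g (F z) - (f z + g z)))) <= ennreal eps" .
 qed
next
 case (lim f s)
 have [measurable]: "f : bmeas" "s i : bmeas" for i using lim.hyps by auto
 \<comment> \<open>The error of s i counts C times after F and once without it: C * e + e = eps /
   2.\<close>
 define e where "e = eps / (2 * (C + 1))"
 have e: "e > 0" using lim.prems C by (simp add: e_def add_nonneg_pos)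
 have "(%i. (LI x. norm (f x - s i x))) \<longlonglongrightarrow> 0"
 proof (rule nn_integral_dominated_convergence_norm[where w = "%x. 2 * norm (f x)"])
  have "(LI x. ennreal (norm (f x))) < \<infinity>" using lim.hyps by (simp add: integrable_iff_bounded)
  thus "(LI x. ennreal (2 * norm (f x))) < \<infinity>"
   by (simp add: ennreal_mult nn_integral_cmult ennreal_mult_less_top)
 qed (use lim.hyps in auto)
 hence "\<forall>\<^sub>F i in sequentially. (LI x. norm (f x - s i x)) < ennreal e"
  using e by (intro order_tendstoD) auto
 then obtain i where i: "(LI x. norm (f x - s i x)) < ennreal e" by (auto simp: eventually_sequentially)
 obtain d where d: "d > 0" "!!F. almost_id b C d F ==> (LI z:b. ennreal (norm (s i (F z) - s i z))) <= ennreal (eps / 2)"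
  using lim.IH[of "eps / 2" i] lim.prems by auto
 show ?case
 proof (intro exI[of _ d] conjI allI impI d(1))
  fix F assume F: "almost_id b C d F"
  have Fm[measurable]: "F : bmeas" using F by (simp add: almost_id_def)
  have "(LI z:b. ennreal (norm (f (F z) - f z)))
   <= (LI z. (ennreal (norm (f (F z) - s i (F z))) * indicator b z + ennreal (norm (s i (F z) - s i z)) * indicator b z)
     + ennreal (norm (f z - s i z)))"
  proof (rule nn_integral_mono)
   fix z
   have "norm (f (F z) - f z) <= norm (f (F z) - s i (F z)) + norm (s i (F z) - s i z) + norm (f z - s i z)" by norm
   thus "ennreal (norm (f (F z) - f z)) * indicator b z
    <= (ennreal (norm (f (F z) - s i (F z))) * indicator b z + ennreal (norm (s i (F z) - s i z)) * indicator b z)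
     + ennreal (norm (f z - s i z))"
    by (auto simp: indicator_def ennreal_plus[symmetric] simp del: ennreal_plus intro: ennreal_leI)
  qed
  also have "... = (LI z:b. ennreal (norm (f (F z) - s i (F z))))
    + (LI z:b. ennreal (norm (s i (F z) - s i z))) + (LI z. ennreal (norm (f z - s i z)))"
   by (subst nn_integral_add, measurable) (subst nn_integral_add, measurable)
  also have "... <= ennreal C * ennreal e + ennreal (eps / 2) + ennreal e"
  proof (intro add_mono d(2) F)
   have "(LI z:b. ennreal (norm (f (F z) - s i (F z)))) <= ennreal C * (LI z. ennreal (norm (f z - s i z)))"
    by (rule nn_integral_almost_id[OF F b, of "%z. ennreal (norm (f z - s i z))"]) measurable
   also have "... <= ennreal C * ennreal e" using i by (intro mult_left_mono) auto
   finally show "(LI z:b. ennreal (norm (f (F z) - s i (F z)))) <= ennreal C * ennreal e" .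
   show "(LI z. ennreal (norm (f z - s i z))) <= ennreal e" using i by simp
  qed
  also have "... = ennreal (C * e + eps / 2 + e)"
   using C e lim.prems by (simp add: ennreal_mult[symmetric] ennreal_plus[symmetric] del: ennreal_plus)
  also have "C * e + eps / 2 + e = eps" using C by (simp add: e_def field_simps add_nonneg_eq_0_iff)
  finally show "(LI z:b. ennreal (norm (f (F z) - f z))) <= ennreal eps" .
 qed
qed

text \<open>Apply the \<open>L1\<close> result to m = |a| a, whose norm is |a|^2; the factor 2 in
  \<open>norm_diff_square_le\<close> is the reason for eps / 2.\<close>

lemma L2_continuity:
 fixes a :: "'e::euclidean_space => complex"
 assumes a[measurable]: "a : bmeas" and fin: "(LI z. nsq (a z)) < \<infinity>"
  and b[measurable]: "b : sets borel" and C: "C >= 0" and eps: "eps > 0"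
 shows "EX \<delta>>0. ALL F. almost_id b C \<delta> F --> (LI z:b. nsq (a (F z) - a z)) <= ennreal eps"
proof -
 define m where "m z = norm (a z) *R a z" for z
 have mm[measurable]: "m : bmeas" unfolding m_def by measurable
 have "integrable lborel m" using fin by (simp add: integrable_iff_bounded m_def power2_eq_square)
 from L1_continuity[OF this b C, of "eps / 2"] eps
 obtain \<delta> where \<delta>: "\<delta> > 0" "!!F. almost_id b C \<delta> F ==> (LI z:b. ennreal (norm (m (F z) - m z))) <= ennreal (eps / 2)"
  by auto
 show ?thesis
 proof (intro exI[of _ \<delta>] conjI allI impI \<delta>(1))
  fix F assume F: "almost_id b C \<delta> F"
  have Fm[measurable]: "F : bmeas" using F by (simp add: almost_id_def)
  have "(LI z:b. nsq (a (F z) - a z)) <= (LI z. 2 * (ennreal (norm (m (F z) - m z)) * indicator b z))"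
  proof (rule nn_integral_mono)
   fix z
   have "nsq (a (F z) - a z) <= ennreal (2 * norm (m (F z) - m z))"
    unfolding m_def by (intro ennreal_leI norm_diff_square_le)
   thus "nsq (a (F z) - a z) * indicator b z <= 2 * (ennreal (norm (m (F z) - m z)) * indicator b z)"
    by (auto simp: indicator_def ennreal_mult)
  qed
  also have "... = 2 * (LI z:b. ennreal (norm (m (F z) - m z)))" by (rule nn_integral_cmult) measurable
  also have "... <= 2 * ennreal (eps / 2)" by (intro mult_left_mono \<delta>(2) F) simp
  also have "... = ennreal (2 * (eps / 2))" using eps by (subst ennreal_mult) auto
  also have "2 * (eps / 2) = eps" by simp
  finally show "(LI z:b. nsq (a (F z) - a z)) <= ennreal eps" .
 qed
qed

text \<open>c - m is the mean of c - a over B, and by Cauchy-Schwarz its square is at most the mean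
  of the square. An infinite right side is dealt with separately.\<close>

lemma mean_deviation:
 fixes a :: "'e::euclidean_space => complex"
 assumes a[measurable]: "a : bmeas" and B[measurable]: "B : sets borel"
  and Bf: "emeasure lborel B < \<infinity>" and V: "measure lborel B > 0"
  and fin: "(LI z:B. nsq (a z)) < \<infinity>"
 defines "m \<equiv> (\<integral>z. indicator B z *R a z \<partial>lborel) /\<^sub>R measure lborel B"
 shows "nsq (c - m) <= ennreal (1 / measure lborel B) * (LI z:B. nsq (c - a z))"
proof (cases "\<integral>\<^sup>+z\<in>B. nsq (c - a z) \<partial>lborel")
 case (real x)
 let ?V = "measure lborel B"
 define u where "u z = indicator B z *R (c - a z)" for z
 have um[measurable]: "u : bmeas" unfolding u_def by measurable
 have iB: "integrable lborel (indicator B :: 'e => real)" using Bf by (simp add: integrable_indicator_iff)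
 have n2: "(LI z. nsq (u z)) = ennreal x"
  unfolding real(2)[symmetric] by (intro nn_integral_cong) (auto simp: u_def indicator_def)
 hence i2: "integrable lborel (%z. (norm (u z))\<^sup>2)" and I2: "(\<integral>z. (norm (u z))\<^sup>2 \<partial>lborel) = x"
  using real(1) by (auto simp: integrable_iff_bounded integral_eq_nn_integral)
 have iu: "integrable lborel u"
 proof (rule Bochner_Integration.integrable_bound[OF Bochner_Integration.integrable_add[OF iB i2]])
  show "AE z in lborel. norm (u z) <= norm (indicator B z + (norm (u z))\<^sup>2)"
  proof (rule AE_I2)
   fix z
   have "t <= 1 + t\<^sup>2" for t :: real using zero_le_power2[of "t - 1/2"] by (simp add: power2_eq_square algebra_simps)
   thus "norm (u z) <= norm (indicator B z + (norm (u z))\<^sup>2)" by (cases "z : B") (auto simp: u_def)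
  qed
 qed measurable
 have ic: "integrable lborel (%z. indicator B z *R c)" using iB by (rule integrable_scaleR_left)
 have au: "(%z. indicator B z *R a z) = (%z. indicator B z *R c - u z)" by (auto simp: u_def indicator_def)
 have "(\<integral>z. indicator B z *R a z \<partial>lborel) = ?V *R c - (\<integral>z. u z \<partial>lborel)"
  unfolding au using ic iu Bochner_Integration.integral_scaleR_left[OF iB, of c] by simp
 hence mu: "(\<integral>z. u z \<partial>lborel) = ?V *R (c - m)" using V by (simp add: m_def scaleR_diff_right)
 define N where "N = (\<integral>z. norm (u z) \<partial>lborel)"
 have "?V * norm (c - m) <= N" using integral_norm_bound[of lborel u] V unfolding mu N_def by simp
 moreover have "N\<^sup>2 <= ?V * x"
 proof -
  \<comment> \<open>The minimiser of the quadratic in t whose nonnegativity is the Cauchy-Schwarz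
    inequality.\<close>
  define t where "t = N / ?V"
  have "0 <= (\<integral>z. (norm (u z) - t * indicator B z)\<^sup>2 \<partial>lborel)" by simp
  also have "... = (\<integral>z. (norm (u z))\<^sup>2 - 2 * t * norm (u z) + t\<^sup>2 * indicator B z \<partial>lborel)"
   by (intro Bochner_Integration.integral_cong) (auto simp: u_def indicator_def power2_eq_square algebra_simps)
  also have "... = x - 2 * t * N + t\<^sup>2 * ?V" using i2 iu iB I2 by (simp add: N_def)
  also have "... = x - N\<^sup>2 / ?V" using V by (simp add: t_def power2_eq_square field_simps)
  finally show ?thesis using V by (simp add: field_simps)
 qed
 ultimately have "(?V * norm (c - m))\<^sup>2 <= ?V * x"
  using V by (meson mult_nonneg_nonneg norm_ge_zero order_less_imp_le order_trans power_mono)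
 hence "?V * (?V * (norm (c - m))\<^sup>2) <= ?V * x" by (simp add: power2_eq_square algebra_simps)
 hence "(norm (c - m))\<^sup>2 <= 1 / ?V * x" using V by (simp add: field_simps)
 thus ?thesis using real V by (simp add: ennreal_mult[symmetric] ennreal_leI)
qed (use V in \<open>simp add: ennreal_mult_top\<close>)

lemma nn_integral_lborel_translate:
 fixes f :: "'e::euclidean_space => ennreal"
 assumes [measurable]: "f : bmeas"
 shows "(LI y. f y) = (LI w. f (x + w))" by (subst lborel_distr_plus[of x, symmetric], subst nn_integral_distr) auto

lemma square_sum3: "(norm (x + y + z :: 'v::real_normed_vector))\<^sup>2 <= 3 * ((norm x)\<^sup>2 + (norm y)\<^sup>2 + (norm z)\<^sup>2)"
proof -
 have "norm (x + y + z) <= norm x + norm y + norm z" by norm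
 hence "(norm (x + y + z))\<^sup>2 <= (norm x + norm y + norm z)\<^sup>2" by (intro power_mono) auto
 also have "... <= 3 * ((norm x)\<^sup>2 + (norm y)\<^sup>2 + (norm z)\<^sup>2)"
  using zero_le_power2[of "norm x - norm y"] zero_le_power2[of "norm y - norm z"] zero_le_power2[of "norm x - norm z"]
  by (simp add: power2_eq_square algebra_simps)
 finally show ?thesis .
qed

definition ball_mean :: "real => 'e::euclidean_space => ('e => complex) => complex" where
 "ball_mean s x a = (\<integral>y. indicator (ball x s) y *R a y \<partial>lborel) /\<^sub>R measure lborel (ball x s)"

lemma measure_ball_center: "measure lborel (ball (x :: 'e::euclidean_space) s) = measure lborel (ball (0 :: 'e) s)"
proof (cases "s >= 0")
 case True
 thus ?thesis by (simp add: content_ball_conv_unit_ball[of s x] content_ball_conv_unit_ball[of s 0])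
next
 case False
 hence e: "ball x s = {}" "ball (0 :: 'e) s = {}" by auto
 show ?thesis unfolding e ..
qed

text \<open>The value a x is compared with the mean over a ball of radius s that contains x. This
  ball lies in the ball of radius 2 s around x, so after Fubini only translations by |w| < 2 s
  occur. The factor 2 ^ DIM is the ratio of the two volumes.\<close>

lemma ball_mean_approx:
 fixes a :: "'e::euclidean_space => complex" and \<zeta> :: "nat => 'e"
 assumes a[measurable]: "a : bmeas" and b[measurable]: "b : sets borel" and s: "s > 0"
  and fin: "!!i. i < N ==> (LI z:ball (\<zeta> i) s. nsq (a z)) < \<infinity>"
  and tr: "!!w. norm w < 2 * s ==> (LI x:b. nsq (a x - a (x + w))) <= ennreal eps"
  and eps: "eps >= 0"
  and idx: "!!x. x : b ==> idx x < N & x : ball (\<zeta> (idx x)) s"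
 shows "(LI x:b. nsq (a x - ball_mean s (\<zeta> (idx x)) a)) <= ennreal (2 ^ DIM('e) * eps)"
proof -
 define V where "V = measure lborel (ball (0 :: 'e) s)"
 have V: "V > 0" using s by (simp add: V_def content_ball_pos)
 have V2: "measure lborel (ball (0 :: 'e) (2 * s)) = 2 ^ DIM('e) * V"
  using s unfolding V_def by (simp add: content_ball_conv_unit_ball[of "2 * s"] content_ball_conv_unit_ball[of s] power_mult_distrib)
 let ?B = "ball (0 :: 'e) (2 * s)"
 define T where "T x w = nsq (a x - a (x + w))" for x w
 have Tm[measurable]: "(%(x, w). T x w) : borel_measurable (lborel \<Otimes>\<^sub>M lborel)"
  unfolding T_def by measurable
 have [measurable]: "(indicator b :: _ => ennreal) : bmeas"
  "(indicator ?B :: _ => ennreal) : bmeas" by (rule borel_measurable_indicator, simp add: b)+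
 have pt: "nsq (a x - ball_mean s (\<zeta> (idx x)) a) <= ennreal (1 / V) * (LI w:?B. T x w)"
  if x: "x : b" for x
 proof -
  let ?z = "\<zeta> (idx x)"
  have "nsq (a x - ball_mean s ?z a)
    <= ennreal (1 / measure lborel (ball ?z s)) * (LI y:ball ?z s. nsq (a x - a y))"
   unfolding ball_mean_def using idx[OF x] fin V emeasure_lborel_ball_finite[of ?z s]
   by (intro mean_deviation) (auto simp: measure_ball_center[of ?z] V_def)
  also have "measure lborel (ball ?z s) = V" by (simp add: measure_ball_center[of ?z] V_def)
  also have "(LI y:ball ?z s. nsq (a x - a y))
   = (LI w. nsq (a x - a (x + w)) * indicator (ball ?z s) (x + w))"
  proof (rule nn_integral_lborel_translate)
   have [measurable]: "ball ?z s : sets borel" by simp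
   show "(%y. nsq (a x - a y) * indicator (ball ?z s) y) : bmeas" by measurable
  qed
  also have "... <= (LI w:?B. T x w)"
  proof (rule nn_integral_mono)
   fix w
   have "w : ?B" if "x + w : ball ?z s"
   proof -
    have "dist ?z x < s" "dist ?z (x + w) < s" using idx[OF x] that by auto
    hence "norm w < s + s" unfolding dist_norm by norm
    thus ?thesis by simp
   qed
   thus "nsq (a x - a (x + w)) * indicator (ball ?z s) (x + w) <= T x w * indicator ?B w"
    by (auto simp: T_def indicator_def)
  qed
  finally show ?thesis by (simp add: mult_left_mono)
 qed
 have "(LI x:b. nsq (a x - ball_mean s (\<zeta> (idx x)) a))
   <= (LI x. ennreal (1 / V) * (LI w. T x w * indicator ?B w * indicator b x))"
 proof (rule nn_integral_mono)
  fix x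
  show "nsq (a x - ball_mean s (\<zeta> (idx x)) a) * indicator b x
   <= ennreal (1 / V) * (LI w. T x w * indicator ?B w * indicator b x)" using pt[of x] by (cases "x : b") auto
 qed
 also have "... = ennreal (1 / V) * (LI x. (LI w. T x w * indicator ?B w * indicator b x))"
  by (rule nn_integral_cmult) measurable
 also have "(LI x. (LI w. T x w * indicator ?B w * indicator b x))
   = (LI w. (LI x. T x w * indicator ?B w * indicator b x))" by (rule lborel_pair.Fubini'[symmetric]) measurable
 also have "... <= (LI w. ennreal eps * indicator ?B w)"
 proof (rule nn_integral_mono)
  fix w
  have "(LI x. T x w * indicator ?B w * indicator b x) = (LI x:b. T x w)" if "w : ?B"
   using that by (intro nn_integral_cong) auto
  thus "(LI x. T x w * indicator ?B w * indicator b x) <= ennreal eps * indicator ?B w"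
   using tr[of w] by (cases "w : ?B") (auto simp: T_def)
 qed
 also have "... = ennreal eps * ennreal (2 ^ DIM('e) * V)"
 proof -
  have "emeasure lborel ?B = ennreal (2 ^ DIM('e) * V)"
   unfolding V2[symmetric] using emeasure_lborel_ball_finite[of "0 :: 'e" "2 * s"]
   by (intro emeasure_eq_ennreal_measure) auto
  thus ?thesis by (subst nn_integral_cmult_indicator) auto
 qed
 also have "ennreal (1 / V) * (ennreal eps * ennreal (2 ^ DIM('e) * V)) = ennreal (2 ^ DIM('e) * eps)"
  using V eps by (simp add: ennreal_mult[symmetric])
 finally show ?thesis by (simp add: mult_left_mono)
qed

text \<open>A finite net of b of mesh s supplies the centres, and a function is compared with its
  mean at a centre near x. Two functions with nearly equal means differ by three terms, hence the
  factor 3 of \<open>square_sum3\<close>; the approximation term counts for both functions, hence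
  6.\<close>

lemma local_means:
 fixes b U :: "'e::euclidean_space set"
 assumes b: "compact b" and s: "s > 0" and U: "U : sets borel" "!!x. x : b ==> ball x s <= U"
 obtains N :: nat and \<zeta> :: "nat => 'e" where
  "!!a R i. a : bmeas ==> 0 <= R ==> (LI z:U. nsq (a z)) <= ennreal R ==> i < N
   ==> (norm (ball_mean s (\<zeta> i) a))\<^sup>2 <= R / measure lborel (ball (0::'e) s)"
  "!!a a' R eps \<eta>. a : bmeas ==> a' : bmeas ==>
   (LI z:U. nsq (a z)) <= ennreal R ==> (LI z:U. nsq (a' z)) <= ennreal R ==>
   (!!w. norm w < 2 * s ==> (LI x:b. nsq (a x - a (x + w))) <= ennreal eps) ==>
   (!!w. norm w < 2 * s ==> (LI x:b. nsq (a' x - a' (x + w))) <= ennreal eps) ==>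
   (!!i. i < N ==> norm (ball_mean s (\<zeta> i) a - ball_mean s (\<zeta> i) a') <= \<eta>) ==> 0 <= eps ==> 0 <= \<eta> ==>
   (LI x:b. nsq (a x - a' x)) <= ennreal (6 * 2 ^ DIM('e) * eps + 3 * \<eta>\<^sup>2 * measure lborel b)"
proof -
 have bb[measurable]: "b : sets borel" using b by (simp add: compact_imp_closed borel_closed)
 have "EX Z. finite Z & Z <= b & b <= (\<Union>x\<in>Z. ball x s)"
  using seq_compact_imp_totally_bounded[OF iffD1[OF compact_eq_seq_compact_metric b]] s by simp
 then obtain Z where Z: "finite Z" "Z <= b" "b <= (\<Union>x\<in>Z. ball x s)" by blast
 obtain \<zeta> where \<zeta>: "bij_betw \<zeta> {0..<card Z} Z" using ex_bij_betw_nat_finite[OF Z(1)] by blast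
 define N where "N = card Z"
 have \<zeta>b: "\<zeta> i : b" if "i < N" for i using \<zeta> that Z(2) by (auto simp: N_def bij_betw_def)
 \<comment> \<open>Taking the least admissible index makes the choice of the centre
   measurable.\<close>
 define idx where "idx x = (LEAST i. i < N & x : ball (\<zeta> i) s)" for x
 have idx: "idx x < N & x : ball (\<zeta> (idx x)) s" if xb: "x : b" for x
 proof -
  obtain z where "z : Z" "x : ball z s" using Z(3) xb by blast
  moreover then obtain i where "i < N" "\<zeta> i = z" using bij_betw_imp_surj_on[OF \<zeta>] unfolding N_def by (metis atLeastLessThan_iff imageE)
  ultimately have "EX i. i < N & x : ball (\<zeta> i) s" by blast
  thus ?thesis unfolding idx_def by (rule LeastI_ex)
 qed
 have idxm: "idx : measurable borel (count_space UNIV)" unfolding idx_def[abs_def]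
 proof (rule measurable_Least)
  fix i
  have "{x. i < N & x : ball (\<zeta> i) s} : sets borel" by (cases "i < N") auto
  thus "(%x. i < N & x : ball (\<zeta> i) s) : measurable borel (count_space UNIV)" by (simp add: pred_def)
 qed
 have sub: "(LI z:ball (\<zeta> i) s. nsq (a z)) <= (LI z:U. nsq (a z))"
  if "i < N" for i and a :: "'e => complex"
  using U(2)[OF \<zeta>b[OF that]] by (intro nn_integral_mono) (auto simp: indicator_def)
 have V: "measure lborel (ball (0::'e) s) > 0" using s by (simp add: content_ball_pos)
 show ?thesis
 proof (rule that[of N \<zeta>])
  fix a :: "'e => complex" and R i
  assume a: "a : bmeas" and R: "0 <= R" "(LI z:U. nsq (a z)) <= ennreal R" and i: "i < N"
  have le: "(LI z:ball (\<zeta> i) s. nsq (a z)) <= ennreal R" using sub[OF i, of a] R(2) by (rule order_trans)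
  let ?V = "measure lborel (ball (\<zeta> i) s)"
  have "nsq (0 - ball_mean s (\<zeta> i) a) <= ennreal (1 / ?V) * (LI z:ball (\<zeta> i) s. nsq (0 - a z))"
   unfolding ball_mean_def using le V emeasure_lborel_ball_finite[of "\<zeta> i" s]
   by (intro mean_deviation a) (auto simp: measure_ball_center[of "\<zeta> i"] order_le_less_trans)
  also have "... <= ennreal (1 / ?V) * ennreal R" using le by (intro mult_left_mono) auto
  also have "... = ennreal (R / ?V)" using R(1) by (simp add: ennreal_mult[symmetric])
  finally show "(norm (ball_mean s (\<zeta> i) a))\<^sup>2 <= R / measure lborel (ball (0::'e) s)"
   using R(1) V by (simp add: measure_ball_center[of "\<zeta> i"])
 next
  fix a a' :: "'e => complex" and R eps \<eta>
  assume a[measurable]: "a : bmeas" and a'[measurable]: "a' : bmeas"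
   and R: "(LI z:U. nsq (a z)) <= ennreal R"
    "(LI z:U. nsq (a' z)) <= ennreal R"
   and tr: "!!w. norm w < 2 * s ==> (LI x:b. nsq (a x - a (x + w))) <= ennreal eps"
    "!!w. norm w < 2 * s ==> (LI x:b. nsq (a' x - a' (x + w))) <= ennreal eps"
   and close: "!!i. i < N ==> norm (ball_mean s (\<zeta> i) a - ball_mean s (\<zeta> i) a') <= \<eta>"
   and eps: "0 <= eps" and \<eta>: "0 <= \<eta>"
  define m where "m x = ball_mean s (\<zeta> (idx x)) a" for x
  define m' where "m' x = ball_mean s (\<zeta> (idx x)) a'" for x
  have [measurable]: "m : bmeas" "m' : bmeas" unfolding m_def m'_def using idxm by (auto intro: measurable_compose)
  have fin: "(LI z:ball (\<zeta> i) s. nsq (a z)) < \<infinity>"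
   "(LI z:ball (\<zeta> i) s. nsq (a' z)) < \<infinity>" if "i < N" for i
   using order_trans[OF sub[OF that, of a] R(1)] order_trans[OF sub[OF that, of a'] R(2)]
   by (auto intro: order_le_less_trans)
  have ap: "(LI x:b. nsq (a x - m x)) <= ennreal (2 ^ DIM('e) * eps)"
   unfolding m_def by (rule ball_mean_approx[OF a bb s fin(1) tr(1) eps idx])
  have ap': "(LI x:b. nsq (a' x - m' x)) <= ennreal (2 ^ DIM('e) * eps)"
   unfolding m'_def by (rule ball_mean_approx[OF a' bb s fin(2) tr(2) eps idx])
  have "(LI x:b. nsq (a x - a' x))
   <= (LI x. 3 * (nsq (a x - m x) * indicator b x + ennreal (\<eta>\<^sup>2) * indicator b x
     + nsq (a' x - m' x) * indicator b x))"
  proof (rule nn_integral_mono)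
   fix x
   show "nsq (a x - a' x) * indicator b x
    <= 3 * (nsq (a x - m x) * indicator b x + ennreal (\<eta>\<^sup>2) * indicator b x
     + nsq (a' x - m' x) * indicator b x)"
   proof (cases "x : b")
    case True
    have "a x - a' x = (a x - m x) + (m x - m' x) + (m' x - a' x)" by simp
    hence "(norm (a x - a' x))\<^sup>2 <= 3 * ((norm (a x - m x))\<^sup>2 + (norm (m x - m' x))\<^sup>2 + (norm (m' x - a' x))\<^sup>2)"
     using square_sum3 by metis
    moreover have "(norm (m x - m' x))\<^sup>2 <= \<eta>\<^sup>2"
     using close[of "idx x"] idx[OF True] by (intro power_mono) (auto simp: m_def m'_def)
    ultimately have "(norm (a x - a' x))\<^sup>2 <= 3 * ((norm (a x - m x))\<^sup>2 + \<eta>\<^sup>2 + (norm (a' x - m' x))\<^sup>2)"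
     by (simp add: norm_minus_commute)
    hence "nsq (a x - a' x) <= ennreal (3 * ((norm (a x - m x))\<^sup>2 + \<eta>\<^sup>2 + (norm (a' x - m' x))\<^sup>2))"
     by (rule ennreal_leI)
    thus ?thesis using True by (simp add: ennreal_mult ennreal_plus)
   qed simp
  qed
  also have "... = 3 * ((LI x:b. nsq (a x - m x)) + ennreal (\<eta>\<^sup>2) * emeasure lborel b
    + (LI x:b. nsq (a' x - m' x)))"
   by (subst nn_integral_cmult, measurable, subst nn_integral_add, measurable, subst nn_integral_add, measurable)
    (simp add: nn_integral_cmult_indicator)
  also have "... <= 3 * (ennreal (2 ^ DIM('e) * eps) + ennreal (\<eta>\<^sup>2) * ennreal (measure lborel b) + ennreal (2 ^ DIM('e) * eps))"
   using emeasure_compact_finite[OF b]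
   by (intro mult_left_mono add_mono ap ap') (auto simp: emeasure_eq_ennreal_measure)
  also have "... = ennreal (3 * (2 ^ DIM('e) * eps + \<eta>\<^sup>2 * measure lborel b + 2 ^ DIM('e) * eps))"
   proof -
   have 1: "ennreal (2 ^ DIM('e) * eps) + ennreal (\<eta>\<^sup>2) * ennreal (measure lborel b) + ennreal (2 ^ DIM('e) * eps)
     = ennreal (2 ^ DIM('e) * eps + \<eta>\<^sup>2 * measure lborel b + 2 ^ DIM('e) * eps)"
   proof -
    have "ennreal x + ennreal y * ennreal w + ennreal x = ennreal (x + y * w + x)" if "x >= 0" "y >= 0" "w >= 0" for x y w
     using that by (simp only: ennreal_mult ennreal_plus add_nonneg_nonneg mult_nonneg_nonneg)
    thus ?thesis using eps by simp
   qed
   show ?thesis unfolding 1 by (subst ennreal_mult) (use eps in \<open>auto intro!: add_nonneg_nonneg mult_nonneg_nonneg\<close>)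
  qed
  finally show "(LI x:b. nsq (a x - a' x)) <= ennreal (6 * 2 ^ DIM('e) * eps + 3 * \<eta>\<^sup>2 * measure lborel b)"
   by (simp add: algebra_simps)
 qed
qed

text \<open>Rounding real and imaginary parts to a grid of mesh \<eta> / 2 leaves finitely many
  codes. One element of S is kept per code, so the net lies in S itself.\<close>

lemma finite_net_of_bounded_coordinates:
 fixes T :: "'x => 'i => complex"
 assumes I: "finite I" and bd: "!!x i. x : S ==> i : I ==> norm (T x i) <= R" and \<eta>: "\<eta> > 0"
 shows "EX K. finite K & K <= S & (ALL x:S. EX k:K. ALL i:I. norm (T x i - T k i) <= \<eta>)"
proof -
 define fl where "fl t = \<lfloor>t * 2 / \<eta>\<rfloor>" for t :: real
 define m where "m = \<lceil>\<bar>R\<bar> * 2 / \<eta>\<rceil> + 1"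
 have fl_bd: "fl t : {-m..m}" if "\<bar>t\<bar> <= R" for t
 proof -
  have "\<bar>t * 2 / \<eta>\<bar> <= \<bar>R\<bar> * 2 / \<eta>" using that \<eta> by (simp add: abs_mult divide_right_mono)
  hence X: "- (\<bar>R\<bar> * 2 / \<eta>) <= t * 2 / \<eta>" "t * 2 / \<eta> <= \<bar>R\<bar> * 2 / \<eta>" by linarith+
  hence "fl t <= \<lceil>\<bar>R\<bar> * 2 / \<eta>\<rceil>" "- \<lceil>\<bar>R\<bar> * 2 / \<eta>\<rceil> <= fl t"
   unfolding fl_def using floor_mono[OF X(1)] floor_mono[OF X(2)] floor_le_ceiling[of "\<bar>R\<bar> * 2 / \<eta>"]
   by (auto simp: ceiling_def)
  thus ?thesis by (simp add: m_def)
 qed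
 have fl_eq: "\<bar>t - t'\<bar> <= \<eta> / 2" if "fl t = fl t'" for t t'
 proof -
  have "\<bar>t * 2 / \<eta> - t' * 2 / \<eta>\<bar> <= 1" using that unfolding fl_def by linarith
  hence "\<bar>(t - t') * (2 / \<eta>)\<bar> <= 1" by (simp add: diff_divide_distrib left_diff_distrib)
  hence "\<bar>t - t'\<bar> * (2 / \<eta>) <= 1" using \<eta> by (simp only: abs_mult) simp
  thus ?thesis using \<eta> by (simp add: field_simps)
 qed
 define code where "code x = (\<lambda>i\<in>I. (fl (Re (T x i)), fl (Im (T x i))))" for x
 have sub: "code ` S <= (\<Pi>\<^sub>E i\<in>I. {-m..m} \<times> {-m..m})"
 proof (rule image_subsetI)
  fix x assume x: "x : S"
  have "\<bar>Re (T x i)\<bar> <= R & \<bar>Im (T x i)\<bar> <= R" if "i : I" for i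
   using bd[OF x that] abs_Re_le_cmod[of "T x i"] abs_Im_le_cmod[of "T x i"] by linarith
  thus "code x : (\<Pi>\<^sub>E i\<in>I. {-m..m} \<times> {-m..m})" using fl_bd by (auto simp: code_def simp del: atLeastAtMost_iff)
 qed
 have "finite (\<Pi>\<^sub>E i\<in>I. {-m..m} \<times> {-m..m})" by (rule finite_PiE[OF I]) simp
 with sub have fin: "finite (code ` S)" by (rule finite_subset)
 define K where "K = inv_into S code ` (code ` S)"
 show ?thesis
 proof (intro exI[of _ K] conjI ballI)
  show "finite K" using fin by (simp add: K_def)
  show "K <= S" by (auto simp: K_def inv_into_into)
  fix x assume x: "x : S"
  define k where "k = inv_into S code (code x)"
  have "k : K" "code k = code x" using x by (auto simp: K_def k_def f_inv_into_f)
  moreover have "norm (T x i - T k i) <= \<eta>" if i: "i : I" for i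
  proof -
   have "code x i = code k i" by (rule fun_cong[OF \<open>code k = code x\<close>[symmetric]])
   hence "fl (Re (T x i)) = fl (Re (T k i))" "fl (Im (T x i)) = fl (Im (T k i))" using i by (auto simp: code_def)
   hence "\<bar>Re (T x i - T k i)\<bar> <= \<eta> / 2" "\<bar>Im (T x i - T k i)\<bar> <= \<eta> / 2"
    using fl_eq by auto
   thus ?thesis using cmod_le[of "T x i - T k i"] by linarith
  qed
  ultimately show "EX k:K. ALL i:I. norm (T x i - T k i) <= \<eta>" by blast
 qed
qed

section \<open>Local bounds and coordinate lines\<close>

lemma continuous_bounded_on_compact:
 fixes f :: "'x::topological_space => real"
 assumes "compact L" "continuous_on L f"
 obtains M where "M >= 0" "!!x. x : L ==> \<bar>f x\<bar> <= M"
proof -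
 have "bounded (f ` L)" using compact_continuous_image[OF assms(2,1)] by (rule compact_imp_bounded)
 then obtain M where M: "!!y. y : f ` L ==> norm y <= M" unfolding bounded_iff by blast
 show ?thesis
 proof (rule that[of "max 0 M"])
  show "\<bar>f x\<bar> <= max 0 M" if "x : L" for x using M[of "f x"] that by auto
 qed simp
qed

lemma sum_Basis_le:
 fixes u :: "'e::euclidean_space" and a :: "'e => real" and M :: real
 assumes "!!b. b : Basis ==> \<bar>a b\<bar> <= M"
 shows "\<bar>SUM b:Basis. (u \<bullet> b) * a b\<bar> <= DIM('e) * M * norm u"
proof -
 have "\<bar>SUM b:Basis. (u \<bullet> b) * a b\<bar> <= (SUM b:(Basis :: 'e set). norm u * M)"
 proof (rule order_trans[OF sum_abs sum_mono])
  fix b :: 'e assume "b : Basis"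
  thus "\<bar>(u \<bullet> b) * a b\<bar> <= norm u * M"
   unfolding abs_mult by (intro mult_mono assms Basis_le_norm) auto
 qed
 thus ?thesis by (simp add: algebra_simps)
qed

lemma C1_differentiable_of_Ck:
 fixes f :: "real => 'v::real_normed_vector"
 assumes "Ck_on (Suc 0) f W" "S <= W"
 shows "f C1_differentiable_on S" unfolding C1_differentiable_on_def
proof (intro exI[of _ "%t. fd f t 1"] conjI ballI)
 fix t assume "t : S"
 hence d: "(f has_derivative fd f t) (at t)" using Ck_on_Suc_has_derivative[OF assms(1)] assms(2) by blast
 have "fd f t h = h *R fd f t 1" for h using linear_scale[OF has_derivative_linear[OF d], of h 1] by simp
 hence "fd f t = (%h. h *R fd f t 1)" by blast
 thus "(f has_vector_derivative fd f t 1) (at t)" using d by (simp add: has_vector_derivative_def)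
next
 show "continuous_on S (%t. fd f t 1)" using assms by (auto intro: continuous_on_subset)
qed

lemma Ck_on_affine: "Ck_on k (%t::real. z + t *R (a :: 'v::real_normed_vector)) S"
proof -
 have "Ck_on k (%t::real. z + t *R a) UNIV"
  by (intro Ck_on_add Ck_on_const Ck_on_bounded_linear bounded_linear_scaleR_left) auto
 thus ?thesis by (rule Ck_on_subset) simp
qed

section \<open>Bounds on compact coordinate sets, and coordinate segments as competitors for
  distances\<close>

context herm_mfd
begin

text \<open>A single constant for all comparisons with Euclidean geometry keeps the later
  inequalities short; K >= 1 lets powers of K be compared freely.\<close>

definition tame :: "('a, 'n) chart => (complex^'n) set => real => bool" where
 "tame c L K \<longleftrightarrow> c : A & L <= img c & 1 <= K &
  (ALL z:L. (ALL u. gmet c z u u <= K * (norm u)\<^sup>2) & (ALL u. (norm u)\<^sup>2 <= K * gmet c z u u) &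
   (ALL u v. norm (chris c z u v) <= K * norm u * norm v) & rho c z <= K & 1 <= K * rho c z)"

lemma continuous_gmet: "c : A ==> continuous_on (img c) (%z. gmet c z u v)" using Ck_gmet[of c 0 u v] by simp

text \<open>The upper bound comes from finitely many continuous functions
  \<open>gmet c z i j\<close>; the lower one is the minimum of the metric on L times the unit
  sphere, extended by homogeneity.\<close>

lemma gmet_bounds:
 assumes c: "c : A" and L: "compact L" "L <= img c"
 obtains K where "K >= 0" "!!z u v. z : L ==> \<bar>gmet c z u v\<bar> <= K * norm u * norm v"
  "!!z u. z : L ==> (norm u)\<^sup>2 <= K * gmet c z u u"
proof -
 let ?D = "real (DIM(complex^'n))"
 have "continuous_on L (%z. SUM i:Basis. SUM j:Basis. \<bar>gmet c z i j\<bar>)"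
  by (intro continuous_on_sum continuous_on_rabs continuous_on_subset[OF continuous_gmet[OF c] L(2)])
 then obtain M where M: "M >= 0" "!!z. z : L ==> \<bar>SUM i:Basis. SUM j:Basis. \<bar>gmet c z i j\<bar>\<bar> <= M"
  using continuous_bounded_on_compact[OF L(1)] by blast
 have Mij: "\<bar>gmet c z i j\<bar> <= M" if "z : L" "i : Basis" "j : Basis" for z i j
 proof -
  have "\<bar>gmet c z i j\<bar> <= (SUM j:Basis. \<bar>gmet c z i j\<bar>)"
   using that by (intro member_le_sum[of j, where f = "%j. \<bar>gmet c z i j\<bar>"]) auto
  also have "... <= (SUM i:Basis. SUM j:Basis. \<bar>gmet c z i j\<bar>)"
   using that by (intro member_le_sum[of i, where f = "%i. SUM j:Basis. \<bar>gmet c z i j\<bar>"]) (auto intro: sum_nonneg)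
  finally show ?thesis using M(2)[OF that(1)] by linarith
 qed
 have up: "\<bar>gmet c z u v\<bar> <= ?D * (?D * M) * norm u * norm v" if z: "z : L" for z u v
 proof -
  have zi: "z : img c" using z L by blast
  have 1: "\<bar>gmet c z i v\<bar> <= ?D * M * norm v" if "i : Basis" for i
   using sum_Basis_le[of "%j. gmet c z i j" M v] Mij[OF z that]
   by (subst linear_expand[OF linear_gmet_right[OF c zi]]) simp
  have "\<bar>gmet c z u v\<bar> <= ?D * (?D * M * norm v) * norm u"
   using sum_Basis_le[of "%i. gmet c z i v" "?D * M * norm v" u] 1
   by (subst linear_expand[OF linear_gmet_left[OF c zi]]) simp
  thus ?thesis by (simp add: mult_ac)
 qed
 have low: "EX m>0. ALL z:L. ALL u. m * (norm u)\<^sup>2 <= gmet c z u u"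
 proof (cases "L = {}")
  case False
  let ?S = "sphere (0 :: complex^'n) 1"
  have Sne: "?S ~= {}" by (metis SOME_Basis dist_0_norm empty_iff mem_sphere norm_Basis)
  have "continuous_on (L \<times> ?S) (%x. SUM i:Basis. SUM j:Basis. (snd x \<bullet> i) * ((snd x \<bullet> j) * gmet c (fst x) i j))"
   by (intro continuous_intros continuous_on_compose2[OF continuous_on_subset[OF continuous_gmet[OF c] L(2)]]) auto
  hence "continuous_on (L \<times> ?S) (%x. gmet c (fst x) (snd x) (snd x))"
   using L(2) by (subst continuous_on_cong[OF refl gmet_expand[OF c]]) auto
  moreover have "compact (L \<times> ?S)" using L(1) by (intro compact_Times) auto
  ultimately obtain x where x: "x : L \<times> ?S" "!!y. y : L \<times> ?S ==> gmet c (fst x) (snd x) (snd x) <= gmet c (fst y) (snd y) (snd y)"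
   using continuous_attains_inf[of "L \<times> ?S"] False Sne by blast
  define m where "m = gmet c (fst x) (snd x) (snd x)"
  have "m > 0" unfolding m_def using x(1) L(2) by (intro gmet_props(4)[OF c]) auto
  moreover have "m * (norm u)\<^sup>2 <= gmet c z u u" if "z : L" for z u
  proof (cases "u = 0")
   case False
   have zi: "z : img c" using that L by blast
   have "m <= gmet c z (u /\<^sub>R norm u) (u /\<^sub>R norm u)"
    using x(2)[of "(z, u /\<^sub>R norm u)"] that False by (simp add: m_def)
   also have "... = gmet c z u u / (norm u)\<^sup>2"
    by (simp add: linear_scale[OF linear_gmet_left[OF c zi]] linear_scale[OF linear_gmet_right[OF c zi]] power2_eq_square divide_inverse)
   finally show ?thesis using False by (simp add: field_simps)
  qed (use that L linear_0[OF linear_gmet_left[OF c]] in auto)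
  ultimately show ?thesis by blast
 qed (auto intro: exI[of _ 1])
 then obtain m where m: "m > 0" "!!z u. z : L ==> m * (norm u)\<^sup>2 <= gmet c z u u" by blast
 define K where "K = max (?D * (?D * M)) (1 / m)"
 show ?thesis
 proof (rule that[of K])
  show "K >= 0" using m by (simp add: K_def le_max_iff_disj)
  show "\<bar>gmet c z u v\<bar> <= K * norm u * norm v" if "z : L" for z u v
   by (rule order_trans[OF up[OF that]]) (auto simp: K_def intro!: mult_right_mono)
  show "(norm u)\<^sup>2 <= K * gmet c z u u" if "z : L" for z u
  proof -
   have g0: "0 <= gmet c z u u" using m(2)[OF that, of u] m(1) by (meson mult_nonneg_nonneg order_less_imp_le order_trans zero_le_power2)
   have "(norm u)\<^sup>2 <= (1 / m) * gmet c z u u" using m(2)[OF that, of u] m(1) by (simp add: field_simps)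
   also have "... <= K * gmet c z u u" using g0 by (intro mult_right_mono) (auto simp: K_def)
   finally show ?thesis .
  qed
 qed
qed

lemma dgmet_bound:
 assumes c: "c : A" and L: "compact L" "L <= img c"
 obtains K where "K >= 0" "!!z x a b. z : L ==> \<bar>dgmet c z x a b\<bar> <= K * norm x * norm a * norm b"
proof -
 let ?D = "real (DIM(complex^'n))"
 have "continuous_on (img c) (%z. dgmet c z x i j)" for x i j
  using Ck_on_Suc_frechet[OF Ck_gmet[OF c, of "Suc 0" i j], of x] by simp
 hence "continuous_on L (%z. SUM x:Basis. SUM i:Basis. SUM j:Basis. \<bar>dgmet c z x i j\<bar>)"
  using L(2) by (intro continuous_on_sum continuous_on_rabs) (blast intro: continuous_on_subset)
 then obtain M where M: "M >= 0" "!!z. z : L ==> \<bar>SUM x:Basis. SUM i:Basis. SUM j:Basis. \<bar>dgmet c z x i j\<bar>\<bar> <= M"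
  using continuous_bounded_on_compact[OF L(1)] by blast
 have Mij: "\<bar>dgmet c z x i j\<bar> <= M" if "z : L" "x : Basis" "i : Basis" "j : Basis" for z x i j
 proof -
  have "\<bar>dgmet c z x i j\<bar> <= (SUM j:Basis. \<bar>dgmet c z x i j\<bar>)"
   using that by (intro member_le_sum[of j, where f = "%j. \<bar>dgmet c z x i j\<bar>"]) auto
  also have "... <= (SUM i:Basis. SUM j:Basis. \<bar>dgmet c z x i j\<bar>)"
   using that by (intro member_le_sum[of i, where f = "%i. SUM j:Basis. \<bar>dgmet c z x i j\<bar>"]) (auto intro: sum_nonneg)
  also have "... <= (SUM x:Basis. SUM i:Basis. SUM j:Basis. \<bar>dgmet c z x i j\<bar>)"
   using that by (intro member_le_sum[of x, where f = "%x. SUM i:Basis. SUM j:Basis. \<bar>dgmet c z x i j\<bar>"]) (auto intro!: sum_nonneg)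
  finally show ?thesis using M(2)[OF that(1)] by linarith
 qed
 show ?thesis
 proof (rule that[of "?D * (?D * (?D * M))"])
  show "?D * (?D * (?D * M)) >= 0" using M by simp
  fix z x a b assume z: "z : L"
  have zi: "z : img c" using z L by blast
  have 1: "\<bar>dgmet c z x i j\<bar> <= ?D * M * norm x" if "i : Basis" "j : Basis" for i j
   using sum_Basis_le[of "%y. dgmet c z y i j" M x] Mij[OF z] that
   by (subst linear_expand[OF linear_dgmet[OF c zi]]) simp
  have 2: "\<bar>SUM j:Basis. (b \<bullet> j) * dgmet c z x i j\<bar> <= ?D * (?D * M * norm x) * norm b" if "i : Basis" for i
   using sum_Basis_le[of "%j. dgmet c z x i j" "?D * M * norm x" b] 1[OF that] by simp
  have "\<bar>SUM i:Basis. (a \<bullet> i) * (SUM j:Basis. (b \<bullet> j) * dgmet c z x i j)\<bar> <= ?D * (?D * (?D * M * norm x) * norm b) * norm a"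
   using sum_Basis_le[of "%i. SUM j:Basis. (b \<bullet> j) * dgmet c z x i j" "?D * (?D * M * norm x) * norm b" a] 2 by simp
  thus "\<bar>dgmet c z x a b\<bar> <= ?D * (?D * (?D * M)) * norm x * norm a * norm b"
   by (subst dgmet_expand[OF c zi]) (simp add: sum_distrib_left mult_ac)
 qed
qed

text \<open>The Christoffel bound comes from testing the Koszul formula on w =
  \<open>chris c z u v\<close> itself: the left side controls |w|^2, the right side is at most 3 K2
  |u| |v| |w|.\<close>

lemma tame_exists:
 assumes c: "c : A" and L: "compact L" "L <= img c"
 shows "EX K. tame c L K"
proof -
 obtain K1 where K1: "K1 >= 0" "!!z u v. z : L ==> \<bar>gmet c z u v\<bar> <= K1 * norm u * norm v"
  "!!z u. z : L ==> (norm u)\<^sup>2 <= K1 * gmet c z u u" using gmet_bounds[OF assms] by blast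
 obtain K2 where K2: "K2 >= 0" "!!z x a b. z : L ==> \<bar>dgmet c z x a b\<bar> <= K2 * norm x * norm a * norm b"
  using dgmet_bound[OF assms] by blast
 obtain K3 where K3: "K3 >= 0" "!!z. z : L ==> \<bar>rho c z\<bar> <= K3"
  using continuous_bounded_on_compact[OF L(1) continuous_on_subset[OF continuous_rho[OF c] L(2)]] by blast
 have rp: "0 < rho c z" if "z : L" for z using rho_pos[OF c] that L by blast
 have "continuous_on L (%z. inverse (rho c z))"
  using rp by (intro continuous_on_inverse continuous_on_subset[OF continuous_rho[OF c] L(2)]) (metis less_irrefl)
 then obtain K4 where K4: "K4 >= 0" "!!z. z : L ==> \<bar>inverse (rho c z)\<bar> <= K4"
  using continuous_bounded_on_compact[OF L(1)] by blast
 define K where "K = max 1 (max K1 (max (3 * K1 * K2) (max K3 K4)))"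
 have KK: "1 <= K" "K1 <= K" "3 * K1 * K2 <= K" "K3 <= K" "K4 <= K" by (auto simp: K_def)
 have chr: "norm (chris c z u v) <= K * norm u * norm v" if z: "z : L" for z u v
 proof (cases "chris c z u v = 0")
  case False
  let ?w = "chris c z u v"
  have zi: "z : img c" using z L by blast
  have "(norm ?w)\<^sup>2 <= K1 * gmet c z ?w ?w" by (rule K1(3)[OF z])
  also have "... <= K1 * (2 * gmet c z ?w ?w)"
   using K1(1) is_inner_nonneg[OF is_inner_gmet[OF c zi]] by (intro mult_left_mono) auto
  also have "2 * gmet c z ?w ?w = dgmet c z u v ?w + dgmet c z v u ?w - dgmet c z ?w u v" by (rule chris_eq[OF c zi])
  also have "K1 * (dgmet c z u v ?w + dgmet c z v u ?w - dgmet c z ?w u v)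
    <= K1 * (3 * (K2 * norm u * norm v * norm ?w))"
   using K2(2)[OF z, of v ?w u] K2(2)[OF z, of u ?w v] K2(2)[OF z, of u v ?w] K1(1)
   by (intro mult_left_mono) (auto simp: mult_ac)
  finally have "norm ?w * norm ?w <= (3 * K1 * K2) * norm u * norm v * norm ?w"
   by (simp add: power2_eq_square mult_ac)
  hence "norm ?w <= (3 * K1 * K2) * norm u * norm v" using False by simp
  also have "... <= K * norm u * norm v" using KK by (intro mult_right_mono) auto
  finally show ?thesis .
 qed (use KK in auto)
 have "tame c L K" unfolding tame_def
 proof (intro conjI ballI allI)
  fix z u assume z: "z : L"
  have zi: "z : img c" using z L by blast
  have g0: "0 <= gmet c z u u" by (rule is_inner_nonneg[OF is_inner_gmet[OF c zi]])
  have "gmet c z u u <= K1 * norm u * norm u" using K1(2)[OF z, of u u] by simp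
  also have "... <= K * (norm u)\<^sup>2" using KK by (simp add: power2_eq_square mult_right_mono mult.assoc)
  finally show "gmet c z u u <= K * (norm u)\<^sup>2" .
  show "(norm u)\<^sup>2 <= K * gmet c z u u" using K1(3)[OF z, of u] KK g0 by (meson mult_right_mono order_trans)
  show "rho c z <= K" using K3(2)[OF z] KK by linarith
  have "inverse (rho c z) <= K" using K4(2)[OF z] KK by linarith
  thus "1 <= K * rho c z" using rp[OF z] by (simp add: field_simps)
 qed (use c L KK chr in auto)
 thus ?thesis ..
qed

lemma tameD:
 assumes "tame c L K"
 shows "c : A" "L <= img c" "1 <= K"
  "z : L ==> gmet c z u u <= K * (norm u)\<^sup>2" "z : L ==> (norm u)\<^sup>2 <= K * gmet c z u u"
  "z : L ==> norm (chris c z u v) <= K * norm u * norm v" "z : L ==> rho c z <= K" "z : L ==> 1 <= K * rho c z"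
  "z : L ==> sqrt (gmet c z u u) <= sqrt K * norm u" "z : L ==> norm u <= sqrt K * sqrt (gmet c z u u)"
proof -
 show 0: "c : A" "L <= img c" "1 <= K"
  "z : L ==> norm (chris c z u v) <= K * norm u * norm v" "z : L ==> rho c z <= K" "z : L ==> 1 <= K * rho c z"
  using assms by (auto simp: tame_def)
 show 1: "gmet c z u u <= K * (norm u)\<^sup>2" and 2: "(norm u)\<^sup>2 <= K * gmet c z u u" if "z : L"
  using assms that by (auto simp: tame_def)
 show "sqrt (gmet c z u u) <= sqrt K * norm u" if "z : L"
  using real_sqrt_le_mono[OF 1[OF that]] by (simp add: real_sqrt_mult)
 show "norm u <= sqrt K * sqrt (gmet c z u u)" if "z : L"
  using real_sqrt_le_mono[OF 2[OF that]] by (simp add: real_sqrt_mult)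
qed

text \<open>The competitor for all upper bounds of distances: a coordinate segment with an affine
  field. Membership in \<open>tangent_curve\<close> has to be verified in every chart, which is done
  through the transition maps.\<close>

lemma line_tangent_curve:
 fixes z a v b :: "complex^'n"
 assumes c: "c : A" and im: "!!t. t : {0..1} ==> z + t *R a : img c"
 defines "\<gamma> \<equiv> %t. chart_inv c (z + t *R a)" and "V \<equiv> %t. vec_of A c (chart_inv c (z + t *R a)) (v + t *R b)"
 shows "tangent_curve A \<gamma> V"
proof -
 have cont: "continuous_on {0..1} \<gamma>" unfolding \<gamma>_def using im
  by (intro continuous_on_compose2[OF continuous_chart_inv[OF c]] continuous_intros) auto
 have main: "(snd d o \<gamma>) piecewise_C1_differentiable_on {x..y}
   & (%t. comps_in A d (\<gamma> t) (V t)) piecewise_C1_differentiable_on {x..y}"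
  if d: "d : A" and xy: "0 <= x" "x < y" "y <= 1" "\<gamma> ` {x..y} <= fst d" for d x y
 proof -
  define W where "W = (%t. z + t *R a) -` overlap c d"
  have oW: "open W" unfolding W_def by (intro open_vimage open_overlap c d continuous_intros)
  have sub: "{x..y} <= W"
  proof
   fix t assume t: "t : {x..y}"
   hence "t : {0..1}" using xy by auto
   from im[OF this] have "z + t *R a : img c" .
   moreover have "\<gamma> t : fst d" using t xy by blast
   ultimately show "t : W" using overlap_eq[OF c] by (simp add: W_def \<gamma>_def)
  qed
  have im': "(%t. z + t *R a) ` W <= overlap c d" by (auto simp: W_def)
  have "Ck_on (Suc 0) (%t. trans c d (z + t *R a)) W" by (rule Ck_on_compose[OF oW im' Ck_trans[OF c d] Ck_on_affine])
  hence 1: "Ck_on (Suc 0) (snd d o \<gamma>) W" by (simp only: \<gamma>_def o_def)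
  have "Ck_on (Suc 0) (%t. SUM i:Basis. ((v + t *R b) \<bullet> i) *R fd (trans c d) (z + t *R a) i) W"
  proof (intro Ck_on_sum[OF oW] Ck_on_bilinear[OF oW bounded_bilinear_scaleR])
   fix i :: "complex^'n"
   show "Ck_on (Suc 0) (%t. (v + t *R b) \<bullet> i) W"
    by (rule Ck_on_bilinear[OF oW bounded_bilinear_inner Ck_on_affine Ck_on_const])
   show "Ck_on (Suc 0) (%t. fd (trans c d) (z + t *R a) i) W"
    by (rule Ck_on_compose[OF oW im' Ck_on_Suc_frechet[OF Ck_trans[OF c d]] Ck_on_affine])
  qed
  moreover have "(SUM i:Basis. ((v + t *R b) \<bullet> i) *R fd (trans c d) (z + t *R a) i) = comps_in A d (\<gamma> t) (V t)"
   if "t : W" for t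
  proof -
   have "z + t *R a : img c" "\<gamma> t : fst d" "\<gamma> t : fst c" "snd c (\<gamma> t) = z + t *R a"
    using that overlap_eq[OF c] c by (auto simp: W_def \<gamma>_def)
   note this(2-4)
   thus ?thesis
    using linear_expand[OF linear_chart_change[OF c d], of "\<gamma> t" "v + t *R b"] comps_of_vec_of[OF c d, of "\<gamma> t" "v + t *R b"]
    \<open>z + t *R a : img c\<close> c by (simp add: V_def \<gamma>_def chart_change_def)
  qed
  ultimately have 2: "Ck_on (Suc 0) (%t. comps_in A d (\<gamma> t) (V t)) W" by (rule Ck_on_transfer[OF oW])
  show ?thesis using C1_differentiable_of_Ck[OF 1 sub] C1_differentiable_of_Ck[OF 2 sub]
   by (auto intro: C1_differentiable_imp_piecewise)
 qed
 show ?thesis unfolding tangent_curve_def curve_def using cont main by blast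
qed

text \<open>In the chart the covariant derivative is b plus the Christoffel symbol of a and v + t b,
  with t <= 1.\<close>

lemma line_speed:
 fixes z a v b :: "complex^'n"
 assumes L: "tame c L K" and im: "!!t. t : {0..1} ==> z + t *R a : L" and t: "t : {0..1}"
 defines "\<gamma> \<equiv> %t. chart_inv c (z + t *R a)" and "V \<equiv> %t. vec_of A c (chart_inv c (z + t *R a)) (v + t *R b)"
 shows "vec_norm h (\<gamma> t) (velocity A \<gamma> t) <= sqrt K * norm a"
  and "vec_norm h (\<gamma> t) (covariant_derivative A h \<gamma> V t) <= sqrt K * (norm b + K * norm a * (norm v + norm b))"
proof -
 note T = tameD[OF L]
 have c: "c : A" by (rule T(1))
 have imc: "z + s *R a : img c" if "s : {0..1}" for s using im[OF that] T(2) by blast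
 have p: "\<gamma> s : fst c" "snd c (\<gamma> s) = z + s *R a" if "s : {0..1}" for s
  using imc[OF that] c by (auto simp: \<gamma>_def)
 have cont: "continuous_on {0..1} \<gamma>" unfolding \<gamma>_def using imc
  by (intro continuous_on_compose2[OF continuous_chart_inv[OF c]] continuous_intros) auto
 have affine: "((%s. y + s *R x) has_vector_derivative x) (at t within {0..1})" for x y :: "complex^'n"
  by (auto intro!: derivative_eq_intros)
 have z': "((snd c o \<gamma>) has_vector_derivative a) (at t within {0..1})"
  by (rule has_vector_derivative_transform[OF t _ affine[of z]]) (simp add: p)
 have v': "((%s. comps_in A c (\<gamma> s) (V s)) has_vector_derivative b) (at t within {0..1})"
  by (rule has_vector_derivative_transform[OF t _ affine[of v]])
   (use p(1) c in \<open>simp add: V_def \<gamma>_def comps_vec_of\<close>)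
 have zL: "snd c (\<gamma> t) : L" using p(2)[OF t] im[OF t] by simp
 show "vec_norm h (\<gamma> t) (velocity A \<gamma> t) <= sqrt K * norm a"
  unfolding velocity_in_chart[OF c p(1)[OF t] t cont z'] vec_norm_vec_of[OF c p(1)[OF t]] by (rule T(9)[OF zL])
 have ut: "comps_in A c (\<gamma> t) (V t) = v + t *R b"
  using p(1)[OF t] c by (simp add: V_def \<gamma>_def comps_vec_of)
 have tb: "norm (v + t *R b) <= norm v + norm b"
  using norm_triangle_ineq[of v "t *R b"] t mult_left_le_one_le[of "norm b" t] by auto
 have "norm (b + chris c (snd c (\<gamma> t)) a (v + t *R b)) <= norm b + K * norm a * norm (v + t *R b)"
  by (rule norm_triangle_le) (simp add: T(6)[OF zL])
 also have "... <= norm b + K * norm a * (norm v + norm b)" using T(3) tb by (intro add_left_mono mult_left_mono) auto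
 finally have le: "norm (b + chris c (snd c (\<gamma> t)) a (v + t *R b)) <= norm b + K * norm a * (norm v + norm b)" .
 have "vec_norm h (\<gamma> t) (covariant_derivative A h \<gamma> V t) <= sqrt K * norm (b + chris c (snd c (\<gamma> t)) a (v + t *R b))"
  unfolding covariant_derivative_in_chart[OF c p(1)[OF t] t cont z' v'] vec_norm_vec_of[OF c p(1)[OF t]] ut
  by (rule T(9)[OF zL])
 also have "... <= sqrt K * (norm b + K * norm a * (norm v + norm b))" using T(3) by (intro mult_left_mono le) auto
 finally show "vec_norm h (\<gamma> t) (covariant_derivative A h \<gamma> V t) <= sqrt K * (norm b + K * norm a * (norm v + norm b))" .
qed

lemma vec_norm_nonneg: "0 <= vec_norm h p v" by (simp add: vec_norm_def is_inner_nonneg[OF is_inner_hmet])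

lemma nn_integral_unit_interval_le:
 assumes "!!t. t : {0..1} ==> f t <= B" "B >= 0"
 shows "(LI t:{0..1::real}. ennreal (f t)) <= ennreal B"
proof -
 have "(LI t:{0..1::real}. ennreal (f t)) <= (LI t:{0..1::real}. ennreal B)"
  using assms by (intro nn_integral_mono) (auto simp: indicator_def ennreal_leI)
 thus ?thesis by (simp add: nn_integral_cmult_indicator)
qed

lemma distX_line:
 assumes L: "tame c L K" and im: "!!t. t : {0..1} ==> z + t *R a : L"
 shows "distX A h (chart_inv c z) (chart_inv c (z + a)) <= ennreal (sqrt K * norm a)"
proof -
 let ?\<gamma> = "%t. chart_inv c (z + t *R a)"
 have "tangent_curve A ?\<gamma> (%t. vec_of A c (chart_inv c (z + t *R a)) (0 + t *R 0))"
  using im tameD(1,2)[OF L] by (intro line_tangent_curve) auto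
 hence "curve A ?\<gamma>" by (simp add: tangent_curve_def)
 hence "distX A h (chart_inv c z) (chart_inv c (z + a)) <= curve_length A h ?\<gamma>"
  unfolding distX_def by (intro INF_lower) auto
 also have "... <= ennreal (sqrt K * norm a)" unfolding curve_length_def
  by (intro nn_integral_unit_interval_le line_speed[OF L im]) (use tameD(3)[OF L] in auto)
 finally show ?thesis .
qed

lemma distTX_line:
 assumes L: "tame c L K" and im: "!!t. t : {0..1} ==> z + t *R a : L"
 shows "distTX A h (chart_inv c z, vec_of A c (chart_inv c z) v) (chart_inv c (z + a), vec_of A c (chart_inv c (z + a)) (v + b))
   <= ennreal (sqrt K * norm a + sqrt K * (norm b + K * norm a * (norm v + norm b)))"
proof -
 let ?\<gamma> = "%t. chart_inv c (z + t *R a)" and ?V = "%t. vec_of A c (chart_inv c (z + t *R a)) (v + t *R b)"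
 have K: "K >= 1" by (rule tameD(3)[OF L])
 have "tangent_curve A ?\<gamma> ?V" using im tameD(1,2)[OF L] by (intro line_tangent_curve) auto
 hence "distTX A h (chart_inv c z, vec_of A c (chart_inv c z) v) (chart_inv c (z + a), vec_of A c (chart_inv c (z + a)) (v + b))
   <= tangent_curve_length A h ?\<gamma> ?V" unfolding distTX_def by (intro INF_lower2[of "(?\<gamma>, ?V)"]) auto
 also have "... <= ennreal (sqrt K * norm a + sqrt K * (norm b + K * norm a * (norm v + norm b)))"
  unfolding tangent_curve_length_def
 proof (rule nn_integral_unit_interval_le)
  fix t :: real assume t: "t : {0..1}"
  let ?x = "vec_norm h (?\<gamma> t) (velocity A ?\<gamma> t)" and ?y = "vec_norm h (?\<gamma> t) (covariant_derivative A h ?\<gamma> ?V t)"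
  have "sqrt (?x\<^sup>2 + ?y\<^sup>2) <= ?x + ?y" by (intro sqrt_sum_squares_le_sum vec_norm_nonneg)
  also have "... <= sqrt K * norm a + sqrt K * (norm b + K * norm a * (norm v + norm b))"
   by (intro add_mono line_speed[OF L im t])
  finally show "sqrt (?x\<^sup>2 + ?y\<^sup>2) <= sqrt K * norm a + sqrt K * (norm b + K * norm a * (norm v + norm b))" .
 qed (use K in auto)
 finally show ?thesis .
qed

lemma distX_refl: "distX A h p p = 0"
proof -
 let ?c = "chart_at A p"
 obtain K where "tame ?c {snd ?c p} K" using tame_exists[OF chart_at(1), of "{snd ?c p}" p] chart_at(2)[of p] by auto
 from distX_line[OF this, of "snd ?c p" 0] show ?thesis using chart_at[of p] by simp
qed

lemma distTX_refl: "distTX A h (p, v) (p, v) = 0"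
proof -
 let ?c = "chart_at A p"
 obtain K where "tame ?c {snd ?c p} K" using tame_exists[OF chart_at(1), of "{snd ?c p}" p] chart_at(2)[of p] by auto
 from distTX_line[OF this, of "snd ?c p" 0 "comps_in A ?c p v" 0] show ?thesis
  using chart_at[of p] by (simp add: vec_of_comps)
qed

text \<open>\<open>push_forward\<close> is defined by the charts selected at p and at its image; the
  chain rule moves it to given charts. Continuity of \<Phi> keeps the composite inside their domains
  near p.\<close>

lemma push_forward_in_charts:
 assumes c: "c : A" "p : fst c" and d: "d : A" "\<Phi> p : fst d"
  and cont: "continuous_on W \<Phi>" "open W" "p : W"
  and T: "((snd d o \<Phi> o chart_inv c) has_derivative T) (at (snd c p))"
 shows "push_forward A \<Phi> p v = vec_of A d (\<Phi> p) (T (comps_in A c p v))"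
proof -
 let ?c = "chart_at A p" and ?d = "chart_at A (\<Phi> p)"
 note pc = chart_at[of p] and pd = chart_at[of "\<Phi> p"]
 have zc: "trans ?c c (snd ?c p) = snd c p" using pc c by simp
 have zd: "(snd d o \<Phi> o chart_inv c) (trans ?c c (snd ?c p)) = snd d (\<Phi> p)" using c zc by simp
 have d1: "((%z. (snd d o \<Phi> o chart_inv c) (trans ?c c z)) has_derivative (%v. T (chart_change ?c c p v))) (at (snd ?c p))"
  by (rule has_derivative_compose[OF trans_deriv[OF pc(1) c(1) pc(2) c(2)]]) (unfold zc, rule T)
 have d2: "((%z. trans d ?d ((snd d o \<Phi> o chart_inv c) (trans ?c c z))) has_derivative
   (%v. chart_change d ?d (\<Phi> p) (T (chart_change ?c c p v)))) (at (snd ?c p))"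
  by (rule has_derivative_compose[OF d1]) (unfold zd, rule trans_deriv[OF d(1) pd(1) d(2) pd(2)])
 define N where "N = {z : img ?c. chart_inv ?c z : fst c \<inter> (W \<inter> \<Phi> -` fst d)}"
 have oN: "open N" unfolding N_def
  using continuous_open_preimage[OF cont(1,2) chart_props(1)[OF d(1)]] chart_props(1)[OF c(1)]
  by (intro open_chart_preimage pc(1)) auto
 have zN: "snd ?c p : N" using pc c d cont(3) by (auto simp: N_def)
 have "((snd ?d o \<Phi> o chart_inv ?c) has_derivative
   (%v. chart_change d ?d (\<Phi> p) (T (chart_change ?c c p v)))) (at (snd ?c p))"
 proof (rule has_derivative_transform_within_open[OF d2 oN zN])
  fix z assume z: "z : N"
  hence "chart_inv c (trans ?c c z) = chart_inv ?c z" using c(1) by (auto simp: N_def)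
  thus "trans d ?d ((snd d o \<Phi> o chart_inv c) (trans ?c c z)) = (snd ?d o \<Phi> o chart_inv ?c) z"
   using z d(1) by (auto simp: N_def)
 qed
 from frechet_derivative_eqI[OF this] show ?thesis
  unfolding push_forward_def Let_def by (simp add: comps_in_def vec_of_def)
qed

text \<open>The derivative at x depends on the values near x, so the map has to be the identity on a
  neighbourhood.\<close>

lemma push_forward_fixed:
 assumes W: "open W" "x : W" "!!y. y : W ==> \<Phi> y = y" and cont: "continuous_on W \<Phi>"
 shows "push_forward A \<Phi> x v = v"
proof -
 let ?d = "chart_at A x"
 note d = chart_at[of x]
 have fx: "\<Phi> x = x" by (rule W(3)[OF W(2)])
 have "((snd ?d o \<Phi> o chart_inv ?d) has_derivative (%v. v)) (at (snd ?d x))"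
 proof (rule has_derivative_transform_within_open[OF has_derivative_ident])
  show "open {z : img ?d. chart_inv ?d z : W}" by (intro open_chart_preimage d W)
  show "snd ?d x : {z : img ?d. chart_inv ?d z : W}" using d W by auto
  fix z assume "z : {z : img ?d. chart_inv ?d z : W}"
  thus "z = (snd ?d o \<Phi> o chart_inv ?d) z" using W(3) d by simp
 qed
 from push_forward_in_charts[OF d d(1) _ cont W(1,2) this, of v]
 show ?thesis using fx d by (simp add: vec_of_comps)
qed

end

section \<open>Cut-off translations\<close>

text \<open>The cut-off behind the translations: full strength up to 2 r and none from 5/2 r on,
  which leaves a collar so that the ball of radius 3 r is mapped onto itself.\<close>

locale bump =
 fixes z0 :: "'e::euclidean_space" and r M :: real and cut :: "'e => real"
 assumes r: "r > 0" and Ck_cut: "!!k. Ck_on k cut UNIV"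
  and cut1: "!!z. dist z0 z <= 2 * r ==> cut z = 1"
  and cut0: "!!z. 5 / 2 * r <= dist z0 z ==> cut z = 0"
  and cut_nonneg: "!!z. 0 <= cut z" and cut_le: "!!z. cut z <= 1"
  and M: "M >= 0" and dcut: "!!z v. \<bar>fd cut z v\<bar> <= M * norm v"
begin

lemma cut_derivative: "(cut has_derivative fd cut z) (at z)"
 by (rule Ck_on_Suc_has_derivative[OF Ck_cut[of "Suc 0"]]) simp

lemma cut_lipschitz: "\<bar>cut y - cut z\<bar> <= M * norm (y - z)"
proof -
 have "norm (cut y - cut z) <= M * norm (y - z)"
 proof (rule differentiable_bound[of UNIV cut "%z. fd cut z"])
  show "onorm (fd cut x) <= M" for x using dcut M by (intro onorm_bound) auto
 qed (auto simp: cut_derivative)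
 thus ?thesis by simp
qed

definition push :: "'e => 'e => 'e" where
 "push w z = z + cut z *R w"

text \<open>A displacement below r / 2 keeps points of the ball of radius 5/2 r inside the one of
  radius 3 r; M * norm w <= 1 / 2 yields a contraction and keeps the Jacobian factor at least 1 /
  2.\<close>

definition small :: "'e => bool" where
 "small w \<longleftrightarrow> norm w < r / 2 & 2 * M * norm w <= 1"

lemma smallD: assumes "small w" shows "norm w < r / 2" "M * norm w <= 1 / 2" using assms by (auto simp: small_def)

lemma push_fix: "5 / 2 * r <= dist z0 z ==> push w z = z" by (simp add: push_def cut0)

lemma dist_push: "norm (push w z - z) <= norm w"
 using cut_nonneg[of z] cut_le[of z] by (simp add: push_def mult_left_le_one_le)

lemma push_ball:
 assumes "small w" shows "push w z : ball z0 (3 * r) \<longleftrightarrow> z : ball z0 (3 * r)"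
proof (cases "5 / 2 * r <= dist z0 z")
 case False
 have "dist z0 (push w z) <= dist z0 z + norm w"
  using dist_triangle[of z0 "push w z" z] dist_push[of w z] by (simp add: dist_norm norm_minus_commute)
 thus ?thesis using False smallD(1)[OF assms] r by simp
qed (simp add: push_fix)

lemma push_derivative:
 "(push w has_derivative (%v. v + fd cut z v *R w)) (at z)"
 unfolding push_def[abs_def] by (auto intro!: derivative_eq_intros cut_derivative)

text \<open>Solutions are the fixed points of the map sending z to y - cut z w, a contraction with
  factor 1 / 2.\<close>

lemma push_solution: assumes "small w" shows "EX! z. push w z = y"
proof -
 have "EX! z. y - cut z *R w = z"
 proof (rule banach_fix_type[of "1 / 2"])
  show "ALL x z. dist (y - cut x *R w) (y - cut z *R w) <= 1 / 2 * dist x z"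
  proof (intro allI)
   fix x z
   have "dist (y - cut x *R w) (y - cut z *R w) = \<bar>cut x - cut z\<bar> * norm w"
    by (simp add: dist_norm scaleR_left_diff_distrib[symmetric] norm_minus_commute abs_minus_commute)
   also have "... <= (M * norm (x - z)) * norm w" by (intro mult_right_mono cut_lipschitz) simp
   also have "... = (M * norm w) * norm (x - z)" by simp
   also have "... <= 1 / 2 * norm (x - z)" by (intro mult_right_mono smallD(2)[OF assms]) simp
   finally show "dist (y - cut x *R w) (y - cut z *R w) <= 1 / 2 * dist x z" by (simp add: dist_norm)
  qed
 qed auto
 moreover have "y - cut z *R w = z \<longleftrightarrow> push w z = y" for z by (auto simp: push_def algebra_simps)
 ultimately show ?thesis by simp
qed

definition pull :: "'e => 'e => 'e" where
 "pull w y = (THE z. push w z = y)"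

lemma push_pull: "small w ==> push w (pull w y) = y" unfolding pull_def by (rule theI'[OF push_solution])

lemma pull_push: "small w ==> pull w (push w z) = z" using push_solution push_pull by blast

lemma pull_fix: "small w ==> 5 / 2 * r <= dist z0 z ==> pull w z = z" using pull_push[of w z] push_fix[of z w] by simp

lemma pull_ball: "small w ==> pull w z : ball z0 (3 * r) \<longleftrightarrow> z : ball z0 (3 * r)"
 using push_ball[of w "pull w z"] push_pull[of w z] by simp

lemma dist_pull: "small w ==> norm (pull w z - z) <= norm w"
 using dist_push[of w "pull w z"] by (simp add: push_pull norm_minus_commute)

lemma pull_lipschitz:
 assumes w: "small w" shows "norm (pull w y - pull w z) <= 2 * norm (y - z)"
proof -
 let ?a = "pull w y" and ?b = "pull w z"
 have "?a - ?b = (y - z) - (cut ?a - cut ?b) *R w"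
  using push_pull[OF w, of y] push_pull[OF w, of z] by (simp add: push_def algebra_simps)
 hence "norm (?a - ?b) <= norm (y - z) + \<bar>cut ?a - cut ?b\<bar> * norm w"
  by (metis norm_scaleR norm_triangle_ineq4)
 also have "\<bar>cut ?a - cut ?b\<bar> * norm w <= (M * norm (?a - ?b)) * norm w" by (intro mult_right_mono cut_lipschitz) simp
 also have "... = (M * norm w) * norm (?a - ?b)" by simp
 also have "... <= 1 / 2 * norm (?a - ?b)" by (intro mult_right_mono smallD(2)[OF w]) simp
 finally show ?thesis by simp
qed

lemma jacobian_pos:
 assumes w: "small w" shows "1 / 2 <= 1 + fd cut z w" using dcut[of z w] smallD(2)[OF w] by linarith

text \<open>The inverse of a rank-one perturbation of the identity, by the Sherman-Morrison formula,
  with the derivative of the cut-off taken at the preimage.\<close>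

definition dpull :: "'e => 'e => 'e => 'e" where
 "dpull w y v = v - (fd cut (pull w y) v * inverse (1 + fd cut (pull w y) w)) *R w"

lemma pull_derivative:
 assumes w: "small w" shows "(pull w has_derivative dpull w y) (at y)"
proof -
 let ?D = "fd cut (pull w y)"
 have lin: "linear ?D" by (rule has_derivative_linear[OF cut_derivative])
 have "dpull w y = (%v. v - (?D v * inverse (1 + ?D w)) *R w)" by (simp add: dpull_def fun_eq_iff)
 moreover have "linear (%v. v - (?D v * inverse (1 + ?D w)) *R w)"
  by (rule linearI) (simp_all add: linear_add[OF lin] linear_scale[OF lin] algebra_simps)
 ultimately have bl: "bounded_linear (dpull w y)" by (simp add: linear_conv_bounded_linear)
 have nz: "1 + ?D w ~= 0" using jacobian_pos[OF w, of "pull w y"] by linarith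
 show ?thesis
 proof (rule has_derivative_inverse_basic[OF push_derivative bl _ _ open_UNIV])
  show "dpull w y o (%v. v + ?D v *R w) = id"
  proof
   fix v
   have "?D v - ?D v * (1 + ?D w) * inverse (1 + ?D w) = 0" using nz by simp
   hence "(?D v - (?D v + ?D v * ?D w) * inverse (1 + ?D w)) *R w = 0" by (simp add: algebra_simps)
   thus "(dpull w y o (%v. v + ?D v *R w)) v = id v"
    by (simp add: dpull_def linear_add[OF lin] linear_scale[OF lin] scaleR_left_diff_distrib)
  qed
  have "2-lipschitz_on UNIV (pull w)" using pull_lipschitz[OF w] by (intro lipschitz_onI) (auto simp: dist_norm)
  thus "continuous (at y) (pull w)"
   using lipschitz_on_continuous_on continuous_on_eq_continuous_at[OF open_UNIV] by blast
 qed (auto simp: push_pull[OF w])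
qed

text \<open>Bootstrap: by \<open>dpull\<close> the derivative of the inverse is a smooth expression
  in the inverse itself, so each order of regularity yields the next.\<close>

lemma Ck_pull: assumes w: "small w" shows "Ck_on k (pull w) UNIV"
proof (induction k)
 case 0
 thus ?case by (simp add: continuous_on_eq_continuous_at has_derivative_continuous[OF pull_derivative[OF w]])
next
 case (Suc k)
 have D: "Ck_on k (%y. fd cut (pull w y) v) UNIV" for v
  by (rule Ck_on_compose[OF open_UNIV _ Ck_on_Suc_frechet[OF Ck_cut] Suc.IH]) simp
 have inv: "Ck_on k (%y. inverse (1 + fd cut (pull w y) w)) UNIV"
 proof (rule Ck_on_compose[OF open_UNIV _ Ck_on_inverse_real])
  have "1 + fd cut (pull w y) w ~= 0" for y using jacobian_pos[OF w, of "pull w y"] by linarith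
  thus "range (%y. 1 + fd cut (pull w y) w) <= - {0}" by auto
  show "Ck_on k (%y. 1 + fd cut (pull w y) w) UNIV" by (intro Ck_on_add[OF open_UNIV] Ck_on_const D)
 qed
 have "Ck_on k (%y. v + (fd cut (pull w y) v * inverse (1 + fd cut (pull w y) w)) *R (- w)) UNIV" for v
  by (intro Ck_on_add[OF open_UNIV] Ck_on_const Ck_on_bilinear[OF open_UNIV bounded_bilinear_scaleR]
    Ck_on_bilinear[OF open_UNIV bounded_bilinear_mult] D inv)
 hence "Ck_on k (%y. dpull w y v) UNIV" for v by (simp add: dpull_def)
 thus ?case
  by (auto simp: frechet_derivative_eqI[OF pull_derivative[OF w]] differentiable_def intro: pull_derivative[OF w])
qed

lemma dpush_near: "norm (v + fd cut z v *R w - v) <= (2 * M * norm w) * norm v"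
proof -
 have "norm (v + fd cut z v *R w - v) <= (M * norm v) * norm w" by (simp add: mult_right_mono dcut)
 also have "... <= (2 * M * norm w) * norm v" using M by (simp add: mult_ac)
 finally show ?thesis .
qed

text \<open>The factor 2 is the bound for the inverse of the Jacobian factor, which is at least 1 /
  2.\<close>

lemma dpull_near: assumes w: "small w" shows "norm (dpull w y v - v) <= (2 * M * norm w) * norm v"
proof -
 let ?D = "fd cut (pull w y)"
 have j: "1 / 2 <= 1 + ?D w" by (rule jacobian_pos[OF w])
 have "norm (dpull w y v - v) = \<bar>?D v\<bar> * \<bar>inverse (1 + ?D w)\<bar> * norm w"
  by (simp add: dpull_def abs_mult)
 also have "... <= (M * norm v) * 2 * norm w"
 proof (intro mult_right_mono mult_mono dcut)
  have "inverse (1 + ?D w) <= inverse (1 / 2)" using j by (intro le_imp_inverse_le) auto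
  thus "\<bar>inverse (1 + ?D w)\<bar> <= 2" using j by simp
 qed (use M in auto)
 finally show ?thesis by (simp add: mult_ac)
qed

lemma Ck_push_family: "Ck_on k (%(t, z). push (t *R w) z) (UNIV :: (real \<times> 'e) set)"
proof -
 have "Ck_on k (%x :: real \<times> 'e. snd x + (fst x * cut (snd x)) *R w) UNIV"
  by (intro Ck_on_add[OF open_UNIV] Ck_on_bilinear[OF open_UNIV bounded_bilinear_scaleR] Ck_on_const
    Ck_on_bilinear[OF open_UNIV bounded_bilinear_mult] Ck_on_bounded_linear bounded_linear_fst bounded_linear_snd
    Ck_on_compose[OF open_UNIV subset_UNIV Ck_cut])
 thus ?thesis by (simp add: push_def case_prod_unfold mult_ac)
qed

end

text \<open>The derivative of the cut-off vanishes off a closed ball and is bounded on it by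
  compactness.\<close>

lemma bump_exists:
 fixes z0 :: "'e::euclidean_space"
 assumes r: "r > 0"
 obtains M cut where "bump z0 r M cut"
proof -
 obtain cut :: "'e => real" where cut: "!!k. Ck_on k cut UNIV" "!!z. dist z0 z <= 2 * r ==> cut z = 1"
  "!!z. dist z0 z >= 5 / 2 * r ==> cut z = 0" "!!z. 0 <= cut z" "!!z. cut z <= 1"
  using smooth_cutoff[of "2 * r" "5 / 2 * r" z0] r by auto
 have der: "(cut has_derivative fd cut z) (at z)" for z by (rule Ck_on_Suc_has_derivative[OF cut(1)[of "Suc 0"]]) simp
 let ?L = "cball z0 (5 / 2 * r)"
 have "continuous_on ?L (%z. SUM i:Basis. \<bar>fd cut z i\<bar>)" using Ck_on_Suc_frechet[OF cut(1)[of "Suc 0"]]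
  by (intro continuous_on_sum continuous_on_rabs) (auto intro: continuous_on_subset)
 then obtain M where M: "M >= 0" "!!z. z : ?L ==> \<bar>SUM i:Basis. \<bar>fd cut z i\<bar>\<bar> <= M"
  using continuous_bounded_on_compact[OF compact_cball] by blast
 have "\<bar>fd cut z v\<bar> <= (DIM('e) * M) * norm v" for z v
 proof (cases "z : ?L")
  case True
  have lin: "linear (fd cut z)" by (rule has_derivative_linear[OF der])
  have "\<bar>fd cut z i\<bar> <= M" if "i : Basis" for i
  proof -
   have "\<bar>fd cut z i\<bar> <= (SUM i:Basis. \<bar>fd cut z i\<bar>)"
    using that by (intro member_le_sum[where f = "%i. \<bar>fd cut z i\<bar>"]) auto
   thus ?thesis using M(2)[OF True] by linarith
  qed
  from sum_Basis_le[of "%i. fd cut z i" M v, OF this]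
  show ?thesis by (subst linear_expand[OF lin]) simp
 next
  case False
  have "(cut has_derivative (%v. 0)) (at z)"
  proof (rule has_derivative_transform_within_open[OF has_derivative_const])
   show "open (- ?L)" by (intro open_Compl closed_cball)
   show "z : - ?L" using False by simp
   show "0 = cut y" if "y : - ?L" for y using that cut(3)[of y] by simp
  qed
  hence "fd cut z = (%v. 0)" by (rule frechet_derivative_eqI)
  thus ?thesis using M by simp
 qed
 hence "bump z0 r (DIM('e) * M) cut" by unfold_locales (use r cut M in auto)
 thus ?thesis by (rule that)
qed

section \<open>Deformations supported in a chart\<close>

context herm_mfd
begin

definition chart_lift :: "('a, 'n) chart => (complex^'n) set => (complex^'n => complex^'n) => 'a => 'a" where
 "chart_lift c B F p = (if p : chart_inv c ` B then chart_inv c (F (snd c p)) else p)"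

text \<open>Freeze t in the local extensions. Applied to constant families this also gives the
  smoothness of single lifted maps.\<close>

lemma smooth_map_of_family:
 assumes \<Psi>: "smooth_family A \<Psi>" and t: "t : {0..1}"
 shows "smooth_map A (\<Psi> t)" unfolding smooth_map_def
proof (intro conjI ballI)
 have j: "continuous_on ({0..1} \<times> UNIV) (%(t, x). \<Psi> t x)" using \<Psi> by (simp add: smooth_family_def)
 have "continuous_on UNIV (%x. (%(t, x). \<Psi> t x) (t, x))"
  by (rule continuous_on_compose2[OF j continuous_on_Pair[OF continuous_on_const continuous_on_id]]) (use t in auto)
 thus "continuous_on UNIV (\<Psi> t)" by simp
 fix c d assume c: "c : A" and d: "d : A"
 let ?S = "{(t, z). t : {0..1} & z : img c & \<Psi> t (chart_inv c z) : fst d}"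
 have sm: "smooth_on ?S (%(t, z). snd d (\<Psi> t (chart_inv c z)))"
  using \<Psi> c d by (auto simp: smooth_family_def)
 show "smooth_on (snd c ` (fst c \<inter> \<Psi> t -` fst d)) (snd d o \<Psi> t o chart_inv c)"
  unfolding smooth_on_def
 proof
  fix z assume "z : snd c ` (fst c \<inter> \<Psi> t -` fst d)"
  hence zS: "(t, z) : ?S" using t c by auto
  from bspec[OF sm[unfolded smooth_on_def] this] obtain W g where W: "open W" "(t, z) : W" "!!k. Ck_on k g W"
   "!!y. y : ?S \<inter> W ==> (%(t, z). snd d (\<Psi> t (chart_inv c z))) y = g y" by (elim exE conjE) blast
  define W' where "W' = (%y. (t, y)) -` W"
  have oW': "open W'" unfolding W'_def by (intro open_vimage W continuous_intros)
  have aff: "Ck_on k (%y. (t, y)) W'" for k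
  proof -
   have "Ck_on k (%y. (t, 0) + (0, y)) W'"
    by (intro Ck_on_add[OF oW'] Ck_on_const Ck_on_bounded_linear bounded_linear_Pair bounded_linear_zero bounded_linear_ident)
   thus ?thesis by simp
  qed
  have "Ck_on k (%y. g (t, y)) W'" for k by (rule Ck_on_compose[OF oW' _ W(3) aff]) (auto simp: W'_def)
  moreover have "(snd d o \<Psi> t o chart_inv c) y = g (t, y)" if "y : snd c ` (fst c \<inter> \<Psi> t -` fst d) \<inter> W'" for y
   using W(4)[of "(t, y)"] that t c by (auto simp: W'_def)
  ultimately show "EX W g. open W & z : W & (ALL k. Ck_on k g W) &
   (ALL y:snd c ` (fst c \<inter> \<Psi> t -` fst d) \<inter> W. (snd d o \<Psi> t o chart_inv c) y = g y)"
   using oW' W(2) by (intro exI[of _ W'] exI[of _ "%y. g (t, y)"]) (auto simp: W'_def)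
 qed
qed

context
 fixes c :: "('a, 'n) chart" and z0 :: "complex^'n" and r :: real
 assumes c: "c : A" and r: "r > 0" and sub: "cball z0 (3 * r) <= img c"
begin

text \<open>\<open>dnbd\<close> plays the role of \<Omega>, and the closed set \<open>dcore\<close>
  contains all points that are actually moved. So \<open>dnbd\<close> and the complement of
  \<open>dcore\<close> form an open cover: a lifted map is given by coordinates on the first and is
  the identity on the second.\<close>

abbreviation "dball \<equiv> ball z0 (3 * r)"
abbreviation "dnbd \<equiv> chart_inv c ` dball"
abbreviation "dcore \<equiv> chart_inv c ` cball z0 (5 / 2 * r)"

lemma B_img: "dball <= img c" using sub by auto

lemma N_eq: "dnbd = {p : fst c. snd c p : dball}"
proof (intro set_eqI iffI)
 fix p assume "p : {p : fst c. snd c p : dball}"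
 hence "p = chart_inv c (snd c p)" "snd c p : dball" using c by auto
 thus "p : dnbd" by blast
qed (use B_img c in auto)

lemma open_N: "open dnbd"
 unfolding N_eq using continuous_open_preimage[OF continuous_chart[OF c] chart_props(1)[OF c], of dball]
 by (simp only: open_ball vimage_def Int_def mem_Collect_eq)

lemma closed_Z: "closed dcore"
proof -
 have "cball z0 (5 / 2 * r) <= img c" using sub r by auto
 thus ?thesis
  by (intro compact_imp_closed compact_continuous_image continuous_on_subset[OF continuous_chart_inv[OF c]]) auto
qed

lemma Z_sub: "dcore <= dnbd" using r by (intro image_mono) auto

lemma relatively_compact_N: "relatively_compact_open dnbd"
proof -
 have "compact (chart_inv c ` cball z0 (3 * r))"
  by (intro compact_continuous_image continuous_on_subset[OF continuous_chart_inv[OF c] sub]) auto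
 moreover have "closure dnbd <= chart_inv c ` cball z0 (3 * r)"
  using calculation by (intro closure_minimal compact_imp_closed image_mono) auto
 ultimately show ?thesis unfolding relatively_compact_open_def using open_N
  by (metis closed_closure compact_Int_closed inf.absorb_iff2)
qed

lemma lift_in: "z : dball ==> chart_lift c dball F (chart_inv c z) = chart_inv c (F z)"
 using B_img c by (auto simp: chart_lift_def)

lemma lift_out: "p ~: dnbd ==> chart_lift c dball F p = p" by (simp add: chart_lift_def)

definition supported :: "(complex^'n => complex^'n) => bool" where
 "supported F \<longleftrightarrow> F ` dball <= dball & (ALL z. 5 / 2 * r <= dist z0 z --> F z = z)"

lemma supported_in: "supported F ==> z : dball ==> F z : dball" by (auto simp: supported_def simp del: mem_ball)

lemma lift_off_Z:
 assumes F: "supported F" and p: "p ~: dcore" shows "chart_lift c dball F p = p"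
proof (cases "p : dnbd")
 case True
 then obtain z where z: "z : dball" "p = chart_inv c z" by blast
 with p have "z ~: cball z0 (5 / 2 * r)" by blast
 hence "F z = z" using F by (auto simp: supported_def)
 thus ?thesis using z lift_in by simp
qed (rule lift_out)

text \<open>The two descriptions of the lift, by coordinates on \<open>dnbd\<close> and as the
  identity off \<open>dcore\<close>, are smooth on open sets that cover. T is open and contains the
  unit interval because smoothness up to the endpoints means extendability beyond them.\<close>

lemma smooth_family_lift:
 assumes T: "open T" "{0..1} <= T" and F: "!!k. Ck_on k (%(t, z). F t z) (T \<times> UNIV)"
  and sup: "!!t. t : T ==> supported (F t)"
 shows "smooth_family A (%t. chart_lift c dball (F t))"
proof -
 let ?\<Psi> = "%t. chart_lift c dball (F t)"
 have FB: "F t z : dball" if "t : T" "z : dball" for t z using supported_in[OF sup] that by blast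
 have contF: "continuous_on (T \<times> UNIV) (%(t, z). F t z)" using F[of 0] by simp
 have coord: "snd c p : dball" "p : fst c" if "p : dnbd" for p using that unfolding N_eq by auto
 have cont: "continuous_on (T \<times> dnbd \<union> T \<times> (- dcore)) (%(t, x). ?\<Psi> t x)"
 proof (rule continuous_on_open_Un)
  have c1: "continuous_on (T \<times> dnbd) (%x. snd c (snd x))"
   by (rule continuous_on_compose2[OF continuous_chart[OF c] continuous_on_snd[OF continuous_on_id]]) (use coord in auto)
  have "continuous_on (T \<times> dnbd) (%x. (%(t, z). F t z) (fst x, snd c (snd x)))"
   by (rule continuous_on_compose2[OF contF continuous_on_Pair[OF continuous_on_fst[OF continuous_on_id] c1]]) auto
  hence "continuous_on (T \<times> dnbd) (%x. chart_inv c (F (fst x) (snd c (snd x))))"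
   by (intro continuous_on_compose2[OF continuous_chart_inv[OF c]]) (use FB coord B_img in \<open>auto simp del: mem_ball\<close>)
  thus "continuous_on (T \<times> dnbd) (%(t, x). ?\<Psi> t x)" by (rule continuous_on_eq) (auto simp: chart_lift_def)
  have "continuous_on (T \<times> (- dcore)) snd" by (rule continuous_on_snd[OF continuous_on_id])
  thus "continuous_on (T \<times> (- dcore)) (%(t, x). ?\<Psi> t x)"
   by (rule continuous_on_eq) (use lift_off_Z[OF sup] in auto)
 qed (intro open_Times T open_N open_Compl closed_Z)+
 have sm: "smooth_on {(t, z). t : {0..1} & z : img c1 & ?\<Psi> t (chart_inv c1 z) : fst d}
     (%(t, z). snd d (?\<Psi> t (chart_inv c1 z)))" (is "smooth_on ?S ?f")
  if c1: "c1 : A" and d: "d : A" for c1 d unfolding smooth_on_def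
 proof
  fix x assume xS: "x : ?S"
  obtain t z where x: "x = (t, z)" by (cases x)
  have t: "t : {0..1}" and z: "z : img c1" and fd: "?\<Psi> t (chart_inv c1 z) : fst d" using xS x by auto
  show "EX W g. open W & x : W & (ALL k. Ck_on k g W) & (ALL y:?S \<inter> W. ?f y = g y)"
  proof (cases "chart_inv c1 z : dnbd")
   case True
   define W1 where "W1 = T \<times> {y : img c1. chart_inv c1 y : dnbd}"
   have oW1: "open W1" unfolding W1_def by (intro open_Times T open_chart_preimage c1 open_N)
   have W1o: "snd y : overlap c1 c" "fst y : T" "chart_inv c1 (snd y) : dnbd" "trans c1 c (snd y) : dball" if "y : W1" for y
    using that overlap_eq[OF c1] coord by (auto simp: W1_def simp del: mem_ball)
   have Ck1: "Ck_on k (%y. trans c1 c (snd y)) W1" for k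
    by (rule Ck_on_compose[OF oW1 _ Ck_trans[OF c1 c] Ck_on_bounded_linear[OF bounded_linear_snd]]) (use W1o in auto)
   have pair: "Ck_on k (%y. (fst y, trans c1 c (snd y))) W1" for k
   proof -
    have "Ck_on k (%y. (fst y, 0) + (0, trans c1 c (snd y))) W1"
     by (intro Ck_on_add[OF oW1] Ck_on_bounded_linear bounded_linear_Pair bounded_linear_fst bounded_linear_zero
       Ck_on_compose[OF oW1 subset_UNIV Ck_on_bounded_linear Ck1, of "%y. (0, y)"] bounded_linear_ident)
    thus ?thesis by simp
   qed
   have G: "Ck_on k (%y. (%(t, z). F t z) (fst y, trans c1 c (snd y))) W1" for k
    by (rule Ck_on_compose[OF oW1 _ F pair]) (use W1o in auto)
   define g1 where "g1 = (%y. F (fst y) (trans c1 c (snd y)))"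
   have G1: "Ck_on k g1 W1" for k using G by (simp add: g1_def)
   define W where "W = W1 \<inter> g1 -` overlap c d"
   have oW: "open W" unfolding W_def using continuous_open_preimage[OF _ oW1 open_overlap[OF c d]] G1[of 0] by simp
   have eq: "?\<Psi> (fst y) (chart_inv c1 (snd y)) = chart_inv c (g1 y)" "g1 y : dball" if "y : W1" for y
    using W1o[OF that] FB[of "fst y" "trans c1 c (snd y)"] by (auto simp: chart_lift_def g1_def simp del: mem_ball)
   have "(t, z) : W1" using t T z True by (auto simp: W1_def)
   hence xW: "x : W" using eq[of "(t, z)"] fd B_img x unfolding W_def overlap_eq[OF c] by (auto simp del: mem_ball)
   have "Ck_on k (%y. trans c d (g1 y)) W" for k
    by (rule Ck_on_compose[OF oW _ Ck_trans[OF c d] Ck_on_subset[OF G1]]) (auto simp: W_def)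
   moreover have "?f y = trans c d (g1 y)" if "y : W" for y using eq[of y] that by (simp add: W_def case_prod_unfold)
   ultimately show ?thesis using oW xW by (intro exI[of _ W] exI[of _ "%y. trans c d (g1 y)"]) auto
  next
   case False
   define W where "W = (UNIV :: real set) \<times> {y : img c1. chart_inv c1 y : fst d \<inter> - dcore}"
   have oW: "open W" unfolding W_def
    by (intro open_Times open_UNIV open_chart_preimage c1 open_Int chart_props(1) d open_Compl closed_Z)
   have "chart_inv c1 z ~: dcore" using False Z_sub by blast
   hence xW: "x : W" using fd lift_off_Z[OF sup] t T z x by (auto simp: W_def)
   have Ck: "Ck_on k (%y. trans c1 d (snd y)) W" for k
    by (rule Ck_on_compose[OF oW _ Ck_trans[OF c1 d] Ck_on_bounded_linear[OF bounded_linear_snd]])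
     (auto simp: W_def overlap_eq[OF c1])
   have "?f y = trans c1 d (snd y)" if "y : ?S \<inter> W" for y
    using that lift_off_Z[OF sup, of "fst y"] T by (auto simp: W_def)
   thus ?thesis using oW xW Ck by (intro exI[of _ W] exI[of _ "%y. trans c1 d (snd y)"]) auto
  qed
 qed
 have "continuous_on ({0..1} \<times> UNIV) (%(t, x). ?\<Psi> t x)"
  by (rule continuous_on_subset[OF cont]) (use T Z_sub in auto)
 thus ?thesis unfolding smooth_family_def using sm by blast
qed

lemma smooth_map_lift:
 assumes F: "!!k. Ck_on k F UNIV" and sup: "supported F"
 shows "smooth_map A (chart_lift c dball F)"
proof -
 have "Ck_on k (%x :: real \<times> (complex^'n). F (snd x)) UNIV" for k
  by (rule Ck_on_compose[OF open_UNIV subset_UNIV F Ck_on_bounded_linear[OF bounded_linear_snd]])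
 hence "smooth_family A (%t. chart_lift c dball F)"
  by (intro smooth_family_lift[OF open_UNIV]) (auto simp: sup case_prod_unfold)
 from smooth_map_of_family[OF this, of 0] show ?thesis by simp
qed

lemma lift_inverse:
 assumes "supported F" "supported G" "!!z. F (G z) = z"
 shows "chart_lift c dball F (chart_lift c dball G p) = p"
proof (cases "p : dnbd")
 case True
 then obtain z where z: "z : dball" "p = chart_inv c z" by blast
 thus ?thesis using supported_in[OF assms(2) z(1)] by (simp add: lift_in assms(3))
qed (simp add: lift_out)

lemma push_forward_lift_out:
 assumes F: "supported F" and cont: "continuous_on UNIV (chart_lift c dball F)" and p: "p ~: dnbd"
 shows "push_forward A (chart_lift c dball F) p v = v"
proof (rule push_forward_fixed)
 show "open (- dcore)" by (intro open_Compl closed_Z)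
 show "p : - dcore" using p Z_sub by blast
 show "chart_lift c dball F y = y" if "y : - dcore" for y using lift_off_Z[OF F, of y] that by simp
 show "continuous_on (- dcore) (chart_lift c dball F)" by (rule continuous_on_subset[OF cont subset_UNIV])
qed

lemma push_forward_lift_in:
 assumes F: "supported F" and cont: "continuous_on UNIV (chart_lift c dball F)" and z: "z : dball"
  and der: "(F has_derivative F') (at z)"
 shows "push_forward A (chart_lift c dball F) (chart_inv c z) v = vec_of A c (chart_inv c (F z)) (F' (comps_in A c (chart_inv c z) v))"
proof -
 have zi: "z : img c" "F z : img c" using z supported_in[OF F z] B_img by auto
 have "((snd c o chart_lift c dball F o chart_inv c) has_derivative F') (at z)"
 proof (rule has_derivative_transform_within_open[OF der open_ball z])
  fix y assume y: "y : dball"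
  hence "F y : img c" using supported_in[OF F] B_img by blast
  thus "F y = (snd c o chart_lift c dball F o chart_inv c) y" using lift_in[OF y] c by simp
 qed
 hence der': "((snd c o chart_lift c dball F o chart_inv c) has_derivative F') (at (snd c (chart_inv c z)))"
  using zi c by simp
 have "chart_lift c dball F (chart_inv c z) : fst c" using lift_in[OF z] zi c by simp
 from push_forward_in_charts[OF c _ c this cont open_UNIV UNIV_I der', of v]
 show ?thesis using zi c lift_in[OF z] by simp
qed

text \<open>Both distances are estimated along the coordinate segment between a point and its image,
  which stays in the convex ball. A unit vector has coordinate norm at most sqrt K, and sqrt K + K +
  3 K^2 is rounded up to 6 K^2.\<close>

lemma lift_distances:
 assumes K: "tame c (cball z0 (3 * r)) K" and F: "supported F"
  and cont: "continuous_on UNIV (chart_lift c dball F)" and \<eta>: "0 <= \<eta>" "\<eta> <= 1"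
  and near: "!!z. norm (F z - z) <= \<eta>"
  and der: "!!z. (F has_derivative F' z) (at z)" and dnear: "!!z u. norm (F' z u - u) <= \<eta> * norm u"
 shows "mapping_distance A h (chart_lift c dball F) <= ennreal (6 * K * K * \<eta>)"
  and "push_forward_distance A h (chart_lift c dball F) <= ennreal (6 * K * K * \<eta>)"
proof -
 let ?\<Phi> = "chart_lift c dball F"
 have K1: "1 <= K" by (rule tameD(3)[OF K])
 hence sK: "sqrt K <= K" by (simp add: real_le_lsqrt power2_eq_square mult_left_mono[of 1 K K, simplified])
 have KK: "K <= K * K" using K1 by simp
 have seg: "y + t *R (z - y) : cball z0 (3 * r)" if "y : dball" "z : dball" "t : {0..1}" for y z t
 proof -
  have "(1 - t) *R y + t *R z : cball z0 (3 * r)" using that by (intro convexD_alt convex_cball) auto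
  thus ?thesis by (simp add: algebra_simps)
 qed
 show "mapping_distance A h ?\<Phi> <= ennreal (6 * K * K * \<eta>)" unfolding mapping_distance_def
 proof (rule SUP_least)
  fix p
  show "distX A h p (?\<Phi> p) <= ennreal (6 * K * K * \<eta>)"
  proof (cases "p : dnbd")
   case True
   then obtain z where z: "z : dball" "p = chart_inv c z" by blast
   have "distX A h (chart_inv c z) (chart_inv c (z + (F z - z))) <= ennreal (sqrt K * norm (F z - z))"
    by (rule distX_line[OF K seg[OF z(1) supported_in[OF F z(1)]]])
   also have "... <= ennreal (6 * K * K * \<eta>)"
   proof (rule ennreal_leI)
    have "sqrt K * norm (F z - z) <= (K * K) * \<eta>" using near[of z] order_trans[OF sK KK] K1 \<eta> by (intro mult_mono) auto
    also have "... <= 6 * K * K * \<eta>" using K1 \<eta> by simp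
    finally show "sqrt K * norm (F z - z) <= 6 * K * K * \<eta>" .
   qed
   finally show ?thesis using z lift_in by simp
  qed (simp add: lift_out distX_refl)
 qed
 show "push_forward_distance A h ?\<Phi> <= ennreal (6 * K * K * \<eta>)" unfolding push_forward_distance_def
 proof (intro SUP_least)
  fix p v assume "v : {v. vec_norm h p v = 1}"
  hence v: "vec_norm h p v = 1" by simp
  show "distTX A h (?\<Phi> p, push_forward A ?\<Phi> p v) (p, v) <= ennreal (6 * K * K * \<eta>)"
  proof (cases "p : dnbd")
   case True
   then obtain z where z: "z : dball" "p = chart_inv c z" by blast
   have zL: "z : cball z0 (3 * r)" using z(1) by auto
   have zi: "z : img c" using z B_img by blast
   have pc: "p : fst c" "snd c p = z" using zi z c by auto
   define u where "u = comps_in A c p v"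
   have "norm u <= sqrt K * sqrt (gmet c z u u)" by (rule tameD(10)[OF K zL])
   also have "sqrt (gmet c z u u) = 1" using vec_norm_comps[OF c pc(1), of v] v pc by (simp add: u_def)
   finally have u: "norm u <= sqrt K" by simp
   let ?a = "z - F z" and ?b = "u - F' z u"
   have a: "norm ?a <= \<eta>" using near[of z] by (simp add: norm_minus_commute)
   have b1: "norm ?b <= \<eta> * norm u" using dnear[of z u] by (simp add: norm_minus_commute)
   have b: "norm ?b <= \<eta> * sqrt K" using b1 u \<eta> by (meson mult_left_mono order_trans)
   have b2: "norm ?b <= sqrt K" using b \<eta> K1 by (meson mult_left_le_one_le order_trans real_sqrt_ge_zero zero_le_one)
   have f: "norm (F' z u) <= 2 * sqrt K" using norm_triangle_ineq4[of u ?b] b2 u by simp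
   have "distTX A h (chart_inv c (F z), vec_of A c (chart_inv c (F z)) (F' z u))
     (chart_inv c (F z + ?a), vec_of A c (chart_inv c (F z + ?a)) (F' z u + ?b))
    <= ennreal (sqrt K * norm ?a + sqrt K * (norm ?b + K * norm ?a * (norm (F' z u) + norm ?b)))"
    by (rule distTX_line[OF K seg[OF supported_in[OF F z(1)] z(1)]])
   also have "... <= ennreal (6 * K * K * \<eta>)"
   proof (rule ennreal_leI)
    have "sqrt K * norm ?a + sqrt K * (norm ?b + K * norm ?a * (norm (F' z u) + norm ?b))
     <= sqrt K * \<eta> + sqrt K * (\<eta> * sqrt K + K * \<eta> * (2 * sqrt K + sqrt K))"
     using K1 \<eta> by (intro add_mono mult_mono mult_left_mono a b b2 f add_nonneg_nonneg mult_nonneg_nonneg) auto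
    also have "... = sqrt K * \<eta> + (sqrt K * sqrt K) * \<eta> + 3 * (sqrt K * sqrt K) * K * \<eta>" by (simp add: algebra_simps)
    also have "... = (sqrt K + K + 3 * K * K) * \<eta>" using K1 by (simp add: algebra_simps)
    also have "... <= (6 * K * K) * \<eta>"
    proof (rule mult_right_mono[OF _ \<eta>(1)])
     have "sqrt K + K + 3 * (K * K) <= 6 * (K * K)" using sK KK zero_le_square[of K] by linarith
     thus "sqrt K + K + 3 * K * K <= 6 * K * K" by (simp add: mult.assoc)
    qed
    finally show "sqrt K * norm ?a + sqrt K * (norm ?b + K * norm ?a * (norm (F' z u) + norm ?b)) <= 6 * K * K * \<eta>" .
   qed
   finally show ?thesis
    using push_forward_lift_in[OF F cont z(1) der, of v] lift_in[OF z(1)] z(2) vec_of_comps[OF c pc(1), of v]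
    by (simp add: u_def)
  next
   case False
   thus ?thesis by (simp add: push_forward_lift_out[OF F cont] lift_out distTX_refl)
  qed
 qed
qed

text \<open>The cut-off translations by t w, for t from 0 to 1, form the required deformation. On
  the ball of radius 2 r the final map is a pure translation in coordinates, so its derivative
  leaves the components of vectors unchanged.\<close>

lemma translation_in_Def:
 assumes \<delta>: "\<delta> > 0"
 shows "EX \<eta>>0. ALL w. norm w < \<eta> --> (EX \<Phi>:Def A h \<delta> dnbd. ALL z:ball z0 (2 * r).
  \<Phi> (chart_inv c z) = chart_inv c (z + w) &
  (ALL v. push_forward A \<Phi> (chart_inv c z) v = vec_of A c (chart_inv c (z + w)) (comps_in A c (chart_inv c z) v)))"
proof -
 obtain M cut where "bump z0 r M cut" using bump_exists[OF r] by blast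
 then interpret bump z0 r M cut .
 obtain K where K: "tame c (cball z0 (3 * r)) K" using tame_exists[OF c compact_cball sub] by blast
 have K1: "1 <= K" by (rule tameD(3)[OF K])
 \<comment> \<open>E * norm w dominates both the displacement norm w and the deviation 2 * M * norm
   w of the derivative.\<close>
 define E where "E = 1 + 2 * M"
 have E: "1 <= E" using M by (simp add: E_def)
 \<comment> \<open>In turn: a displacement below r / 2, E * norm w <= 1, and the distance bound 6
   K^2 E |w| < \<delta>; 7 in place of 6 is slack.\<close>
 define \<eta> where "\<eta> = min (r / 2) (min (1 / E) (\<delta> / (7 * K * K * E)))"
 have \<eta>: "\<eta> > 0" using r \<delta> E K1 by (simp add: \<eta>_def)
 have sup: "supported (push w)" "supported (pull w)" if "small w" for w
  unfolding supported_def using push_ball[OF that] pull_ball[OF that] push_fix pull_fix[OF that] by blast+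
 have main: "EX \<Phi>:Def A h \<delta> dnbd. ALL z:ball z0 (2 * r).
  \<Phi> (chart_inv c z) = chart_inv c (z + w) &
  (ALL v. push_forward A \<Phi> (chart_inv c z) v = vec_of A c (chart_inv c (z + w)) (comps_in A c (chart_inv c z) v))"
  if w: "norm w < \<eta>" for w
 proof -
  \<comment> \<open>An open set of parameters around [0, 1] for which t w is still small.\<close>
  define I where "I = {t :: real. norm (t *R w) < \<eta>}"
  have oI: "open I" unfolding I_def by (intro open_Collect_less continuous_intros)
  have I01: "{0..1} <= I"
  proof
   fix t :: real assume "t : {0..1}"
   hence "\<bar>t\<bar> * norm w <= norm w" by (intro mult_left_le_one_le) auto
   thus "t : I" using w by (simp add: I_def)
  qed
  have sm: "small w'" if "norm w' < \<eta>" for w'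
  proof -
   have 1: "norm w' < r / 2" "norm w' < 1 / E" using that by (auto simp: \<eta>_def)
   have "E * norm w' < 1" using 1(2) E by (simp add: field_simps)
   moreover have "2 * M * norm w' <= E * norm w'" by (intro mult_right_mono) (auto simp: E_def)
   ultimately show ?thesis using 1 by (simp add: small_def)
  qed
  let ?\<Psi> = "%t. chart_lift c dball (push (t *R w))"
  have smI: "small (t *R w)" if "t : I" for t using that sm by (simp add: I_def)
  have fam: "smooth_family A ?\<Psi>"
   by (rule smooth_family_lift[OF oI I01]) (auto intro: Ck_on_subset[OF Ck_push_family] sup smI)
  have Kbound: "6 * K * K * (E * norm w') < \<delta>" if "norm w' < \<eta>" for w'
  proof -
   have pos: "0 < 7 * K * K * E" using K1 E by simp
   have "norm w' < \<delta> / (7 * K * K * E)" using that by (simp add: \<eta>_def)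
   hence "norm w' * (7 * K * K * E) < \<delta>" using pos by (simp only: pos_less_divide_eq)
   moreover have "6 * K * K * (E * norm w') <= norm w' * (7 * K * K * E)" using K1 E by (simp add: mult_ac)
   ultimately show ?thesis by linarith
  qed
  have Var: "?\<Psi> t : Var A h \<delta> dnbd" if t: "t : {0..1}" for t
  proof -
   let ?w = "t *R w"
   have tI: "t : I" using t I01 by blast
   have s: "small ?w" by (rule smI[OF tI])
   have nw: "norm ?w < \<eta>" using tI by (simp add: I_def)
   have smf: "smooth_map A (?\<Psi> t)" by (rule smooth_map_of_family[OF fam t])
   have smg: "smooth_map A (chart_lift c dball (pull ?w))" by (rule smooth_map_lift[OF Ck_pull[OF s] sup(2)[OF s]])
   have fg: "?\<Psi> t (chart_lift c dball (pull ?w) p) = p" for p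
    by (rule lift_inverse[OF sup[OF s]]) (rule push_pull[OF s])
   have gf: "chart_lift c dball (pull ?w) (?\<Psi> t p) = p" for p
    by (rule lift_inverse[OF sup(2,1)[OF s]]) (rule pull_push[OF s])
   have bij: "bij (?\<Psi> t)" by (rule o_bij[of "chart_lift c dball (pull ?w)"]) (auto simp: fun_eq_iff fg gf)
   have inv: "inv (?\<Psi> t) = chart_lift c dball (pull ?w)" by (rule inv_unique_comp) (auto simp: fun_eq_iff fg gf)
   have img: "?\<Psi> t ` dnbd = dnbd"
   proof
    show "?\<Psi> t ` dnbd <= dnbd" using supported_in[OF sup(1)[OF s]] by (auto simp: lift_in simp del: mem_ball)
    have "chart_lift c dball (pull ?w) ` dnbd <= dnbd" using supported_in[OF sup(2)[OF s]] by (auto simp: lift_in simp del: mem_ball)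
    hence "?\<Psi> t ` (chart_lift c dball (pull ?w) ` dnbd) <= ?\<Psi> t ` dnbd" by (rule image_mono)
    thus "dnbd <= ?\<Psi> t ` dnbd" by (simp only: image_image fg image_ident)
   qed
   have e: "0 <= E * norm ?w" "E * norm ?w <= 1" "norm ?w <= E * norm ?w" "2 * M * norm ?w <= E * norm ?w"
   proof -
    have "norm ?w < 1 / E" using nw by (simp add: \<eta>_def)
    thus "E * norm ?w <= 1" using E by (simp only: pos_less_divide_eq mult.commute)
    show "2 * M * norm ?w <= E * norm ?w" by (intro mult_right_mono) (auto simp: E_def)
    show "norm ?w <= E * norm ?w" using mult_right_mono[OF E norm_ge_zero[of ?w]] by (simp only: mult_1_left)
    show "0 <= E * norm ?w" using E by (intro mult_nonneg_nonneg) auto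
   qed
   have contf: "continuous_on UNIV (?\<Psi> t)" and contg: "continuous_on UNIV (chart_lift c dball (pull ?w))"
    using smf smg by (auto simp: smooth_map_def)
   note f = lift_distances[OF K sup(1)[OF s] contf e(1,2) order_trans[OF dist_push e(3)] push_derivative
     order_trans[OF dpush_near mult_right_mono[OF e(4) norm_ge_zero]]]
   note g = lift_distances[OF K sup(2)[OF s] contg e(1,2) order_trans[OF dist_pull[OF s] e(3)] pull_derivative[OF s]
     order_trans[OF dpull_near[OF s] mult_right_mono[OF e(4) norm_ge_zero]]]
   have lt: "ennreal (6 * K * K * (E * norm ?w)) < ennreal \<delta>" "ennreal (6 * K * K * (E * norm ?w)) < ennreal (3 * \<delta>)"
    by (intro ennreal_lessI; use Kbound[OF nw] \<delta> in linarith)+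
   show ?thesis unfolding Var_def diffeo_def
    using bij smf smg img f g lt lift_out by (auto simp: inv intro: le_less_trans)
  qed
  have w1: "?\<Psi> 1 = chart_lift c dball (push w)" by simp
  have id0: "?\<Psi> 0 = id"
  proof
   fix p
   show "?\<Psi> 0 p = id p" by (cases "p : dnbd") (auto simp: lift_in lift_out push_def simp del: mem_ball)
  qed
  have vel: "vec_norm h (?\<Psi> t p) (velocity A (%s. ?\<Psi> s p) t) <= 3 * \<delta>" if t: "t : {0..1}" for t p
  proof -
   have cont: "continuous_on {0..1} (%s. ?\<Psi> s p)"
   proof -
    have j: "continuous_on ({0..1} \<times> UNIV) (%(t, x). ?\<Psi> t x)" using fam by (simp add: smooth_family_def)
    have "continuous_on {0..1} (%s. (%(t, x). ?\<Psi> t x) (s, p))"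
     by (rule continuous_on_compose2[OF j continuous_on_Pair[OF continuous_on_id continuous_on_const]]) auto
    thus ?thesis by simp
   qed
   show ?thesis
   proof (cases "p : dnbd")
    case True
    then obtain z where z: "z : dball" "p = chart_inv c z" by blast
    have eq: "?\<Psi> s p = chart_inv c (z + s *R (cut z *R w))" for s
     unfolding z(2) lift_in[OF z(1)] by (simp add: push_def mult.commute)
    have inB: "z + s *R (cut z *R w) : dball" if "s : {0..1}" for s
     using supported_in[OF sup(1)[OF smI] z(1), of s] that I01 by (auto simp: push_def mult.commute simp del: mem_ball)
    have ini: "z + s *R (cut z *R w) : img c" if "s : {0..1}" for s using inB[OF that] B_img by blast
    have fc: "?\<Psi> t p : fst c" unfolding eq using ini[OF t] c by simp
    have "((%s. z + s *R (cut z *R w)) has_vector_derivative cut z *R w) (at t within {0..1})"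
     by (auto intro!: derivative_eq_intros)
    hence "((snd c o (%s. ?\<Psi> s p)) has_vector_derivative cut z *R w) (at t within {0..1})"
     by (rule has_vector_derivative_transform[OF t, rotated]) (use ini c in \<open>simp add: eq del: scaleR_scaleR\<close>)
    note v = velocity_in_chart[OF c fc t cont this]
    have zL: "snd c (?\<Psi> t p) : cball z0 (3 * r)" unfolding eq using inB[OF t] ini[OF t] c by simp
    have "vec_norm h (?\<Psi> t p) (velocity A (%s. ?\<Psi> s p) t) <= sqrt K * norm (cut z *R w)"
     unfolding v vec_norm_vec_of[OF c fc] by (rule tameD(9)[OF K zL])
    also have "... <= (6 * K * K) * (E * norm w)"
    proof (rule mult_mono)
     have "sqrt K <= K" using K1 by (simp add: real_le_lsqrt power2_eq_square)
     moreover have "K <= K * K" using K1 by simp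
     ultimately show "sqrt K <= 6 * K * K" using K1 by linarith
     have "norm (cut z *R w) <= norm w" using cut_nonneg[of z] cut_le[of z] by (simp add: mult_left_le_one_le)
     moreover have "1 * norm w <= E * norm w" by (intro mult_right_mono E) simp
     ultimately show "norm (cut z *R w) <= E * norm w" by linarith
    qed (use K1 in auto)
    also have "... <= 3 * \<delta>" using Kbound[OF w] \<delta> by linarith
    finally show ?thesis .
   next
    case False
    let ?d = "chart_at A p"
    note d = chart_at[of p]
    have eq: "(%s. ?\<Psi> s p) = (%s. p)" using False by (simp add: lift_out)
    have "velocity A (%s. p) t = vec_of A ?d p 0"
     by (rule velocity_in_chart[OF d(1)]) (use d t in \<open>auto simp: o_def\<close>)
    hence "vec_norm h p (velocity A (%s. p) t) = 0"
     using vec_norm_vec_of[OF d, of 0] gmet_props by (simp add: linear_0[OF linear_gmet_left] d)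
    thus ?thesis using \<delta> False by (simp add: lift_out)
   qed
  qed
  have "?\<Psi> 1 : Var A h \<delta> dnbd" by (rule Var) simp
  hence "?\<Psi> 1 : Def A h \<delta> dnbd"
   unfolding Def_def using Var fam id0 vel by (auto intro!: exI[of _ ?\<Psi>])
  moreover have "?\<Psi> 1 (chart_inv c z) = chart_inv c (z + w) &
   (ALL v. push_forward A (?\<Psi> 1) (chart_inv c z) v = vec_of A c (chart_inv c (z + w)) (comps_in A c (chart_inv c z) v))"
   if z: "z : ball z0 (2 * r)" for z
  proof -
   have zB: "z : dball" using z r by auto
   have p: "push w z = z + w" using cut1[of z] z by (simp add: push_def)
   have "(push w has_derivative (%v. v)) (at z)"
   proof (rule has_derivative_transform_within_open[OF _ open_ball z])
    show "((%y. y + w) has_derivative (%v. v)) (at z)" by (auto intro!: derivative_eq_intros)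
    show "y + w = push w y" if "y : ball z0 (2 * r)" for y using cut1[of y] that by (simp add: push_def)
   qed
   moreover have "continuous_on UNIV (?\<Psi> 1)"
    using smooth_map_of_family[OF fam, of 1] by (simp add: smooth_map_def)
   ultimately show ?thesis using push_forward_lift_in[OF sup(1)[OF sm[OF w]] _ zB] lift_in[OF zB] p by simp
  qed
  ultimately show ?thesis by blast
 qed
 show ?thesis using \<eta> main by blast
qed

end

end

section \<open>Coordinate patches\<close>

lemma mlin_diff: "mlin k \<omega> ==> mlin k \<eta> ==> mlin k (%vs. \<omega> vs - \<eta> vs)"
proof (induction k arbitrary: \<omega> \<eta>)
 case (Suc k)
 have "linear (%v. \<omega> (v # vs) - \<eta> (v # vs))" for vs using Suc.prems by (intro linear_compose_sub) auto
 moreover have "mlin k (%vs. \<omega> (v # vs) - \<eta> (v # vs))" for v using Suc.prems by (intro Suc.IH) auto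
 ultimately show ?case using Suc.prems by simp
qed simp

context herm_mfd
begin

text \<open>Total Borel version of the chart map, the counterpart of \<open>cinv\<close>.\<close>

definition cmap :: "('a, 'n) chart => 'a => complex^'n" where
 "cmap c x = (if x : fst c then snd c x else 0)"

lemma cmap_chart_inv [simp]: "c : A ==> z : img c ==> cmap c (chart_inv c z) = z" by (simp add: cmap_def)

lemma measurable_cmap: "c : A ==> cmap c : bmeas" unfolding cmap_def[abs_def]
 by (intro borel_measurable_continuous_on_if continuous_chart dom_borel continuous_on_const)

lemma open_chart_image:
 assumes "c : A" "open B" "B <= img c" shows "open (chart_inv c ` B)"
proof -
 have "chart_inv c ` B = fst c \<inter> snd c -` B"
 proof (intro set_eqI iffI)
  fix p assume "p : fst c \<inter> snd c -` B"
  hence "p = chart_inv c (snd c p)" "snd c p : B" using assms by auto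
  thus "p : chart_inv c ` B" by blast
 qed (use assms in auto)
 thus ?thesis
  using continuous_open_preimage[OF continuous_chart[OF assms(1)] chart_props(1)[OF assms(1)] assms(2)] by simp
qed

lemma tame_mono_const:
 assumes "tame c L K" "K <= K'" shows "tame c L K'"
proof -
 note T = tameD[OF assms(1)]
 show ?thesis unfolding tame_def
 proof (intro conjI ballI allI)
  fix z u v assume z: "z : L"
  have "0 <= K * gmet c z u u" by (rule order_trans[OF zero_le_power2 T(5)[OF z]])
  hence g: "0 <= gmet c z u u" using T(3) by (simp add: zero_le_mult_iff)
  show "gmet c z u u <= K' * (norm u)\<^sup>2" by (rule order_trans[OF T(4)[OF z] mult_right_mono[OF assms(2)]]) simp
  show "(norm u)\<^sup>2 <= K' * gmet c z u u" by (rule order_trans[OF T(5)[OF z] mult_right_mono[OF assms(2) g]])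
  show "norm (chris c z u v) <= K' * norm u * norm v"
   by (rule order_trans[OF T(6)[OF z]]) (intro mult_right_mono assms(2) norm_ge_zero)
  show "rho c z <= K'" using T(7)[OF z] assms(2) by linarith
  have "0 <= rho c z" using T(1,2) z rho_pos[of c z] by (auto intro: less_imp_le)
  thus "1 <= K' * rho c z" using order_trans[OF T(8)[OF z] mult_right_mono[OF assms(2)]] by blast
 qed (use T assms in auto)
qed

lemma nn_integral_patch:
 assumes c: "c : A" and S: "S : sets borel" "S <= img c" and u: "u : bmeas"
 shows "(\<integral>\<^sup>+x\<in>chart_inv c ` S. u (cmap c x) \<partial>vol) = (LI z:S. ennreal (rho c z) * u z)"
proof -
 have sub: "chart_inv c ` S <= fst c" using S c by auto
 have img: "snd c ` chart_inv c ` S = S"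
 proof -
  have "snd c ` chart_inv c ` S = (%z. z) ` S" unfolding image_image using S c by (intro image_cong) auto
  thus ?thesis by simp
 qed
 have m: "(%x. u (cmap c x)) : bmeas" by (rule measurable_compose[OF measurable_cmap[OF c] u])
 have "(\<integral>\<^sup>+x\<in>chart_inv c ` S. u (cmap c x) \<partial>vol)
   = (LI z:S. ennreal (rho c z) * u (cmap c (chart_inv c z)))"
  using nn_integral_vol_chart[OF c chart_inv_image_borel[OF c S] sub m] unfolding img .
 also have "... = (LI z:S. ennreal (rho c z) * u z)"
  using S c by (intro nn_integral_cong) (auto simp: subset_iff split: split_indicator)
 finally show ?thesis .
qed

text \<open>On a tame set the density lies between 1 / K and K.\<close>

lemma patch_integral_bounds:
 assumes L: "tame c L K" and S: "S : sets borel" "S <= L" and u[measurable]: "u : bmeas"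
 shows "(\<integral>\<^sup>+x\<in>chart_inv c ` S. u (cmap c x) \<partial>vol) <= ennreal K * (LI z:S. u z)"
  and "(LI z:S. u z) <= ennreal K * (\<integral>\<^sup>+x\<in>chart_inv c ` S. u (cmap c x) \<partial>vol)"
proof -
 note T = tameD[OF L]
 have [measurable]: "S : sets borel" by fact
 have Si: "S <= img c" using S T(2) by blast
 have rho_m: "(%z. indicator S z *R rho c z) : bmeas"
  using borel_measurable_continuous_on_indicator[OF S(1) continuous_on_subset[OF continuous_rho[OF T(1)] Si]] .
 have e: "ennreal (rho c z) * u z * indicator S z = ennreal (indicator S z *R rho c z) * u z" for z
  by (auto split: split_indicator)
 have eq: "(\<integral>\<^sup>+x\<in>chart_inv c ` S. u (cmap c x) \<partial>vol) = (LI z. ennreal (indicator S z *R rho c z) * u z)"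
  unfolding nn_integral_patch[OF T(1) S(1) Si u] e ..
 have K: "0 <= K" using T(3) by simp
 have "(LI z. ennreal (indicator S z *R rho c z) * u z) <= (LI z. ennreal K * (u z * indicator S z))"
  using T(7) S(2) by (intro nn_integral_mono) (auto split: split_indicator intro!: mult_right_mono ennreal_leI)
 also have "... = ennreal K * (LI z:S. u z)" by (rule nn_integral_cmult) measurable
 finally show "(\<integral>\<^sup>+x\<in>chart_inv c ` S. u (cmap c x) \<partial>vol) <= ennreal K * (LI z:S. u z)"
  unfolding eq .
 have "(LI z:S. u z) <= (LI z. ennreal K * (ennreal (indicator S z *R rho c z) * u z))"
 proof (intro nn_integral_mono)
  fix z
  show "u z * indicator S z <= ennreal K * (ennreal (indicator S z *R rho c z) * u z)"
  proof (cases "z : S")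
   case True
   have "0 <= rho c z" using less_imp_le[OF rho_pos[OF T(1)]] True Si by blast
   hence "ennreal 1 <= ennreal K * ennreal (rho c z)"
    using ennreal_leI[OF T(8)[of z]] True S(2) K by (auto simp: ennreal_mult)
   hence "1 * u z <= (ennreal K * ennreal (rho c z)) * u z" by (intro mult_right_mono) auto
   thus ?thesis using True by (simp add: mult.assoc)
  qed simp
 qed
 also have "... = ennreal K * (LI z. ennreal (indicator S z *R rho c z) * u z)"
  by (rule nn_integral_cmult, unfold measurable_lborel2, intro borel_measurable_times_ennreal measurable_compose[OF rho_m measurable_ennreal] u)
 finally show "(LI z:S. u z) <= ennreal K * (\<integral>\<^sup>+x\<in>chart_inv c ` S. u (cmap c x) \<partial>vol)"
  unfolding eq .
qed

end

section \<open>Patches and the coefficients of forms\<close>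

context herm_L2
begin

abbreviation pc :: "('a, 'n) chart \<times> (complex^'n) \<times> real \<times> real => ('a, 'n) chart" where "pc j \<equiv> fst j"
abbreviation pz :: "('a, 'n) chart \<times> (complex^'n) \<times> real \<times> real => complex^'n" where "pz j \<equiv> fst (snd j)"
abbreviation pr :: "('a, 'n) chart \<times> (complex^'n) \<times> real \<times> real => real" where "pr j \<equiv> fst (snd (snd j))"
abbreviation pK :: "('a, 'n) chart \<times> (complex^'n) \<times> real \<times> real => real" where "pK j \<equiv> snd (snd (snd j))"

abbreviation "dom4 j \<equiv> cball (pz j) (4 * pr j)"
abbreviation "dom3 j \<equiv> ball (pz j) (3 * pr j)"
abbreviation "dom1 j \<equiv> cball (pz j) (pr j)"
abbreviation "pinv j \<equiv> chart_inv (pc j)"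

text \<open>A patch is a tuple (chart, centre, radius r, constant K). The bounds hold up to radius 4
  r so that short curves and small translations starting in the smaller balls stay in their
  range.\<close>

definition patch :: "('a, 'n) chart \<times> (complex^'n) \<times> real \<times> real => bool" where
 "patch j \<longleftrightarrow> 0 < pr j & tame (pc j) (dom4 j) (pK j) &
  (ALL z:dom4 j. exp (- \<phi> (pinv j z)) <= pK j & 1 <= pK j * exp (- \<phi> (pinv j z)))"

lemma patchD:
 assumes "patch j"
 shows "0 < pr j" "tame (pc j) (dom4 j) (pK j)" "pc j : A" "dom4 j <= img (pc j)" "1 <= pK j"
  "z : dom4 j ==> exp (- \<phi> (pinv j z)) <= pK j" "z : dom4 j ==> 1 <= pK j * exp (- \<phi> (pinv j z))"
  "dom3 j <= dom4 j" "dom1 j <= dom3 j" "dom3 j <= img (pc j)" "dom1 j <= img (pc j)" "dom1 j <= dom4 j"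
 using assms by (auto simp: patch_def tame_def)

text \<open>The radius is a quarter of that of a coordinate ball, and K is enlarged by exp M to
  absorb the weight, which is bounded on compact sets.\<close>

lemma patch_exists: "EX j. patch j & x : pinv j ` ball (pz j) (pr j)"
proof -
 let ?c = "chart_at A x" and ?z = "snd (chart_at A x) x"
 note c = chart_at[of x]
 obtain e where e: "e > 0" "cball ?z e <= img ?c"
  using chart_props(2)[OF c(1)] c(2) unfolding open_contains_cball by blast
 obtain K where K: "tame ?c (cball ?z e) K" using tame_exists[OF c(1) compact_cball e(2)] by blast
 have "continuous_on (cball ?z e) (%z. \<phi> (chart_inv ?c z))"
  by (rule continuous_on_compose2[OF weight continuous_on_subset[OF continuous_chart_inv[OF c(1)] e(2)]]) simp
 then obtain M where M: "M >= 0" "!!z. z : cball ?z e ==> \<bar>\<phi> (chart_inv ?c z)\<bar> <= M"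
  using continuous_bounded_on_compact[OF compact_cball] by blast
 define K' where "K' = max K (exp M)"
 have t: "tame ?c (cball ?z e) K'" by (rule tame_mono_const[OF K]) (simp add: K'_def)
 have w: "exp (- \<phi> (chart_inv ?c z)) <= K' & 1 <= K' * exp (- \<phi> (chart_inv ?c z))" if "z : cball ?z e" for z
 proof
  have b: "- \<phi> (chart_inv ?c z) <= M" "\<phi> (chart_inv ?c z) <= M" using M(2)[OF that] by auto
  show "exp (- \<phi> (chart_inv ?c z)) <= K'" using b(1) by (simp add: K'_def le_max_iff_disj)
  have "exp (\<phi> (chart_inv ?c z)) <= K'" using b(2) by (simp add: K'_def le_max_iff_disj)
  hence "exp (\<phi> (chart_inv ?c z)) * exp (- \<phi> (chart_inv ?c z)) <= K' * exp (- \<phi> (chart_inv ?c z))"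
   by (intro mult_right_mono) auto
  thus "1 <= K' * exp (- \<phi> (chart_inv ?c z))" by (simp add: exp_minus)
 qed
 have "patch (?c, ?z, e / 4, K')" using e t w by (simp add: patch_def)
 moreover have "x : chart_inv ?c ` ball ?z (e / 4)" using e c by (intro image_eqI[of _ _ ?z]) auto
 ultimately show ?thesis by (intro exI[of _ "(?c, ?z, e / 4, K')"]) simp
qed

lemma patch_cover:
 assumes L: "compact L"
 obtains P where "finite P" "!!j. j : P ==> patch j" "L <= (\<Union>j\<in>P. pinv j ` ball (pz j) (pr j))"
proof (rule compactE_image[OF L, of "{j. patch j}" "%j. pinv j ` ball (pz j) (pr j)"])
 fix j assume "j : {j. patch j}"
 hence j: "patch j" by simp
 show "open (pinv j ` ball (pz j) (pr j))" by (rule open_chart_image) (use patchD(3,11)[OF j] in auto)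
next
 show "L <= (\<Union>j\<in>{j. patch j}. pinv j ` ball (pz j) (pr j))" using patch_exists by blast
next
 fix P assume "P <= {j. patch j}" "finite P" "L <= (\<Union>j\<in>P. pinv j ` ball (pz j) (pr j))"
 thus thesis by (intro that[of P]) auto
qed

abbreviation idx :: "(complex^'n) list set" where
 "idx \<equiv> {us. set us <= Basis & length us = deg}"

lemma finite_idx: "finite idx" by (rule finite_lists_length_eq) simp

text \<open>The factor between the weighted pointwise norm and the sum of squared coefficients: pK
  for the weight, the power from \<open>fnorm2_coord_bounds\<close>, the factorial from the
  normalisation of the norm.\<close>

definition pQ :: "('a, 'n) chart \<times> (complex^'n) \<times> real \<times> real => real" where
 "pQ j = pK j * (real (DIM(complex^'n)) * pK j) ^ deg * fact deg"

lemma pQ_ge: "patch j ==> 1 <= pQ j"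
proof -
 assume "patch j"
 hence K: "1 <= pK j" by (rule patchD)
 have "1 <= real (DIM(complex^'n))" using DIM_positive[where 'a = "complex^'n"] by linarith
 hence "1 * 1 <= real (DIM(complex^'n)) * pK j" using K by (intro mult_mono) auto
 hence 1: "1 <= (real (DIM(complex^'n)) * pK j) ^ deg" by (intro one_le_power) simp
 have "1 * 1 <= pK j * (real (DIM(complex^'n)) * pK j) ^ deg" using K 1 by (intro mult_mono) auto
 hence "1 * 1 <= pK j * (real (DIM(complex^'n)) * pK j) ^ deg * fact deg" by (intro mult_mono) auto
 thus ?thesis by (simp add: pQ_def)
qed

lemma patch_pointwise:
 assumes j: "patch j" and z: "z : dom4 j" and m: "mlin deg \<omega>"
 defines "x \<equiv> pinv j z"
 shows "fnorm2 deg x \<omega> * exp (- \<phi> x) <= pQ j * frame_sum Basis deg (cform (pc j) x \<omega>)"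
  and "frame_sum Basis deg (cform (pc j) x \<omega>) <= pQ j * (fnorm2 deg x \<omega> * exp (- \<phi> x))"
proof -
 note P = patchD[OF j]
 note T = tameD[OF P(2)]
 let ?D = "real (DIM(complex^'n)) * pK j" and ?fs = "frame_sum Basis deg (cform (pc j) x \<omega>)"
 have K: "1 <= pK j" by (rule P(5))
 have zi: "z : img (pc j)" using z P(4) by blast
 have x: "x : fst (pc j)" "snd (pc j) x = z" using zi P(3) by (auto simp: x_def)
 have K0: "0 < pK j" using K by linarith
 have b: "fnorm2 deg x \<omega> <= ?D ^ deg * ?fs" "?fs <= ?D ^ deg * fact deg * fnorm2 deg x \<omega>"
  by (rule fnorm2_coord_bounds[OF P(3) x(1) m K0]; unfold x(2); rule T(4)[OF z] T(5)[OF z])+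
 have D0: "0 <= ?D ^ deg" using K by simp
 have fs0: "0 <= ?fs" by (rule frame_sum_nonneg)
 have "fnorm2 deg x \<omega> * exp (- \<phi> x) <= (?D ^ deg * ?fs) * pK j"
  using b(1) P(6)[OF z] fs0 D0 unfolding x_def[symmetric] by (intro mult_mono mult_nonneg_nonneg) auto
 also have "... <= (?D ^ deg * ?fs * pK j) * fact deg"
  using mult_left_mono[of 1 "fact deg" "?D ^ deg * ?fs * pK j"] fs0 D0 K by simp
 finally show "fnorm2 deg x \<omega> * exp (- \<phi> x) <= pQ j * ?fs" by (simp add: pQ_def mult_ac)
 have "?fs <= (?D ^ deg * fact deg * fnorm2 deg x \<omega>) * 1" using b(2) by simp
 also have "... <= (?D ^ deg * fact deg * fnorm2 deg x \<omega>) * (pK j * exp (- \<phi> x))"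
  using P(7)[OF z] D0 fnorm2_nonneg[of deg x \<omega>] unfolding x_def[symmetric] by (intro mult_left_mono mult_nonneg_nonneg) auto
 finally show "?fs <= pQ j * (fnorm2 deg x \<omega> * exp (- \<phi> x))" by (simp add: pQ_def mult_ac)
qed

text \<open>The bound for the energy over a patch in terms of coefficients: pK accounts for the
  volume density, pQ for the pointwise norm.\<close>

definition psum :: "('a, 'n) chart \<times> (complex^'n) \<times> real \<times> real => ((complex^'n) list => complex^'n => complex) => ennreal" where
 "psum j a = ennreal (pK j * pQ j) * (SUM us:idx. \<integral>\<^sup>+z\<in>dom1 j. nsq (a us z) \<partial>lborel)"

lemma energy_patches:
 assumes P: "finite P" "!!j. j : P ==> patch j" and S: "S <= (\<Union>j\<in>P. pinv j ` dom1 j)"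
  and m: "!!j z. j : P ==> z : dom1 j ==> mlin deg (\<omega> (pinv j z))"
  and a[measurable]: "!!j us. a j us : bmeas"
  and eq: "!!j z us. j : P ==> z : dom1 j ==> us : idx ==> norm (cform (pc j) (pinv j z) (\<omega> (pinv j z)) us) <= norm (a j us z)"
 shows "energy S \<omega> <= (SUM j:P. psum j (a j))"
proof -
 define u where "u j z = ennreal (pQ j) * (SUM us:idx. nsq (a j us z))" for j z
 have u[measurable]: "u j : bmeas" for j unfolding u_def[abs_def] by measurable
 have um: "(%x. u j (cmap (pc j) x)) : bmeas" if "j : P" for j
  by (rule measurable_compose[OF measurable_cmap[OF patchD(3)[OF P(2)[OF that]]] u])
 have V: "pinv j ` dom1 j : sets borel" if "j : P" for j
  using patchD(3,11)[OF P(2)[OF that]] by (intro chart_inv_image_borel) auto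
 have pt: "ennreal (dens \<omega> x) * indicator S x <= (SUM j:P. u j (cmap (pc j) x) * indicator (pinv j ` dom1 j) x)" for x
 proof (cases "x : S")
  case True
  then obtain j z where j: "j : P" "z : dom1 j" "x = pinv j z" using S by blast
  note Pj = patchD[OF P(2)[OF j(1)]]
  have zi: "z : img (pc j)" "z : dom4 j" using j(2) Pj(11,12) by auto
  have "dens \<omega> x <= pQ j * frame_sum Basis deg (cform (pc j) x (\<omega> x))"
   unfolding dens_def j(3) by (rule patch_pointwise(1)[OF P(2)[OF j(1)] zi(2) m[OF j(1,2)]])
  also have "... <= pQ j * (SUM us:idx. (norm (a j us z))\<^sup>2)"
   unfolding frame_sum_def j(3) using pQ_ge[OF P(2)[OF j(1)]]
   by (intro mult_left_mono sum_mono power_mono eq[OF j(1,2)]) auto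
  finally have "ennreal (dens \<omega> x) <= ennreal (pQ j * (SUM us:idx. (norm (a j us z))\<^sup>2))" by (rule ennreal_leI)
  also have "... = u j z"
   unfolding u_def using pQ_ge[OF P(2)[OF j(1)]] by (simp add: ennreal_mult sum_nonneg sum_ennreal)
  also have "... = u j (cmap (pc j) x) * indicator (pinv j ` dom1 j) x" using j zi Pj(3) by simp
  also have "... <= (SUM j:P. u j (cmap (pc j) x) * indicator (pinv j ` dom1 j) x)"
   using P(1) j(1) by (intro member_le_sum[where f = "%j. u j (cmap (pc j) x) * indicator (pinv j ` dom1 j) x"]) auto
  finally show ?thesis using True by simp
 qed simp
 have "energy S \<omega> <= (\<integral>\<^sup>+x. (SUM j:P. u j (cmap (pc j) x) * indicator (pinv j ` dom1 j) x) \<partial>vol)"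
  unfolding energy_def by (rule nn_integral_mono) (rule pt)
 also have "... = (SUM j:P. \<integral>\<^sup>+x\<in>pinv j ` dom1 j. u j (cmap (pc j) x) \<partial>vol)"
  by (rule nn_integral_sum) (use um V in auto)
 also have "... <= (SUM j:P. psum j (a j))"
 proof (rule sum_mono)
  fix j assume j: "j : P"
  note Pj = patchD[OF P(2)[OF j]]
  have d1: "dom1 j : sets borel" by simp
  have "(\<integral>\<^sup>+x\<in>pinv j ` dom1 j. u j (cmap (pc j) x) \<partial>vol) <= ennreal (pK j) * (LI z:dom1 j. u j z)"
   by (rule patch_integral_bounds(1)[OF Pj(2) d1 Pj(12) u])
  also have "(LI z:dom1 j. u j z)
    = (LI z. ennreal (pQ j) * (SUM us:idx. nsq (a j us z) * indicator (dom1 j) z))"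
   unfolding u_def by (intro nn_integral_cong) (simp only: sum_distrib_right mult.assoc)
  also have "... = ennreal (pQ j) * (SUM us:idx. \<integral>\<^sup>+z\<in>dom1 j. nsq (a j us z) \<partial>lborel)"
  proof -
   have m: "(%z. nsq (a j us z) * indicator (dom1 j) z) : borel_measurable lborel" for us
    by (simp add: borel_measurable_times_ennreal borel_measurable_indicator)
   show ?thesis unfolding nn_integral_cmult[OF borel_measurable_sum[OF m]] nn_integral_sum[OF m] ..
  qed
  also have "ennreal (pK j) * ... = psum j (a j)"
   unfolding psum_def using Pj(5) pQ_ge[OF P(2)[OF j]] by (simp add: ennreal_mult mult.assoc)
  finally show "(\<integral>\<^sup>+x\<in>pinv j ` dom1 j. u j (cmap (pc j) x) \<partial>vol) <= psum j (a j)" .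
 qed
 finally show ?thesis .
qed

text \<open>The reverse comparison, again for forms not known to be measurable: the measurable
  function |a|^2 / pQ lies below the density of \<omega> on the patch, so its integral is at most
  the energy.\<close>

lemma coefficient_energy:
 assumes j: "patch j" and S: "S : sets borel" "S <= dom4 j"
  and m: "!!z. z : S ==> mlin deg (\<omega> (pinv j z))"
  and a[measurable]: "a : bmeas" and us: "us : idx"
  and eq: "!!z. z : S ==> cform (pc j) (pinv j z) (\<omega> (pinv j z)) us = a z"
 shows "(LI z:S. nsq (a z)) <= ennreal (pK j * pQ j) * energy UNIV \<omega>"
proof -
 note Pj = patchD[OF j]
 have [measurable]: "S : sets borel" by fact
 have Q: "1 <= pQ j" by (rule pQ_ge[OF j])
 define u where "u z = ennreal ((norm (a z))\<^sup>2 / pQ j)" for z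
 have [measurable]: "u : bmeas" unfolding u_def[abs_def] by measurable
 have au: "nsq (a z) = ennreal (pQ j) * u z" for z unfolding u_def using Q by (subst ennreal_mult[symmetric]) auto
 have "(LI z:S. nsq (a z)) = ennreal (pQ j) * (LI z:S. u z)"
  unfolding au mult.assoc by (rule nn_integral_cmult) measurable
 also have "... <= ennreal (pQ j) * (ennreal (pK j) * (\<integral>\<^sup>+x\<in>pinv j ` S. u (cmap (pc j) x) \<partial>vol))"
  by (intro mult_left_mono patch_integral_bounds(2)[OF Pj(2) S]) auto
 also have "... <= ennreal (pQ j) * (ennreal (pK j) * energy UNIV \<omega>)" unfolding energy_def
 proof (intro mult_left_mono)
  show "(\<integral>\<^sup>+x\<in>pinv j ` S. u (cmap (pc j) x) \<partial>vol) <= (\<integral>\<^sup>+x\<in>UNIV. ennreal (dens \<omega> x) \<partial>vol)"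
 proof (rule nn_integral_mono)
  fix x
  show "u (cmap (pc j) x) * indicator (pinv j ` S) x <= ennreal (dens \<omega> x) * indicator UNIV x"
  proof (cases "x : pinv j ` S")
   case True
   then obtain z where z: "z : S" "x = pinv j z" by blast
   have z4: "z : dom4 j" "z : img (pc j)" using z S(2) Pj(4) by auto
   have "(norm (a z))\<^sup>2 = (norm (cform (pc j) x (\<omega> x) us))\<^sup>2" using eq[OF z(1)] z(2) by simp
   also have "... <= frame_sum Basis deg (cform (pc j) x (\<omega> x))" unfolding frame_sum_def using us finite_idx
    by (intro member_le_sum[where f = "%us. (norm (cform (pc j) x (\<omega> x) us))\<^sup>2"]) auto
   also have "... <= pQ j * dens \<omega> x"
    unfolding dens_def z(2) by (rule patch_pointwise(2)[OF j z4(1) m[OF z(1)]])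
   finally have "(norm (a z))\<^sup>2 / pQ j <= dens \<omega> x" using Q by (simp add: field_simps)
   thus ?thesis using z z4 Pj(3) True by (simp add: u_def ennreal_leI)
  qed simp
 qed
 qed simp_all
 also have "... = ennreal (pK j * pQ j) * energy UNIV \<omega>" using Q Pj(5) by (simp add: ennreal_mult mult_ac)
 finally show ?thesis .
qed

text \<open>The extension by 0 off the ball of radius 3 r makes it a function on the whole space, to
  which translations and means apply.\<close>

definition coef :: "('a, 'n) chart \<times> (complex^'n) \<times> real \<times> real => ('a => 'n form) => (complex^'n) list => complex^'n => complex" where
 "coef j f us z = (if z : dom3 j then cform (pc j) (pinv j z) (f (pinv j z)) us else 0)"

lemma measurable_coef:
 assumes j: "patch j" and f: "measurable_form A f"
 shows "coef j f us : bmeas"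
proof -
 note Pj = patchD[OF j]
 have "cinv (pc j) : restrict_space borel (dom3 j) \<rightarrow>\<^sub>M restrict_space borel (fst (pc j))"
  by (rule measurable_restrict_space3[OF measurable_cinv[OF Pj(3)]]) (use Pj(3,10) in \<open>auto simp: cinv_def simp del: mem_ball\<close>)
 moreover have "(%x. f x (map (vec_of A (pc j) x) us)) : borel_measurable (restrict_space borel (fst (pc j)))"
  using f Pj(3) by (auto simp: measurable_form_def)
 ultimately have "(%z. f (cinv (pc j) z) (map (vec_of A (pc j) (cinv (pc j) z)) us)) : borel_measurable (restrict_space borel (dom3 j))"
  by (rule measurable_compose)
 hence "(%z. if z : dom3 j then f (cinv (pc j) z) (map (vec_of A (pc j) (cinv (pc j) z)) us) else 0) : bmeas"
  by (subst (asm) measurable_restrict_space_iff[where c = 0]) auto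
 moreover have "coef j f us = (%z. if z : dom3 j then f (cinv (pc j) z) (map (vec_of A (pc j) (cinv (pc j) z)) us) else 0)"
 proof
  fix z
  have "z : dom3 j ==> cinv (pc j) z = pinv j z" using Pj(10) by (auto simp: cinv_def simp del: mem_ball)
  thus "coef j f us z = (if z : dom3 j then f (cinv (pc j) z) (map (vec_of A (pc j) (cinv (pc j) z)) us) else 0)"
   by (simp add: coef_def cform_def)
 qed
 ultimately show ?thesis by simp
qed

lemma coef_energy:
 assumes j: "patch j" and f: "f : forms" and us: "us : idx"
 shows "(LI z. nsq (coef j f us z)) <= ennreal (pK j * pQ j) * energy UNIV f"
proof -
 have "(LI z. nsq (coef j f us z)) = (LI z:dom3 j. nsq (coef j f us z))"
  by (intro nn_integral_cong) (auto simp: coef_def split: split_indicator)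
 also have "... <= ennreal (pK j * pQ j) * energy UNIV f"
  by (rule coefficient_energy[OF j _ patchD(8)[OF j] formsD(2)[OF f] measurable_coef[OF j formsD(3)[OF f]] us])
   (auto simp: coef_def)
 finally show ?thesis .
qed

section \<open>Sufficiency\<close>

text \<open>The derivative is the identity in coordinates, so the coefficients of the pull-back are
  translated coefficients.\<close>

lemma pull_back_translation:
 assumes j: "patch j" and z: "z : dom3 j" "z + w : dom3 j" and f: "mlin deg (f (pinv j (z + w)))"
  and \<Phi>: "\<Phi> (pinv j z) = pinv j (z + w)"
   "!!v. push_forward A \<Phi> (pinv j z) v = vec_of A (pc j) (pinv j (z + w)) (comps_in A (pc j) (pinv j z) v)"
 shows "mlin deg (pull_back A \<Phi> f (pinv j z))"
  and "cform (pc j) (pinv j z) (pull_back A \<Phi> f (pinv j z)) us = coef j f us (z + w)"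
proof -
 note Pj = patchD[OF j]
 have p: "pinv j z : fst (pc j)" "pinv j (z + w) : fst (pc j)" using Pj(3,10) z by (auto simp del: mem_ball)
 have pf: "push_forward A \<Phi> (pinv j z) = (%v. vec_of A (pc j) (pinv j (z + w)) (comps_in A (pc j) (pinv j z) v))"
  using \<Phi>(2) by blast
 have "linear (push_forward A \<Phi> (pinv j z))"
  unfolding pf using linear_compose[OF linear_comps_in[OF Pj(3) p(1)] linear_vec_of[OF Pj(3) p(2)]] by (simp add: o_def)
 thus "mlin deg (pull_back A \<Phi> f (pinv j z))" unfolding pull_back_def \<Phi>(1) using f by (rule mlin_map_linear)
 show "cform (pc j) (pinv j z) (pull_back A \<Phi> f (pinv j z)) us = coef j f us (z + w)"
  using z(2) by (simp add: cform_def pull_back_def \<Phi> coef_def comps_vec_of[OF Pj(3) p(1)] o_def)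
qed

text \<open>Condition (i) is used for the chart ball of radius 3 r, with eps divided by the constant
  of \<open>coefficient_energy\<close>. The restriction |w| < r keeps z + w in that ball, where the
  coefficient has not been replaced by 0.\<close>

lemma translation_estimate:
 assumes j: "patch j" and F: "\<F> <= forms"
  and cond: "!!eps \<Omega>. eps > 0 ==> relatively_compact_open \<Omega> ==>
   EX \<delta>>0. ALL \<Phi>:Def A h \<delta> \<Omega>. ALL f:\<F>. energy UNIV (form_diff (pull_back A \<Phi> f) f) < ennreal eps"
  and eps: "eps > 0"
 shows "EX \<eta>>0. ALL w. norm w < \<eta> --> (ALL f:\<F>. ALL us:idx.
  (LI z:dom1 j. nsq (coef j f us z - coef j f us (z + w))) <= ennreal eps)"
proof -
 note Pj = patchD[OF j]
 have sub3: "cball (pz j) (3 * pr j) <= img (pc j)" using Pj(1,4) by (auto intro: order_trans)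
 have KQ: "0 < pK j * pQ j" using Pj(5) pQ_ge[OF j] by (intro mult_pos_pos) auto
 let ?N = "pinv j ` dom3 j"
 obtain \<delta> where \<delta>: "\<delta> > 0" "!!\<Phi> f. \<Phi> : Def A h \<delta> ?N ==> f : \<F> ==>
   energy UNIV (form_diff (pull_back A \<Phi> f) f) < ennreal (eps / (pK j * pQ j))"
  using cond[OF divide_pos_pos[OF eps KQ] relatively_compact_N[OF Pj(3,1) sub3]] by blast
 obtain \<eta> where \<eta>: "\<eta> > 0" "!!w. norm w < \<eta> ==> EX \<Phi>:Def A h \<delta> ?N. ALL z:ball (pz j) (2 * pr j).
  \<Phi> (pinv j z) = pinv j (z + w) &
  (ALL v. push_forward A \<Phi> (pinv j z) v = vec_of A (pc j) (pinv j (z + w)) (comps_in A (pc j) (pinv j z) v))"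
  using translation_in_Def[OF Pj(3,1) sub3 \<delta>(1)] by blast
 have "(LI z:dom1 j. nsq (coef j f us z - coef j f us (z + w))) <= ennreal eps"
  if w: "norm w < min \<eta> (pr j)" and f: "f : \<F>" and us: "us : idx" for w f us
 proof -
  have ff: "f : forms" using F f by blast
  have "norm w < \<eta>" using w by simp
  from \<eta>(2)[OF this] obtain \<Phi> where \<Phi>: "\<Phi> : Def A h \<delta> ?N" "!!z. z : ball (pz j) (2 * pr j) ==> \<Phi> (pinv j z) = pinv j (z + w)"
   "!!z v. z : ball (pz j) (2 * pr j) ==> push_forward A \<Phi> (pinv j z) v = vec_of A (pc j) (pinv j (z + w)) (comps_in A (pc j) (pinv j z) v)"
   by blast
  have in2: "z : ball (pz j) (2 * pr j)" "z : dom3 j" "z + w : dom3 j" if "z : dom1 j" for z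
  proof -
   have d: "dist (pz j) z <= pr j" using that by simp
   show "z : ball (pz j) (2 * pr j)" "z : dom3 j" using d Pj(1) by auto
   have "dist (pz j) (z + w) <= dist (pz j) z + norm w" using dist_triangle[of "pz j" "z + w" z] by (simp add: dist_norm)
   thus "z + w : dom3 j" using d w Pj(1) by simp
  qed
  note tr = pull_back_translation[where \<Phi> = \<Phi> and f = f, OF j in2(2,3) formsD(2)[OF ff] \<Phi>(2)[OF in2(1)] \<Phi>(3)[OF in2(1)]]
  have [measurable]: "coef j f us : bmeas" by (rule measurable_coef[OF j formsD(3)[OF ff]])
  have "(LI z:dom1 j. nsq (coef j f us (z + w) - coef j f us z))
    <= ennreal (pK j * pQ j) * energy UNIV (form_diff (pull_back A \<Phi> f) f)"
  proof (rule coefficient_energy[OF j _ Pj(12) _ _ us])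
   fix z assume z: "z : dom1 j"
   show "mlin deg (form_diff (pull_back A \<Phi> f) f (pinv j z))"
    unfolding form_diff_def by (intro mlin_diff tr(1)[OF z z z z] formsD(2)[OF ff])
   show "cform (pc j) (pinv j z) (form_diff (pull_back A \<Phi> f) f (pinv j z)) us = coef j f us (z + w) - coef j f us z"
    using tr(2)[OF z z z z, of us] in2(2)[OF z] by (simp add: form_diff_def cform_def coef_def)
  qed measurable
  also have "... <= ennreal (pK j * pQ j) * ennreal (eps / (pK j * pQ j))"
   by (intro mult_left_mono less_imp_le[OF \<delta>(2)[OF \<Phi>(1) f]]) auto
  also have "... = ennreal eps"
  proof -
   have "ennreal x * ennreal (eps / x) = ennreal eps" if "x > 0" for x
    using that eps by (subst ennreal_mult[symmetric]) auto
   from this[OF KQ] show ?thesis .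
  qed
  finally show ?thesis by (simp add: norm_minus_commute)
 qed
 thus ?thesis using \<eta>(1) Pj(1) by (intro exI[of _ "min \<eta> (pr j)"]) auto
qed

text \<open>Finitely many bounded quantities that decide closeness of two forms in a patch. They are
  scaled so that the threshold is always 1, which lets one finite net serve all patches.\<close>

definition patch_coords :: "('a, 'n) chart \<times> (complex^'n) \<times> real \<times> real => ('a => 'n form) set => real => 'i set =>
  (('a => 'n form) => 'i => complex) => real => bool" where
 "patch_coords j \<F> eps I T M \<longleftrightarrow> finite I & (ALL f:\<F>. ALL i:I. cmod (T f i) <= M) &
  (ALL f:\<F>. ALL g:\<F>. (ALL i:I. cmod (T f i - T g i) <= 1) --> psum j (%us z. coef j f us z - coef j g us z) <= ennreal eps)"

lemma patch_net:
 assumes j: "patch j" and F: "\<F> <= forms" and R: "!!f. f : \<F> ==> energy UNIV f <= ennreal R" "R >= 0"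
  and tr: "!!eps. eps > 0 ==> EX \<eta>>0. ALL w. norm w < \<eta> --> (ALL f:\<F>. ALL us:idx.
   (LI z:dom1 j. nsq (coef j f us z - coef j f us (z + w))) <= ennreal eps)"
  and eps: "eps > 0"
 shows "EX Y :: (nat \<times> (complex^'n) list) set \<times> _. patch_coords j \<F> eps (fst Y) (fst (snd Y)) (snd (snd Y))"
proof -
 note Pj = patchD[OF j]
 let ?KQ = "pK j * pQ j" and ?D = "2 ^ DIM(complex^'n) :: real" and ?m = "measure lborel (dom1 j)"
 let ?n = "real (card idx)"
 have KQ: "0 < ?KQ" using Pj(5) pQ_ge[OF j] by (intro mult_pos_pos) auto
 \<comment> \<open>There are n coefficients, each contributing 2 e with weight KQ; n + 1 keeps the
   denominator positive.\<close>
 define e where "e = eps / (2 * (?KQ * (?n + 1)))"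
 have q: "0 < 2 * (?KQ * (?n + 1))" by (rule mult_pos_pos[OF _ mult_pos_pos[OF KQ]]) auto
 have e: "e > 0" unfolding e_def by (rule divide_pos_pos[OF eps q])
 \<comment> \<open>e1 and \<eta>1 are chosen so that the two terms in the bound of
   \<open>local_means\<close> are at most e each.\<close>
 define e1 where "e1 = e / (6 * ?D)"
 have e1: "e1 > 0" using e by (simp add: e1_def)
 define \<eta>1 where "\<eta>1 = sqrt (e / (3 * (?m + 1)))"
 have m0: "0 <= ?m" by simp
 have "0 < 3 * (m + 1)" if "0 <= m" for m :: real using that by simp
 from this[OF m0] have \<eta>1: "\<eta>1 > 0" unfolding \<eta>1_def by (intro real_sqrt_gt_zero divide_pos_pos e)
 obtain \<eta> where \<eta>: "\<eta> > 0" "!!w f us. norm w < \<eta> ==> f : \<F> ==> us : idx ==>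
   (LI z:dom1 j. nsq (coef j f us z - coef j f us (z + w))) <= ennreal e1" using tr[OF e1] by blast
 \<comment> \<open>The means over balls of radius s need translations up to 2 s.\<close>
 define s where "s = \<eta> / 2"
 have s: "s > 0" using \<eta> by (simp add: s_def)
 obtain N :: nat and \<zeta> :: "nat => complex^'n" where
  L1: "!!a R i. a : bmeas ==> 0 <= R ==> (LI z:UNIV. nsq (a z)) <= ennreal R ==> i < N
   ==> (norm (ball_mean s (\<zeta> i) a))\<^sup>2 <= R / measure lborel (ball (0::complex^'n) s)" and
  L2: "!!a a' R eps \<eta>. a : bmeas ==> a' : bmeas ==>
   (LI z:UNIV. nsq (a z)) <= ennreal R ==> (LI z:UNIV. nsq (a' z)) <= ennreal R ==>
   (!!w. norm w < 2 * s ==> (LI x:dom1 j. nsq (a x - a (x + w))) <= ennreal eps) ==>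
   (!!w. norm w < 2 * s ==> (LI x:dom1 j. nsq (a' x - a' (x + w))) <= ennreal eps) ==>
   (!!i. i < N ==> norm (ball_mean s (\<zeta> i) a - ball_mean s (\<zeta> i) a') <= \<eta>) ==> 0 <= eps ==> 0 <= \<eta> ==>
   (LI x:dom1 j. nsq (a x - a' x)) <= ennreal (6 * 2 ^ DIM(complex^'n) * eps + 3 * \<eta>\<^sup>2 * measure lborel (dom1 j))"
 proof (rule local_means[OF compact_cball[of "pz j" "pr j"] s, of UNIV], goal_cases)
  case (3 N \<zeta>)
  show ?case by (rule that) (fact 3)+
 qed auto
 define R1 where "R1 = ?KQ * R"
 have R1: "0 <= R1" using KQ R(2) by (simp add: R1_def)
 have cR: "(LI z:UNIV. nsq (coef j f us z)) <= ennreal R1" if "f : \<F>" "us : idx" for f us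
 proof -
  have "(LI z. nsq (coef j f us z)) <= ennreal ?KQ * energy UNIV f"
   by (rule coef_energy[OF j _ that(2)]) (use F that in blast)
  also have "... <= ennreal ?KQ * ennreal R" by (intro mult_left_mono R that) auto
  also have "... = ennreal R1" using KQ R(2) by (simp add: R1_def ennreal_mult)
  finally show ?thesis by simp
 qed
 have mc: "coef j f us : bmeas" if "f : \<F>" for f us by (rule measurable_coef[OF j formsD(3)]) (use F that in blast)
 define T where "T f i = ball_mean s (\<zeta> (fst i)) (coef j f (snd i)) / complex_of_real \<eta>1" for f and i :: "nat \<times> (complex^'n) list"
 define I :: "(nat \<times> (complex^'n) list) set" where "I = {..<N} \<times> idx"
 define M where "M = sqrt (R1 / measure lborel (ball (0::complex^'n) s)) / \<eta>1"
 have bd: "cmod (T f i) <= M" if "f : \<F>" "i : I" for f i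
 proof -
  have "(norm (ball_mean s (\<zeta> (fst i)) (coef j f (snd i))))\<^sup>2 <= R1 / measure lborel (ball (0::complex^'n) s)"
   by (rule L1[OF mc[OF that(1)] R1 cR[OF that(1)]]) (use that(2) in \<open>auto simp: I_def\<close>)
  hence "norm (ball_mean s (\<zeta> (fst i)) (coef j f (snd i))) <= sqrt (R1 / measure lborel (ball (0::complex^'n) s))"
   by (rule real_le_rsqrt)
  thus ?thesis using \<eta>1 by (simp add: T_def M_def norm_divide divide_right_mono)
 qed
 have close: "psum j (%us z. coef j f us z - coef j g us z) <= ennreal eps"
  if f: "f : \<F>" and g: "g : \<F>" and cl: "!!i. i : I ==> cmod (T f i - T g i) <= 1" for f g
 proof -
  have each: "(LI x:dom1 j. nsq (coef j f us x - coef j g us x)) <= ennreal (2 * e)"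
   if us: "us : idx" for us
  proof -
   have "(LI x:dom1 j. nsq (coef j f us x - coef j g us x))
    <= ennreal (6 * ?D * e1 + 3 * \<eta>1\<^sup>2 * ?m)"
   proof (rule L2[OF mc[OF f] mc[OF g] cR[OF f us] cR[OF g us]])
    fix i assume i: "i < N"
    have "(i, us) : I" using i us by (simp add: I_def)
    from cl[OF this] have "norm (ball_mean s (\<zeta> i) (coef j f us) - ball_mean s (\<zeta> i) (coef j g us)) / \<eta>1 <= 1"
     using \<eta>1 by (simp add: T_def diff_divide_distrib[symmetric] norm_divide)
    thus "norm (ball_mean s (\<zeta> i) (coef j f us) - ball_mean s (\<zeta> i) (coef j g us)) <= \<eta>1"
     using \<eta>1 by simp
   qed (use \<eta>(2) f g us e1 \<eta>1 in \<open>auto simp: s_def\<close>)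
   also have "... <= ennreal (2 * e)"
   proof (rule ennreal_leI)
    have 1: "6 * ?D * e1 = e" by (simp add: e1_def)
    have "\<eta>1\<^sup>2 = e / (3 * (?m + 1))" using e m0 by (simp add: \<eta>1_def)
    moreover have "3 * (e / (3 * (m + 1))) * m = e * (m / (m + 1))" if "0 <= m" for m
     using that by (simp add: divide_simps)
    ultimately have "3 * \<eta>1\<^sup>2 * ?m = e * (?m / (?m + 1))" using m0 by simp
    also have "... <= e * 1"
    proof (rule mult_left_mono)
     have "m / (m + 1) <= 1" if "0 <= m" for m :: real using that by (simp add: divide_simps)
     from this[OF m0] show "?m / (?m + 1) <= 1" .
    qed (use e in simp)
    finally show "6 * ?D * e1 + 3 * \<eta>1\<^sup>2 * ?m <= 2 * e" using 1 by linarith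
   qed
   finally show ?thesis .
  qed
  have "psum j (%us z. coef j f us z - coef j g us z) <= ennreal ?KQ * (SUM us:idx. ennreal (2 * e))"
   unfolding psum_def by (intro mult_left_mono sum_mono each) auto
  also have "... = ennreal (?KQ * (?n * (2 * e)))"
   using KQ e by (simp add: ennreal_mult ennreal_of_nat_eq_real_of_nat)
  also have "... <= ennreal eps"
  proof (rule ennreal_leI)
   have "?KQ * (?n * (2 * e)) <= ?KQ * ((?n + 1) * (2 * e))" using KQ e by (intro mult_left_mono mult_right_mono) auto
   also have "... = (2 * (?KQ * (?n + 1))) * e" by (simp only: mult_ac)
   also have "... = eps"
   proof -
    have "x * (eps / x) = eps" if "x > 0" for x using that by simp
    from this[OF q] show ?thesis unfolding e_def .
   qed
   finally show "?KQ * (?n * (2 * e)) <= eps" .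
  qed
  finally show ?thesis .
 qed
 have "finite I" unfolding I_def using finite_idx by auto
 hence "patch_coords j \<F> eps I T M" unfolding patch_coords_def using bd close by blast
 thus ?thesis by (intro exI[of _ "(I, T, M)"]) simp
qed

text \<open>One finite net for the scaled means of all patches together is a net for the family:
  agreement up to 1 controls the energy over \<Omega>, and (ii) controls the complement.\<close>

lemma sufficiency:
 assumes sub: "\<A> <= space2" and bd: "L2_bounded A h \<phi> p q \<A>"
  and cond1: "!!eps \<Omega>. eps > 0 ==> relatively_compact_open \<Omega> ==>
   EX \<delta>>0. ALL \<Phi>:Def A h \<delta> \<Omega>. ALL f:\<Union>\<A>. energy UNIV (form_diff (pull_back A \<Phi> f) f) < ennreal eps"
  and cond2: "!!eps. eps > 0 ==> EX \<Omega>. relatively_compact_open \<Omega> & (ALL f:\<Union>\<A>. energy (- \<Omega>) f < ennreal eps)"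
 shows "L2.mtotally_bounded \<A>" unfolding L2.mtotally_bounded_def
proof (intro allI impI)
 fix eps :: real assume eps: "eps > 0"
 let ?F = "\<Union>\<A>"
 have F: "?F <= forms" using sub space2D(1) by blast
 obtain R where R: "R > 0" "!!f. f : ?F ==> energy UNIV f <= ennreal R" using bounded_energy[OF bd sub] by blast
 \<comment> \<open>The squared distance is at most 2 e + 2 e outside \<Omega> plus e inside, and 5 e
   < eps^2.\<close>
 define e where "e = eps\<^sup>2 / 8"
 have e: "e > 0" using eps by (simp add: e_def)
 obtain \<Omega> where \<Omega>: "relatively_compact_open \<Omega>" "!!f. f : ?F ==> energy (- \<Omega>) f < ennreal e"
  using cond2[OF e] by blast
 have cl: "compact (closure \<Omega>)" "open \<Omega>" using \<Omega>(1) by (auto simp: relatively_compact_open_def)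
 obtain P where P: "finite P" "!!j. j : P ==> patch j" "closure \<Omega> <= (\<Union>j\<in>P. pinv j ` ball (pz j) (pr j))"
  using patch_cover[OF cl(1)] by blast
 define e2 where "e2 = e / (real (card P) + 1)"
 have e2: "e2 > 0" unfolding e2_def using e by (intro divide_pos_pos) auto
 have "ALL j:P. EX Y :: (nat \<times> (complex^'n) list) set \<times> _. patch_coords j ?F e2 (fst Y) (fst (snd Y)) (snd (snd Y))"
 proof
  fix j assume "j : P"
  hence j: "patch j" by (rule P(2))
  show "EX Y :: (nat \<times> (complex^'n) list) set \<times> _. patch_coords j ?F e2 (fst Y) (fst (snd Y)) (snd (snd Y))"
   by (rule patch_net[OF j F R(2) less_imp_le[OF R(1)] translation_estimate[OF j F cond1] e2])
 qed
 then obtain Y where Y: "ALL j:P. patch_coords j ?F e2 (fst (Y j) :: (nat \<times> (complex^'n) list) set) (fst (snd (Y j))) (snd (snd (Y j)))"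
  unfolding bchoice_iff ..
 define I T M where "I j = fst (Y j)" and "T j = fst (snd (Y j))" and "M j = snd (snd (Y j))" for j
 have ITM: "!!j. j : P ==> finite (I j :: (nat \<times> (complex^'n) list) set)"
  "!!j f i. j : P ==> f : ?F ==> i : I j ==> cmod (T j f i) <= M j"
  "!!j f g. j : P ==> f : ?F ==> g : ?F ==> (ALL i:I j. cmod (T j f i - T j g i) <= 1) ==> psum j (%us z. coef j f us z - coef j g us z) <= ennreal e2"
  using Y unfolding I_def T_def M_def patch_coords_def by blast+
 define M1 where "M1 = (SUM j:P. \<bar>M j\<bar>)"
 have "EX K. finite K & K <= ?F & (ALL x:?F. EX k:K. ALL i:Sigma P I. norm ((%f i. T (fst i) f (snd i)) x i - (%f i. T (fst i) f (snd i)) k i) <= 1)"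
 proof (rule finite_net_of_bounded_coordinates)
  show "finite (Sigma P I)" using P(1) ITM(1) by auto
  show "norm (T (fst i) x (snd i)) <= M1" if "x : ?F" "i : Sigma P I" for x i
  proof -
   have i: "fst i : P" "snd i : I (fst i)" using that(2) by auto
   have "norm (T (fst i) x (snd i)) <= \<bar>M (fst i)\<bar>" using ITM(2)[OF i(1) that(1) i(2)] by linarith
   also have "... <= M1" unfolding M1_def using P(1) i(1) by (intro member_le_sum[where f = "%j. \<bar>M j\<bar>"]) auto
   finally show ?thesis .
  qed
 qed simp
 then obtain Kf where Kf0: "finite Kf & Kf <= ?F & (ALL f:?F. EX k:Kf. ALL i:Sigma P I. cmod (T (fst i) f (snd i) - T (fst i) k (snd i)) <= 1)" ..
 have Kf: "finite Kf" "Kf <= ?F" by (rule conjunct1[OF Kf0], rule conjunct1[OF conjunct2[OF Kf0]])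
 have Kf3: "EX k:Kf. ALL i:Sigma P I. cmod (T (fst i) f (snd i) - T (fst i) k (snd i)) <= 1" if "f : ?F" for f
  using conjunct2[OF conjunct2[OF Kf0]] that by (rule bspec)
 \<comment> \<open>The net consists of representatives; each is sent back to a class of \<A>
   containing it.\<close>
 define cls where "cls k = (SOME G. G : \<A> & k : G)" for k
 have cls: "cls k : \<A>" "k : cls k" if "k : ?F" for k
  using someI_ex[of "%G. G : \<A> & k : G"] that by (auto simp: cls_def)
 show "EX K. finite K & K <= \<A> & \<A> <= (\<Union>x\<in>K. L2.mball x eps)"
 proof (intro exI[of _ "cls ` Kf"] conjI subsetI)
  show "finite (cls ` Kf)" using Kf by simp
  show "G : \<A>" if "G : cls ` Kf" for G using that cls Kf(2) by blast
  fix G assume G: "G : \<A>"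
  have Gs: "G : space2" using G sub by blast
  obtain f where f: "f : G" using space2D(4)[OF Gs] by blast
  have fF: "f : ?F" using f G by blast
  obtain k where k: "k : Kf" "!!i. i : Sigma P I ==> cmod (T (fst i) f (snd i) - T (fst i) k (snd i)) <= 1"
   using Kf3[OF fF] by blast
  have kF: "k : ?F" using k Kf by blast
  have forms: "f : forms" "k : forms" using F fF kF by auto
  note D = formsD[OF forms_diff[OF forms]]
  have dm: "dens (form_diff f k) : bmeas" by (rule measurable_dens[OF D(3) D(2)])
  have ob: "\<Omega> : sets borel" using cl by simp
  have split: "energy UNIV (form_diff f k) = energy (- \<Omega>) (form_diff f k) + energy \<Omega> (form_diff f k)"
   unfolding energy_def
  proof (subst nn_integral_add[symmetric])
   show "(%x. ennreal (dens (form_diff f k) x) * indicator (- \<Omega>) x) : borel_measurable vol"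
    "(%x. ennreal (dens (form_diff f k) x) * indicator \<Omega> x) : borel_measurable vol"
    using dm ob by (auto intro!: borel_measurable_times_ennreal borel_measurable_indicator)
   show "(\<integral>\<^sup>+x\<in>UNIV. ennreal (dens (form_diff f k) x) \<partial>vol)
    = (\<integral>\<^sup>+x. ennreal (dens (form_diff f k) x) * indicator (- \<Omega>) x + ennreal (dens (form_diff f k) x) * indicator \<Omega> x \<partial>vol)"
    by (intro nn_integral_cong) (auto split: split_indicator)
  qed
  \<comment> \<open>\<open>energy_patches\<close> asks for measurable majorants at all indices, also
    at those that are not patches; hence the default 0.\<close>
  have "energy \<Omega> (form_diff f k) <= (SUM j:P. psum j (%us z. if patch j then coef j f us z - coef j k us z else 0))"
  proof (rule energy_patches[OF P(1,2)])
   show "\<Omega> <= (\<Union>j\<in>P. pinv j ` dom1 j)"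
    by (rule order_trans[OF closure_subset order_trans[OF P(3)]]) (intro UN_mono image_mono ball_subset_cball order_refl)
   show "mlin deg (form_diff f k x)" for x by (rule D(2))
   show "(%z. if patch j then coef j f us z - coef j k us z else 0) : bmeas" for j us
    using measurable_coef[OF _ formsD(3)[OF forms(1)]] measurable_coef[OF _ formsD(3)[OF forms(2)]]
    by (cases "patch j") auto
   show "norm (cform (pc j) (pinv j z) (form_diff f k (pinv j z)) us) <= norm (if patch j then coef j f us z - coef j k us z else 0)"
    if "j : P" "z : dom1 j" for j z us
   proof -
    have "z : dom3 j" using patchD(9)[OF P(2)[OF that(1)]] that(2) by blast
    thus ?thesis using P(2)[OF that(1)] by (simp add: cform_def form_diff_def coef_def)
   qed
  qed
  also have "... <= (SUM j:P. ennreal e2)"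
  proof (rule sum_mono)
   fix j assume j: "j : P"
   have "ALL i:I j. cmod (T j f i - T j k i) <= 1"
   proof
    fix i assume "i : I j"
    hence "(j, i) : Sigma P I" using j by blast
    from k(2)[OF this] show "cmod (T j f i - T j k i) <= 1" by simp
   qed
   from ITM(3)[OF j fF kF this] show "psum j (%us z. if patch j then coef j f us z - coef j k us z else 0) <= ennreal e2"
    using P(2)[OF j] by simp
  qed
  also have "... = ennreal (real (card P) * e2)" using e2 by (simp add: ennreal_mult ennreal_of_nat_eq_real_of_nat)
  also have "... <= ennreal e" using e by (intro ennreal_leI) (simp add: e2_def field_simps)
  finally have in\<Omega>: "energy \<Omega> (form_diff f k) <= ennreal e" .
  have "energy (- \<Omega>) (form_diff f k) <= 2 * energy (- \<Omega>) f + 2 * energy (- \<Omega>) k"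
   by (rule energy_diff_le[OF forms]) (use ob in auto)
  also have "... <= 2 * ennreal e + 2 * ennreal e"
   by (intro add_mono mult_left_mono less_imp_le[OF \<Omega>(2)] fF kF) auto
  finally have "energy UNIV (form_diff f k) <= 2 * ennreal e + 2 * ennreal e + ennreal e"
   unfolding split by (rule add_mono[OF _ in\<Omega>])
  also have "... = ennreal (5 * e)"
  proof -
   have "2 * ennreal e = ennreal (2 * e)" using e by (simp add: ennreal_mult)
   thus ?thesis using e by (simp add: ennreal_plus[symmetric] del: ennreal_plus)
  qed
  also have "... < ennreal (eps\<^sup>2)" using e by (intro ennreal_lessI) (auto simp: e_def)
  finally have "dist2 G (cls k) < eps" using dist2_less_iff[OF Gs _ f cls(2)[OF kF] eps] sub cls(1)[OF kF] by blast
  thus "G : (\<Union>x\<in>cls ` Kf. L2.mball x eps)"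
   using k(1) Gs cls(1)[OF kF] sub by (auto simp: L2.in_mball L2.commute)
 qed
qed

end

section \<open>Closeness in the tangent bundle\<close>

text \<open>N will be a speed assembled from charts chosen pointwise and is not known to be
  measurable. So the derivative, continuous off a finite set, is what gets integrated, and N enters
  only through monotonicity. If the integral of the norm of the derivative is infinite, so is the
  right side.\<close>

lemma piecewise_C1_increment_bound:
 fixes f :: "real => 'v::euclidean_space" and N :: "real => real"
 assumes f: "f piecewise_C1_differentiable_on {a..b}" and ab: "a <= b" and E: "finite E" and C: "C > 0"
  and N: "!!t D. t : {a<..<b} - E ==> (f has_vector_derivative D) (at t) ==> norm D <= C * N t"
 shows "ennreal (norm (f b - f a)) <= ennreal C * (LI t:{a..b}. ennreal (N t))"
proof -
 obtain F D where F: "finite F" and cf: "continuous_on {a..b} f" and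
  D: "!!x. x : {a..b} - F ==> (f has_vector_derivative D x) (at x)" "continuous_on ({a..b} - F) D"
  using f unfolding piecewise_C1_differentiable_on_def C1_differentiable_on_def by blast
 define G where "G = F \<union> E \<union> {a, b}"
 have G: "finite G" using F E by (simp add: G_def)
 have Gb: "{a..b} - G : sets borel" using G by (intro sets.Diff) (auto simp: finite_imp_closed borel_closed)
 define g where "g t = indicator ({a..b} - G) t *R D t" for t
 have gm: "g : bmeas" unfolding g_def[abs_def]
  by (rule borel_measurable_continuous_on_indicator[OF Gb continuous_on_subset[OF D(2)]]) (auto simp: G_def)
 have gN: "norm (g t) <= C * N t" "t : {a..b}" if "g t ~= 0" for t
 proof -
  have t: "t : {a..b} - G" using that by (auto simp: g_def split: split_indicator_asm)
  hence "norm (D t) <= C * N t" by (intro N D(1)) (auto simp: G_def)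
  thus "norm (g t) <= C * N t" "t : {a..b}" using t by (auto simp: g_def)
 qed
 have nm: "(%t. ennreal (norm (g t) / C)) : borel_measurable lborel" using gm by simp
 have "(LI t. ennreal (norm (g t))) = (LI t. ennreal C * ennreal (norm (g t) / C))"
  using C by (subst ennreal_mult[symmetric]) auto
 also have "... = ennreal C * (LI t. ennreal (norm (g t) / C))" by (rule nn_integral_cmult[OF nm])
 also have "... <= ennreal C * (LI t:{a..b}. ennreal (N t))"
 proof (intro mult_left_mono nn_integral_mono)
  fix t
  show "ennreal (norm (g t) / C) <= ennreal (N t) * indicator {a..b} t"
   using gN[of t] C by (cases "g t = 0") (auto intro!: ennreal_leI simp: field_simps)
 qed simp
 finally have le: "(LI t. ennreal (norm (g t))) <= ennreal C * (LI t:{a..b}. ennreal (N t))" .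
 show ?thesis
 proof (cases "(LI t. ennreal (norm (g t))) = \<infinity>")
  case True
  hence "ennreal C * (LI t:{a..b}. ennreal (N t)) = \<infinity>" using le by (simp add: top_unique)
  thus ?thesis by simp
 next
  case False
  have int: "integrable lborel g" using gm False by (intro integrableI_bounded) (auto simp: less_top)
  have "(D has_integral (f b - f a)) {a..b}"
   by (rule fundamental_theorem_of_calculus_interior_strong[OF F ab _ cf]) (use D in auto)
  hence "((%t. if t : {a..b} then D t else 0) has_integral (f b - f a)) UNIV"
   by (simp only: has_integral_restrict_UNIV)
  hence "(g has_integral (f b - f a)) UNIV" by (rule has_integral_spike_finite[OF G, rotated]) (auto simp: g_def)
  hence "f b - f a = integral\<^sup>L lborel g"
   using has_integral_integral_lborel[OF int] by (rule has_integral_unique)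
  thus ?thesis using integral_norm_bound_ennreal[OF int] le by (metis order_trans)
 qed
qed

context herm_mfd
begin

text \<open>The curve is followed backwards from its end p, whose coordinates are known. Its length
  is too short for leaving the ball of radius 3 r; inside it the components of the vector are
  controlled by the covariant derivative and the Christoffel bound.\<close>

lemma tangent_close:
 assumes r: "r > 0" and K: "tame c (cball z0 (4 * r)) K"
  and p: "p : fst c" "snd c p : cball z0 (2 * r)" and v: "vec_norm h p v = 1"
  and d: "distTX A h (p', v') (p, v) < ennreal s" and s: "0 < s" "K * s < r" "2 * K * K * s <= 1"
 shows "p' : fst c" "norm (snd c p' - snd c p) <= K * s"
  "norm (comps_in A c p' v' - comps_in A c p v) <= 4 * K * K * s"
proof -
 note T = tameD[OF K]
 have c: "c : A" and K1: "1 <= K" using T by auto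
 have sK: "sqrt K <= K" using K1 by (simp add: real_le_lsqrt power2_eq_square)
 have chart_sub: "chart_inv c ` cball z0 (4 * r) <= fst c" using chart_inv_in[OF c] T(2) by blast
 obtain \<gamma> V where tc: "tangent_curve A \<gamma> V" and ends: "\<gamma> 0 = p'" "V 0 = v'" "\<gamma> 1 = p" "V 1 = v"
  and len: "tangent_curve_length A h \<gamma> V < ennreal s" using d unfolding distTX_def INF_less_iff by auto
 define N where "N t = sqrt ((vec_norm h (\<gamma> t) (velocity A \<gamma> t))\<^sup>2 + (vec_norm h (\<gamma> t) (covariant_derivative A h \<gamma> V t))\<^sup>2)" for t
 have N0: "0 <= N t" for t by (simp add: N_def)
 have Nge: "vec_norm h (\<gamma> t) (velocity A \<gamma> t) <= N t" "vec_norm h (\<gamma> t) (covariant_derivative A h \<gamma> V t) <= N t" for t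
  unfolding N_def by (auto intro!: real_le_rsqrt)
 have lenN: "(LI t:{a..1}. ennreal (N t)) <= ennreal s" if "0 <= a" for a
 proof -
  have "(LI t:{a..1}. ennreal (N t)) <= (LI t:{0..1}. ennreal (N t))"
   using that by (intro nn_integral_mono) (auto split: split_indicator)
  thus ?thesis using len unfolding tangent_curve_length_def N_def by auto
 qed
 have cv: "curve A \<gamma>" using tc by (simp add: tangent_curve_def)
 have cont: "continuous_on {0..1} \<gamma>" using cv by (simp add: curve_def)
 have pc1: "(snd c o \<gamma>) piecewise_C1_differentiable_on {a..1}" if "0 <= a" "a < 1" "\<gamma> ` {a..1} <= fst c" for a
  using cv c that unfolding curve_def by auto
 have pc2: "(%t. comps_in A c (\<gamma> t) (V t)) piecewise_C1_differentiable_on {a..1}" if "0 <= a" "a < 1" "\<gamma> ` {a..1} <= fst c" for a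
  using tc c that unfolding tangent_curve_def by auto
 have zder: "norm D <= sqrt K * N t"
  if t: "t : {0..1}" and g: "\<gamma> t : chart_inv c ` cball z0 (4 * r)" and D: "((snd c o \<gamma>) has_vector_derivative D) (at t)" for t D
 proof -
  obtain z where z: "z : cball z0 (4 * r)" "\<gamma> t = chart_inv c z" using g by blast
  have zi: "z : img c" using z T(2) by blast
  have gt: "\<gamma> t : fst c" "snd c (\<gamma> t) = z" using z zi c by auto
  have "norm D <= sqrt K * sqrt (gmet c z D D)" by (rule T(10)[OF z(1)])
  also have "sqrt (gmet c z D D) = vec_norm h (\<gamma> t) (velocity A \<gamma> t)"
   using velocity_in_chart[OF c gt(1) t cont has_vector_derivative_at_within[OF D]] vec_norm_vec_of[OF c gt(1), of D] gt(2) by simp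
  also have "sqrt K * ... <= sqrt K * N t" using K1 by (intro mult_left_mono Nge) auto
  finally show ?thesis .
 qed
 have zdist: "norm (snd c (\<gamma> 1) - snd c (\<gamma> a)) <= K * s"
  if a: "0 <= a" "a < 1" and im: "\<gamma> ` {a..1} <= chart_inv c ` cball z0 (4 * r)" for a
 proof -
  have imc: "\<gamma> ` {a..1} <= fst c" using im chart_sub by (rule order_trans)
  have "ennreal (norm ((snd c o \<gamma>) 1 - (snd c o \<gamma>) a)) <= ennreal (sqrt K) * (LI t:{a..1}. ennreal (N t))"
  proof (rule piecewise_C1_increment_bound[OF pc1[OF a imc] _ finite.emptyI])
   show "norm D <= sqrt K * N t" if "t : {a<..<1} - {}" "((snd c o \<gamma>) has_vector_derivative D) (at t)" for t D
    using that a im by (intro zder) auto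
  qed (use a K1 in auto)
  also have "... <= ennreal (sqrt K) * ennreal s" by (intro mult_left_mono lenN a) auto
  also have "... = ennreal (sqrt K * s)" using K1 s by (simp add: ennreal_mult)
  finally have "norm (snd c (\<gamma> 1) - snd c (\<gamma> a)) <= sqrt K * s" using K1 s by simp
  also have "... <= K * s" using sK s by (intro mult_right_mono) auto
  finally show ?thesis .
 qed
 let ?V = "chart_inv c ` ball z0 (3 * r)"
 have b3: "ball z0 (3 * r) <= cball z0 (4 * r)" "cball z0 (3 * r) <= cball z0 (4 * r)" using r by auto
 have oV: "open ?V" by (rule open_chart_image[OF c open_ball]) (use b3 T(2) in blast)
 have clV: "closed (chart_inv c ` cball z0 (3 * r))"
  by (rule compact_imp_closed[OF compact_continuous_image[OF continuous_on_subset[OF continuous_chart_inv[OF c]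
     order_trans[OF b3(2) T(2)]] compact_cball]])
 have pV: "p : ?V"
 proof -
  have "p = chart_inv c (snd c p)" using p c by simp
  moreover have "snd c p : ball z0 (3 * r)" using p r by auto
  ultimately show ?thesis by blast
 qed
 have all: "\<gamma> ` {0..1} <= ?V"
 proof (rule ccontr)
  \<comment> \<open>Let a be the last time outside the open ball of radius 3 r. On [a, 1] the curve
    stays in the closed ball, so the length estimate applies and puts the point at time a inside the
    open ball.\<close>
  define X where "X = {t : {0..1}. \<gamma> t : - ?V}"
  assume "\<not> \<gamma> ` {0..1} <= ?V"
  hence Xne: "X ~= {}" by (auto simp: X_def)
  have "closed X"
   unfolding X_def using continuous_closed_preimage[OF cont closed_real_atLeastAtMost closed_Compl[OF oV]]
   by (simp add: Int_def vimage_def)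
  moreover have bX: "bdd_above X" by (rule bdd_aboveI[of _ 1]) (auto simp: X_def)
  ultimately have aX: "Sup X : X" using closed_contains_Sup[OF Xne] by blast
  define a where "a = Sup X"
  have a: "0 <= a" "a <= 1" "\<gamma> a ~: ?V" using aX by (auto simp: X_def a_def)
  have "a ~= 1" using a(3) pV ends by auto
  hence a1: "a < 1" using a(2) by simp
  have right: "\<gamma> t : ?V" if "t : {a<..1}" for t
  proof (rule ccontr)
   assume "\<gamma> t ~: ?V"
   hence "t : X" using that a by (auto simp: X_def)
   hence "t <= a" unfolding a_def by (rule cSup_upper[OF _ bX])
   thus False using that by simp
  qed
  have "\<gamma> ` closure {a<..1} <= chart_inv c ` cball z0 (3 * r)"
  proof (rule image_closure_subset[OF _ clV])
   show "continuous_on (closure {a<..1}) \<gamma>" using a a1 by (intro continuous_on_subset[OF cont]) auto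
   show "\<gamma> ` {a<..1} <= chart_inv c ` cball z0 (3 * r)" using right ball_subset_cball by blast
  qed
  hence im3: "\<gamma> ` {a..1} <= chart_inv c ` cball z0 (3 * r)" using a1 by simp
  hence im4: "\<gamma> ` {a..1} <= chart_inv c ` cball z0 (4 * r)" using b3 by blast
  have "norm (snd c (\<gamma> 1) - snd c (\<gamma> a)) < r" using zdist[OF a(1) a1 im4] s by linarith
  moreover have "dist z0 (snd c (\<gamma> 1)) <= 2 * r" using p ends by simp
  moreover have "dist z0 (snd c (\<gamma> a)) <= dist z0 (snd c (\<gamma> 1)) + dist (snd c (\<gamma> 1)) (snd c (\<gamma> a))" by (rule dist_triangle)
  ultimately have "snd c (\<gamma> a) : ball z0 (3 * r)" by (simp add: dist_norm)
  moreover have "\<gamma> a : fst c" using order_trans[OF im4 chart_sub] a1 by auto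
  hence "\<gamma> a = chart_inv c (snd c (\<gamma> a))" using c by simp
  ultimately have "\<gamma> a : ?V" by blast
  thus False using a(3) by blast
 qed
 have im4: "\<gamma> ` {0..1} <= chart_inv c ` cball z0 (4 * r)" using all b3 by blast
 hence imc: "\<gamma> ` {0..1} <= fst c" using chart_sub by (rule order_trans)
 show "p' : fst c" using imc ends by auto
 show "norm (snd c p' - snd c p) <= K * s" using zdist[OF _ _ im4] ends by (simp add: norm_minus_commute)
 define u where "u t = comps_in A c (\<gamma> t) (V t)" for t
 have pu: "u piecewise_C1_differentiable_on {0..1}" using pc2[OF _ _ imc] by (simp add: u_def[abs_def])
 have cu: "continuous_on {0..1} u" using pu by (simp add: piecewise_C1_differentiable_on_def)
 \<comment> \<open>At t0 the components deviate most from their final value; this maximum U bounds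
   them along the whole curve before U itself is estimated.\<close>
 obtain t0 where t0: "t0 : {0..1}" "!!t. t : {0..1} ==> norm (u t - u 1) <= norm (u t0 - u 1)"
 proof -
  have "continuous_on {0..1} (%t. norm (u t - u 1))" by (intro continuous_intros cu)
  moreover have "({0..1} :: real set) ~= {}" by simp
  ultimately have "EX x:{0..1}. ALL y:{0..1}. norm (u y - u 1) <= norm (u x - u 1)"
   by (intro continuous_attains_sup compact_Icc)
  thus ?thesis using that by blast
 qed
 define U where "U = norm (u t0 - u 1)"
 have u1: "norm (u 1) <= sqrt K"
 proof -
  have "snd c p : cball z0 (4 * r)" using p r by auto
  from T(10)[OF this, of "u 1"] show ?thesis using vec_norm_comps[OF c p(1), of v] v ends by (simp add: u_def)
 qed
 have ub: "norm (u t) <= sqrt K + U" if "t : {0..1}" for t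
  using t0(2)[OF that] norm_triangle_sub[of "u t" "u 1"] u1 by (simp add: U_def)
 have U: "U <= 4 * K * K * s"
 proof (cases "t0 = 1")
  case True
  thus ?thesis using K1 s by (simp add: U_def)
 next
  case False
  hence t01: "0 <= t0" "t0 < 1" using t0(1) by auto
  have sub: "{t0..1} <= {0..1}" using t01 by auto
  obtain E where E: "finite E" "!!t. t : {0..1} - E ==> EX D. ((snd c o \<gamma>) has_vector_derivative D) (at t)"
   using pc1[OF _ _ imc] unfolding piecewise_C1_differentiable_on_def C1_differentiable_on_def by fastforce
  \<comment> \<open>The growth rate involves U itself. Since 2 K^2 s <= 1, the term with U on the
    right is at most U / 2 and is absorbed, whence 2 K^2 s becomes 4 K^2 s.\<close>
  let ?C = "sqrt K * (1 + K * (sqrt K + U))"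
  have U0: "0 <= U" by (simp add: U_def)
  have C0: "?C > 0" using K1 U0 by (intro mult_pos_pos add_pos_nonneg mult_nonneg_nonneg) auto
  have "ennreal (norm (u 1 - u t0)) <= ennreal ?C * (LI t:{t0..1}. ennreal (N t))"
  proof (rule piecewise_C1_increment_bound[OF piecewise_C1_differentiable_on_subset[OF pu sub] _ E(1) C0])
   fix t D assume t: "t : {t0<..<1} - E" and D: "(u has_vector_derivative D) (at t)"
   have t1: "t : {0..1}" using t t01 by auto
   obtain z' where z': "((snd c o \<gamma>) has_vector_derivative z') (at t)" using E(2) t t1 by blast
   obtain z where z: "z : cball z0 (4 * r)" "\<gamma> t = chart_inv c z" using im4 t1 by blast
   have zi: "z : img c" using z T(2) by blast
   have gt: "\<gamma> t : fst c" "snd c (\<gamma> t) = z" using z zi c by auto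
   have z'b: "norm z' <= sqrt K * N t" by (rule zder[OF t1 _ z']) (use im4 t1 in blast)
   let ?w = "D + chris c z z' (u t)"
   have "covariant_derivative A h \<gamma> V t = vec_of A c (\<gamma> t) ?w"
    using covariant_derivative_in_chart[OF c gt(1) t1 cont has_vector_derivative_at_within[OF z']
      has_vector_derivative_at_within[OF D[unfolded u_def[abs_def]]]] gt(2) by (simp add: u_def)
   hence "norm ?w <= sqrt K * vec_norm h (\<gamma> t) (covariant_derivative A h \<gamma> V t)"
    using T(10)[OF z(1), of ?w] vec_norm_vec_of[OF c gt(1), of ?w] gt(2) by simp
   also have "... <= sqrt K * N t" using K1 by (intro mult_left_mono Nge) auto
   finally have w: "norm ?w <= sqrt K * N t" .
   have "norm (chris c z z' (u t)) <= K * norm z' * norm (u t)" by (rule T(6)[OF z(1)])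
   also have "... <= K * (sqrt K * N t) * (sqrt K + U)"
    using K1 z'b ub[OF t1] N0 by (intro mult_mono mult_left_mono mult_nonneg_nonneg) auto
   finally have "norm D <= sqrt K * N t + K * (sqrt K * N t) * (sqrt K + U)"
    using w norm_triangle_ineq4[of ?w "chris c z z' (u t)"] by simp
   also have "... = ?C * N t" by (simp add: algebra_simps)
   finally show "norm D <= ?C * N t" .
  qed (use t01 in auto)
  also have "... <= ennreal ?C * ennreal s" by (intro mult_left_mono lenN t01) auto
  also have "... = ennreal (?C * s)" using C0 s by (simp add: ennreal_mult)
  finally have "U <= ?C * s" using C0 s by (simp add: U_def norm_minus_commute)
  also have "... = (sqrt K + K * (sqrt K * sqrt K)) * s + (sqrt K * K * s) * U" by (simp add: algebra_simps)
  also have "... <= (K * K + K * K) * s + (1 / 2) * U"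
  proof (intro add_mono mult_right_mono)
   show "sqrt K <= K * K" using sK K1 mult_left_mono[of 1 K K] by linarith
   show "K * (sqrt K * sqrt K) <= K * K" using K1 by simp
   have "sqrt K * K * s <= K * K * s" using sK K1 s by (intro mult_right_mono) auto
   thus "sqrt K * K * s <= 1 / 2" using s(3) by simp
  qed (use s U0 in auto)
  finally show ?thesis by (simp add: algebra_simps)
 qed
 have "norm (u 0 - u 1) <= U" using t0(2)[of 0] by (simp add: U_def)
 thus "norm (comps_in A c p' v' - comps_in A c p v) <= 4 * K * K * s" using U ends by (simp add: u_def)
qed

section \<open>Variations in coordinates\<close>

definition coord :: "('a, 'n) chart => ('a => 'a) => complex^'n => complex^'n" where
 "coord c \<Phi> z = snd c (\<Phi> (chart_inv c z))"

lemma smooth_coord: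
 assumes c: "c : A" and \<Phi>: "smooth_map A \<Phi>" and z: "z : img c" "\<Phi> (chart_inv c z) : fst c"
 obtains W where "open W" "z : W" "W <= img c" "!!y. y : W ==> \<Phi> (chart_inv c y) : fst c" "!!k. Ck_on k (coord c \<Phi>) W"
proof -
 have cont: "continuous_on UNIV \<Phi>" using \<Phi> by (simp add: smooth_map_def)
 let ?V = "\<Phi> -` fst c"
 have oV: "open ?V" using continuous_open_vimage[OF chart_props(1)[OF c]] cont
  by (simp add: continuous_on_eq_continuous_at continuous_at_imp_continuous_on open_vimage[OF chart_props(1)[OF c]])
 let ?W = "{y : img c. chart_inv c y : ?V}"
 have oW: "open ?W" by (rule open_chart_preimage[OF c oV])
 have eq: "snd c ` (fst c \<inter> \<Phi> -` fst c) = ?W"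
 proof (intro set_eqI iffI)
  fix y assume y: "y : ?W"
  hence "y = snd c (chart_inv c y)" "chart_inv c y : fst c \<inter> \<Phi> -` fst c" using c by auto
  thus "y : snd c ` (fst c \<inter> \<Phi> -` fst c)" by blast
 qed (use c in auto)
 have "smooth_on ?W (snd c o \<Phi> o chart_inv c)" using \<Phi> c unfolding smooth_map_def eq[symmetric] by blast
 hence "ALL k. Ck_on k (snd c o \<Phi> o chart_inv c) ?W" by (rule iffD1[OF smooth_on_open_iff[OF oW]])
 moreover have "snd c o \<Phi> o chart_inv c = coord c \<Phi>" by (simp add: coord_def fun_eq_iff)
 ultimately have Ck: "Ck_on k (coord c \<Phi>) ?W" for k by simp
 show ?thesis by (rule that[OF oW _ _ _ Ck]) (use z in auto)
qed

text \<open>The distance on the tangent bundle speaks of unit vectors. Rescaling by the metric norm,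
  at most K |u|, adds the third factor K.\<close>

lemma coord_close:
 assumes r: "r > 0" and K: "tame c (cball z0 (4 * r)) K" and \<Phi>: "smooth_map A \<Phi>"
  and d: "push_forward_distance A h \<Phi> < ennreal s" and s: "0 < s" "K * s < r" "2 * K * K * s <= 1"
  and z: "z : cball z0 (2 * r)"
 shows "\<Phi> (chart_inv c z) : fst c" "norm (coord c \<Phi> z - z) <= K * s"
  "(coord c \<Phi> has_derivative fd (coord c \<Phi>) z) (at z)"
  "norm (fd (coord c \<Phi>) z u - u) <= 4 * K ^ 3 * s * norm u"
  "push_forward A \<Phi> (chart_inv c z) w = vec_of A c (\<Phi> (chart_inv c z))
    (fd (coord c \<Phi>) z (comps_in A c (chart_inv c z) w))"
proof -
 note T = tameD[OF K]
 have c: "c : A" and K1: "1 <= K" using T by auto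
 have z4: "z : cball z0 (4 * r)" using z r by auto
 have zi: "z : img c" using z4 T(2) by blast
 let ?p = "chart_inv c z" and ?D = "fd (coord c \<Phi>) z"
 have p: "?p : fst c" "snd c ?p = z" using zi c by auto
 have close: "\<Phi> ?p : fst c & norm (coord c \<Phi> z - z) <= K * s
   & norm (comps_in A c (\<Phi> ?p) (push_forward A \<Phi> ?p v) - comps_in A c ?p v) <= 4 * K * K * s"
  if v: "vec_norm h ?p v = 1" for v
 proof -
  have "distTX A h (\<Phi> ?p, push_forward A \<Phi> ?p v) (?p, v) <= push_forward_distance A h \<Phi>"
   unfolding push_forward_distance_def using v by (intro SUP_upper2[of ?p] SUP_upper2[of v]) auto
  hence "distTX A h (\<Phi> ?p, push_forward A \<Phi> ?p v) (?p, v) < ennreal s" using d by simp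
  from tangent_close[OF r K p(1) _ v this s] z p(2) show ?thesis by (simp add: coord_def)
 qed
 have unit: "vec_norm h ?p (vec_of A c ?p ((1 / sqrt (gmet c z u u)) *R u)) = 1" "0 < gmet c z u u" if "u ~= 0" for u
 proof -
  show g: "0 < gmet c z u u" using gmet_props(4)[OF c zi that] .
  have "gmet c z (a *R u) (a *R u) = a * (a * gmet c z u u)" for a
   by (simp add: linear_scale[OF linear_gmet_left[OF c zi]] linear_scale[OF linear_gmet_right[OF c zi]])
  hence "gmet c z ((1 / sqrt (gmet c z u u)) *R u) ((1 / sqrt (gmet c z u u)) *R u) = 1"
   using g by (simp add: divide_simps)
  thus "vec_norm h ?p (vec_of A c ?p ((1 / sqrt (gmet c z u u)) *R u)) = 1"
   using vec_norm_vec_of[OF c p(1)] p(2) by simp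
 qed
 \<comment> \<open>A nonzero vector is needed: it is a unit vector, after scaling, that reveals how
   little the base point moves.\<close>
 have ne: "(SOME b. b : (Basis :: (complex^'n) set)) ~= 0" using SOME_Basis nonzero_Basis by blast
 show 1: "\<Phi> ?p : fst c" and "norm (coord c \<Phi> z - z) <= K * s" using close[OF unit(1)[OF ne]] by auto
 obtain W where W: "open W" "z : W" "W <= img c" "!!y. y : W ==> \<Phi> (chart_inv c y) : fst c" "!!k. Ck_on k (coord c \<Phi>) W"
  using smooth_coord[OF c \<Phi> zi 1] by blast
 show D: "(coord c \<Phi> has_derivative ?D) (at z)" by (rule Ck_on_Suc_has_derivative[OF W(5)[of "Suc 0"] W(2)])
 have cont: "continuous_on UNIV \<Phi>" using \<Phi> by (simp add: smooth_map_def)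
 have "((snd c o \<Phi> o chart_inv c) has_derivative ?D) (at (snd c ?p))"
  using D p(2) by (simp add: coord_def[abs_def] o_def)
 from push_forward_in_charts[OF c p(1) c 1 cont open_UNIV UNIV_I this]
 show pf: "push_forward A \<Phi> ?p w = vec_of A c (\<Phi> ?p) (?D (comps_in A c ?p w))" for w .
 have lin: "linear ?D" by (rule has_derivative_linear[OF D])
 show "norm (?D u - u) <= 4 * K ^ 3 * s * norm u"
 proof (cases "u = 0")
  case False
  let ?g = "sqrt (gmet c z u u)"
  have g: "0 < ?g" using unit(2)[OF False] by simp
  have "norm (?D ((1 / ?g) *R u) - (1 / ?g) *R u) <= 4 * K * K * s"
   using close[OF unit(1)[OF False]] by (simp add: pf comps_vec_of[OF c p(1)] comps_vec_of[OF c 1])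
  hence "norm ((1 / ?g) *R (?D u - u)) <= 4 * K * K * s" by (simp add: linear_scale[OF lin] scaleR_right_diff_distrib)
  hence "norm (?D u - u) <= 4 * K * K * s * ?g" using g by (simp add: divide_simps)
  also have "... <= 4 * K * K * s * (K * norm u)"
  proof (intro mult_left_mono)
   have "?g <= sqrt K * norm u" by (rule T(9)[OF z4])
   also have "... <= K * norm u" using K1 by (intro mult_right_mono) (auto simp: real_le_lsqrt power2_eq_square)
   finally show "?g <= K * norm u" .
  qed (use K1 s in auto)
  finally show ?thesis by (simp add: power3_eq_cube mult_ac)
 qed (simp add: linear_0[OF lin])
qed

text \<open>The preimage of S is contained in the image of S under the inverse map, whose measure is
  an integral of the Jacobian of the inverse. The derivative of the inverse is within 1 of the
  identity, so it has norm at most 2 and \<open>jac_bounded\<close> supplies C.\<close>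

lemma almost_id_coord:
 assumes r: "r > 0" and K: "tame c (cball z0 (4 * r)) K"
 shows "EX C>=0. ALL \<Phi> s. diffeo A \<Phi> --> push_forward_distance A h \<Phi> < ennreal s --> push_forward_distance A h (inv \<Phi>) < ennreal s -->
  0 < s --> K * s < r --> 4 * K ^ 3 * s <= 1 -->
  almost_id (cball z0 r) C (K * s) (%z. if z : cball z0 r then coord c \<Phi> z else 0)"
proof -
 note T = tameD[OF K]
 have c: "c : A" and K1: "1 <= K" using T by auto
 obtain C where C: "C > 0" "!!L :: complex^'n => complex^'n. (!!z. norm (L z) <= 2 * norm z) ==> jac L <= C"
  using jac_bounded[of 2] by blast
 have "almost_id (cball z0 r) C (K * s) (%z. if z : cball z0 r then coord c \<Phi> z else 0)"
  if \<Phi>: "diffeo A \<Phi>" and d: "push_forward_distance A h \<Phi> < ennreal s" "push_forward_distance A h (inv \<Phi>) < ennreal s"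
   and s: "0 < s" "K * s < r" "4 * K ^ 3 * s <= 1" for \<Phi> s
 proof -
  have s3: "2 * K * K * s <= 1"
  proof -
   have "2 * (K * K * 1) * s <= 4 * (K * K * K) * s" using K1 s by (intro mult_right_mono mult_mono) auto
   thus ?thesis using s(3) by (simp add: power3_eq_cube mult.assoc)
  qed
  have bij: "bij \<Phi>" and sm: "smooth_map A \<Phi>" "smooth_map A (inv \<Phi>)" using \<Phi> by (auto simp: diffeo_def)
  note f = coord_close[OF r K sm(1) d(1) s(1,2) s3]
  note g = coord_close[OF r K sm(2) d(2) s(1,2) s3]
  let ?F = "%z. if z : cball z0 r then coord c \<Phi> z else 0"
  let ?G = "coord c (inv \<Phi>)" and ?B = "ball z0 (2 * r)"
  have b12: "cball z0 r <= cball z0 (2 * r)" "?B <= cball z0 (2 * r)" "cball z0 (2 * r) <= img c" using r T(2) by auto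
  have contF: "continuous_on (cball z0 r) (coord c \<Phi>)"
  proof (intro continuous_at_imp_continuous_on ballI)
   fix z assume "z : cball z0 r"
   hence "z : cball z0 (2 * r)" using b12(1) by blast
   from has_derivative_continuous[OF f(3)[OF this]] show "isCont (coord c \<Phi>) z" .
  qed
  have mF: "?F : bmeas" by (rule borel_measurable_continuous_on_if[OF _ contF continuous_on_const]) simp
  have FB: "coord c \<Phi> z : ?B" if "z : cball z0 r" for z
  proof -
   have "norm (coord c \<Phi> z - z) <= K * s" by (rule f(2)) (use b12 that in blast)
   thus ?thesis using that s(2) dist_triangle[of z0 "coord c \<Phi> z" z] by (simp add: dist_norm norm_minus_commute)
  qed
  have GF: "?G (coord c \<Phi> z) = z" if "z : cball z0 r" for z
  proof -
   have "\<Phi> (chart_inv c z) : fst c" by (rule f(1)) (use b12 that in blast)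
   moreover have "z : img c" using that b12 by blast
   ultimately show ?thesis using c bij by (simp add: coord_def bij_is_inj)
  qed
  have injG: "inj_on ?G ?B"
  proof (rule inj_onI)
   fix x y assume xy: "x : ?B" "y : ?B" "?G x = ?G y"
   have "inv \<Phi> (chart_inv c x) : fst c" "inv \<Phi> (chart_inv c y) : fst c" by (rule g(1); use b12 xy in blast)+
   hence "inv \<Phi> (chart_inv c x) = inv \<Phi> (chart_inv c y)" using xy(3) c unfolding coord_def by (metis chart_inv_chart)
   hence "chart_inv c x = chart_inv c y" using bij by (metis bij_inv_eq_iff)
   moreover have "x : img c" "y : img c" using xy b12 by blast+
   ultimately show "x = y" using c by (metis chart_chart_inv)
  qed
  have em: "emeasure lborel (cball z0 r \<inter> ?F -` S) <= ennreal C * emeasure lborel S" if S: "S : sets borel" for S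
  proof -
   \<comment> \<open>The map sends the ball of radius r into the one of radius 2 r, where the
     inverse is under control.\<close>
   let ?S = "S \<inter> ?B"
   have Sb: "?S : sets borel" using S by simp
   have Si: "?S <= img c" using b12 by blast
   have "?G ` ?S = snd c ` (\<Phi> -` (chart_inv c ` ?S))"
   proof -
    have "\<Phi> -` (chart_inv c ` ?S) = inv \<Phi> ` (chart_inv c ` ?S)" using bij by (rule bij_vimage_eq_inv_image)
    thus ?thesis by (simp add: image_image coord_def)
   qed
   moreover have "\<Phi> -` (chart_inv c ` ?S) : sets borel"
   proof -
    have "\<Phi> : bmeas" using sm(1) by (intro borel_measurable_continuous_onI) (simp add: smooth_map_def)
    from measurable_sets[OF this chart_inv_image_borel[OF c Sb Si]] show ?thesis by simp
   qed
   moreover have "\<Phi> -` (chart_inv c ` ?S) <= fst c"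
   proof
    fix x assume "x : \<Phi> -` (chart_inv c ` ?S)"
    then obtain y where y: "y : ?B" "\<Phi> x = chart_inv c y" by blast
    have "inv \<Phi> (chart_inv c y) : fst c" by (rule g(1)) (use b12 y in blast)
    thus "x : fst c" using bij y(2) by (metis bij_inv_eq_iff)
   qed
   ultimately have GS: "?G ` ?S : sets borel" using image_chart_borel[OF c] by simp
   let ?D = "%y. fd ?G y"
   have der: "(?G has_derivative ?D y) (at y)" if "y : ?S" for y by (rule g(3)) (use b12 that in blast)
   have contD: "continuous_on ?B (%y. ?D y v)" for v
   proof (rule continuous_at_imp_continuous_on, rule)
    fix y assume y: "y : ?B"
    have y2: "y : cball z0 (2 * r)" "y : img c" using y b12 by blast+
    obtain W where W: "open W" "y : W" "!!k. Ck_on k ?G W"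
     using smooth_coord[OF c sm(2) y2(2) g(1)[OF y2(1)]] by metis
    have "continuous_on W (%y. ?D y v)" using Ck_on_Suc_frechet[OF W(3)[of "Suc 0"], of v] by simp
    thus "isCont (%y. ?D y v) y" using W(1,2) by (simp add: continuous_on_eq_continuous_at)
   qed
   have meas: "(%x. indicator ?S x * jac (?D x)) : bmeas"
    using borel_measurable_continuous_on_indicator[OF Sb continuous_on_subset[OF continuous_on_jac[OF contD]]] by simp
   have jle: "jac (?D y) <= C" if "y : ?S" for y
   proof (rule C(2))
    fix v
    have "norm (?D y v - v) <= 4 * K ^ 3 * s * norm v" by (rule g(4)) (use b12 that in blast)
    also have "... <= 1 * norm v" by (intro mult_right_mono s) simp
    finally show "norm (?D y v) <= 2 * norm v" using norm_triangle_sub[of "?D y v" v] by simp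
   qed
   have "cball z0 r \<inter> ?F -` S <= ?G ` ?S"
   proof
    fix z assume "z : cball z0 r \<inter> ?F -` S"
    hence z: "z : cball z0 r" "coord c \<Phi> z : S" by (auto split: if_splits)
    hence "coord c \<Phi> z : ?S" "z = ?G (coord c \<Phi> z)" using FB GF by auto
    thus "z : ?G ` ?S" by blast
   qed
   hence "emeasure lborel (cball z0 r \<inter> ?F -` S) <= emeasure lborel (?G ` ?S)"
    using GS by (intro emeasure_mono) auto
   also have "... = (LI x:?S. ennreal (jac (?D x)))"
    by (rule emeasure_image_jac[OF Sb GS der inj_on_subset[OF injG] meas]) auto
   also have "... <= (LI x. ennreal C * indicator S x)"
    using jle by (intro nn_integral_mono) (auto split: split_indicator intro!: ennreal_leI)
   also have "... = ennreal C * emeasure lborel S" using S by (simp add: nn_integral_cmult_indicator)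
   finally show ?thesis .
  qed
  have "dist (?F z) z <= K * s" if "z : cball z0 r" for z using f(2)[of z] that b12(1) by (auto simp: dist_norm)
  thus ?thesis unfolding almost_id_def using mF em by blast
 qed
 thus ?thesis using C(1) by (intro exI[of _ C]) auto
qed

end

section \<open>Perturbation of the arguments of a form\<close>

definition form_sum :: "nat => ('v::euclidean_space list => complex) => real" where
 "form_sum k \<omega> = (\<Sum>vs | set vs <= Basis & length vs = k. cmod (\<omega> vs))"

lemma form_sum_Suc: "form_sum (Suc k) \<omega> = (SUM v:Basis. form_sum k (%vs. \<omega> (v # vs)))"
 unfolding form_sum_def lists_Suc_image
 by (subst sum.reindex) (auto simp: inj_on_def sum.cartesian_product case_prod_beta)

lemma form_sum_nonneg: "0 <= form_sum k \<omega>" by (simp add: form_sum_def sum_nonneg)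

lemma form_sum_Cons_le:
 fixes \<omega> :: "'v::euclidean_space list => complex"
 assumes m: "mlin (Suc k) \<omega>"
 shows "form_sum k (%vs. \<omega> (u # vs)) <= norm u * form_sum (Suc k) \<omega>"
proof -
 have pt: "cmod (\<omega> (u # vs)) <= (SUM b:Basis. norm u * cmod (\<omega> (b # vs)))" for vs
 proof -
  have "\<omega> (u # vs) = (SUM b:Basis. (u \<bullet> b) *R \<omega> (b # vs))"
   using m by (intro linear_expand[of "%v. \<omega> (v # vs)"]) auto
  hence "cmod (\<omega> (u # vs)) <= (SUM b:Basis. cmod ((u \<bullet> b) *R \<omega> (b # vs)))" by (simp only: norm_sum)
  also have "... <= (SUM b:Basis. norm u * cmod (\<omega> (b # vs)))"
   by (intro sum_mono) (auto intro!: mult_right_mono Basis_le_norm)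
  finally show ?thesis .
 qed
 have "form_sum k (%vs. \<omega> (u # vs)) <= (\<Sum>vs | set vs <= Basis & length vs = k. SUM b:Basis. norm u * cmod (\<omega> (b # vs)))"
  unfolding form_sum_def by (intro sum_mono pt)
 also have "... = norm u * (SUM v:Basis. form_sum k (%vs. \<omega> (v # vs)))"
  unfolding form_sum_def sum_distrib_left by (rule sum.swap)
 finally show ?thesis by (simp only: form_sum_Suc)
qed

lemma mlin_bound:
 fixes \<omega> :: "'v::euclidean_space list => complex"
 shows "mlin k \<omega> ==> length us = k ==> cmod (\<omega> us) <= prod_list (map norm us) * form_sum k \<omega>"
proof (induction k arbitrary: \<omega> us)
 case 0
 have "{vs :: 'v list. set vs <= Basis & length vs = 0} = {[]}" by auto
 thus ?case using 0 by (simp only: form_sum_def) simp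
next
 case (Suc k)
 then obtain u ws where us: "us = u # ws" "length ws = k" by (cases us) auto
 have "cmod (\<omega> us) <= prod_list (map norm ws) * form_sum k (%vs. \<omega> (u # vs))"
  unfolding us(1) using Suc.prems us by (intro Suc.IH) auto
 also have "... <= prod_list (map norm ws) * (norm u * form_sum (Suc k) \<omega>)"
  by (intro mult_left_mono form_sum_Cons_le Suc.prems prod_list_nonneg) auto
 finally show ?case using us by (simp add: mult_ac)
qed

lemma prod_list_norm_map_le:
 assumes "!!u. norm (T u) <= 2 * norm u"
 shows "prod_list (map norm (map T us)) <= 2 ^ length us * prod_list (map norm us)"
proof (induction us)
 case (Cons u us)
 have "norm (T u) * prod_list (map norm (map T us)) <= (2 * norm u) * (2 ^ length us * prod_list (map norm us))"
  using assms Cons by (intro mult_mono prod_list_nonneg) auto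
 thus ?case by (simp add: mult_ac)
qed simp

text \<open>The arguments are exchanged one at a time. The first exchange costs \<eta>, with the
  norms of the moved remaining arguments at most doubled each; the others follow by induction. The
  two contributions with factor 2 ^ k add up to 2 ^ Suc k.\<close>

lemma mlin_perturb:
 fixes \<omega> :: "'v::euclidean_space list => complex"
 assumes T: "!!u. norm (T u - u) <= \<eta> * norm u" and \<eta>: "0 <= \<eta>" "\<eta> <= 1"
 shows "mlin k \<omega> ==> length us = k ==>
  cmod (\<omega> (map T us) - \<omega> us) <= 2 ^ k * \<eta> * prod_list (map norm us) * form_sum k \<omega>"
proof (induction k arbitrary: \<omega> us)
 case 0
 thus ?case using \<eta> by (simp add: form_sum_nonneg)
next
 case (Suc k)
 then obtain u ws where us: "us = u # ws" "length ws = k" by (cases us) auto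
 have T2: "norm (T u) <= 2 * norm u" for u
  using norm_triangle_sub[of "T u" u] T[of u] mult_right_mono[OF \<eta>(2), of "norm u"] by simp
 have pw: "0 <= prod_list (map norm ws)" by (intro prod_list_nonneg) auto
 have lin: "linear (%v. \<omega> (v # map T ws))" using Suc.prems(1) by simp
 have 1: "cmod (\<omega> ((T u - u) # map T ws)) <= 2 ^ k * \<eta> * prod_list (map norm us) * form_sum (Suc k) \<omega>"
 proof -
  have "cmod (\<omega> ((T u - u) # map T ws)) <= prod_list (map norm ((T u - u) # map T ws)) * form_sum (Suc k) \<omega>"
   using us by (intro mlin_bound Suc.prems) simp
  also have "prod_list (map norm ((T u - u) # map T ws)) <= (\<eta> * norm u) * (2 ^ length ws * prod_list (map norm ws))"
   using T[of u] prod_list_norm_map_le[OF T2, of ws] \<eta> by (simp, intro mult_mono) (auto intro!: prod_list_nonneg)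
  finally show ?thesis using us form_sum_nonneg[of "Suc k" \<omega>] by (simp add: mult_ac mult_right_mono)
 qed
 have 2: "cmod (\<omega> (u # map T ws) - \<omega> (u # ws)) <= 2 ^ k * \<eta> * prod_list (map norm us) * form_sum (Suc k) \<omega>"
 proof -
  have "cmod (\<omega> (u # map T ws) - \<omega> (u # ws)) <= 2 ^ k * \<eta> * prod_list (map norm ws) * form_sum k (%vs. \<omega> (u # vs))"
   using Suc.prems us by (intro Suc.IH) auto
  also have "... <= 2 ^ k * \<eta> * prod_list (map norm ws) * (norm u * form_sum (Suc k) \<omega>)"
   using \<eta> pw by (intro mult_left_mono form_sum_Cons_le Suc.prems mult_nonneg_nonneg) auto
  finally show ?thesis using us by (simp add: mult_ac)
 qed
 have "\<omega> (map T us) - \<omega> us = \<omega> ((T u - u) # map T ws) + (\<omega> (u # map T ws) - \<omega> (u # ws))"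
  using us linear_diff[OF lin, of "T u" u] by simp
 hence "cmod (\<omega> (map T us) - \<omega> us) <= cmod (\<omega> ((T u - u) # map T ws)) + cmod (\<omega> (u # map T ws) - \<omega> (u # ws))"
  by (metis norm_triangle_ineq)
 thus ?case using 1 2 by simp
qed

lemma finite_uniform_radius:
 fixes P :: "'x => real => bool"
 assumes "finite X" "!!x. x : X ==> EX d>0. P x d" "!!x d d'. x : X ==> P x d ==> 0 < d' ==> d' <= d ==> P x d'"
 shows "EX d>0. ALL x:X. P x d" using assms
proof (induction X rule: finite_induct)
 case empty
 thus ?case by (intro exI[of _ 1]) auto
next
 case (insert x X)
 obtain d1 where d1: "d1 > 0" "ALL y:X. P y d1" using insert by blast
 obtain d2 where d2: "d2 > 0" "P x d2" using insert.prems(1) by blast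
 have "P y (min d1 d2)" if "y : insert x X" for y
  using that d1 d2 insert.prems(2)[of y d1 "min d1 d2"] insert.prems(2)[of y d2 "min d1 d2"] by auto
 thus ?case using d1 d2 by (intro exI[of _ "min d1 d2"]) auto
qed

lemma all_pos_square: "(ALL eps>0::real. P (eps\<^sup>2)) \<longleftrightarrow> (ALL eps>0. P eps)"
proof (intro iffI allI impI)
 fix eps :: real assume "ALL eps>0. P (eps\<^sup>2)" "eps > 0"
 thus "P eps" by (elim allE[of _ "sqrt eps"]) simp
qed simp

section \<open>Necessity\<close>

context herm_L2
begin

lemma net_of_forms:
 assumes sub: "\<A> <= space2" and tb: "L2.mtotally_bounded \<A>" and e: "e > 0"
 shows "EX X. finite X & X <= forms & (ALL f:\<Union>\<A>. EX g:X. energy UNIV (form_diff f g) <= ennreal e)"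
proof -
 have "EX K. finite K & K <= \<A> & \<A> <= (\<Union>x\<in>K. L2.mball x (sqrt e))"
  using tb e unfolding L2.mtotally_bounded_def by simp
 then obtain K where K: "finite K" "K <= \<A>" "\<A> <= (\<Union>x\<in>K. L2.mball x (sqrt e))" by blast
 define rep where "rep G = (SOME f. f : G)" for G :: "('a => 'n form) set"
 have rep: "rep G : G" "G : space2" if "G : K" for G
 proof -
  show "G : space2" using that K(2) sub by blast
  thus "rep G : G" unfolding rep_def by (rule space2D(2))
 qed
 have "EX g:rep ` K. energy UNIV (form_diff f g) <= ennreal e" if f: "f : \<Union>\<A>" for f
 proof -
  obtain F where F: "F : \<A>" "f : F" using f by blast
  then obtain G where G: "G : K" "F : L2.mball G (sqrt e)" using K(3) by blast
  have "dist2 G F < sqrt e" "F : space2" using G(2) by (auto simp: L2.in_mball)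
  hence "energy UNIV (form_diff (rep G) f) < ennreal ((sqrt e)\<^sup>2)"
   using dist2_less_iff[OF rep(2)[OF G(1)] _ rep(1)[OF G(1)] F(2)] e by auto
  hence "energy UNIV (form_diff f (rep G)) <= ennreal e" using e energy_diff_commute[of UNIV f "rep G"] by simp
  thus ?thesis using G(1) by blast
 qed
 note net = this
 have "rep ` K <= forms" using rep space2D(1) by blast
 thus ?thesis using net by (intro exI[of _ "rep ` K"] conjI ballI finite_imageI K(1))
qed

lemma coef_diff: "coef j (form_diff f g) us z = coef j f us z - coef j g us z"
 by (simp add: coef_def cform_def form_diff_def)

text \<open>Continuity for the finitely many forms of a net passes to the whole family. The error f
  - g occurs once at z and once at G z, where the measure clause of \<open>almost_id\<close> costs
  the factor C.\<close>

lemma uniform_L2_continuity: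
 assumes sub: "\<A> <= space2" and tb: "L2.mtotally_bounded \<A>" and j: "patch j" and C: "C >= 0" and eps: "eps > 0"
 shows "EX \<delta>>0. ALL G. almost_id (dom1 j) C \<delta> G --> (ALL f:\<Union>\<A>. ALL us:idx.
  (LI z:dom1 j. nsq (coef j f us (G z) - coef j f us z)) <= ennreal eps)"
proof -
 let ?KQ = "pK j * pQ j" and ?b = "dom1 j"
 have KQ: "0 < ?KQ" using patchD(5)[OF j] pQ_ge[OF j] by (intro mult_pos_pos) auto
 \<comment> \<open>With the factor 3 for three squares, the two errors contribute 3 KQ (C + 1) e =
   eps / 2 and the net element 3 eps / 6.\<close>
 define e where "e = eps / (6 * (?KQ * (C + 1)))"
 have q: "0 < 6 * (?KQ * (C + 1))" using C by (intro mult_pos_pos KQ mult_pos_pos[OF _ mult_pos_pos[OF KQ]]) auto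
 have e: "e > 0" unfolding e_def by (rule divide_pos_pos[OF eps q])
 have eq: "6 * (?KQ * (C + 1)) * e = eps"
 proof -
  have "x * (eps / x) = eps" if "x > 0" for x using that by simp
  from this[OF q] show ?thesis unfolding e_def .
 qed
 obtain X where X0: "finite X & X <= forms & (ALL f:\<Union>\<A>. EX g:X. energy UNIV (form_diff f g) <= ennreal e)"
  using net_of_forms[OF sub tb e] ..
 note X = conjunct1[OF X0] conjunct1[OF conjunct2[OF X0]] conjunct2[OF conjunct2[OF X0]]
 have bb: "?b : sets borel" by simp
 have fin: "finite (X \<times> idx)" using X(1) finite_idx by simp
 have "EX \<delta>>0. ALL x:X \<times> idx. ALL G. almost_id ?b C \<delta> G -->
   (LI z:?b. nsq (coef j (fst x) (snd x) (G z) - coef j (fst x) (snd x) z)) <= ennreal (eps / 6)"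
 proof (rule finite_uniform_radius[OF fin])
  fix x assume x: "x : X \<times> idx"
  hence f: "fst x : forms" "snd x : idx" using X(2) by auto
  have "(LI z. nsq (coef j (fst x) (snd x) z)) < \<infinity>"
   using coef_energy[OF j f] formsD(4)[OF f(1)] by (auto simp: ennreal_mult_less_top intro: le_less_trans)
  from L2_continuity[OF measurable_coef[OF j formsD(3)[OF f(1)]] this bb C, of "eps / 6"] eps
  show "EX \<delta>>0. ALL G. almost_id ?b C \<delta> G -->
   (LI z:?b. nsq (coef j (fst x) (snd x) (G z) - coef j (fst x) (snd x) z)) <= ennreal (eps / 6)" by simp
 qed (blast intro: almost_id_mono)
 then obtain \<delta> where \<delta>: "\<delta> > 0" "!!g us G. g : X ==> us : idx ==> almost_id ?b C \<delta> G ==>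
   (LI z:?b. nsq (coef j g us (G z) - coef j g us z)) <= ennreal (eps / 6)" by force
 have "(LI z:?b. nsq (coef j f us (G z) - coef j f us z)) <= ennreal eps"
  if G: "almost_id ?b C \<delta> G" and f: "f : \<Union>\<A>" and us: "us : idx" for G f us
 proof -
  obtain g where g: "g : X" "energy UNIV (form_diff f g) <= ennreal e" using bspec[OF X(3) f] by blast
  have fg: "f : forms" "g : forms" using f sub space2D(1) g X(2) by blast+
  let ?f = "coef j f us" and ?g = "coef j g us" and ?d = "coef j (form_diff f g) us"
  have [measurable]: "?f : bmeas" "?g : bmeas" "?d : bmeas" "?b : sets borel"
   using measurable_coef[OF j] formsD(3) fg forms_diff[OF fg] by auto
  have [measurable]: "G : bmeas" using G by (simp add: almost_id_def)
  have d: "(LI z. nsq (?d z)) <= ennreal (?KQ * e)"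
  proof -
   have "(LI z. nsq (?d z)) <= ennreal ?KQ * energy UNIV (form_diff f g)"
    by (rule coef_energy[OF j forms_diff[OF fg] us])
   also have "... <= ennreal ?KQ * ennreal e" by (intro mult_left_mono g) auto
   finally show ?thesis using KQ e by (simp only: ennreal_mult less_imp_le)
  qed
  have dG: "(LI z:?b. nsq (?d (G z))) <= ennreal (C * (?KQ * e))"
  proof -
   have "(LI z:?b. nsq (?d (G z))) <= ennreal C * (LI z. nsq (?d z))"
    by (rule nn_integral_almost_id[OF G bb, where u = "%z. nsq (?d z)"]) measurable
   also have "... <= ennreal C * ennreal (?KQ * e)" by (intro mult_left_mono d) auto
   finally show ?thesis using KQ e C by (simp only: ennreal_mult less_imp_le mult_nonneg_nonneg)
  qed
  have db: "(LI z:?b. nsq (?d z)) <= ennreal (?KQ * e)"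
   by (rule order_trans[OF nn_integral_mono d]) (auto split: split_indicator)
  have "(LI z:?b. nsq (?f (G z) - ?f z))
   <= (LI z. 3 * (nsq (?d (G z)) * indicator ?b z + nsq (?g (G z) - ?g z) * indicator ?b z
      + nsq (?d z) * indicator ?b z))"
  proof (rule nn_integral_mono)
   fix z
   have "?f (G z) - ?f z = ?d (G z) + (?g (G z) - ?g z) + (- ?d z)" by (simp add: coef_diff)
   hence "(norm (?f (G z) - ?f z))\<^sup>2 <= 3 * ((norm (?d (G z)))\<^sup>2 + (norm (?g (G z) - ?g z))\<^sup>2 + (norm (- ?d z))\<^sup>2)"
    using square_sum3 by metis
   hence "nsq (?f (G z) - ?f z) <= ennreal (3 * ((norm (?d (G z)))\<^sup>2 + (norm (?g (G z) - ?g z))\<^sup>2 + (norm (?d z))\<^sup>2))"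
    by (intro ennreal_leI) simp
   also have "... = 3 * (nsq (?d (G z)) + nsq (?g (G z) - ?g z) + nsq (?d z))"
    by (simp add: ennreal_mult ennreal_plus)
   finally show "nsq (?f (G z) - ?f z) * indicator ?b z
    <= 3 * (nsq (?d (G z)) * indicator ?b z + nsq (?g (G z) - ?g z) * indicator ?b z
      + nsq (?d z) * indicator ?b z)" by (simp split: split_indicator)
  qed
  also have "... = 3 * ((LI z:?b. nsq (?d (G z))) + (LI z:?b. nsq (?g (G z) - ?g z))
    + (LI z:?b. nsq (?d z)))"
   by (subst nn_integral_cmult, measurable, subst nn_integral_add, measurable, subst nn_integral_add, measurable)
  also have "... <= 3 * (ennreal (C * (?KQ * e)) + ennreal (eps / 6) + ennreal (?KQ * e))"
   by (intro mult_left_mono add_mono dG db \<delta>(2)[OF g(1) us G]) auto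
  also have "... = ennreal (3 * (C * (?KQ * e) + eps / 6 + ?KQ * e))"
  proof -
   have "3 * (ennreal x + ennreal y + ennreal w) = ennreal (3 * (x + y + w))" if "x >= 0" "y >= 0" "w >= 0" for x y w
    using that by (simp add: ennreal_mult ennreal_plus)
   moreover have "0 <= C * (?KQ * e)" "0 <= eps / 6" "0 <= ?KQ * e"
    using C less_imp_le[OF mult_pos_pos[OF KQ e]] eps by (auto intro!: mult_nonneg_nonneg)
   ultimately show ?thesis by blast
  qed
  also have "3 * (C * (?KQ * e) + eps / 6 + ?KQ * e) = eps"
  proof -
   have "3 * (C * y + eps / 6 + y) = eps" if "6 * ((C + 1) * y) = eps" for y
   proof -
    have h: "eps = 6 * (C * y) + 6 * y" using that by (simp add: algebra_simps)
    show ?thesis by (simp add: h field_simps)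
   qed
   moreover have "6 * ((C + 1) * (?KQ * e)) = eps" using eq by (simp only: mult_ac)
   ultimately show ?thesis .
  qed
  finally show ?thesis .
 qed
 thus ?thesis using \<delta>(1) by blast
qed

text \<open>The coefficients of the pull-back at z are those of f at w, with arguments moved by the
  derivative. The difference from f splits into the effect of moving the arguments, bounded by
  \<open>mlin_perturb\<close>, and that of moving the point.\<close>

lemma pull_back_coefficients:
 assumes j: "patch j" and \<Phi>: "smooth_map A \<Phi>"
  and d: "push_forward_distance A h \<Phi> < ennreal s" and s: "0 < s" "pK j * s < pr j" "4 * pK j ^ 3 * s <= 1"
  and f: "f : forms" and z: "z : dom1 j"
 defines "w \<equiv> coord (pc j) \<Phi> z"
 shows "mlin deg (form_diff (pull_back A \<Phi> f) f (pinv j z))"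
  and "us : idx ==> norm (cform (pc j) (pinv j z) (form_diff (pull_back A \<Phi> f) f (pinv j z)) us)
   <= 2 ^ deg * (4 * pK j ^ 3 * s) * (SUM vs:idx. cmod (coef j f vs w)) + cmod (coef j f us w - coef j f us z)"
proof -
 note Pj = patchD[OF j]
 have K1: "1 <= pK j" by (rule Pj(5))
 have s3: "2 * pK j * pK j * s <= 1"
 proof -
  have "2 * (pK j * pK j * 1) * s <= 4 * (pK j * pK j * pK j) * s" using K1 s by (intro mult_right_mono mult_mono) auto
  also have "4 * (pK j * pK j * pK j) * s = 4 * pK j ^ 3 * s" by (simp only: power3_eq_cube)
  also have "... <= 1" by (rule s(3))
  finally show ?thesis by (simp only: mult_1_right mult.assoc)
 qed
 have z2: "z : cball (pz j) (2 * pr j)" using z Pj(1) by auto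
 note F = coord_close[OF Pj(1,2) \<Phi> d s(1,2) s3 z2]
 let ?c = "pc j" and ?x = "pinv j z" and ?D = "fd (coord (pc j) \<Phi>) z"
 have zi: "z : img ?c" "z : dom3 j" using z Pj(9,11) by blast+
 have x: "?x : fst ?c" using zi Pj(3) by simp
 have w3: "w : dom3 j"
  using F(2) z s(2) Pj(1) dist_triangle[of "pz j" w z] by (simp add: w_def dist_norm norm_minus_commute)
 have \<Phi>x: "\<Phi> ?x = pinv j w" using F(1) Pj(3) by (simp add: w_def coord_def)
 have lin: "linear ?D" by (rule has_derivative_linear[OF F(3)])
 have pf: "push_forward A \<Phi> ?x = (%v. vec_of A ?c (\<Phi> ?x) (?D (comps_in A ?c ?x v)))" using F(5) by blast
 have "linear (push_forward A \<Phi> ?x)"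
  unfolding pf using linear_compose[OF linear_compose[OF linear_comps_in[OF Pj(3) x] lin] linear_vec_of[OF Pj(3) F(1)]]
  by (simp add: o_def)
 hence "mlin deg (pull_back A \<Phi> f ?x)" unfolding pull_back_def by (rule mlin_map_linear) (rule formsD(2)[OF f])
 thus "mlin deg (form_diff (pull_back A \<Phi> f) f (pinv j z))"
  unfolding form_diff_def by (rule mlin_diff) (rule formsD(2)[OF f])
 assume us: "us : idx"
 let ?\<eta> = "cform ?c (pinv j w) (f (pinv j w))"
 have m\<eta>: "mlin deg ?\<eta>" using mlin_cform[OF Pj(3) _ formsD(2)[OF f]] F(1) \<Phi>x by simp
 have \<eta>c: "?\<eta> vs = coef j f vs w" for vs using w3 by (simp add: coef_def)
 have eq: "cform ?c ?x (form_diff (pull_back A \<Phi> f) f ?x) us = (?\<eta> (map ?D us) - ?\<eta> us) + (coef j f us w - coef j f us z)"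
 proof -
  have "cform ?c ?x (pull_back A \<Phi> f ?x) us = ?\<eta> (map ?D us)"
   by (simp add: cform_def pull_back_def pf comps_vec_of[OF Pj(3) x] o_def \<Phi>x)
  moreover have "cform ?c ?x (f ?x) us = coef j f us z" using zi by (simp add: coef_def)
  ultimately show ?thesis by (simp add: \<eta>c) (simp add: cform_def form_diff_def)
 qed
 have len: "length us = deg" and bas: "set us <= Basis" using us by auto
 have "prod_list (map norm us) = 1" using bas by (induction us) auto
 hence "cmod (?\<eta> (map ?D us) - ?\<eta> us) <= 2 ^ deg * (4 * pK j ^ 3 * s) * 1 * form_sum deg ?\<eta>"
  using mlin_perturb[OF F(4) _ s(3) m\<eta> len] K1 s(1) by simp
 also have "form_sum deg ?\<eta> = (SUM vs:idx. cmod (coef j f vs w))" by (simp add: form_sum_def \<eta>c)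
 finally show "norm (cform ?c ?x (form_diff (pull_back A \<Phi> f) f ?x) us)
   <= 2 ^ deg * (4 * pK j ^ 3 * s) * (SUM vs:idx. cmod (coef j f vs w)) + cmod (coef j f us w - coef j f us z)"
  unfolding eq by (intro norm_triangle_le add_mono) auto
qed

text \<open>\<open>a\<close> has the form of the bound in \<open>pull_back_coefficients\<close> and
  is Borel, unlike possibly the coefficients it majorises. Its square is split by (x + y)^2 <= 2 x^2
  + 2 y^2, and the inner sum by Cauchy-Schwarz with the factor \<open>card idx\<close>.\<close>

lemma pull_back_psum:
 assumes j: "patch j" and f: "f : forms" and R: "energy UNIV f <= ennreal R" "R >= 0" and C: "C >= 0" and \<theta>: "\<theta> >= 0"
  and G: "almost_id (dom1 j) C s G" and e: "e >= 0"
  and cont: "!!us. us : idx ==> (LI z:dom1 j. nsq (coef j f us (G z) - coef j f us z)) <= ennreal e"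
 defines "a \<equiv> %us z. complex_of_real (\<theta> * (SUM vs:idx. cmod (coef j f vs (G z))) + cmod (coef j f us (G z) - coef j f us z))"
 shows "a us : bmeas"
  and "psum j a <= ennreal (pK j * pQ j * (real (card idx) * (2 * \<theta>\<^sup>2 * real (card idx) * (real (card idx) * (C * (pK j * pQ j * R))) + 2 * e)))"
proof -
 let ?n = "real (card idx)" and ?b = "dom1 j" and ?KQ = "pK j * pQ j"
 have KQ: "0 < ?KQ" using patchD(5)[OF j] pQ_ge[OF j] by (intro mult_pos_pos) auto
 have mc[measurable]: "coef j f us : bmeas" for us by (rule measurable_coef[OF j formsD(3)[OF f]])
 have mG[measurable]: "G : bmeas" using G by (simp add: almost_id_def)
 have bb[measurable]: "?b : sets borel" by simp
 show "a us : bmeas" unfolding a_def by measurable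
 have cG: "(LI z:?b. nsq (coef j f vs (G z))) <= ennreal (C * (?KQ * R))" if "vs : idx" for vs
 proof -
  have "(LI z:?b. nsq (coef j f vs (G z))) <= ennreal C * (LI z. nsq (coef j f vs z))"
   by (rule nn_integral_almost_id[OF G bb, where u = "%z. nsq (coef j f vs z)"]) measurable
  also have "... <= ennreal C * (ennreal ?KQ * energy UNIV f)" by (intro mult_left_mono coef_energy[OF j f that]) auto
  also have "... <= ennreal C * (ennreal ?KQ * ennreal R)" by (intro mult_left_mono R) auto
  finally show ?thesis using KQ C R by (simp only: ennreal_mult less_imp_le mult_nonneg_nonneg)
 qed
 have each: "(LI z:?b. nsq (a us z)) <= ennreal (2 * \<theta>\<^sup>2 * ?n * (?n * (C * (?KQ * R))) + 2 * e)"
  if us: "us : idx" for us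
 proof -
  have pt: "nsq (a us z) * indicator ?b z
   <= ennreal (2 * \<theta>\<^sup>2 * ?n) * (SUM vs:idx. nsq (coef j f vs (G z)) * indicator ?b z)
     + 2 * (nsq (coef j f us (G z) - coef j f us z) * indicator ?b z)" for z
  proof (cases "z : ?b")
   case True
   let ?S = "SUM vs:idx. cmod (coef j f vs (G z))" and ?t = "cmod (coef j f us (G z) - coef j f us z)"
   have "(norm (a us z))\<^sup>2 = (\<theta> * ?S + ?t)\<^sup>2" by (simp only: a_def norm_of_real power2_abs)
   also have "... <= 2 * (\<theta> * ?S)\<^sup>2 + 2 * ?t\<^sup>2"
    using zero_le_power2[of "\<theta> * ?S - ?t"] by (simp only: power2_sum power2_diff)
   also have "... <= 2 * (\<theta>\<^sup>2 * ((SUM vs:idx. (cmod (coef j f vs (G z)))\<^sup>2) * ?n)) + 2 * ?t\<^sup>2"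
    unfolding power_mult_distrib by (intro add_right_mono mult_left_mono sum_squared_le_sum_of_squares) auto
   also have "... = 2 * \<theta>\<^sup>2 * ?n * (SUM vs:idx. (cmod (coef j f vs (G z)))\<^sup>2) + 2 * ?t\<^sup>2" by (simp only: mult_ac)
   finally have "nsq (a us z) <= ennreal (2 * \<theta>\<^sup>2 * ?n * (SUM vs:idx. (cmod (coef j f vs (G z)))\<^sup>2) + 2 * ?t\<^sup>2)"
    by (rule ennreal_leI)
   also have "... = ennreal (2 * \<theta>\<^sup>2 * ?n) * (SUM vs:idx. nsq (coef j f vs (G z))) + 2 * ennreal (?t\<^sup>2)"
   proof -
    have "ennreal (x * y + 2 * t) = ennreal x * ennreal y + 2 * ennreal t" if "0 <= x" "0 <= y" "0 <= t" for x y t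
     using that by (simp add: ennreal_mult ennreal_plus)
    thus ?thesis by (simp only: sum_ennreal zero_le_power2 sum_nonneg mult_nonneg_nonneg of_nat_0_le_iff zero_le_numeral)
   qed
   finally show ?thesis using True by simp
  qed simp
  have m1: "(%z. nsq (coef j f vs (G z)) * indicator ?b z) : borel_measurable lborel" for vs by measurable
  have m2: "(%z. nsq (coef j f us (G z) - coef j f us z) * indicator ?b z) : borel_measurable lborel" by measurable
  have "(LI z:?b. nsq (a us z))
   <= (LI z. ennreal (2 * \<theta>\<^sup>2 * ?n) * (SUM vs:idx. nsq (coef j f vs (G z)) * indicator ?b z)
     + 2 * (nsq (coef j f us (G z) - coef j f us z) * indicator ?b z))" by (rule nn_integral_mono) (rule pt)
  also have "... = ennreal (2 * \<theta>\<^sup>2 * ?n) * (SUM vs:idx. \<integral>\<^sup>+z\<in>?b. nsq (coef j f vs (G z)) \<partial>lborel)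
     + 2 * (LI z:?b. nsq (coef j f us (G z) - coef j f us z))"
  proof -
   have "(%z. ennreal (2 * \<theta>\<^sup>2 * ?n) * (SUM vs:idx. nsq (coef j f vs (G z)) * indicator ?b z)) : borel_measurable lborel"
    by (intro borel_measurable_times_ennreal borel_measurable_const borel_measurable_sum m1)
   moreover have "(%z. 2 * (nsq (coef j f us (G z) - coef j f us z) * indicator ?b z)) : borel_measurable lborel"
    by (intro borel_measurable_times_ennreal[OF borel_measurable_const m2])
   ultimately show ?thesis
    by (simp only: nn_integral_add nn_integral_cmult[OF borel_measurable_sum[OF m1]] nn_integral_cmult[OF m2] nn_integral_sum[OF m1])
  qed
  also have "... <= ennreal (2 * \<theta>\<^sup>2 * ?n) * (SUM vs:idx. ennreal (C * (?KQ * R))) + 2 * ennreal e"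
   by (intro add_mono mult_left_mono sum_mono cG cont us) auto
  also have "... = ennreal (2 * \<theta>\<^sup>2 * ?n * (?n * (C * (?KQ * R))) + 2 * e)"
  proof -
   have r: "0 <= C * (?KQ * R)" by (rule mult_nonneg_nonneg[OF C mult_nonneg_nonneg[OF less_imp_le[OF KQ] R(2)]])
   have "ennreal x * (of_nat m * ennreal y) + 2 * ennreal e = ennreal (x * (real m * y) + 2 * e)" if "0 <= x" "0 <= y" for x y m
    using that e by (simp add: ennreal_mult ennreal_plus ennreal_of_nat_eq_real_of_nat)
   from this[OF _ r, of "2 * \<theta>\<^sup>2 * ?n" "card idx"] show ?thesis by simp
  qed
  finally show ?thesis .
 qed
 have "psum j a <= ennreal ?KQ * (SUM us:idx. ennreal (2 * \<theta>\<^sup>2 * ?n * (?n * (C * (?KQ * R))) + 2 * e))"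
  unfolding psum_def by (intro mult_left_mono sum_mono each) auto
 also have "... = ennreal (?KQ * (?n * (2 * \<theta>\<^sup>2 * ?n * (?n * (C * (?KQ * R))) + 2 * e)))"
 proof -
  have r: "0 <= C * (?KQ * R)" by (rule mult_nonneg_nonneg[OF C mult_nonneg_nonneg[OF less_imp_le[OF KQ] R(2)]])
  have y: "0 <= 2 * \<theta>\<^sup>2 * ?n * (?n * (C * (?KQ * R))) + 2 * e"
   using e by (intro add_nonneg_nonneg mult_nonneg_nonneg[OF _ mult_nonneg_nonneg[OF _ r]]) auto
  have "ennreal x * (of_nat m * ennreal y) = ennreal (x * (real m * y))" if "0 <= x" "0 <= y" for x y m
   using that by (simp add: ennreal_mult ennreal_of_nat_eq_real_of_nat)
  from this[OF less_imp_le[OF KQ] y, of "card idx"] show ?thesis by simp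
 qed
 finally show "psum j a <= ennreal (?KQ * (?n * (2 * \<theta>\<^sup>2 * ?n * (?n * (C * (?KQ * R))) + 2 * e)))" .
qed

lemma dens_zero: "(!!vs. \<omega> x vs = 0) ==> dens \<omega> x = 0"
 by (simp add: dens_def fnorm2_def form_norm_def Let_def)

lemma equicontinuity:
 assumes sub: "\<A> <= space2" and bd: "L2_bounded A h \<phi> p q \<A>" and tb: "L2.mtotally_bounded \<A>"
  and eps: "eps > 0" and \<Omega>: "relatively_compact_open \<Omega>"
 shows "EX \<delta>>0. ALL \<Phi>:Def A h \<delta> \<Omega>. ALL f:\<Union>\<A>. energy UNIV (form_diff (pull_back A \<Phi> f) f) < ennreal eps"
proof -
 let ?F = "\<Union>\<A>" and ?n = "real (card idx)"
 have F: "?F <= forms" using sub space2D(1) by blast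
 obtain R where R: "R > 0" "!!f. f : ?F ==> energy UNIV f <= ennreal R" using bounded_energy[OF bd sub] by blast
 have cl: "compact (closure \<Omega>)" using \<Omega> by (simp add: relatively_compact_open_def)
 obtain P where P: "finite P" "!!j. j : P ==> patch j" "closure \<Omega> <= (\<Union>j\<in>P. pinv j ` ball (pz j) (pr j))"
  using patch_cover[OF cl] by blast
 define e2 where "e2 = eps / (real (card P) + 1)"
 have e2: "e2 > 0" unfolding e2_def using eps by (intro divide_pos_pos) auto
 define ok where "ok d \<Phi> \<longleftrightarrow> diffeo A \<Phi> & push_forward_distance A h \<Phi> < ennreal d & push_forward_distance A h (inv \<Phi>) < ennreal d" for d \<Phi>
 define good where "good j f \<Phi> a \<longleftrightarrow> (ALL us. a us : bmeas) & psum j a <= ennreal e2 &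
   (ALL z:dom1 j. mlin deg (form_diff (pull_back A \<Phi> f) f (pinv j z)) &
    (ALL us:idx. norm (cform (pc j) (pinv j z) (form_diff (pull_back A \<Phi> f) f (pinv j z)) us) <= norm (a us z)))" for j f \<Phi> a
 have "EX d>0. ALL j:P. ALL \<Phi>. ok d \<Phi> --> (ALL f:?F. EX a. good j f \<Phi> a)"
 proof (rule finite_uniform_radius[OF P(1)])
  fix j assume "j : P"
  hence j: "patch j" by (rule P(2))
  note Pj = patchD[OF j]
  let ?KQ = "pK j * pQ j"
  have KQ: "0 < ?KQ" using Pj(5) pQ_ge[OF j] by (intro mult_pos_pos) auto
  have K0: "0 < pK j" using Pj(5) by simp
  obtain C where C: "C >= 0" "!!\<Phi> s. diffeo A \<Phi> ==> push_forward_distance A h \<Phi> < ennreal s ==> push_forward_distance A h (inv \<Phi>) < ennreal s ==>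
   0 < s ==> pK j * s < pr j ==> 4 * pK j ^ 3 * s <= 1 ==>
   almost_id (dom1 j) C (pK j * s) (%z. if z : dom1 j then coord (pc j) \<Phi> z else 0)"
   using almost_id_coord[OF Pj(1,2)] by blast
  \<comment> \<open>The bound of \<open>pull_back_psum\<close> becomes KQ * n * (2 e + 2 e), the
    first 2 e from the moved arguments and the second from the moved point.\<close>
  define e where "e = e2 / (4 * (?KQ * (?n + 1)))"
  have q: "0 < 4 * (?KQ * (?n + 1))" by (rule mult_pos_pos[OF _ mult_pos_pos[OF KQ]]) auto
  have e: "e > 0" unfolding e_def by (rule divide_pos_pos[OF e2 q])
  have eq: "4 * (?KQ * (?n + 1)) * e = e2"
  proof -
   have "x * (e2 / x) = e2" if "x > 0" for x using that by simp
   from this[OF q] show ?thesis unfolding e_def .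
  qed
  obtain \<delta> where \<delta>: "\<delta> > 0" "!!G f us. almost_id (dom1 j) C \<delta> G ==> f : ?F ==> us : idx ==>
   (LI z:dom1 j. nsq (coef j f us (G z) - coef j f us z)) <= ennreal e"
   using uniform_L2_continuity[OF sub tb j C(1) e] by blast
  let ?B = "2 * ?n * (?n * (C * (?KQ * R)))"
  \<comment> \<open>The largest distortion of the arguments that still contributes at most 2 e; the
    1 avoids division by 0.\<close>
  define \<theta>0 where "\<theta>0 = sqrt (2 * e / (?B + 1))"
  have r0: "0 <= C * (?KQ * R)" by (rule mult_nonneg_nonneg[OF C(1) less_imp_le[OF mult_pos_pos[OF KQ R(1)]]])
  have B0: "0 <= ?B" by (intro mult_nonneg_nonneg[OF _ mult_nonneg_nonneg[OF _ r0]]) auto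
  have B1: "0 < ?B + 1" using B0 by (rule add_nonneg_pos) simp
  have \<theta>0: "\<theta>0 > 0" unfolding \<theta>0_def using e by (intro real_sqrt_gt_zero divide_pos_pos B1) simp
  have \<theta>B: "\<theta>0\<^sup>2 * ?B <= 2 * e"
  proof -
   have "\<theta>0\<^sup>2 = 2 * e / (?B + 1)" unfolding \<theta>0_def using e B1 by (intro real_sqrt_pow2 divide_nonneg_pos) auto
   moreover have "2 * e / (y + 1) * y <= 2 * e" if "0 <= y" for y using that e by (simp add: field_simps)
   note this[OF B0]
   ultimately show ?thesis by (simp only:)
  qed
  \<comment> \<open>The four bounds give the four parts of \<open>dle\<close> in order: staying in
    the chart (the 2 makes this strict), a derivative within 1 of the identity, the continuity
    radius, and distortion at most \<theta>0.\<close>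
  define d where "d = min (pr j / (2 * pK j)) (min (1 / (4 * pK j ^ 3)) (min (\<delta> / pK j) (\<theta>0 / (2 ^ deg * (4 * pK j ^ 3)))))"
  have d: "d > 0" using Pj(1) K0 \<delta>(1) \<theta>0 by (simp add: d_def)
  have dle: "pK j * d < pr j" "4 * pK j ^ 3 * d <= 1" "pK j * d <= \<delta>" "2 ^ deg * (4 * pK j ^ 3 * d) <= \<theta>0"
  proof -
   have "d <= pr j / (2 * pK j)" "d <= 1 / (4 * pK j ^ 3)" "d <= \<delta> / pK j" "d <= \<theta>0 / (2 ^ deg * (4 * pK j ^ 3))"
    by (auto simp: d_def)
   hence "d * (2 * pK j) <= pr j" "d * (4 * pK j ^ 3) <= 1" "d * pK j <= \<delta>" "d * (2 ^ deg * (4 * pK j ^ 3)) <= \<theta>0"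
    using K0 by (simp_all add: pos_le_divide_eq)
   thus "pK j * d < pr j" "4 * pK j ^ 3 * d <= 1" "pK j * d <= \<delta>" "2 ^ deg * (4 * pK j ^ 3 * d) <= \<theta>0"
    using Pj(1) by (simp_all add: mult_ac)
  qed
  have "EX a. good j f \<Phi> a" if ok: "ok d \<Phi>" and f: "f : ?F" for \<Phi> f
  proof -
   have ff: "f : forms" using F f by blast
   have \<Phi>: "diffeo A \<Phi>" "push_forward_distance A h \<Phi> < ennreal d" "push_forward_distance A h (inv \<Phi>) < ennreal d"
    using ok by (auto simp: ok_def)
   have sm: "smooth_map A \<Phi>" using \<Phi>(1) by (simp add: diffeo_def)
   let ?G = "%z. if z : dom1 j then coord (pc j) \<Phi> z else 0" and ?\<theta> = "2 ^ deg * (4 * pK j ^ 3 * d)"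
   have G: "almost_id (dom1 j) C (pK j * d) ?G" by (rule C(2)[OF \<Phi> d dle(1,2)])
   have G': "almost_id (dom1 j) C \<delta> ?G" by (rule almost_id_mono[OF G dle(3)])
   have \<theta>: "0 <= ?\<theta>" using K0 d by simp
   let ?a = "%us z. complex_of_real (?\<theta> * (SUM vs:idx. cmod (coef j f vs (?G z))) + cmod (coef j f us (?G z) - coef j f us z))"
   note ps = pull_back_psum[OF j ff R(2)[OF f] less_imp_le[OF R(1)] C(1) \<theta> G less_imp_le[OF e] \<delta>(2)[OF G' f]]
   have "psum j ?a <= ennreal (?KQ * (?n * (2 * ?\<theta>\<^sup>2 * ?n * (?n * (C * (?KQ * R))) + 2 * e)))" by (rule ps(2))
   also have "... <= ennreal e2"
   proof (rule ennreal_leI)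
    have "?\<theta>\<^sup>2 * ?B <= \<theta>0\<^sup>2 * ?B" by (intro mult_right_mono power_mono dle(4) \<theta> B0)
    note le = order_trans[OF this \<theta>B]
    have "2 * t * x * y = t * (2 * x * y)" for t x y :: real by simp
    hence g: "2 * ?\<theta>\<^sup>2 * ?n * (?n * (C * (?KQ * R))) = ?\<theta>\<^sup>2 * ?B" .
    have t: "2 * ?\<theta>\<^sup>2 * ?n * (?n * (C * (?KQ * R))) <= 2 * e" unfolding g by (rule le)
    have "?KQ * (?n * (2 * ?\<theta>\<^sup>2 * ?n * (?n * (C * (?KQ * R))) + 2 * e)) <= ?KQ * (?n * (4 * e))"
     using t by (intro mult_left_mono less_imp_le[OF KQ]) auto
    also have "... <= ?KQ * ((?n + 1) * (4 * e))"
     using e by (intro mult_left_mono mult_right_mono less_imp_le[OF KQ]) auto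
    also have "... = e2" using eq by (simp only: mult_ac)
    finally show "?KQ * (?n * (2 * ?\<theta>\<^sup>2 * ?n * (?n * (C * (?KQ * R))) + 2 * e)) <= e2" .
   qed
   finally have "psum j ?a <= ennreal e2" .
   moreover have "mlin deg (form_diff (pull_back A \<Phi> f) f (pinv j z)) &
    (ALL us:idx. norm (cform (pc j) (pinv j z) (form_diff (pull_back A \<Phi> f) f (pinv j z)) us) <= norm (?a us z))"
    if z: "z : dom1 j" for z
   proof (intro conjI ballI)
    note pb = pull_back_coefficients[OF j sm \<Phi>(2) d dle(1,2) ff z]
    show "mlin deg (form_diff (pull_back A \<Phi> f) f (pinv j z))" by (rule pb(1))
    fix us assume us: "us : idx"
    have Gz: "?G z = coord (pc j) \<Phi> z" using z by simp
    show "norm (cform (pc j) (pinv j z) (form_diff (pull_back A \<Phi> f) f (pinv j z)) us) <= norm (?a us z)"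
     unfolding Gz norm_of_real using pb(2)[OF us] by linarith
   qed
   ultimately have "good j f \<Phi> ?a" unfolding good_def using ps(1) by blast
   thus ?thesis by (rule exI[where P = "good j f \<Phi>"])
  qed
  thus "EX d>0. ALL \<Phi>. ok d \<Phi> --> (ALL f:?F. EX a. good j f \<Phi> a)" using d by blast
 next
  fix j d d' assume *: "ALL \<Phi>. ok d \<Phi> --> (ALL f:?F. EX a. good j f \<Phi> a)" and "0 < d'" "d' <= d"
  hence "ok d' \<Phi> ==> ok d \<Phi>" for \<Phi> unfolding ok_def using ennreal_leI[of d' d] by (meson order_less_le_trans)
  thus "ALL \<Phi>. ok d' \<Phi> --> (ALL f:?F. EX a. good j f \<Phi> a)" using * by metis
 qed
 then obtain d where d0: "d > 0 & (ALL j:P. ALL \<Phi>. ok d \<Phi> --> (ALL f:?F. EX a. good j f \<Phi> a))" ..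
 have d: "d > 0" by (rule conjunct1[OF d0])
 have dgood: "EX a. good j f \<Phi> a" if "j : P" "ok d \<Phi>" "f : ?F" for j \<Phi> f
  by (rule bspec[OF mp[OF spec[OF bspec[OF conjunct2[OF d0] that(1)]] that(2)] that(3)])
 \<comment> \<open>\<open>Var\<close> bounds the push-forward distances by three times its
   parameter, hence d / 3.\<close>
 have "energy UNIV (form_diff (pull_back A \<Phi> f) f) < ennreal eps" if \<Phi>: "\<Phi> : Def A h (d / 3) \<Omega>" and f: "f : ?F" for \<Phi> f
 proof -
  let ?\<omega> = "form_diff (pull_back A \<Phi> f) f"
  have V: "\<Phi> : Var A h (d / 3) \<Omega>" using \<Phi> by (simp add: Def_def)
  have ok: "ok d \<Phi>" using V by (simp add: Var_def ok_def)
  have fixed: "\<Phi> x = x" if "x ~: \<Omega>" for x using V that by (simp add: Var_def)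
  have cont: "continuous_on UNIV \<Phi>" using V by (simp add: Var_def diffeo_def smooth_map_def)
  have out: "dens ?\<omega> x = 0" if x: "x ~: closure \<Omega>" for x
  proof (rule dens_zero)
   have W: "open (- closure \<Omega>)" "x : - closure \<Omega>" using x by auto
   have fx: "\<Phi> y = y" if "y : - closure \<Omega>" for y using that closure_subset fixed by blast
   have "push_forward A \<Phi> x = (%v. v)"
    using push_forward_fixed[OF W fx continuous_on_subset[OF cont subset_UNIV]] by blast
   thus "?\<omega> x vs = 0" for vs using fx[OF W(2)] by (simp add: form_diff_def pull_back_def)
  qed
  have "ALL j:P. EX a. good j f \<Phi> a" using dgood[OF _ ok f] by blast
  then obtain a where a: "!!j. j : P ==> good j f \<Phi> (a j)" unfolding bchoice_iff by blast
  define a' where "a' j us z = (if j : P then a j us z else 0)" for j us z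
  have a': "a' j = a j" if "j : P" for j using that by (simp add: a'_def[abs_def])
  have "energy UNIV ?\<omega> <= energy (closure \<Omega>) ?\<omega>"
   unfolding energy_def using out by (intro nn_integral_mono) (auto split: split_indicator)
  also have "... <= (SUM j:P. psum j (a' j))"
  proof (rule energy_patches[OF P(1,2)])
   show "closure \<Omega> <= (\<Union>j\<in>P. pinv j ` dom1 j)"
    by (rule order_trans[OF P(3)]) (intro UN_mono image_mono ball_subset_cball order_refl)
   show "mlin deg (?\<omega> (pinv j z))" if "j : P" "z : dom1 j" for j z using a[OF that(1)] that(2) by (simp add: good_def)
   show "a' j us : bmeas" for j us using a[of j] a'[of j] by (cases "j : P") (auto simp: good_def a'_def[abs_def])
   show "norm (cform (pc j) (pinv j z) (?\<omega> (pinv j z)) us) <= norm (a' j us z)" if "j : P" "z : dom1 j" "us : idx" for j z us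
    using a[OF that(1)] that a'[OF that(1)] by (simp add: good_def)
  qed
  also have "... <= (SUM j:P. ennreal e2)" using a a' by (intro sum_mono) (simp add: good_def)
  also have "... = ennreal (real (card P) * e2)" using e2 by (simp add: ennreal_mult ennreal_of_nat_eq_real_of_nat)
  also have "... < ennreal eps" using eps by (intro ennreal_lessI) (auto simp: e2_def field_simps)
  finally show ?thesis .
 qed
 hence "ALL \<Phi>:Def A h (d / 3) \<Omega>. ALL f:?F. energy UNIV (form_diff (pull_back A \<Phi> f) f) < ennreal eps" by (intro ballI)
 moreover have "d / 3 > 0" using d by simp
 ultimately show ?thesis by (intro exI[of _ "d / 3"] conjI)
qed

lemma relatively_compact_openI:
 fixes S :: "'a set"
 assumes "open S" "S <= L" "compact L" shows "relatively_compact_open S"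
proof -
 have "closure S <= L" by (rule closure_minimal[OF assms(2) compact_imp_closed[OF assms(3)]])
 thus ?thesis unfolding relatively_compact_open_def
  using assms by (metis closed_closure compact_Int_closed inf.absorb_iff2)
qed

text \<open>Lindelof selects countably many coordinate balls, each inside a compact set; their
  finite unions increase to the manifold.\<close>

lemma exhaustion:
 obtains W :: "nat => 'a set" where "!!n. relatively_compact_open (W n)" "incseq W" "(\<Union>n. W n) = UNIV"
proof -
 let ?\<F> = "(%j. pinv j ` ball (pz j) (pr j)) ` {j. patch j}"
 have op: "open S" if S: "S : ?\<F>" for S
 proof -
  obtain j where j: "patch j" "S = pinv j ` ball (pz j) (pr j)" using S by blast
  have "ball (pz j) (pr j) <= img (pc j)" using patchD(11)[OF j(1)] ball_subset_cball by blast
  thus ?thesis unfolding j(2) by (rule open_chart_image[OF patchD(3)[OF j(1)] open_ball])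
 qed
 obtain \<F>' where F': "\<F>' <= ?\<F>" "countable \<F>'" "\<Union>\<F>' = \<Union>?\<F>"
 proof (rule Lindelof[of ?\<F>])
  show "open S" if "S : ?\<F>" for S using that by (rule op)
 qed
 have un: "\<Union>\<F>' = UNIV" unfolding F'(3) using patch_exists by blast
 have ne: "\<F>' ~= {}" using un by auto
 let ?S = "from_nat_into \<F>'"
 have Sin: "?S n : ?\<F>" for n using from_nat_into[OF ne] F'(1) by blast
 have rg: "(\<Union>n. ?S n) = UNIV" using un range_from_nat_into[OF ne F'(2)] by simp
 have "EX L. compact L & ?S n <= L" for n
 proof -
  obtain j where j: "patch j" "?S n = pinv j ` ball (pz j) (pr j)" using Sin by blast
  have "compact (pinv j ` dom1 j)"
   by (intro compact_continuous_image continuous_on_subset[OF continuous_chart_inv[OF patchD(3)[OF j(1)]] patchD(11)[OF j(1)]]) auto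
  moreover have "?S n <= pinv j ` dom1 j" unfolding j(2) by (intro image_mono ball_subset_cball)
  ultimately show ?thesis by blast
 qed
 then obtain L where L: "!!n. compact (L n)" "!!n. ?S n <= L n" by metis
 show ?thesis
 proof (rule that[of "%n. \<Union>i\<le>n. ?S i"])
  show "relatively_compact_open (\<Union>i\<le>n. ?S i)" for n
  proof (rule relatively_compact_openI)
   show "open (\<Union>i\<le>n. ?S i)" by (intro open_UN ballI op Sin)
   show "(\<Union>i\<le>n. ?S i) <= (\<Union>i\<le>n. L i)" by (intro UN_mono order_refl L(2))
   show "compact (\<Union>i\<le>n. L i)" by (intro compact_UN finite_atMost L(1))
  qed
  show "incseq (%n. \<Union>i\<le>n. ?S i)" by (auto simp: incseq_def intro: order_trans)
  show "(\<Union>n. \<Union>i\<le>n. ?S i) = UNIV" using rg by blast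
 qed
qed

text \<open>The energy of a single form is a finite measure, so it tends to 0 along complements that
  decrease to the empty set; a finite net of forms allows a common n.\<close>

lemma tails:
 assumes sub: "\<A> <= space2" and tb: "L2.mtotally_bounded \<A>" and eps: "eps > 0"
 shows "EX \<Omega>. relatively_compact_open \<Omega> & (ALL f:\<Union>\<A>. energy (- \<Omega>) f < ennreal eps)"
proof -
 \<comment> \<open>The tail of f is at most 2 e + 2 e, from the net element and from the distance to
   it.\<close>
 define e where "e = eps / 5"
 have e: "e > 0" using eps by (simp add: e_def)
 obtain X where X0: "finite X & X <= forms & (ALL f:\<Union>\<A>. EX g:X. energy UNIV (form_diff f g) <= ennreal e)"
  using net_of_forms[OF sub tb e] ..
 note X = conjunct1[OF X0] conjunct1[OF conjunct2[OF X0]] conjunct2[OF conjunct2[OF X0]]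
 obtain W :: "nat => 'a set" where W: "!!n. relatively_compact_open (W n)" "incseq W" "(\<Union>n. W n) = UNIV"
  using exhaustion by blast
 have Wb: "- W n : sets borel" for n using W(1)[of n] by (simp add: relatively_compact_open_def)
 have "eventually (%n. energy (- W n) g < ennreal e) sequentially" if g: "g : X" for g
 proof -
  have gf: "g : forms" using g X(2) by blast
  have dm: "(%x. ennreal (dens g x)) : borel_measurable vol"
   using measurable_dens[OF formsD(3)[OF gf] formsD(2)[OF gf]] by simp
  let ?M = "density vol (%x. ennreal (dens g x))"
  have em: "emeasure ?M S = energy S g" if "S : sets borel" for S
   unfolding energy_def using dm that by (simp add: emeasure_density)
  have "(%n. emeasure ?M (- W n)) \<longlonglongrightarrow> emeasure ?M (\<Inter>n. - W n)"
  proof (rule Lim_emeasure_decseq)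
   show "range (%n. - W n) <= sets ?M" using Wb by auto
   show "decseq (%n. - W n)" using W(2) by (auto simp: decseq_def incseq_def)
   show "emeasure ?M (- W n) ~= \<infinity>" for n
    using em[OF Wb] energy_mono_set[of "- W n" UNIV g] formsD(4)[OF gf] by (auto simp: top_unique)
  qed
  moreover have "(\<Inter>n. - W n) = {}" using W(3) by blast
  ultimately have "(%n. energy (- W n) g) \<longlonglongrightarrow> 0" using em[OF Wb] by simp
  thus ?thesis by (rule order_tendstoD(2)) (use e in simp)
 qed
 hence "eventually (%n. ALL g:X. energy (- W n) g < ennreal e) sequentially"
  using X(1) by (intro eventually_ball_finite) auto
 from eventually_happens'[OF sequentially_bot this]
 obtain n where "ALL g:X. energy (- W n) g < ennreal e" ..
 note n = bspec[OF this]
 have "energy (- W n) f < ennreal eps" if f: "f : \<Union>\<A>" for f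
 proof -
  obtain g where g: "g : X" "energy UNIV (form_diff f g) <= ennreal e" using bspec[OF X(3) f] by blast
  have fg: "f : forms" "g : forms" using f sub space2D(1) g X(2) by blast+
  have "f = form_diff g (form_diff g f)" by (simp add: form_diff_def fun_eq_iff)
  hence "energy (- W n) f <= 2 * energy (- W n) g + 2 * energy (- W n) (form_diff g f)"
   using energy_diff_le[OF fg(2) forms_diff[OF fg(2,1)] Wb[of n]] by metis
  also have "... <= 2 * ennreal e + 2 * ennreal e"
  proof (intro add_mono mult_left_mono less_imp_le[OF n[OF g(1)]])
   show "energy (- W n) (form_diff g f) <= ennreal e"
    using energy_mono_set[of "- W n" UNIV "form_diff g f"] g(2) energy_diff_commute[of UNIV f g] by (metis order_trans subset_UNIV)
  qed auto
  also have "... = ennreal (4 * e)"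
  proof -
   have "2 * ennreal e = ennreal (2 * e)" using e by (simp add: ennreal_mult)
   thus ?thesis using e by (simp add: ennreal_plus[symmetric] del: ennreal_plus)
  qed
  also have "... < ennreal eps" using e eps by (intro ennreal_lessI) (auto simp: e_def)
  finally show ?thesis .
 qed
 hence "ALL f:\<Union>\<A>. energy (- W n) f < ennreal eps" by (intro ballI)
 with W(1)[of n] show ?thesis by (intro exI[of _ "W n"] conjI)
qed

end

theorem theorem2p5:
  fixes A :: "('a::{t2_space,second_countable_topology}, 'n::finite) chart set"
    and h :: "('a, 'n) metric_field"
    and \<phi> :: "'a \<Rightarrow> real"
    and p q :: nat
    and \<A> :: "('a \<Rightarrow> 'n form) set set"
  assumes "hermitian_manifold A h"
    and "connected (UNIV :: 'a set)"
    and "continuous_on UNIV \<phi>"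
    and "\<A> \<subseteq> L2_space A h \<phi> p q"
    and "L2_bounded A h \<phi> p q \<A>"
  shows "L2_precompact A h \<phi> p q \<A> \<longleftrightarrow>
    (\<forall>\<epsilon>>0. \<forall>\<Omega>. relatively_compact_open \<Omega> \<longrightarrow>
       (\<exists>\<delta>>0. \<forall>\<Phi>\<in>Def A h \<delta> \<Omega>. \<forall>F\<in>\<A>. \<forall>f\<in>F.
          L2_norm A h \<phi> (p + q) UNIV (form_diff (pull_back A \<Phi> f) f) < ennreal \<epsilon>)) \<and>
    (\<forall>\<epsilon>>0. \<exists>\<Omega>. relatively_compact_open \<Omega> \<and>
       (\<forall>F\<in>\<A>. \<forall>f\<in>F. L2_norm A h \<phi> (p + q) (- \<Omega>) f < ennreal \<epsilon>))"
    (is "?pre \<longleftrightarrow> ?i & ?ii")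
proof -
 interpret herm_L2 A h \<phi> p q by unfold_locales (use assms in auto)
 note sub = assms(4) and bd = assms(5)
 \<comment> \<open>The two conditions for squared norms; eps runs over all positive numbers, so eps
   and its square are interchangeable.\<close>
 define Q where "Q e \<longleftrightarrow> (ALL \<Omega>. relatively_compact_open \<Omega> -->
   (EX \<delta>>0. ALL \<Phi>:Def A h \<delta> \<Omega>. ALL f:\<Union>\<A>. energy UNIV (form_diff (pull_back A \<Phi> f) f) < ennreal e))" for e
 define Q' where "Q' e \<longleftrightarrow> (EX \<Omega>. relatively_compact_open \<Omega> & (ALL f:\<Union>\<A>. energy (- \<Omega>) f < ennreal e))" for e
 have "?i \<longleftrightarrow> (ALL eps>0. Q (eps\<^sup>2))" unfolding Q_def by (simp add: L2n_less_iff)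
 hence i: "?i \<longleftrightarrow> (ALL eps>0. Q eps)" unfolding all_pos_square .
 have "?ii \<longleftrightarrow> (ALL eps>0. Q' (eps\<^sup>2))" unfolding Q'_def by (simp add: L2n_less_iff)
 hence ii: "?ii \<longleftrightarrow> (ALL eps>0. Q' eps)" unfolding all_pos_square .
 show ?thesis unfolding precompact_iff_totally_bounded[OF sub] i ii
 proof (intro iffI conjI allI impI)
  assume tb: "L2.mtotally_bounded \<A>"
  show "Q eps" if "eps > 0" for eps unfolding Q_def by (intro allI impI equicontinuity[OF sub bd tb that])
  show "Q' eps" if "eps > 0" for eps unfolding Q'_def by (rule tails[OF sub tb that])
 next
  assume c: "(ALL eps>0. Q eps) & (ALL eps>0. Q' eps)"
  show "L2.mtotally_bounded \<A>"
  proof (rule sufficiency[OF sub bd])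
   show "EX \<delta>>0. ALL \<Phi>:Def A h \<delta> \<Omega>. ALL f:\<Union>\<A>. energy UNIV (form_diff (pull_back A \<Phi> f) f) < ennreal eps"
    if "eps > 0" "relatively_compact_open \<Omega>" for eps \<Omega>
    by (rule mp[OF spec[OF mp[OF spec[OF conjunct1[OF c]] that(1), unfolded Q_def]] that(2)])
   show "EX \<Omega>. relatively_compact_open \<Omega> & (ALL f:\<Union>\<A>. energy (- \<Omega>) f < ennreal eps)" if "eps > 0" for eps
    by (rule mp[OF spec[OF conjunct2[OF c]] that, unfolded Q'_def])
  qed
 qed
qed

end
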